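(* Let $H\leq K$ and $H\leq_{\mathrm m} L$ be groups with $K\cap L=H$, and suppose that $$S=\{(h_i,a_i,b_i,b_i')\mid i\in I\}\subseteq H\times(K\setminus H)\times(L\setminus H)\times(L\setminus H)$$ satisfies the following two conditions: \begin{enumerate} \item for every $i\in I$, $b_i$ and $b_i'$ are good fellows over $H$; \item for all $i\neq j$ in $I$, at least one of the following holds: \begin{itemize} \item[(a)] $a_i$ and $a_j$ are good fellows over $H$ (in $K$); \item[(b)] $b_i=b_j$, $b_i'=b_j'$, and $a_i\neq a_j$; \item[(c)] $b_i$ and $b_j$ are good fellows over $H$; \item[(d)] there are subgroups $H'\leq H$ and $K'\leq K$ such that all of the following hold: (i) $K'\cap H=H'$; (ii) $a_i,a_j\in K'\setminus H=K'\setminus H'$; (iii) $b_i$ and $b_j$ are good fellows over $H'$ (in $L$); (iv) $b_i$ and $b_j'$ are good fellows over $H$; (v) $(K'\setminus H)\cdot(H\setminus K')\cdot(K'\setminus H)\subseteq K\setminus H$. \end{itemize} \end{enumerate} Let $M=K*_H L$, let $R\subseteq M$ be the symmetric closure of $\{h_i^{-1}\varrho(b_ia_i,b_i'a_i)\mid i\in I\}$, let $N$ be the normal subgroup of $M$ generated by $R$, and let $M^*=M/N$. Then all of the following hold: \begin{itemize} \item[(A)] $R$ satisfies the condition $C'(\frac1{10})$; consequently, for the canonical map $\pi:M\to M^*$, $\pi\restriction(K\cup L)$ is injective (and $K$, $L$ are identified with their images in $M^*$). \item[(B)] $K\leq_{\mathrm m}M^*$, and if $H\leq_{\mathrm m}K$,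 then $L\leq_{\mathrm m}M^*$. \item[(C)] If $b,b'\in L\setminus H$ are \emph{not} good fellows over $H$, and $d\in K\setminus H$, then the group elements $db'$ and $dbdb$ are good fellows over $K$ in $M^*$. \item[(D)] If $b,b'\in L\setminus H$ and $a\in K\setminus H$, then in $M^*$, $bab'\notin K$ and $ba\notin K$; and similarly with $K$ and $L$ interchanged (if $a,a'\in K\setminus H$ and $b\in L\setminus H$, then in $M^*$, $aba'\notin L$ and $ab\notin L$). \item[(E)] If $a,a'\in K$ are good fellows over $H'\leq H$ (in $K$), and $L'\leq L$ is such that $L'\cap K=L'\cap H=H'$, then $a,a'$ are good fellows over $L'$ in $M^*$. \item[(F)] If $b,b'\in L$ are good fellows over $H$, then they are good fellows over $K$ in $M^*$. \item[(G)] If $K$ and $L$ are torsion-free, then so is $M^*=M/N$. \end{itemize}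
   Context: $\varrho(x,y)$ denotes the word $xyx^2yx^3y\cdots x^{80}y$, of length $3320$. $1$ denotes the identity element. Malnormality: for groups $H\leq L$, $H\leq_{\mathrm m}L$ means that $H$ is a malnormal subgroup of $L$, i.e., for all $h\in H\setminus\{1\}$ and $g\in L\setminus H$, $g^{-1}hg\notin H$. Good fellows: for a group $G$, a subgroup $H\leq G$, and $g,g'\in G$, the elements $g,g'$ are good fellows over $H$ (in $G$) if $g\notin H g' H\cup H(g')^{-1}H$. Free amalgam: for groups $K,L$ with $K\cap L=H$ a common subgroup, $K*_HL$ is the free product of $K$ and $L$ with amalgamated subgroup $H$. Canonical form: a representation $g=g_0g_1\cdots g_{n-1}\in K*_HL$ with $g_i\in K\cup L$ is canonical if either $n=1$, or $n>1$, $g_i\notin H$ for all $i<n$, and for all $i+1<n$, $g_i\in K$ iff $g_{i+1}\in L$. (The length $n$ is determined by $g$.) Weakly cyclically reduced: an element $g\neq 1$ of $K*_HL$ with canonical form $g_0g_1\cdots g_{n-1}$ is weakly cyclically reduced if $n=1$, or $n$ is even, or $g_{n-1}g_0\notin H$; this does not depend on the choice of the canonical form. Symmetrized: $R\subseteq K*_HL$ is symmetrized if for every $g\in R$, $g^{-1}\in R$ and every weakly cyclically reduced conjugate $g'$ of $g$ is in $R$. The symmetric closure of a set is the smallest symmetrized set containing it. Condition $C'(\chi)$, for $\chi\in(0,1)$: $X\subseteq K*_HL$ satisfies $C'(\chi)$ if whenever (1) $g^*_{n-1}g^*_{n-2}\cdots g^*_0$ and $g^{**}_0g^{**}_1\cdots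 g^{**}_{m-1}$ are canonical forms of elements of $X$, (2) $g^*_{n-1}\cdots g^*_0\cdot g^{**}_0\cdots g^{**}_{m-1}\neq 1$, (3) $\ell<n,m$, and (4) $g^*_{\ell-1}g^*_{\ell-2}\cdots g^*_0g^{**}_0g^{**}_1\cdots g^{**}_{\ell-1}\in H$, then $\ell<\min(n,m)\cdot\chi$.
   Formalization: In (E) it is additionally assumed that a and a' do not both lie in H; as printed (E) fails, e.g. for L=AGL(1,5), H=K the stabilizer of 0 generated by t, I empty, H'=1, L' the stabilizer of 1, a=t², a'=t. *)

theory Defs
  imports Complex_Main "HOL-Algebra.Coset"
begin

section \<open>Notions in a single group\<close>

definition malnormal :: "'a set \<Rightarrow> ('a, 'm) monoid_scheme \<Rightarrow> bool" where
  "malnormal H G \<longleftrightarrow> subgroup H G \<and>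
     (\<forall>h \<in> H - {\<one>\<^bsub>G\<^esub>}. \<forall>g \<in> carrier G - H. inv\<^bsub>G\<^esub> g \<otimes>\<^bsub>G\<^esub> h \<otimes>\<^bsub>G\<^esub> g \<notin> H)"

definition good_fellows :: "('a, 'm) monoid_scheme \<Rightarrow> 'a set \<Rightarrow> 'a \<Rightarrow> 'a \<Rightarrow> bool" where
  "good_fellows G H g g' \<longleftrightarrow>
     g \<notin> (H <#>\<^bsub>G\<^esub> {g'} <#>\<^bsub>G\<^esub> H) \<union> (H <#>\<^bsub>G\<^esub> {inv\<^bsub>G\<^esub> g'} <#>\<^bsub>G\<^esub> H)"

definition torsion_free :: "('a, 'm) monoid_scheme \<Rightarrow> bool" where
  "torsion_free G \<longleftrightarrow>
     (\<forall>g \<in> carrier G. \<forall>n::nat. n > 0 \<longrightarrow> g [^]\<^bsub>G\<^esub> n = \<one>\<^bsub>G\<^esub> \<longrightarrow> g = \<one>\<^bsub>G\<^esub>)"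

definition normal_closure :: "('a, 'm) monoid_scheme \<Rightarrow> 'a set \<Rightarrow> 'a set" where
  "normal_closure G S = \<Inter>{N. normal N G \<and> S \<subseteq> N}"

definition word_prod :: "('a, 'm) monoid_scheme \<Rightarrow> 'a list \<Rightarrow> 'a" where
  "word_prod G gs = foldr (\<otimes>\<^bsub>G\<^esub>) gs \<one>\<^bsub>G\<^esub>"

definition rho_word :: "'a \<Rightarrow> 'a \<Rightarrow> 'a list" where
  "rho_word x y = concat (map (\<lambda>k. replicate k x @ [y]) [1..<81])"

lemma length_rho_word: "length (rho_word x y) = 3320"
proof -
  have "length (rho_word x y) = sum_list (map Suc [1..<81])"
    by (simp add: rho_word_def length_concat comp_def del: upt_rec_numeral)
  also have "\<dots> = 3320"
    by code_simp
  finally show ?thesis .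
qed

definition rho :: "('a, 'm) monoid_scheme \<Rightarrow> 'a \<Rightarrow> 'a \<Rightarrow> 'a" where
  "rho G x y = word_prod G (rho_word x y)"

section \<open>The free product with amalgamation\<close>

text \<open>
  Two groups on subsets of the same type, whose operations agree on the intersection
  of the carriers, are amalgamated along that intersection. The elements are the words over the
  union of the carriers, modulo the congruence that multiplies adjacent letters lying in a common
  factor and deletes the identity letters.
\<close>

inductive amalg_step :: "('a, 'm) monoid_scheme \<Rightarrow> ('a, 'n) monoid_scheme \<Rightarrow> 'a list \<Rightarrow> 'a list \<Rightarrow> bool"
  for K L where
  mult_left: "\<lbrakk>x \<in> carrier K; y \<in> carrier K\<rbrakk> \<Longrightarrow>
     amalg_step K L (us @ [x, y] @ vs) (us @ [x \<otimes>\<^bsub>K\<^esub> y] @ vs)"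
| mult_right: "\<lbrakk>x \<in> carrier L; y \<in> carrier L\<rbrakk> \<Longrightarrow>
     amalg_step K L (us @ [x, y] @ vs) (us @ [x \<otimes>\<^bsub>L\<^esub> y] @ vs)"
| one_left: "amalg_step K L (us @ [\<one>\<^bsub>K\<^esub>] @ vs) (us @ vs)"
| one_right: "amalg_step K L (us @ [\<one>\<^bsub>L\<^esub>] @ vs) (us @ vs)"

definition amalg_words :: "('a, 'm) monoid_scheme \<Rightarrow> ('a, 'n) monoid_scheme \<Rightarrow> 'a list set" where
  "amalg_words K L = lists (carrier K \<union> carrier L)"

definition amalg_rel ::
  "('a, 'm) monoid_scheme \<Rightarrow> ('a, 'n) monoid_scheme \<Rightarrow> ('a list \<times> 'a list) set" where
  "amalg_rel K L = {(us, vs). us \<in> amalg_words K L \<and> vs \<in> amalg_words K L \<and>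
     equivclp (amalg_step K L) us vs}"

definition amalgam ::
  "('a, 'm) monoid_scheme \<Rightarrow> ('a, 'n) monoid_scheme \<Rightarrow> 'a list set monoid" where
  "amalgam K L =
     \<lparr>carrier = amalg_words K L // amalg_rel K L,
      monoid.mult = (\<lambda>A B. \<Union>us \<in> A. \<Union>vs \<in> B. amalg_rel K L `` {us @ vs}),
      one = amalg_rel K L `` {[]}\<rparr>"

definition amalg_emb ::
  "('a, 'm) monoid_scheme \<Rightarrow> ('a, 'n) monoid_scheme \<Rightarrow> 'a \<Rightarrow> 'a list set" where
  "amalg_emb K L x = amalg_rel K L `` {[x]}"

section \<open>Canonical forms and small cancellation\<close>

text \<open>
  Below, \<open>M\<close> is the amalgamated product, and \<open>H\<close>, \<open>K\<close>, \<open>L\<close> are the amalgamated subgroup and the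
  two factors, regarded as subsets of \<open>M\<close>.
\<close>

definition canonical :: "'a set \<Rightarrow> 'a set \<Rightarrow> 'a set \<Rightarrow> 'a list \<Rightarrow> bool" where
  "canonical H K L gs \<longleftrightarrow> set gs \<subseteq> K \<union> L \<and>
     (length gs = 1 \<or>
      length gs > 1 \<and> (\<forall>i < length gs. gs ! i \<notin> H) \<and>
      (\<forall>i. i + 1 < length gs \<longrightarrow> (gs ! i \<in> K \<longleftrightarrow> gs ! (i + 1) \<in> L)))"

definition weakly_cyclically_reduced ::
  "('a, 'm) monoid_scheme \<Rightarrow> 'a set \<Rightarrow> 'a set \<Rightarrow> 'a set \<Rightarrow> 'a \<Rightarrow> bool" where
  "weakly_cyclically_reduced M H K L g \<longleftrightarrow> g \<noteq> \<one>\<^bsub>M\<^esub> \<and>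
     (\<exists>gs. canonical H K L gs \<and> word_prod M gs = g \<and>
        (length gs = 1 \<or> even (length gs) \<or> last gs \<otimes>\<^bsub>M\<^esub> hd gs \<notin> H))"

definition symmetrized ::
  "('a, 'm) monoid_scheme \<Rightarrow> 'a set \<Rightarrow> 'a set \<Rightarrow> 'a set \<Rightarrow> 'a set \<Rightarrow> bool" where
  "symmetrized M H K L R \<longleftrightarrow> R \<subseteq> carrier M \<and>
     (\<forall>g \<in> R. inv\<^bsub>M\<^esub> g \<in> R \<and>
        (\<forall>x \<in> carrier M. weakly_cyclically_reduced M H K L (inv\<^bsub>M\<^esub> x \<otimes>\<^bsub>M\<^esub> g \<otimes>\<^bsub>M\<^esub> x) \<longrightarrow>
           inv\<^bsub>M\<^esub> x \<otimes>\<^bsub>M\<^esub> g \<otimes>\<^bsub>M\<^esub> x \<in> R))"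

definition symmetric_closure ::
  "('a, 'm) monoid_scheme \<Rightarrow> 'a set \<Rightarrow> 'a set \<Rightarrow> 'a set \<Rightarrow> 'a set \<Rightarrow> 'a set" where
  "symmetric_closure M H K L S = \<Inter>{R. symmetrized M H K L R \<and> S \<subseteq> R}"

text \<open>
  The list \<open>us\<close> is $[g^*_0, \dots, g^*_{n-1}]$; the corresponding canonical form
  $g^*_{n-1} \cdots g^*_0$ is read off \<open>rev us\<close>. The list \<open>vs\<close> is $[g^{**}_0, \dots, g^{**}_{m-1}]$.
\<close>

definition C_prime ::
  "('a, 'm) monoid_scheme \<Rightarrow> 'a set \<Rightarrow> 'a set \<Rightarrow> 'a set \<Rightarrow> real \<Rightarrow> 'a set \<Rightarrow> bool" where
  "C_prime M H K L \<chi> S \<longleftrightarrow>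
     (\<forall>us vs l.
        canonical H K L (rev us) \<and> word_prod M (rev us) \<in> S \<and>
        canonical H K L vs \<and> word_prod M vs \<in> S \<and>
        word_prod M (rev us @ vs) \<noteq> \<one>\<^bsub>M\<^esub> \<and>
        l < length us \<and> l < length vs \<and>
        word_prod M (rev (take l us) @ take l vs) \<in> H
        \<longrightarrow> real l < real (min (length us) (length vs)) * \<chi>)"

section \<open>The amalgam is the pushout of its factors\<close>

lemma amalg_words_simps [simp]:
  "[] \<in> amalg_words K L"
  "us @ vs \<in> amalg_words K L \<longleftrightarrow> us \<in> amalg_words K L \<and> vs \<in> amalg_words K L"
  "x # us \<in> amalg_words K L \<longleftrightarrow> (x \<in> carrier K \<or> x \<in> carrier L) \<and> us \<in> amalg_words K L"
  by (auto simp: amalg_words_def)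

lemma equiv_amalg_rel: "equiv (amalg_words K L) (amalg_rel K L)"
  by (rule equivI) (auto simp: amalg_rel_def refl_on_def sym_def trans_def
      intro: equivclp_sym equivclp_trans)

lemma amalg_step_append:
  assumes "amalg_step K L us vs"
  shows "amalg_step K L (ps @ us @ qs) (ps @ vs @ qs)"
  using assms
proof cases
  case (mult_left x y as bs)
  then show ?thesis using amalg_step.mult_left[of x K y L "ps @ as" "bs @ qs"] by simp
next
  case (mult_right x y as bs)
  then show ?thesis using amalg_step.mult_right[of x L y K "ps @ as" "bs @ qs"] by simp
next
  case (one_left as bs)
  then show ?thesis using amalg_step.one_left[of K L "ps @ as" "bs @ qs"] by simp
next
  case (one_right as bs)
  then show ?thesis using amalg_step.one_right[of K L "ps @ as" "bs @ qs"] by simp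
qed

lemma equivclp_amalg_append:
  assumes "equivclp (amalg_step K L) us vs"
  shows "equivclp (amalg_step K L) (ps @ us @ qs) (ps @ vs @ qs)"
  using assms
proof (induction rule: equivclp_induct)
  case base
  then show ?case by simp
next
  case (step y z)
  then have "equivclp (amalg_step K L) (ps @ y @ qs) (ps @ z @ qs)"
    by (meson amalg_step_append r_into_equivclp equivclp_sym)
  then show ?case using step.IH equivclp_trans by metis
qed

lemma amalg_rel_append:
  assumes "(us, us') \<in> amalg_rel K L" "(vs, vs') \<in> amalg_rel K L"
  shows "(us @ vs, us' @ vs') \<in> amalg_rel K L"
proof -
  have "equivclp (amalg_step K L) (us @ vs) (us' @ vs)"
    using equivclp_amalg_append[of K L us us' "[]" vs] assms by (simp add: amalg_rel_def)
  moreover have "equivclp (amalg_step K L) (us' @ vs) (us' @ vs')"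
    using equivclp_amalg_append[of K L vs vs' us' "[]"] assms by (simp add: amalg_rel_def)
  ultimately show ?thesis
    using assms equivclp_trans by (fastforce simp: amalg_rel_def)
qed

lemma amalgam_mult_class:
  assumes "us \<in> amalg_words K L" "vs \<in> amalg_words K L"
  shows "amalg_rel K L `` {us} \<otimes>\<^bsub>amalgam K L\<^esub> amalg_rel K L `` {vs} = amalg_rel K L `` {us @ vs}"
proof -
  have "amalg_rel K L `` {us' @ vs'} = amalg_rel K L `` {us @ vs}"
    if "(us, us') \<in> amalg_rel K L" "(vs, vs') \<in> amalg_rel K L" for us' vs'
    using equiv_class_eq[OF equiv_amalg_rel amalg_rel_append[OF that]] by simp
  moreover have "(us, us) \<in> amalg_rel K L" "(vs, vs) \<in> amalg_rel K L"
    using assms by (auto simp: amalg_rel_def)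
  ultimately show ?thesis
    unfolding amalgam_def monoid.simps by (intro equalityI UN_least) blast+
qed

lemma amalgam_cases:
  assumes "A \<in> carrier (amalgam K L)"
  obtains us where "us \<in> amalg_words K L" "A = amalg_rel K L `` {us}"
  using assms by (auto simp: amalgam_def elim: quotientE)

lemma amalgam_class_closed:
  "us \<in> amalg_words K L \<Longrightarrow> amalg_rel K L `` {us} \<in> carrier (amalgam K L)"
  by (simp add: amalgam_def quotientI)

lemma amalgam_one: "\<one>\<^bsub>amalgam K L\<^esub> = amalg_rel K L `` {[]}"
  by (simp add: amalgam_def)

lemma amalg_class_step:
  assumes "us \<in> amalg_words K L" "vs \<in> amalg_words K L" "amalg_step K L us vs"
  shows "amalg_rel K L `` {us} = amalg_rel K L `` {vs}"
  using assms by (intro equiv_class_eq[OF equiv_amalg_rel]) (auto simp: amalg_rel_def)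

lemma amalg_emb_hom_left:
  assumes "group K" shows "amalg_emb K L \<in> hom K (amalgam K L)"
proof (rule homI)
  show "amalg_emb K L x \<in> carrier (amalgam K L)" if "x \<in> carrier K" for x
    using that by (simp add: amalg_emb_def amalgam_class_closed)
  show "amalg_emb K L (x \<otimes>\<^bsub>K\<^esub> y) = amalg_emb K L x \<otimes>\<^bsub>amalgam K L\<^esub> amalg_emb K L y"
    if "x \<in> carrier K" "y \<in> carrier K" for x y
    using that amalg_step.mult_left[of x K y L "[]" "[]"] assms
    by (simp add: amalg_emb_def amalgam_mult_class)
      (rule amalg_class_step[symmetric], auto simp: group.is_monoid monoid.m_closed)
qed

lemma amalg_emb_hom_right:
  assumes "group L" shows "amalg_emb K L \<in> hom L (amalgam K L)"
proof (rule homI)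
  show "amalg_emb K L x \<in> carrier (amalgam K L)" if "x \<in> carrier L" for x
    using that by (simp add: amalg_emb_def amalgam_class_closed)
  show "amalg_emb K L (x \<otimes>\<^bsub>L\<^esub> y) = amalg_emb K L x \<otimes>\<^bsub>amalgam K L\<^esub> amalg_emb K L y"
    if "x \<in> carrier L" "y \<in> carrier L" for x y
    using that amalg_step.mult_right[of x L y K "[]" "[]"] assms
    by (simp add: amalg_emb_def amalgam_mult_class)
      (rule amalg_class_step[symmetric], auto simp: group.is_monoid monoid.m_closed)
qed

lemma group_amalgam:
  assumes K: "group K" and L: "group L"
  shows "group (amalgam K L)"
proof (rule groupI)
  show "A \<otimes>\<^bsub>amalgam K L\<^esub> B \<in> carrier (amalgam K L)"
    if "A \<in> carrier (amalgam K L)" "B \<in> carrier (amalgam K L)" for A B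
    using that by (elim amalgam_cases) (simp add: amalgam_mult_class amalgam_class_closed)
  show "\<one>\<^bsub>amalgam K L\<^esub> \<in> carrier (amalgam K L)"
    by (simp add: amalgam_one amalgam_class_closed)
  show "A \<otimes>\<^bsub>amalgam K L\<^esub> B \<otimes>\<^bsub>amalgam K L\<^esub> C = A \<otimes>\<^bsub>amalgam K L\<^esub> (B \<otimes>\<^bsub>amalgam K L\<^esub> C)"
    if "A \<in> carrier (amalgam K L)" "B \<in> carrier (amalgam K L)" "C \<in> carrier (amalgam K L)"
    for A B C
    using that by (elim amalgam_cases) (simp add: amalgam_mult_class)
  show "\<one>\<^bsub>amalgam K L\<^esub> \<otimes>\<^bsub>amalgam K L\<^esub> A = A" if "A \<in> carrier (amalgam K L)" for A
    using that by (elim amalgam_cases) (simp add: amalgam_mult_class amalgam_one)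
  fix A assume "A \<in> carrier (amalgam K L)"
  then obtain us where us: "us \<in> amalg_words K L" "A = amalg_rel K L `` {us}"
    by (rule amalgam_cases)
  have "\<exists>vs \<in> amalg_words K L. amalg_rel K L `` {vs @ us} = amalg_rel K L `` {[]}"
    using us(1)
  proof (induction us)
    case Nil
    then show ?case by (intro bexI[of _ "[]"]) auto
  next
    case (Cons x us)
    then obtain vs where vs: "vs \<in> amalg_words K L"
      "amalg_rel K L `` {vs @ us} = amalg_rel K L `` {[]}" by auto
    obtain y where y: "y \<in> carrier K \<or> y \<in> carrier L"
      "amalg_rel K L `` {[y, x]} = amalg_rel K L `` {[]}"
    proof (cases "x \<in> carrier K")
      case True
      interpret group K by (rule K)
      have "amalg_rel K L `` {[inv\<^bsub>K\<^esub> x, x]} = amalg_rel K L `` {[\<one>\<^bsub>K\<^esub>]}"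
        using True amalg_step.mult_left[of "inv\<^bsub>K\<^esub> x" K x L "[]" "[]"]
        by (intro amalg_class_step) auto
      also have "\<dots> = amalg_rel K L `` {[]}"
        using amalg_step.one_left[of K L "[]" "[]"] by (intro amalg_class_step) auto
      finally show ?thesis using True by (intro that[of "inv\<^bsub>K\<^esub> x"]) auto
    next
      case False
      then have x: "x \<in> carrier L" using Cons.prems by simp
      interpret group L by (rule L)
      have "amalg_rel K L `` {[inv\<^bsub>L\<^esub> x, x]} = amalg_rel K L `` {[\<one>\<^bsub>L\<^esub>]}"
        using x amalg_step.mult_right[of "inv\<^bsub>L\<^esub> x" L x K "[]" "[]"]
        by (intro amalg_class_step) auto
      also have "\<dots> = amalg_rel K L `` {[]}"
        using amalg_step.one_right[of K L "[]" "[]"] by (intro amalg_class_step) auto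
      finally show ?thesis using x by (intro that[of "inv\<^bsub>L\<^esub> x"]) auto
    qed
    have x: "x \<in> carrier K \<or> x \<in> carrier L" and us: "us \<in> amalg_words K L"
      using Cons.prems by auto
    have "amalg_rel K L `` {(vs @ [y]) @ x # us} =
        amalg_rel K L `` {vs} \<otimes>\<^bsub>amalgam K L\<^esub> (amalg_rel K L `` {[y, x]} \<otimes>\<^bsub>amalgam K L\<^esub> amalg_rel K L `` {us})"
      using x y(1) us vs(1) by (simp add: amalgam_mult_class)
    also have "\<dots> = amalg_rel K L `` {vs @ us}"
      using us vs(1) unfolding y(2) by (simp add: amalgam_mult_class)
    finally show ?case using vs y by (intro bexI[of _ "vs @ [y]"]) auto
  qed
  then obtain vs where vs: "vs \<in> amalg_words K L"
    "amalg_rel K L `` {vs @ us} = amalg_rel K L `` {[]}" by blast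
  show "\<exists>B \<in> carrier (amalgam K L). B \<otimes>\<^bsub>amalgam K L\<^esub> A = \<one>\<^bsub>amalgam K L\<^esub>"
  proof
    show "amalg_rel K L `` {vs} \<otimes>\<^bsub>amalgam K L\<^esub> A = \<one>\<^bsub>amalgam K L\<^esub>"
      unfolding us(2) amalgam_mult_class[OF vs(1) us(1)] vs(2) amalgam_one ..
    show "amalg_rel K L `` {vs} \<in> carrier (amalgam K L)"
      by (rule amalgam_class_closed[OF vs(1)])
  qed
qed

lemma word_prod_append:
  assumes "group G" "set us \<subseteq> carrier G" "set vs \<subseteq> carrier G"
  shows "word_prod G (us @ vs) = word_prod G us \<otimes>\<^bsub>G\<^esub> word_prod G vs \<and> word_prod G us \<in> carrier G
    \<and> word_prod G vs \<in> carrier G"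
proof -
  interpret group G by fact
  have closed: "word_prod G ws \<in> carrier G" if "set ws \<subseteq> carrier G" for ws
    using that by (induction ws) (auto simp: word_prod_def)
  show ?thesis using assms(2) closed[OF assms(3)] closed
    by (induction us) (auto simp: word_prod_def m_assoc)
qed

lemma amalgam_universal:
  assumes K: "group K" and L: "group L" and G: "group G"
    and f: "f \<in> hom K G" "f \<in> hom L G"
  shows "\<exists>h \<in> hom (amalgam K L) G. \<forall>x \<in> carrier K \<union> carrier L. h (amalg_emb K L x) = f x"
    and "\<lbrakk>h \<in> hom (amalgam K L) G; h' \<in> hom (amalgam K L) G;
          \<forall>x \<in> carrier K \<union> carrier L. h (amalg_emb K L x) = f x;
          \<forall>x \<in> carrier K \<union> carrier L. h' (amalg_emb K L x) = f x;
          A \<in> carrier (amalgam K L)\<rbrakk> \<Longrightarrow> h A = h' A"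
proof -
  interpret group G by (rule G)
  define P where "P us = word_prod G (map (\<lambda>x. if x \<in> carrier K \<union> carrier L then f x else \<one>\<^bsub>G\<^esub>) us)"
    for us
  have fc: "x \<in> carrier K \<Longrightarrow> f x \<in> carrier G" "x \<in> carrier L \<Longrightarrow> f x \<in> carrier G" for x
    using f by (auto simp: hom_def)
  have sub: "set (map (\<lambda>x. if x \<in> carrier K \<union> carrier L then f x else \<one>\<^bsub>G\<^esub>) us) \<subseteq> carrier G" for us
    using fc by auto
  have Pc: "P us \<in> carrier G" and Papp: "P (us @ vs) = P us \<otimes>\<^bsub>G\<^esub> P vs" for us vs
    using word_prod_append[OF G sub sub, of us vs] by (auto simp: P_def)
  have P1: "P [x] = f x" if "x \<in> carrier K \<union> carrier L" for x
    using that fc by (auto simp: P_def word_prod_def)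
  have P2: "P [x, y] = f x \<otimes>\<^bsub>G\<^esub> f y" if "x \<in> carrier K \<union> carrier L" "y \<in> carrier K \<union> carrier L" for x y
    using that fc by (auto simp: P_def word_prod_def)
  have f1: "f \<one>\<^bsub>K\<^esub> = \<one>\<^bsub>G\<^esub>" "f \<one>\<^bsub>L\<^esub> = \<one>\<^bsub>G\<^esub>"
    using f hom_one K L G by blast+
  have Pnil: "P [] = \<one>\<^bsub>G\<^esub>" by (simp add: P_def word_prod_def)
  have Pstep: "P us = P vs" if "amalg_step K L us vs" for us vs
    using that
  proof cases
    case (mult_left x y as bs)
    moreover have "P [x, y] = P [x \<otimes>\<^bsub>K\<^esub> y]"
      using mult_left K f by (subst P1 P2; simp add: hom_mult group.is_monoid monoid.m_closed)+
    ultimately show ?thesis by (simp only: Papp)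
  next
    case (mult_right x y as bs)
    moreover have "P [x, y] = P [x \<otimes>\<^bsub>L\<^esub> y]"
      using mult_right L f by (subst P1 P2; simp add: hom_mult group.is_monoid monoid.m_closed)+
    ultimately show ?thesis by (simp only: Papp)
  next
    case (one_left as bs)
    moreover have "P [\<one>\<^bsub>K\<^esub>] = \<one>\<^bsub>G\<^esub>"
      using P1 f1 K by (simp add: group.is_monoid monoid.one_closed)
    ultimately show ?thesis using Pc by (simp only: Papp l_one r_one)
  next
    case (one_right as bs)
    moreover have "P [\<one>\<^bsub>L\<^esub>] = \<one>\<^bsub>G\<^esub>"
      using P1 f1 L by (simp add: group.is_monoid monoid.one_closed)
    ultimately show ?thesis using Pc by (simp only: Papp l_one r_one)
  qed
  have Prel: "P us = P vs" if "(us, vs) \<in> amalg_rel K L" for us vs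
  proof -
    have "equivclp (amalg_step K L) us vs" using that by (simp add: amalg_rel_def)
    then show ?thesis by (induction rule: equivclp_induct) (auto dest: Pstep)
  qed
  define h0 where "h0 A = P (SOME us. us \<in> A)" for A
  have h0: "h0 (amalg_rel K L `` {us}) = P us" if "us \<in> amalg_words K L" for us
  proof -
    have "us \<in> amalg_rel K L `` {us}" using that by (auto simp: amalg_rel_def)
    then have "(SOME vs. vs \<in> amalg_rel K L `` {us}) \<in> amalg_rel K L `` {us}" by (rule someI)
    then show ?thesis unfolding h0_def using Prel by (metis Image_singleton_iff)
  qed
  have "h0 \<in> hom (amalgam K L) G"
  proof (rule homI)
    show "h0 A \<in> carrier G" if "A \<in> carrier (amalgam K L)" for A
      using Pc by (simp add: h0_def)
    show "h0 (A \<otimes>\<^bsub>amalgam K L\<^esub> B) = h0 A \<otimes>\<^bsub>G\<^esub> h0 B"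
      if "A \<in> carrier (amalgam K L)" "B \<in> carrier (amalgam K L)" for A B
      using that by (elim amalgam_cases) (simp add: amalgam_mult_class h0 Papp)
  qed
  moreover have "\<forall>x \<in> carrier K \<union> carrier L. h0 (amalg_emb K L x) = f x"
    using P1 by (auto simp: amalg_emb_def h0)
  ultimately show "\<exists>h \<in> hom (amalgam K L) G. \<forall>x \<in> carrier K \<union> carrier L. h (amalg_emb K L x) = f x"
    by blast
  have uniq: "h (amalg_rel K L `` {us}) = P us"
    if h: "h \<in> hom (amalgam K L) G" "\<forall>x \<in> carrier K \<union> carrier L. h (amalg_emb K L x) = f x"
      and us: "us \<in> amalg_words K L" for h us
    using us
  proof (induction us)
    case Nil
    then show ?case
      using hom_one[OF h(1) group_amalgam[OF K L] G] by (simp add: amalgam_one Pnil)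
  next
    case (Cons x us)
    then have x: "x \<in> carrier K \<union> carrier L" and us: "us \<in> amalg_words K L" by auto
    have "amalg_rel K L `` {x # us} = amalg_emb K L x \<otimes>\<^bsub>amalgam K L\<^esub> amalg_rel K L `` {us}"
      using x us by (simp add: amalg_emb_def amalgam_mult_class)
    then have "h (amalg_rel K L `` {x # us}) = h (amalg_emb K L x) \<otimes>\<^bsub>G\<^esub> h (amalg_rel K L `` {us})"
      using x us by (simp add: hom_mult[OF h(1)] amalg_emb_def amalgam_class_closed)
    also have "\<dots> = P [x] \<otimes>\<^bsub>G\<^esub> P us" using h(2) x P1 Cons.IH us by simp
    also have "\<dots> = P (x # us)" using Papp[of "[x]" us] by simp
    finally show ?case .
  qed
  show "h A = h' A"
    if "h \<in> hom (amalgam K L) G" "h' \<in> hom (amalgam K L) G"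
      "\<forall>x \<in> carrier K \<union> carrier L. h (amalg_emb K L x) = f x"
      "\<forall>x \<in> carrier K \<union> carrier L. h' (amalg_emb K L x) = f x"
      "A \<in> carrier (amalgam K L)"
    using that(5) uniq[OF that(1,3)] uniq[OF that(2,4)] by (elim amalgam_cases) simp
qed

end

theory Submission
  imports Defs "HOL-Algebra.Generated_Groups" "HOL-Algebra.Bij"
begin

text \<open>
  \<open>M\<close> acts on its Bass--Serre tree, where every relator translates an axis by 6640. Because the blocks of
  \<open>rho\<close> have pairwise distinct lengths, two axes that share 600 edges carry the same pattern in the same
  direction. The alternatives (a), (c) and (d) exclude this for different indices; otherwise malnormality of
  \<open>H\<close> in \<open>L\<close> makes the discrepancy between the two paths trivial, so the axes coincide. This gives \<open>C'(1/10)\<close>.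

  Instead of van Kampen diagrams, Greendlinger's lemma is obtained by a windmill argument: starting from a
  vertex \<open>v\<close>, repeatedly adjoin all axes that meet the subtree built so far, together with their
  stabilizers. A ping-pong argument shows that every newly generated element \<open>n\<close> of the normal closure
  \<open>N\<close> moves \<open>v\<close> along a path that follows some axis for almost a whole period.
  Hence short elements of \<open>N\<close> are trivial, which settles injectivity and (C)--(F). For malnormality and
  torsion, one takes an element of minimal displacement modulo \<open>N\<close>: following more than half a period
  of an axis would allow a shortcut through a relator.
\<close>

section \<open>Trees as integer metric spaces\<close>

text \<open>Everything quantitative rests on two numbers. The cyclic word of a relator has 2 * 3320
  = 6640 letters, the period \<tau> of its axis, and \<Delta> = 600 bounds overlaps: 600 edges carry
  about 300 letters from \<open>L\<close>, enough to see complete gaps of the pattern (at most 81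
  each) and to dodge the positions perturbed by \<open>h\<close>. A tenth of a period is 664 > 600,
  and 8 * 600 + 8 <= 6640 is all that the windmill needs.

  The obstacle is that canonical forms are unique only up to elements of \<open>H\<close> and that
  the tree may have infinite valence, so neither letters nor finite diagrams can be counted
  directly. Geodesics do not depend on the choice of a canonical form, and the windmill uses only
  convexity and projections. Besides its role in (B), malnormality of \<open>H\<close> in
  \<open>L\<close> is needed so that an element fixing a long stretch of an axis pointwise is
  trivial. The stabilizer of an axis is then generated by the relator, and its nontrivial elements
  move by at least a full period.\<close>

locale tree_metric =
  fixes V :: "'v set" and d :: "'v \<Rightarrow> 'v \<Rightarrow> nat"
  assumes d_zero: "\<lbrakk>x \<in> V; y \<in> V\<rbrakk> \<Longrightarrow> d x y = 0 \<longleftrightarrow> x = y"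
    and d_sym: "\<lbrakk>x \<in> V; y \<in> V\<rbrakk> \<Longrightarrow> d x y = d y x"
    and d_tri: "\<lbrakk>x \<in> V; y \<in> V; z \<in> V\<rbrakk> \<Longrightarrow> d x z \<le> d x y + d y z"
    and seg_point: "\<lbrakk>x \<in> V; y \<in> V; n \<le> d x y\<rbrakk> \<Longrightarrow> \<exists>z \<in> V. d x z + d z y = d x y \<and> d x z = n"
    and seg_unique: "\<lbrakk>x \<in> V; y \<in> V; z \<in> V; z' \<in> V; d x z + d z y = d x y;
        d x z' + d z' y = d x y; d x z = d x z'\<rbrakk> \<Longrightarrow> z = z'"
    and median: "\<lbrakk>x \<in> V; y \<in> V; z \<in> V\<rbrakk> \<Longrightarrow> \<exists>m \<in> V. d x m + d m y = d x y \<and>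
        d y m + d m z = d y z \<and> d x m + d m z = d x z"
begin

definition seg :: "'v \<Rightarrow> 'v \<Rightarrow> 'v set" where
  "seg x y = {z \<in> V. d x z + d z y = d x y}"

definition convex :: "'v set \<Rightarrow> bool" where
  "convex S \<longleftrightarrow> S \<subseteq> V \<and> (\<forall>x\<in>S. \<forall>y\<in>S. seg x y \<subseteq> S)"

text \<open>The nearest-point projection to a convex set, encoded by the stronger property of lying
  on the segment to every point of the set.\<close>

definition gate :: "'v set \<Rightarrow> 'v \<Rightarrow> 'v" where
  "gate S x = (SOME p. p \<in> S \<and> (\<forall>s\<in>S. p \<in> seg x s))"

lemma d_refl [simp]: "x \<in> V \<Longrightarrow> d x x = 0"
  using d_zero by blast

lemma segI: "z \<in> V \<Longrightarrow> d x z + d z y = d x y \<Longrightarrow> z \<in> seg x y"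
  by (simp add: seg_def)

lemma segD: "z \<in> seg x y \<Longrightarrow> d x z + d z y = d x y" "z \<in> seg x y \<Longrightarrow> z \<in> V"
  by (simp_all add: seg_def)

lemma seg_commute: "x \<in> V \<Longrightarrow> y \<in> V \<Longrightarrow> seg x y = seg y x"
  by (auto simp: seg_def d_sym)

lemma seg_ends [simp]: "x \<in> V \<Longrightarrow> y \<in> V \<Longrightarrow> x \<in> seg x y" "x \<in> V \<Longrightarrow> y \<in> V \<Longrightarrow> y \<in> seg x y"
  by (auto simp: seg_def)

lemma seg_self [simp]: "x \<in> V \<Longrightarrow> seg x x = {x}"
  using d_zero by (auto simp: seg_def)

lemma convexD: "convex S \<Longrightarrow> x \<in> S \<Longrightarrow> y \<in> S \<Longrightarrow> seg x y \<subseteq> S" "convex S \<Longrightarrow> S \<subseteq> V"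
  by (auto simp: convex_def)

lemma convex_in_V: "convex S \<Longrightarrow> x \<in> S \<Longrightarrow> x \<in> V"
  by (auto simp: convex_def)

lemma seg_trans:
  assumes "x \<in> V" "y \<in> V" "z \<in> seg x y" "w \<in> seg x z"
  shows "w \<in> seg x y" "z \<in> seg w y"
proof -
  have V: "z \<in> V" "w \<in> V" using assms by (auto dest: segD)
  have "d x z + d z y = d x y" "d x w + d w z = d x z" using assms segD by auto
  moreover have "d w y \<le> d w z + d z y" "d x y \<le> d x w + d w y"
    using d_tri V assms by auto
  ultimately show "w \<in> seg x y" "z \<in> seg w y" using V by (auto simp: seg_def)
qed

text \<open>A segment has only one point at each distance from an end, so its points are linearly
  ordered: the point of a subsegment at the distance of \<open>w\<close> must be
  \<open>w\<close>.\<close>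

lemma seg_split:
  assumes "x \<in> V" "y \<in> V" "z \<in> seg x y" "w \<in> seg x y"
  shows "w \<in> seg x z \<or> w \<in> seg z y"
proof -
  have V: "z \<in> V" "w \<in> V" using assms by (auto dest: segD)
  note dz = segD(1)[OF assms(3)] and dw = segD(1)[OF assms(4)]
  show ?thesis
  proof (cases "d x w \<le> d x z")
    case True
    then obtain u where u: "u \<in> V" "d x u + d u z = d x z" "d x u = d x w"
      using seg_point assms(1) V(1) by blast
    then have "u \<in> seg x y" using seg_trans(1)[OF assms(1-3), of u] by (simp add: seg_def)
    then have "u = w" using seg_unique assms V u dw by (auto simp: seg_def)
    then show ?thesis using u V by (auto simp: seg_def)
  next
    case False
    then have "d w y \<le> d z y" using dz dw by linarith
    then obtain u where u: "u \<in> V" "d y u + d u z = d y z" "d y u = d y w"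
      using seg_point[of y z "d w y"] assms V d_sym by metis
    have "u \<in> seg y x" using seg_trans(1)[of y x z u] assms u V
      by (metis segI seg_commute)
    moreover have "w \<in> seg y x" using assms seg_commute by blast
    ultimately have "u = w" using seg_unique[of y x u w] assms V u by (auto simp: seg_def)
    then show ?thesis using u V assms by (metis d_sym segI add.commute)
  qed
qed

lemma median_ex:
  assumes "x \<in> V" "y \<in> V" "z \<in> V"
  obtains m where "m \<in> V" "m \<in> seg x y" "m \<in> seg y z" "m \<in> seg x z"
  using median[OF assms] by (auto simp: seg_def)

text \<open>Triangles are tripods: the median cuts every side into two legs shared with the other
  sides.\<close>

lemma seg_cover:
  assumes "x \<in> V" "y \<in> V" "z \<in> V"
  shows "seg x y \<subseteq> seg x z \<union> seg z y"
proof
  fix w assume w: "w \<in> seg x y"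
  obtain m where m: "m \<in> V" "m \<in> seg x y" "m \<in> seg y z" "m \<in> seg x z"
    using median_ex assms by blast
  have "w \<in> seg x m \<or> w \<in> seg m y" using seg_split[OF assms(1,2) m(2) w] .
  moreover have "seg x m \<subseteq> seg x z" using seg_trans(1) m assms by blast
  moreover have "seg m y \<subseteq> seg z y"
    using seg_trans(1)[of y z m] m assms seg_commute by blast
  ultimately show "w \<in> seg x z \<union> seg z y" by blast
qed

lemma convex_seg: "x \<in> V \<Longrightarrow> y \<in> V \<Longrightarrow> convex (seg x y)"
  unfolding convex_def
proof (intro conjI ballI)
  show "seg x y \<subseteq> V" by (auto simp: seg_def)
  fix u v assume a: "x \<in> V" "y \<in> V" "u \<in> seg x y" "v \<in> seg x y"
  have V: "u \<in> V" "v \<in> V" using a by (auto dest: segD)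
  from seg_split[OF a] show "seg u v \<subseteq> seg x y"
  proof
    assume "v \<in> seg x u"
    then have "seg v u \<subseteq> seg x u" using seg_trans(1)[of u x v] a V seg_commute by blast
    also have "\<dots> \<subseteq> seg x y" using seg_trans(1) a by blast
    finally show ?thesis using V seg_commute by simp
  next
    assume "v \<in> seg u y"
    then have "seg u v \<subseteq> seg u y" using seg_trans(1) a V by blast
    also have "\<dots> \<subseteq> seg x y" using seg_trans(1)[of y x u] a V seg_commute by blast
    finally show ?thesis .
  qed
qed

lemma convex_Un:
  assumes "convex S" "convex T" "S \<inter> T \<noteq> {}"
  shows "convex (S \<union> T)"
  unfolding convex_def
proof (intro conjI ballI)
  show "S \<union> T \<subseteq> V" using assms convexD by auto
  obtain q where q: "q \<in> S" "q \<in> T" using assms by auto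
  fix x y assume "x \<in> S \<union> T" "y \<in> S \<union> T"
  moreover have "seg x y \<subseteq> seg x q \<union> seg q y"
    using seg_cover calculation assms q convexD(2) by blast
  ultimately show "seg x y \<subseteq> S \<union> T"
    using convexD(1) assms q by blast
qed

text \<open>A nearest point \<open>p\<close> exists because distances are natural numbers. The
  median of \<open>p\<close>, \<open>s\<close> and \<open>x\<close> belongs to the set by convexity
  and is no farther from \<open>x\<close> than \<open>p\<close>, hence equals
  \<open>p\<close>.\<close>

lemma gate:
  assumes "convex S" "S \<noteq> {}" "x \<in> V"
  shows "gate S x \<in> S" "s \<in> S \<Longrightarrow> gate S x \<in> seg x s"
proof -
  obtain p where p: "p \<in> S" "\<And>s. s \<in> S \<Longrightarrow> d x p \<le> d x s"
    using ex_has_least_nat[of "\<lambda>p. p \<in> S" _ "d x"] assms(2) by blast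
  have "p \<in> seg x s" if "s \<in> S" for s
  proof -
    have V: "p \<in> V" "s \<in> V" using assms p that convex_in_V by auto
    obtain m where m: "m \<in> V" "m \<in> seg p s" "m \<in> seg x s" "m \<in> seg x p"
      using median_ex[of x p s] V assms by blast
    then have "m \<in> S" using convexD(1)[OF assms(1) p(1) that] by blast
    then have "d x p \<le> d x m" using p by blast
    then have "d m p = 0" using segD[OF m(4)] by simp
    then show ?thesis using m V d_zero by auto
  qed
  then have "\<exists>p. p \<in> S \<and> (\<forall>s\<in>S. p \<in> seg x s)" using p by blast
  then have *: "gate S x \<in> S \<and> (\<forall>s\<in>S. gate S x \<in> seg x s)"
    unfolding gate_def by (rule someI_ex)
  show "gate S x \<in> S" "s \<in> S \<Longrightarrow> gate S x \<in> seg x s" using * by auto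
qed

lemma seg_antisym:
  assumes "x \<in> V" "p \<in> seg x q" "q \<in> seg x p" shows "p = q"
proof -
  have "p \<in> V" "q \<in> V" using assms segD by auto
  then show ?thesis using segD(1)[OF assms(2)] segD(1)[OF assms(3)] d_zero d_sym by fastforce
qed

lemma gate_eq:
  assumes "convex S" "x \<in> V" "p \<in> S" "\<And>s. s \<in> S \<Longrightarrow> p \<in> seg x s"
  shows "gate S x = p"
  using assms gate[of S x] by (intro seg_antisym[OF assms(2)]) auto

lemma gate_id: "convex S \<Longrightarrow> x \<in> S \<Longrightarrow> gate S x = x"
  using convex_in_V by (intro gate_eq) auto

text \<open>The segment from \<open>x\<close> to a common point stays in \<open>T\<close> and runs
  through the gate.\<close>

lemma gate_in_meet:
  assumes "convex S" "convex T" "S \<inter> T \<noteq> {}" "x \<in> T"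
  shows "gate S x \<in> S \<inter> T"
proof -
  obtain q where q: "q \<in> S" "q \<in> T" using assms by auto
  have "x \<in> V" using assms convex_in_V by auto
  then have "gate S x \<in> S" "gate S x \<in> seg x q"
    using gate(1)[OF assms(1), of x] gate(2)[OF assms(1), of x q] q by auto
  then show ?thesis using convexD(1)[OF assms(2,4) q(2)] by auto
qed

text \<open>Distinct projections force the geodesic to enter \<open>S\<close> at one gate and to
  leave it at the other. The contrapositive is used too: a geodesic that misses \<open>S\<close> has
  ends with the same gate.\<close>

lemma gates_on_seg:
  assumes S: "convex S" and x: "x \<in> V" and y: "y \<in> V" and S0: "S \<noteq> {}"
    and ne: "gate S x \<noteq> gate S y"
  shows "d x y = d x (gate S x) + d (gate S x) (gate S y) + d (gate S y) y"
    "gate S x \<in> seg x y" "gate S y \<in> seg x y"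
proof -
  let ?p = "gate S x" and ?q = "gate S y"
  have V: "?p \<in> V" "?q \<in> V" "?p \<in> S" "?q \<in> S"
    using gate(1)[OF S S0 x] gate(1)[OF S S0 y] S convex_in_V by auto
  have pq: "?p \<in> seg x ?q" "?q \<in> seg y ?p" using gate(2)[OF S S0 x V(4)] gate(2)[OF S S0 y V(3)] .
  obtain m where m: "m \<in> V" "m \<in> seg x y" "m \<in> seg y ?q" "m \<in> seg x ?q"
    using median_ex[of x y ?q] x y V by blast
  have "m \<in> seg x ?p \<or> m \<in> seg ?p ?q" using seg_split[OF x V(2) pq(1) m(4)] .
  then have "m = ?q"
  proof
    assume "m \<in> seg ?p ?q"
    then have "m \<in> S" using convexD(1)[OF S] V by blast
    then have "?q \<in> seg y m" using gate(2)[OF S S0 y] by blast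
    then show ?thesis using seg_antisym[OF y m(3)] by simp
  next
    assume mp: "m \<in> seg x ?p"
    have "?p \<in> seg m ?q" using seg_trans(2)[OF x V(2) pq(1) mp] .
    then have "?p \<in> seg ?q m" using seg_commute m V by blast
    moreover have "m \<in> seg ?q y" using m(3) seg_commute V y by blast
    ultimately have "?p \<in> seg ?q y" using seg_trans(1)[of ?q y m ?p] V y by blast
    then have "?p \<in> seg y ?q" using seg_commute V y by blast
    then have "?p = ?q" using seg_antisym[OF y _ pq(2)] by blast
    then show ?thesis using ne by simp
  qed
  then have q: "?q \<in> seg x y" using m by simp
  then show "?q \<in> seg x y" "?p \<in> seg x y" using seg_trans(1)[OF x y q pq(1)] by auto
  show "d x y = d x ?p + d ?p ?q + d ?q y"
    using segD(1)[OF q] segD(1)[OF pq(1)] by simp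
qed

text \<open>The distance to \<open>S\<close> does not increase on the way from a point to its gate,
  and a geodesic is covered by two such ways and a segment inside \<open>S\<close>.\<close>

lemma gate_neighbourhood_convex:
  assumes S: "convex S" and S0: "S \<noteq> {}"
  shows "convex {x \<in> V. d x (gate S x) \<le> 1}"
  unfolding convex_def
proof (intro conjI ballI subsetI)
  fix x y z assume x: "x \<in> {x \<in> V. d x (gate S x) \<le> 1}" and y: "y \<in> {x \<in> V. d x (gate S x) \<le> 1}"
    and z: "z \<in> seg x y"
  have V: "x \<in> V" "y \<in> V" "z \<in> V" using x y z segD by auto
  let ?p = "gate S x" and ?q = "gate S y"
  have pq: "?p \<in> S" "?q \<in> S" "?p \<in> V" "?q \<in> V" using gate[OF S S0] V convexD(2)[OF S] by auto
  have near: "d w (gate S w) \<le> 1" if "u \<in> V" "d u (gate S u) \<le> 1" "w \<in> seg u (gate S u)" for u w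
  proof -
    have g: "gate S u \<in> S" "gate S u \<in> V" using gate[OF S S0] that convexD(2)[OF S] by auto
    have w: "w \<in> V" using that segD by auto
    have "gate S w \<in> seg w (gate S u)" using gate(2)[OF S S0 w g(1)] .
    then show ?thesis using segD(1)[OF that(3)] that(2) segD(1)[of "gate S w" w "gate S u"] by simp
  qed
  have "z \<in> seg x ?p \<union> seg ?p y" using seg_cover[of x y ?p] z V pq by auto
  moreover have "seg ?p y \<subseteq> seg ?p ?q \<union> seg ?q y" using seg_cover V pq by auto
  ultimately consider "z \<in> seg x ?p" | "z \<in> seg ?p ?q" | "z \<in> seg y ?q"
    using seg_commute V pq by blast
  then have "d z (gate S z) \<le> 1"
  proof cases
    case 1 then show ?thesis using near[of x z] x by auto
  next
    case 2 
    then have "z \<in> S" using convexD(1)[OF S pq(1,2)] by auto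
    then show ?thesis using gate_id[OF S] V by simp
  next
    case 3 then show ?thesis using near[of y z] y by auto
  qed
  then show "z \<in> {x \<in> V. d x (gate S x) \<le> 1}" using V by simp
qed auto

end

section \<open>Isometric group actions on a tree\<close>

lemma (in group) cancel_inv [simp]:
  assumes "g \<in> carrier G" "h \<in> carrier G"
  shows "inv g \<otimes> (g \<otimes> h) = h" "g \<otimes> (inv g \<otimes> h) = h"
  using assms by (simp_all flip: m_assoc)

lemma (in group) conj_eq_one:
  assumes "g \<in> carrier G" "s \<in> carrier G" "g \<otimes> s \<otimes> inv g = \<one>"
  shows "s = \<one>"
proof -
  have "s = inv g \<otimes> (g \<otimes> s \<otimes> inv g) \<otimes> g" using assms(1,2) by (simp add: m_assoc)
  then show ?thesis using assms by simp
qed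

locale tree_action = tree_metric V d + group G
  for V :: "'v set" and d and G (structure) +
  fixes act :: "'g \<Rightarrow> 'v \<Rightarrow> 'v"
  assumes act_closed [simp]: "\<lbrakk>g \<in> carrier G; x \<in> V\<rbrakk> \<Longrightarrow> act g x \<in> V"
    and act_one [simp]: "x \<in> V \<Longrightarrow> act \<one> x = x"
    and act_mult: "\<lbrakk>g \<in> carrier G; h \<in> carrier G; x \<in> V\<rbrakk> \<Longrightarrow> act (g \<otimes> h) x = act g (act h x)"
    and act_dist [simp]: "\<lbrakk>g \<in> carrier G; x \<in> V; y \<in> V\<rbrakk> \<Longrightarrow> d (act g x) (act g y) = d x y"
begin

lemma act_inv [simp]:
  assumes "g \<in> carrier G" "x \<in> V"
  shows "act (inv g) (act g x) = x" "act g (act (inv g) x) = x"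
  using assms by (simp_all flip: act_mult)

lemma act_image_mult: "\<lbrakk>g \<in> carrier G; h \<in> carrier G; S \<subseteq> V\<rbrakk> \<Longrightarrow> act (g \<otimes> h) ` S = act g ` act h ` S"
  by (auto simp: act_mult image_iff subset_iff Bex_def)

lemma act_image_one: "S \<subseteq> V \<Longrightarrow> act \<one> ` S = S"
  by (force simp: subset_iff)

lemma act_image_inv:
  assumes "g \<in> carrier G" "S \<subseteq> V"
  shows "act (inv g) ` act g ` S = S" "act g ` act (inv g) ` S = S"
  using assms by (simp_all flip: act_image_mult add: act_image_one)

lemma act_image_sub: "\<lbrakk>g \<in> carrier G; S \<subseteq> V\<rbrakk> \<Longrightarrow> act g ` S \<subseteq> V"
  by auto

lemma act_seg_iff: 
  "\<lbrakk>g \<in> carrier G; x \<in> V; y \<in> V; z \<in> V\<rbrakk> \<Longrightarrow> act g z \<in> seg (act g x) (act g y) \<longleftrightarrow> z \<in> seg x y"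
  by (simp add: seg_def)

lemma act_image_iff:
  "\<lbrakk>g \<in> carrier G; S \<subseteq> V; x \<in> V\<rbrakk> \<Longrightarrow> x \<in> act g ` S \<longleftrightarrow> act (inv g) x \<in> S"
  by (auto simp: subset_iff intro: image_eqI[of _ _ "act (inv g) x"])

lemma act_convex:
  assumes g: "g \<in> carrier G" and S: "convex S"
  shows "convex (act g ` S)"
  unfolding convex_def
proof (intro conjI ballI subsetI)
  have SV: "S \<subseteq> V" using S convexD by auto
  show "z \<in> V" if "z \<in> act g ` S" for z using that g SV by auto
  fix x y z assume x: "x \<in> act g ` S" and y: "y \<in> act g ` S" and z: "z \<in> seg x y"
  obtain x' y' where xy: "x' \<in> S" "y' \<in> S" "x = act g x'" "y = act g y'" using x y by auto
  have V: "x' \<in> V" "y' \<in> V" "z \<in> V" using xy SV z segD by auto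
  have "act (inv g) z \<in> seg x' y'"
    using act_seg_iff[of "inv g" x y z] z xy V g by simp
  then have "act (inv g) z \<in> S" using convexD(1)[OF S xy(1,2)] by auto
  then show "z \<in> act g ` S" using act_image_iff[OF g SV V(3)] by simp
qed

lemma act_gate:
  assumes g: "g \<in> carrier G" and S: "convex S" "S \<noteq> {}" and x: "x \<in> V"
  shows "gate (act g ` S) (act g x) = act g (gate S x)"
proof (rule gate_eq)
  show "convex (act g ` S)" "act g x \<in> V" "act g (gate S x) \<in> act g ` S"
    using act_convex g S x gate by auto
  fix s assume "s \<in> act g ` S"
  then obtain t where t: "t \<in> S" "s = act g t" by auto
  have V: "t \<in> V" "gate S x \<in> V" using t gate[OF S x] convex_in_V[OF S(1)] by auto
  show "act g (gate S x) \<in> seg (act g x) s"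
    using gate(2)[OF S x t(1)] t g V x by (simp add: act_seg_iff)
qed

end

section \<open>Small cancellation over a tree\<close>

text \<open>The axes are abstract here. \<open>axis_shortcut\<close> supplies a rotation in the
  right direction: moving \<open>x\<close> past \<open>y\<close> replaces a stretch of length
  \<open>d x y\<close> by its complement in a period. The constants in \<open>large\<close> make
  \<open>2 * c\<close> exceed \<open>\<tau> + 2 * \<Delta> + 2\<close>.\<close>

locale small_cancellation = tree_action V d G act
  for V :: "'v set" and d and G (structure) and act :: "'g \<Rightarrow> 'v \<Rightarrow> 'v" +
  fixes \<A> :: "'v set set" and \<tau> \<Delta> :: nat
  assumes axis_convex: "A \<in> \<A> \<Longrightarrow> convex A"
    and axis_nonempty: "A \<in> \<A> \<Longrightarrow> A \<noteq> {}"
    and axis_image: "\<lbrakk>g \<in> carrier G; A \<in> \<A>\<rbrakk> \<Longrightarrow> act g ` A \<in> \<A>"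
    and axis_displacement: "\<lbrakk>A \<in> \<A>; s \<in> carrier G; act s ` A = A; s \<noteq> \<one>; x \<in> A\<rbrakk> \<Longrightarrow> \<tau> \<le> d x (act s x)"
    and axis_overlap: "\<lbrakk>A \<in> \<A>; B \<in> \<A>; A \<noteq> B; x \<in> A \<inter> B; y \<in> A \<inter> B\<rbrakk> \<Longrightarrow> d x y \<le> \<Delta>"
    and axis_shortcut: "\<lbrakk>A \<in> \<A>; x \<in> A; y \<in> A; d x y \<le> \<tau>\<rbrakk> \<Longrightarrow>
        \<exists>s \<in> carrier G. act s ` A = A \<and> d y (act s x) = \<tau> - d x y"
    and large: "8 * \<Delta> + 8 \<le> \<tau>"
begin

definition Z :: "'v set \<Rightarrow> 'g set" where
  "Z A = {s \<in> carrier G. act s ` A = A}"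

text \<open>Generated by the full setwise stabilizers of the axes. It is normal because the set of
  axes is invariant, and it turns out to be the normal closure of the relators.\<close>

definition relator_group :: "'g set" where
  "relator_group = generate G (\<Union>A\<in>\<A>. Z A)"

text \<open>What is left of a period after subtracting the extent \<open>2 * \<Delta> + 2\<close> of
  the overlap of an axis with \<open>W\<close> and the tolerance \<Delta> of \<open>near\<close>. A
  stretch of length \<open>c\<close> exceeds half a period.\<close>

definition c :: nat where "c = \<tau> - 3 * \<Delta> - 2"

lemma axis_sub: "A \<in> \<A> \<Longrightarrow> A \<subseteq> V"
  using axis_convex convexD by blast

lemma axis_V: "A \<in> \<A> \<Longrightarrow> x \<in> A \<Longrightarrow> x \<in> V"
  using axis_sub by blast

lemma Z_carrier: "s \<in> Z A \<Longrightarrow> s \<in> carrier G"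
  by (simp add: Z_def)

lemma Z_image: "s \<in> Z A \<Longrightarrow> act s ` A = A"
  by (simp add: Z_def)

lemma Z_inv: "A \<in> \<A> \<Longrightarrow> s \<in> Z A \<Longrightarrow> inv s \<in> Z A"
  using act_image_inv(1)[of s A] axis_sub[of A] by (auto simp: Z_def)

lemma Z_mult: "A \<in> \<A> \<Longrightarrow> s \<in> Z A \<Longrightarrow> t \<in> Z A \<Longrightarrow> s \<otimes> t \<in> Z A"
  using act_image_mult[of s t A] axis_sub[of A] by (auto simp: Z_def)

lemma Z_one: "A \<in> \<A> \<Longrightarrow> \<one> \<in> Z A"
  using act_image_one[of A] axis_sub[of A] by (auto simp: Z_def)

lemma Z_conj:
  assumes "A \<in> \<A>" "g \<in> carrier G" "s \<in> Z A"
  shows "g \<otimes> s \<otimes> inv g \<in> Z (act g ` A)"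
proof -
  have "act (g \<otimes> s \<otimes> inv g) ` act g ` A = act g ` act s ` act (inv g) ` act g ` A"
    using assms axis_sub[of A] Z_carrier[of s A] by (simp add: act_image_mult act_image_sub)
  also have "\<dots> = act g ` A"
    using assms axis_sub[of A] Z_image by (simp add: act_image_inv)
  finally show ?thesis using assms by (auto simp: Z_def)
qed

text \<open>No orientation of \<open>p\<close> and \<open>q\<close> along the geodesic is recorded;
  \<open>big_ordered\<close> restores it.\<close>

definition big :: "'v \<Rightarrow> 'v \<Rightarrow> bool" where
  "big x y \<longleftrightarrow> (\<exists>A\<in>\<A>. \<exists>p\<in>A \<inter> seg x y. \<exists>q\<in>A \<inter> seg x y. c \<le> d p q)"

text \<open>
  The bound for the axes not yet absorbed has room for thickening \<open>W\<close> by 1: the estimate produced by a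
  step is \<open>2 * \<Delta>\<close> whatever the previous bound was, so the errors do not accumulate.
\<close>

definition windmill :: "'v \<Rightarrow> 'v set \<Rightarrow> 'g set \<Rightarrow> bool" where
  "windmill v W \<Gamma> \<longleftrightarrow> convex W \<and> v \<in> W \<and> subgroup \<Gamma> G \<and> (\<forall>g\<in>\<Gamma>. act g ` W = W) \<and>
     (\<forall>C\<in>\<A>. Z C \<subseteq> \<Gamma> \<or> (\<forall>x\<in>C \<inter> W. \<forall>y\<in>C \<inter> W. d x y \<le> 2 * \<Delta> + 2)) \<and>
     (\<forall>g\<in>\<Gamma>. g \<noteq> \<one> \<longrightarrow> big v (act g v))"

lemma windmill_start: "v \<in> V \<Longrightarrow> windmill v {v} {\<one>}"
  using triv_subgroup by (auto simp: windmill_def convex_def)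

end

section \<open>One step of the windmill: ping-pong\<close>

locale windmill_step = small_cancellation V d G act \<A> \<tau> \<Delta>
  for V :: "'v set" and d and G (structure) and act :: "'g \<Rightarrow> 'v \<Rightarrow> 'v" and \<A> \<tau> \<Delta> +
  fixes v :: 'v and W :: "'v set" and \<Gamma> :: "'g set"
  assumes W: "windmill v W \<Gamma>"
begin

text \<open>Axes whose stabilizer already lies in \<Gamma> are left out: only for the others does
  \<open>windmill\<close> bound the overlap with \<open>W\<close>.\<close>

definition \<B> :: "'v set set" where
  "\<B> = {A \<in> \<A>. A \<inter> W \<noteq> {} \<and> \<not> Z A \<subseteq> \<Gamma>}"

definition \<Gamma>' :: "'g set" where
  "\<Gamma>' = generate G (\<Gamma> \<union> (\<Union>A\<in>\<B>. Z A))"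

text \<open>
  The second component of a cell records a coset of \<open>\<Gamma>\<close>, so that a translate of \<open>(W, \<Gamma>)\<close> is again
  \<open>(W, \<Gamma>)\<close> only if the translating element lies in \<open>\<Gamma>\<close>. A pair \<open>(Q, A)\<close> in \<open>beyond\<close> is a translated cell
  whose reduced expression starts with a rotation about the axis \<open>A\<close>; these are the ping-pong moves.
\<close>

definition cells :: "('v set \<times> 'g set) set" where
  "cells = insert (W, \<Gamma>) ((\<lambda>A. (A, {})) ` \<B>)"

definition move :: "'g \<Rightarrow> ('v set \<times> 'g set) \<Rightarrow> ('v set \<times> 'g set)" where
  "move g Q = (act g ` fst Q, (\<otimes>) g ` snd Q)"

inductive_set beyond :: "(('v set \<times> 'g set) \<times> 'v set) set" where
  base: "\<lbrakk>Q \<in> cells; A \<in> \<B>; Q \<noteq> (A, {}); s \<in> Z A; s \<noteq> \<one>\<rbrakk> \<Longrightarrow> (move s Q, A) \<in> beyond"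
| step: "\<lbrakk>(Q, B) \<in> beyond; A \<in> \<B>; A \<noteq> B; s \<in> Z A; s \<noteq> \<one>\<rbrakk> \<Longrightarrow> (move s Q, A) \<in> beyond"

text \<open>The ping-pong sets \<open>far\<close> and \<open>near\<close> measure positions on
  \<open>A\<close> after projection, relative to the overlap of \<open>A\<close> with
  \<open>W\<close>. Nontrivial rotations about \<open>A\<close> send \<open>near A\<close> into
  \<open>far A\<close>, and \<open>far B\<close> lies in \<open>near A\<close> for every other axis
  \<open>B\<close>.\<close>

definition far :: "'v set \<Rightarrow> 'v set" where
  "far A = {z \<in> V. \<forall>j\<in>A \<inter> W. c \<le> d j (gate A z)}"

definition near :: "'v set \<Rightarrow> 'v set" where
  "near A = {z \<in> V. \<exists>j\<in>A \<inter> W. d j (gate A z) \<le> \<Delta>}"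

lemma W_convex: "convex W" and v_in: "v \<in> W" and \<Gamma>_subgroup: "subgroup \<Gamma> G"
  and \<Gamma>_W: "g \<in> \<Gamma> \<Longrightarrow> act g ` W = W"
  and \<Gamma>_big: "g \<in> \<Gamma> \<Longrightarrow> g \<noteq> \<one> \<Longrightarrow> big v (act g v)"
  using W by (auto simp: windmill_def)

lemma W_V: "x \<in> W \<Longrightarrow> x \<in> V"
  using W_convex convex_in_V by blast

lemma \<Gamma>_carrier: "g \<in> \<Gamma> \<Longrightarrow> g \<in> carrier G"
  by (rule subgroup.mem_carrier[OF \<Gamma>_subgroup])

lemma \<Gamma>_closed: "\<one> \<in> \<Gamma>" "g \<in> \<Gamma> \<Longrightarrow> inv g \<in> \<Gamma>" "g \<in> \<Gamma> \<Longrightarrow> h \<in> \<Gamma> \<Longrightarrow> g \<otimes> h \<in> \<Gamma>"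
  using \<Gamma>_subgroup subgroup.one_closed subgroup.m_inv_closed subgroup.m_closed by metis+

lemma \<B>_\<A>: "A \<in> \<B> \<Longrightarrow> A \<in> \<A>"
  by (simp add: \<B>_def)

lemma \<B>_meets: "A \<in> \<B> \<Longrightarrow> A \<inter> W \<noteq> {}"
  by (simp add: \<B>_def)

lemma \<B>_overlap: "\<lbrakk>A \<in> \<B>; x \<in> A \<inter> W; y \<in> A \<inter> W\<rbrakk> \<Longrightarrow> d x y \<le> 2 * \<Delta> + 2"
  using W unfolding windmill_def \<B>_def by blast

lemma \<B>_image:
  assumes "A \<in> \<B>" "g \<in> \<Gamma>" shows "act g ` A \<in> \<B>"
proof -
  have g: "g \<in> carrier G" using \<Gamma>_carrier assms by simp
  have A: "A \<in> \<A>" "A \<subseteq> V" using \<B>_\<A> axis_sub assms by auto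
  have ig: "inv g \<in> \<Gamma>" using \<Gamma>_closed(2) assms by blast
  have "act g ` (A \<inter> W) \<subseteq> act g ` A \<inter> W" using \<Gamma>_W[OF assms(2)] by blast
  then have 1: "act g ` A \<inter> W \<noteq> {}" using \<B>_meets[OF assms(1)] by blast
  have "\<not> Z (act g ` A) \<subseteq> \<Gamma>"
  proof
    assume *: "Z (act g ` A) \<subseteq> \<Gamma>"
    have "s \<in> \<Gamma>" if s: "s \<in> Z A" for s
    proof -
      have "g \<otimes> s \<otimes> inv g \<in> \<Gamma>" using Z_conj[OF A(1) g s] * by auto
      then have "inv g \<otimes> (g \<otimes> s \<otimes> inv g) \<otimes> g \<in> \<Gamma>"
        using \<Gamma>_closed(3) ig assms(2) by blast
      moreover have "inv g \<otimes> (g \<otimes> s \<otimes> inv g) \<otimes> g = s"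
        using g Z_carrier[OF s] by (simp add: m_assoc)
      ultimately show ?thesis by simp
    qed
    then show False using assms(1) by (auto simp: \<B>_def)
  qed
  then show ?thesis using 1 axis_image[OF g A(1)] by (simp add: \<B>_def)
qed

lemma near_W:
  assumes "A \<in> \<B>" "z \<in> W" shows "z \<in> near A"
proof -
  have "gate A z \<in> A \<inter> W"
    using gate_in_meet[OF _ W_convex \<B>_meets] axis_convex \<B>_\<A> assms by blast
  then show ?thesis using assms W_V by (auto simp: near_def intro!: bexI[of _ "gate A z"])
qed

text \<open>By the Helly property of subtrees, the overlap of two axes meeting \<open>W\<close> reaches \<open>W\<close>.\<close>

lemma near_overlap:
  assumes "A \<in> \<B>" "B \<in> \<B>" "A \<noteq> B" "p \<in> A \<inter> B"
  shows "\<exists>j \<in> A \<inter> B \<inter> W. d j p \<le> \<Delta>"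
proof -
  have AB: "A \<in> \<A>" "B \<in> \<A>" using assms \<B>_\<A> by auto
  obtain x y where x: "x \<in> A" "x \<in> W" and y: "y \<in> B" "y \<in> W"
    using \<B>_meets assms by blast
  have V: "x \<in> V" "y \<in> V" "p \<in> V" using x y W_V assms axis_V[OF AB(1)] by auto
  obtain m where m: "m \<in> V" "m \<in> seg x y" "m \<in> seg y p" "m \<in> seg x p"
    using median_ex V by blast
  have "m \<in> W" "m \<in> A" "m \<in> B"
    using m convexD(1)[OF W_convex x(2) y(2)] convexD(1)[OF axis_convex[OF AB(1)] x(1), of p]
      convexD(1)[OF axis_convex[OF AB(2)] y(1), of p] assms(4) by auto
  moreover have "d m p \<le> \<Delta>" using axis_overlap[OF AB assms(3)] calculation assms(4) by auto
  ultimately show ?thesis by blast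
qed

text \<open>\<open>B\<close> together with \<open>W\<close> is convex and meets \<open>A\<close>, so
  the gate of a point of \<open>B\<close> falls into \<open>A \<inter> B\<close> or into
  \<open>A \<inter> W\<close>.\<close>

lemma near_axis:
  assumes "A \<in> \<B>" "B \<in> \<B>" "A \<noteq> B" "z \<in> B"
  shows "z \<in> near A"
proof -
  have AB: "A \<in> \<A>" "B \<in> \<A>" using assms \<B>_\<A> by auto
  have z: "z \<in> V" using axis_V AB assms by blast
  show ?thesis
  proof (cases "gate A z \<in> B")
    case True
    then have "gate A z \<in> A \<inter> B" using gate(1)[OF axis_convex axis_nonempty z] AB by auto
    then show ?thesis using near_overlap[OF assms(1-3)] z by (auto simp: near_def)
  next
    case False
    have conv: "convex (B \<union> W)"
      using convex_Un axis_convex AB(2) W_convex \<B>_meets[OF assms(2)] by blast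
    have "gate A z \<in> A \<inter> (B \<union> W)"
      using gate_in_meet[OF axis_convex[OF AB(1)] conv, of z] \<B>_meets[OF assms(1)] assms by blast
    then have "gate A z \<in> A \<inter> W" using False by blast
    then show ?thesis using z axis_V AB by (auto simp: near_def intro!: bexI[of _ "gate A z"])
  qed
qed

text \<open>The gate on \<open>A\<close> could miss \<open>B \<union> W\<close> only on the way from
  \<open>z\<close> to \<open>?b\<close>. Then \<open>A\<close> would contain both \<open>?b\<close>
  and a point of \<open>B \<inter> W\<close>; these are at least \<open>c\<close> apart, more than
  two axes can share.\<close>

lemma near_far:
  assumes "A \<in> \<B>" "B \<in> \<B>" "A \<noteq> B" "z \<in> far B"
  shows "z \<in> near A"
proof -
  have AB: "A \<in> \<A>" "B \<in> \<A>" using assms \<B>_\<A> by auto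
  have z: "z \<in> V" using assms by (auto simp: far_def)
  let ?b = "gate B z"
  have b: "?b \<in> B" using gate(1)[OF axis_convex axis_nonempty z] AB by auto
  have bV: "?b \<in> V" using axis_V AB b by blast
  let ?S = "B \<union> W"
  have S: "convex ?S"
    using convex_Un axis_convex AB(2) W_convex \<B>_meets[OF assms(2)] by blast
  have seg: "convex (seg z ?b)" using convex_seg z bV by simp
  have T: "convex (seg z ?b \<union> ?S)"
    by (rule convex_Un[OF seg S]) (use b seg_ends(2)[OF z bV] in blast)
  have AT: "A \<inter> (seg z ?b \<union> ?S) \<noteq> {}" using \<B>_meets[OF assms(1)] by blast
  have a: "gate A z \<in> A" "gate A z \<in> seg z ?b \<union> ?S"
    using gate_in_meet[OF axis_convex[OF AB(1)] T AT, of z] z bV by auto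
  have notS: "gate A z \<in> ?S" 
  proof (rule ccontr)
    assume n: "gate A z \<notin> ?S"
    then have "gate A z \<in> seg z ?b" using a by blast
    obtain j where j: "j \<in> A" "j \<in> W" using \<B>_meets assms by blast
    have V: "gate A z \<in> V" "j \<in> V" using a axis_V AB j by auto
    have gg: "gate B (gate A z) = ?b"
    proof (rule gate_eq[OF axis_convex[OF AB(2)] V(1) b])
      fix s assume s: "s \<in> B"
      have "?b \<in> seg z s" using gate(2)[OF axis_convex[OF AB(2)] _ z s] s by auto
      then show "?b \<in> seg (gate A z) s"
        using seg_trans(2)[OF z axis_V[OF AB(2) s]] \<open>gate A z \<in> seg z ?b\<close> by blast
    qed
    have jb: "gate B j \<in> B \<inter> W" using gate_in_meet[OF axis_convex[OF AB(2)] W_convex] \<B>_meets[OF assms(2)] j by blast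
    then have "c \<le> d (gate B j) ?b" using assms(4) by (auto simp: far_def)
    then have ne: "gate B j \<noteq> gate B (gate A z)" using gg large bV by (auto simp: c_def)
    have "gate B j \<in> seg j (gate A z)" "?b \<in> seg j (gate A z)"
      using gates_on_seg[OF axis_convex[OF AB(2)] V(2,1) axis_nonempty[OF AB(2)] ne] gg by auto
    then have "?b \<in> A \<inter> B" "gate B j \<in> A \<inter> B"
      using convexD(1)[OF axis_convex[OF AB(1)] j(1) a(1)] b jb by auto
    then have "d (gate B j) ?b \<le> \<Delta>" using axis_overlap[OF AB assms(3)] by blast
    then show False using \<open>c \<le> d (gate B j) ?b\<close> large by (simp add: c_def)
  qed
  then show ?thesis
  proof
    assume "gate A z \<in> W"
    then show ?thesis using a z axis_V AB by (auto simp: near_def intro!: bexI[of _ "gate A z"])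
  next
    assume "gate A z \<in> B"
    then have "gate A z \<in> A \<inter> B" using a by simp
    then show ?thesis using near_overlap[OF assms(1-3)] z by (auto simp: near_def)
  qed
qed

text \<open>This estimate dictates the value of \<open>c\<close>: of the displacement \<tau> at
  \<open>j'\<close>, at most \<open>2 * \<Delta> + 2\<close> is lost in passing from
  \<open>j'\<close> to \<open>j\<close>, and at most \<Delta> in passing to the gate.\<close>

lemma far_if_near:
  assumes "A \<in> \<B>" "z \<in> near A" "s \<in> Z A" "s \<noteq> \<one>"
  shows "act s z \<in> far A"
proof -
  have A: "A \<in> \<A>" using assms \<B>_\<A> by auto
  have z: "z \<in> V" using assms by (auto simp: near_def)
  have s: "s \<in> carrier G" "act s ` A = A" using assms Z_carrier Z_image by auto
  let ?p = "gate A z"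
  have p: "?p \<in> A" "?p \<in> V" using gate(1)[OF axis_convex axis_nonempty z] A axis_V by auto
  have g: "gate A (act s z) = act s ?p"
    using act_gate[OF s(1) axis_convex[OF A] axis_nonempty[OF A] z] s(2) by simp
  obtain j' where j': "j' \<in> A \<inter> W" "d j' ?p \<le> \<Delta>" using assms by (auto simp: near_def)
  have "c \<le> d j (act s ?p)" if j: "j \<in> A \<inter> W" for j
  proof -
    have V: "j \<in> V" "j' \<in> V" using j j' axis_V A by auto
    have "\<tau> \<le> d j' (act s j')" using axis_displacement[OF A s(1,2) assms(4)] j' by auto
    also have "\<dots> \<le> d j' j + d j (act s j')" using d_tri V s by auto
    also have "d j (act s j') \<le> d j (act s ?p) + d (act s ?p) (act s j')"
      by (rule d_tri) (use V s p in auto)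
    also have "d (act s ?p) (act s j') = d ?p j'" using s p V by simp
    also have "d ?p j' = d j' ?p" using d_sym p V by simp
    finally show ?thesis using j'(2) \<B>_overlap[OF assms(1) j'(1) j] by (simp add: c_def)
  qed
  then show ?thesis using g s z by (auto simp: far_def)
qed

text \<open>The ping-pong itself: each further rotation about a different axis moves
  \<open>far\<close> of the old axis into \<open>far\<close> of the new one.\<close>

lemma beyond_far: "(Q, A) \<in> beyond \<Longrightarrow> A \<in> \<B> \<and> fst Q \<subseteq> far A"
proof (induction rule: beyond.induct)
  case (base Q A s)
  have "fst Q \<subseteq> near A"
  proof (cases "Q = (W, \<Gamma>)")
    case True
    then show ?thesis using near_W[OF base(2)] by auto
  next
    case False
    then obtain B where "B \<in> \<B>" "Q = (B, {})" using base(1) by (auto simp: cells_def)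
    then show ?thesis using near_axis[OF base(2)] base(3) by auto
  qed
  then show ?case using base far_if_near by (auto simp: move_def)
next
  case (step Q B A s)
  then have "fst Q \<subseteq> near A" using near_far by blast
  then show ?case using step far_if_near by (auto simp: move_def)
qed

lemma move_one: "fst Q \<subseteq> V \<Longrightarrow> snd Q \<subseteq> carrier G \<Longrightarrow> move \<one> Q = Q"
  by (cases Q) (force simp: move_def act_image_one subset_iff)

lemma move_mult:
  "\<lbrakk>g \<in> carrier G; h \<in> carrier G; fst Q \<subseteq> V; snd Q \<subseteq> carrier G\<rbrakk> \<Longrightarrow> move (g \<otimes> h) Q = move g (move h Q)"
  by (auto simp: move_def act_image_mult m_assoc subset_iff image_iff)

lemma move_sub:
  "\<lbrakk>g \<in> carrier G; fst Q \<subseteq> V; snd Q \<subseteq> carrier G\<rbrakk> \<Longrightarrow> fst (move g Q) \<subseteq> V \<and> snd (move g Q) \<subseteq> carrier G"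
  by (auto simp: move_def)

lemma cells_sub: "Q \<in> cells \<Longrightarrow> fst Q \<subseteq> V \<and> snd Q \<subseteq> carrier G"
  using W_V \<Gamma>_carrier axis_V[OF \<B>_\<A>] by (auto simp: cells_def)

lemma beyond_sub: "(Q, A) \<in> beyond \<Longrightarrow> fst Q \<subseteq> V \<and> snd Q \<subseteq> carrier G"
  by (induction rule: beyond.induct) (use move_sub cells_sub Z_carrier in blast)+

lemma in_beyondD: "Q \<in> fst ` beyond \<Longrightarrow> \<exists>A. (Q, A) \<in> beyond"
  by (erule imageE) (metis prod.collapse)

lemma orbit_sub: "Q \<in> cells \<union> fst ` beyond \<Longrightarrow> fst Q \<subseteq> V \<and> snd Q \<subseteq> carrier G"
  using cells_sub[of Q] beyond_sub[of Q] in_beyondD[of Q] by blast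

lemma cells_move:
  assumes "g \<in> \<Gamma>" "Q \<in> cells" shows "move g Q \<in> cells"
proof -
  consider "Q = (W, \<Gamma>)" | A where "A \<in> \<B>" "Q = (A, {})"
    using assms(2) by (auto simp: cells_def)
  then show ?thesis
  proof cases
    case 1
    have "h \<in> (\<otimes>) g ` \<Gamma>" if "h \<in> \<Gamma>" for h
      by (rule image_eqI[of _ _ "inv g \<otimes> h"])
        (use that assms(1) \<Gamma>_closed(2,3) \<Gamma>_carrier in simp_all)
    then have "(\<otimes>) g ` \<Gamma> = \<Gamma>" using \<Gamma>_closed(3)[OF assms(1)] by fast
    then show ?thesis
      unfolding move_def 1 fst_conv snd_conv \<Gamma>_W[OF assms(1)] by (simp add: cells_def)
  next
    case 2
    then show ?thesis using \<B>_image[OF 2(1) assms(1)] by (simp add: cells_def move_def)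
  qed
qed

text \<open>Conjugation turns a rotation about \<open>A\<close> into one about its translate, so an
  element of \<Gamma> can be pushed past all rotations.\<close>

lemma beyond_move:
  assumes "(Q, A) \<in> beyond" and g: "g \<in> \<Gamma>"
  shows "(move g Q, act g ` A) \<in> beyond"
  using assms(1)
proof (induction rule: beyond.induct)
  case (base Q A s)
  have A: "A \<in> \<A>" "A \<subseteq> V" using \<B>_\<A> axis_sub base by auto
  have gc: "g \<in> carrier G" "s \<in> carrier G" using \<Gamma>_carrier g Z_carrier base by auto
  have Q: "fst Q \<subseteq> V" "snd Q \<subseteq> carrier G" using cells_sub base by auto
  have "(move (g \<otimes> s \<otimes> inv g) (move g Q), act g ` A) \<in> beyond"
  proof (rule beyond.base)
    show "move g Q \<in> cells" using cells_move g base by simp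
    show "act g ` A \<in> \<B>" using \<B>_image g base by simp
    show "g \<otimes> s \<otimes> inv g \<in> Z (act g ` A)" using Z_conj A gc base by simp
    show "g \<otimes> s \<otimes> inv g \<noteq> \<one>" using gc base conj_eq_one by blast
    show "move g Q \<noteq> (act g ` A, {})"
    proof
      assume "move g Q = (act g ` A, {})"
      then have "move (inv g) (move g Q) = move (inv g) (move g (A, {}))" by (simp add: move_def)
      then have "Q = (A, {})"
        using gc Q A by (simp flip: move_mult add: move_one)
      then show False using base by simp
    qed
  qed
  moreover have "move (g \<otimes> s \<otimes> inv g) (move g Q) = move g (move s Q)"
    using gc Q by (simp flip: move_mult add: m_assoc)
  ultimately show ?case by simp
next
  case (step Q B A s)
  have A: "A \<in> \<A>" "A \<subseteq> V" using \<B>_\<A> axis_sub step by auto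
  have B: "B \<subseteq> V" using beyond_far[OF step(1)] \<B>_\<A> axis_sub by auto
  have gc: "g \<in> carrier G" "s \<in> carrier G" using \<Gamma>_carrier g Z_carrier step by auto
  have Q: "fst Q \<subseteq> V" "snd Q \<subseteq> carrier G" using beyond_sub step by auto
  have "(move (g \<otimes> s \<otimes> inv g) (move g Q), act g ` A) \<in> beyond"
  proof (rule beyond.step)
    show "(move g Q, act g ` B) \<in> beyond" using step by simp
    show "act g ` A \<in> \<B>" using \<B>_image g step by simp
    show "g \<otimes> s \<otimes> inv g \<in> Z (act g ` A)" using Z_conj A gc step by simp
    show "g \<otimes> s \<otimes> inv g \<noteq> \<one>" using gc step conj_eq_one by blast
    show "act g ` A \<noteq> act g ` B"
      using act_image_inv(1)[OF gc(1) A(2)] act_image_inv(1)[OF gc(1) B] step.hyps by metis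
  qed
  moreover have "move (g \<otimes> s \<otimes> inv g) (move g Q) = move g (move s Q)"
    using gc Q by (simp flip: move_mult add: m_assoc)
  ultimately show ?case by simp
qed

lemma \<Gamma>'_subgroup: "subgroup \<Gamma>' G"
  unfolding \<Gamma>'_def using \<Gamma>_carrier Z_carrier by (intro generate_is_subgroup) auto

lemma \<Gamma>'_carrier: "g \<in> \<Gamma>' \<Longrightarrow> g \<in> carrier G"
  by (rule subgroup.mem_carrier[OF \<Gamma>'_subgroup])

lemma \<Gamma>_\<Gamma>': "\<Gamma> \<subseteq> \<Gamma>'" and Z_\<Gamma>': "A \<in> \<B> \<Longrightarrow> Z A \<subseteq> \<Gamma>'"
  unfolding \<Gamma>'_def by (auto intro: generate.incl)

lemma \<Gamma>'_induct [consumes 1, case_names \<Gamma> Z mult]: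
  assumes "g \<in> \<Gamma>'" and 1: "\<And>g. g \<in> \<Gamma> \<Longrightarrow> P g" and 2: "\<And>A g. A \<in> \<B> \<Longrightarrow> g \<in> Z A \<Longrightarrow> P g"
    and 3: "\<And>g h. g \<in> \<Gamma>' \<Longrightarrow> h \<in> \<Gamma>' \<Longrightarrow> P g \<Longrightarrow> P h \<Longrightarrow> P (g \<otimes> h)"
  shows "P g"
  using assms(1) unfolding \<Gamma>'_def
proof (induction rule: generate.induct)
  case one
  then show ?case using 1 \<Gamma>_closed(1) by blast
next
  case (incl h)
  then show ?case using 1 2 by blast
next
  case (inv h)
  then show ?case using 1 2 \<Gamma>_closed(2) Z_inv \<B>_\<A> by blast
next
  case (eng h1 h2)
  then show ?case using 3 by (simp add: \<Gamma>'_def)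
qed

text \<open>This stands in for a normal form theorem for \<open>\<Gamma>'\<close>: only generators
  have to be checked, and they preserve the family of cells and their reduced translates.\<close>

lemma cells_or_beyond:
  assumes "g \<in> \<Gamma>'" "Q \<in> cells \<union> fst ` beyond"
  shows "move g Q \<in> cells \<union> fst ` beyond"
  using assms
proof (induction arbitrary: Q rule: \<Gamma>'_induct)
  case (\<Gamma> g)
  then consider "Q \<in> cells" | A where "(Q, A) \<in> beyond" by auto
  then show ?case
  proof cases
    case 1
    then show ?thesis using cells_move \<Gamma> by simp
  next
    case 2
    then show ?thesis using beyond_move[OF 2 \<Gamma>(1)] by force
  qed
next
  case (mult g h)
  then have "move (g \<otimes> h) Q = move g (move h Q)"
    using \<Gamma>'_carrier orbit_sub by (intro move_mult) blast+
  then show ?case using mult by simp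
next
  case (Z A s)
  have sc: "s \<in> carrier G" using Z Z_carrier by blast
  have QV: "fst Q \<subseteq> V" "snd Q \<subseteq> carrier G" using orbit_sub[OF Z(3)] by auto
  \<comment> \<open>Covers both a new outermost rotation and the result of merging two rotations
    about \<open>A\<close>; the merged one may be trivial, which leads back to the inner
    cell.\<close>
  have key: "move s Q \<in> cells \<union> fst ` beyond" 
    if s: "s \<in> Z A" and Q: "Q \<in> cells \<or> (\<exists>B. B \<noteq> A \<and> (Q, B) \<in> beyond)" for s Q
  proof (cases "s = \<one>")
    case True
    have "fst Q \<subseteq> V \<and> snd Q \<subseteq> carrier G" using Q cells_sub beyond_sub by blast
    then have "move s Q = Q" using True move_one by blast
    then show ?thesis using Q by force
  next
    case False
    show ?thesis
    proof (cases "Q = (A, {})")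
      case True
      then have "move s Q = Q" using s Z_image by (simp add: move_def)
      then show ?thesis using True Z by (simp add: cells_def)
    next
      case nQ: False
      have "(move s Q, A) \<in> beyond"
        using Q beyond.base[OF _ Z(1) nQ s False] beyond.step[OF _ Z(1) _ s False] by metis
      then show ?thesis by force
    qed
  qed
  from Z(3) consider "Q \<in> cells \<or> (\<exists>B. B \<noteq> A \<and> (Q, B) \<in> beyond)" | "(Q, A) \<in> beyond"
    by force
  then show ?case
  proof cases
    case 1 then show ?thesis using key Z by blast
  next
    case 2
    then show ?thesis
    proof (cases rule: beyond.cases)
      case (base Q' t)
      have "move s Q = move (s \<otimes> t) Q'"
        using base sc Z_carrier[OF base(5)] cells_sub[OF base(2)] by (simp add: move_mult)
      then show ?thesis using key[of "s \<otimes> t" Q'] Z_mult[OF \<B>_\<A>] Z base by simp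
    next
      case (step Q' B t)
      have "move s Q = move (s \<otimes> t) Q'"
        using step sc Z_carrier[OF step(5)] beyond_sub[OF step(2)] by (simp add: move_mult)
      moreover have "s \<otimes> t \<in> Z A" by (rule Z_mult[OF \<B>_\<A>[OF Z(1)] Z(2) step(5)])
      moreover have "\<exists>B. B \<noteq> A \<and> (Q', B) \<in> beyond" using step(2,4) by (intro exI[of _ B]) auto
      ultimately show ?thesis using key[of "s \<otimes> t" Q'] by simp
    qed
  qed
qed

lemma \<Gamma>'_big:
  assumes "g \<in> \<Gamma>'" "g \<noteq> \<one>" shows "big v (act g v)"
proof -
  have g: "g \<in> carrier G" using \<Gamma>'_carrier assms by simp
  have v: "v \<in> V" using v_in W_V by simp
  have one: "\<one> \<in> \<Gamma>" by (rule \<Gamma>_closed)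
  have "move g (W, \<Gamma>) \<in> cells \<union> fst ` beyond"
    by (rule cells_or_beyond[OF assms(1)]) (simp add: cells_def)
  \<comment> \<open>The coset in the second component contains \<open>g\<close>; so if the translate
    is a cell, that cell is \<open>(W, \<Gamma>)\<close> and \<open>g\<close> lies in
    \<Gamma>.\<close>
  moreover have "g \<in> snd (move g (W, \<Gamma>))" using g one by (force simp: move_def)
  ultimately consider "g \<in> \<Gamma>" | A where "(move g (W, \<Gamma>), A) \<in> beyond"
    by (auto simp: cells_def)
  then show ?thesis
  proof cases
    case 1 then show ?thesis using \<Gamma>_big assms by blast
  next
    case (2 A)
    then have A: "A \<in> \<B>" "act g v \<in> far A" using beyond_far[OF 2] v_in by (auto simp: move_def)
    have A': "A \<in> \<A>" using \<B>_\<A> A by blast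
    have p: "gate A v \<in> A \<inter> W"
      using gate_in_meet[OF axis_convex[OF A'] W_convex \<B>_meets[OF A(1)] v_in] .
    have q: "gate A (act g v) \<in> A" using gate(1)[OF axis_convex axis_nonempty] A' v g by simp
    have "c \<le> d (gate A v) (gate A (act g v))" using A(2) p by (auto simp: far_def)
    moreover from this have "gate A v \<noteq> gate A (act g v)"
      using large axis_V[OF A' q] by (auto simp: c_def)
    then have "gate A v \<in> seg v (act g v)" "gate A (act g v) \<in> seg v (act g v)"
      using gates_on_seg(2,3)[OF axis_convex _ _ axis_nonempty] A' v g by auto
    ultimately show ?thesis using A' p q unfolding big_def by blast
  qed
qed

section \<open>The new subtree and its overlaps with the remaining axes\<close>

definition W0 :: "'v set" where
  "W0 = W \<union> \<Union>\<B>"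

definition W1 :: "'v set" where
  "W1 = (\<Union>g\<in>\<Gamma>'. act g ` W0)"

lemma W0_sub: "W0 \<subseteq> V"
  using W_V axis_V \<B>_\<A> by (auto simp: W0_def)

text \<open>Any two pieces \<open>W \<union> A\<close> and \<open>W \<union> B\<close> are convex
  and share \<open>W\<close>.\<close>

lemma W0_convex: "convex W0"
  unfolding convex_def
proof (intro conjI ballI)
  show "W0 \<subseteq> V" by (rule W0_sub)
  have conv: "convex (W \<union> A)" if "A \<in> insert W \<B>" for A
    using that W_convex convex_Un[OF W_convex axis_convex] \<B>_\<A> \<B>_meets by fastforce
  fix x y assume "x \<in> W0" "y \<in> W0"
  then obtain A B where A: "A \<in> insert W \<B>" "x \<in> A" and B: "B \<in> insert W \<B>" "y \<in> B"
    by (auto simp: W0_def)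
  have "convex ((W \<union> A) \<union> (W \<union> B))"
    by (rule convex_Un[OF conv conv]) (use A B v_in in auto)
  then have "seg x y \<subseteq> (W \<union> A) \<union> (W \<union> B)" using convexD(1) A B by blast
  then show "seg x y \<subseteq> W0" using A B by (auto simp: W0_def)
qed

lemma W1_V: "x \<in> W1 \<Longrightarrow> x \<in> V"
  using W0_sub \<Gamma>'_carrier by (auto simp: W1_def)

lemma W0_W1: "W0 \<subseteq> W1"
  using act_image_one[OF W0_sub] subgroup.one_closed[OF \<Gamma>'_subgroup] unfolding W1_def by blast

lemma W1_act: 
  assumes "g \<in> \<Gamma>'" shows "act g ` W1 = W1"
proof -
  have sub: "act g ` W1 \<subseteq> W1" if g: "g \<in> \<Gamma>'" for g
  proof
    fix y assume "y \<in> act g ` W1"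
    then obtain h x where "h \<in> \<Gamma>'" "x \<in> W0" "y = act g (act h x)" by (auto simp: W1_def)
    moreover from this have "y = act (g \<otimes> h) x" using g \<Gamma>'_carrier W0_sub by (auto simp: act_mult)
    ultimately show "y \<in> W1"
      using subgroup.m_closed[OF \<Gamma>'_subgroup g] unfolding W1_def by blast
  qed
  have "W1 = act g ` act (inv g) ` W1" using act_image_inv(2)[of g W1] W1_V assms \<Gamma>'_carrier by auto
  also have "\<dots> \<subseteq> act g ` W1" 
    using sub[of "inv g"] subgroup.m_inv_closed[OF \<Gamma>'_subgroup assms] by (intro image_mono) auto
  finally show ?thesis using sub[OF assms] by auto
qed

text \<open>Every generator of \<open>\<Gamma>'\<close> preserves \<open>W\<close> or an axis in
  \<B>, so \<open>W0\<close> meets its translate; chains of such translates connect any two points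
  of the orbit.\<close>

lemma W1_convex: "convex W1"
proof -
  have meet: "W0 \<inter> act g ` W0 \<noteq> {}" if "g \<in> \<Gamma> \<or> (\<exists>A\<in>\<B>. g \<in> Z A)" for g
  proof -
    have "\<exists>A. A \<noteq> {} \<and> A \<subseteq> W0 \<and> act g ` A = A"
      using that
    proof
      assume "g \<in> \<Gamma>" then show ?thesis using \<Gamma>_W v_in by (intro exI[of _ W]) (auto simp: W0_def)
    next
      assume "\<exists>A\<in>\<B>. g \<in> Z A"
      then obtain A where "A \<in> \<B>" "g \<in> Z A" by blast
      then show ?thesis using Z_image[of g A] \<B>_meets[of A] by (intro exI[of _ A]) (auto simp: W0_def)
    qed
    then show ?thesis by blast
  qed
  \<comment> \<open>With an arbitrary \<open>h\<close> behind \<open>g\<close>, the claim is closed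
    under products of the leading factor, as the induction on generators requires.\<close>
  have main: "\<forall>h\<in>\<Gamma>'. \<forall>x\<in>W0. \<forall>y\<in>W0. (\<forall>x\<in>W0. seg x (act h y) \<subseteq> W1) \<longrightarrow> seg x (act (g \<otimes> h) y) \<subseteq> W1"
    if "g \<in> \<Gamma>'" for g
    using that
  proof (induction rule: \<Gamma>'_induct)
    case (mult g h)
    show ?case
    proof (intro ballI impI)
      fix k x y assume k: "k \<in> \<Gamma>'" "x \<in> W0" "y \<in> W0" "\<forall>x\<in>W0. seg x (act k y) \<subseteq> W1"
      then have "\<forall>x\<in>W0. seg x (act (h \<otimes> k) y) \<subseteq> W1" using mult.IH(2) by blast
      then have "seg x (act (g \<otimes> (h \<otimes> k)) y) \<subseteq> W1"
        using mult.IH(1) k subgroup.m_closed[OF \<Gamma>'_subgroup mult.hyps(2) k(1)] by blast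
      then show "seg x (act (g \<otimes> h \<otimes> k) y) \<subseteq> W1"
        using mult.hyps k(1) \<Gamma>'_carrier by (simp add: m_assoc)
    qed
  next
    have gen: "seg x (act (g \<otimes> h) y) \<subseteq> W1" 
      if g: "g \<in> \<Gamma>'" "g \<in> \<Gamma> \<or> (\<exists>A\<in>\<B>. g \<in> Z A)" and h: "h \<in> \<Gamma>'" and xy: "x \<in> W0" "y \<in> W0"
        and IH: "\<forall>x\<in>W0. seg x (act h y) \<subseteq> W1" for g h x y
    proof -
      have gh: "g \<in> carrier G" "h \<in> carrier G" using g h \<Gamma>'_carrier by auto
      have V: "x \<in> V" "y \<in> V" "act h y \<in> V" "act (g \<otimes> h) y \<in> V" using xy W0_sub gh by auto
      obtain q where q: "q \<in> W0" "act g q \<in> W0" using meet[OF g(2)] by auto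
      have qV: "q \<in> V" "act g q \<in> V" using q W0_sub by auto
      have "seg (act g q) (act (g \<otimes> h) y) \<subseteq> W1"
      proof
        fix z assume z: "z \<in> seg (act g q) (act (g \<otimes> h) y)"
        then have zV: "z \<in> V" using segD by auto
        have "act (inv g) z \<in> seg q (act h y)"
          using z act_seg_iff[of g q "act h y" "act (inv g) z"] gh V qV zV by (simp add: act_mult)
        then have "act (inv g) z \<in> W1" using IH q by blast
        then have "act g (act (inv g) z) \<in> W1" using W1_act[OF g(1)] by blast
        then show "z \<in> W1" using gh zV by simp
      qed
      moreover have "seg x (act g q) \<subseteq> W1" using convexD(1)[OF W0_convex xy(1) q(2)] W0_W1 by simp
      ultimately show ?thesis using seg_cover[OF V(1,4) qV(2)] by blast
    qed
    {
      case (\<Gamma> g)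
      then show ?case using gen \<Gamma>_\<Gamma>' by blast
    next
      case (Z A g)
      then show ?case using gen Z_\<Gamma>' by blast
    }
  qed
  have base: "seg x (act g y) \<subseteq> W1" if "g \<in> \<Gamma>'" "x \<in> W0" "y \<in> W0" for g x y
  proof -
    have "\<forall>x\<in>W0. seg x (act \<one> y) \<subseteq> W1"
      using convexD(1)[OF W0_convex] W0_W1 W0_sub that by fastforce
    then have "seg x (act (g \<otimes> \<one>) y) \<subseteq> W1"
      using main[OF that(1)] that subgroup.one_closed[OF \<Gamma>'_subgroup] by blast
    then show ?thesis using that \<Gamma>'_carrier by simp
  qed
  show ?thesis
    unfolding convex_def
  proof (intro conjI ballI subsetI)
    show "x \<in> V" if "x \<in> W1" for x using that W1_V by simp
    fix x y z assume "x \<in> W1" "y \<in> W1" and z: "z \<in> seg x y"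
    then obtain g h x' y' where g: "g \<in> \<Gamma>'" "x' \<in> W0" "x = act g x'" and h: "h \<in> \<Gamma>'" "y' \<in> W0" "y = act h y'"
      by (auto simp: W1_def)
    have c: "g \<in> carrier G" "h \<in> carrier G" "x' \<in> V" "y' \<in> V" "z \<in> V"
      using g h \<Gamma>'_carrier W0_sub z segD by auto
    have "act (inv g) z \<in> seg x' (act (inv g \<otimes> h) y')"
      using z g h c act_seg_iff[of g x' "act (inv g \<otimes> h) y'" "act (inv g) z"]
      by (simp flip: act_mult add: m_assoc)
    then have "act (inv g) z \<in> W1"
      using base[of "inv g \<otimes> h" x' y'] g h subgroup.m_closed[OF \<Gamma>'_subgroup]
        subgroup.m_inv_closed[OF \<Gamma>'_subgroup] by blast
    then have "act g (act (inv g) z) \<in> W1" using W1_act[OF g(1)] by blast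
    then show "z \<in> W1" using c by simp
  qed
qed

text \<open>A translate that meets \<open>W\<close> is in \<B> or has its stabilizer in \<Gamma>;
  either way the stabilizer lies in \<open>\<Gamma>'\<close>, and so does its conjugate.\<close>

lemma axis_in_orbit:
  assumes "C \<in> \<A>" "g \<in> \<Gamma>'" "act g ` C \<in> \<B> \<or> act g ` C \<inter> W \<noteq> {}"
  shows "Z C \<subseteq> \<Gamma>'"
proof
  fix s assume s: "s \<in> Z C"
  have g: "g \<in> carrier G" "s \<in> carrier G" using assms \<Gamma>'_carrier s Z_carrier by auto
  have "act g ` C \<in> \<B> \<or> Z (act g ` C) \<subseteq> \<Gamma>"
    using assms axis_image g by (auto simp: \<B>_def)
  then have "g \<otimes> s \<otimes> inv g \<in> \<Gamma>'"
    using Z_conj[OF assms(1) g(1) s] \<Gamma>_\<Gamma>' Z_\<Gamma>' by blast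
  from subgroup.m_closed[OF \<Gamma>'_subgroup subgroup.m_closed[OF \<Gamma>'_subgroup
      subgroup.m_inv_closed[OF \<Gamma>'_subgroup assms(2)] this] assms(2)]
  have "inv g \<otimes> (g \<otimes> s \<otimes> inv g) \<otimes> g \<in> \<Gamma>'" .
  then show "s \<in> \<Gamma>'" using g by (simp add: m_assoc)
qed

text \<open>
  An axis that meets no translate of \<open>W\<close> can meet the new subtree only in two adjacent axes: otherwise
  it would have to follow one of the rotated axes for too long.
\<close>

lemma overlap_base:
  assumes C: "C \<in> \<A>" "C \<notin> \<B>" "C \<inter> W = {}"
    and A: "A \<in> \<B>" and Q: "Q \<in> cells \<or> (\<exists>B. B \<noteq> A \<and> (Q, B) \<in> beyond)" "Q \<noteq> (W, \<Gamma>)"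
    and x: "x \<in> C \<inter> A" and y: "y \<in> C \<inter> fst Q" and ax: "fst Q \<in> \<A>" "fst Q \<noteq> C"
  shows "d x y \<le> 2 * \<Delta>"
  using Q(1)
proof
  have V: "x \<in> V" "y \<in> V" using x y axis_V C by auto
  have xy: "seg x y \<subseteq> C" using convexD(1)[OF axis_convex[OF C(1)]] x y by blast
  have A': "A \<in> \<A>" "A \<noteq> C" using A C \<B>_\<A> by auto
  {
    assume "Q \<in> cells"
    then have "Q \<in> (\<lambda>A. (A, {})) ` \<B>" using Q(2) by (simp add: cells_def)
    then obtain B where B: "B \<in> \<B>" "fst Q = B" by auto
    have B': "B \<in> \<A>" "B \<noteq> C" using ax B by auto
    have W0: "W \<noteq> {}" using v_in by auto
    have "gate W x = gate W y"
    proof (rule ccontr)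
      assume "gate W x \<noteq> gate W y"
      then have "gate W x \<in> seg x y" using gates_on_seg(2)[OF W_convex V W0] by blast
      then show False using xy gate(1)[OF W_convex W0 V(1)] C(3) by blast
    qed
    moreover have "gate W x \<in> W \<inter> A" "gate W y \<in> W \<inter> B"
      using gate_in_meet[OF W_convex axis_convex] \<B>_meets A A' B B' x y by blast+
    ultimately have w: "gate W x \<in> A" "gate W x \<in> B" "gate W x \<in> V" using W_V by auto
    \<comment> \<open>With the common gate as third vertex, \<open>m\<close> lies on
      \<open>A\<close>, \<open>B\<close> and \<open>C\<close>; it splits the segment into an overlap
      of \<open>C\<close> with \<open>A\<close> and one with \<open>B\<close>, whence the factor
      2.\<close>
    obtain m where m: "m \<in> V" "m \<in> seg x y" "m \<in> seg y (gate W x)" "m \<in> seg x (gate W x)"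
      using median_ex[OF V w(3)] by blast
    have "m \<in> A" "m \<in> B"
      using convexD(1)[OF axis_convex, of A x "gate W x"] convexD(1)[OF axis_convex, of B y "gate W x"]
        A' B' B x y w m by auto
    then have "d x m \<le> \<Delta>" "d m y \<le> \<Delta>"
      using axis_overlap[OF C(1) A'(1)] axis_overlap[OF C(1) B'(1)] A' B' B x y m xy by auto
    then show ?thesis using segD(1)[OF m(2)] by simp
  next
    assume "\<exists>B. B \<noteq> A \<and> (Q, B) \<in> beyond"
    then obtain B where B: "B \<noteq> A" "(Q, B) \<in> beyond" by blast
    have BB: "B \<in> \<B>" "y \<in> far B" using beyond_far[OF B(2)] y by auto
    have B': "B \<in> \<A>" "B \<noteq> C" using BB C \<B>_\<A> by auto
    have "x \<in> near B" using near_axis[OF BB(1) A B(1)] x by blast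
    then obtain j where j: "j \<in> B \<inter> W" "d j (gate B x) \<le> \<Delta>" by (auto simp: near_def)
    have far: "c \<le> d j (gate B y)" using BB j by (auto simp: far_def)
    have g: "gate B x \<in> B" "gate B y \<in> B" using gate(1)[OF axis_convex axis_nonempty] B' V by auto
    have gV: "gate B x \<in> V" "gate B y \<in> V" "j \<in> V" using g j axis_V[OF B'(1)] by auto
    have "d j (gate B y) \<le> d j (gate B x) + d (gate B x) (gate B y)" by (rule d_tri) (use gV in auto)
    \<comment> \<open>\<open>C\<close> would have to follow \<open>B\<close> from the gate of
      \<open>x\<close> to that of \<open>y\<close>, farther than two axes can agree.\<close>
    then have big: "\<Delta> < d (gate B x) (gate B y)" using far j large by (simp add: c_def)
    then have "gate B x \<noteq> gate B y" using gV by auto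
    then have "gate B x \<in> C" "gate B y \<in> C"
      using gates_on_seg(2,3)[OF axis_convex[OF B'(1)] V axis_nonempty[OF B'(1)]] xy by auto
    then have False using axis_overlap[OF C(1) B'(1)] B'(2) g big by fastforce
    then show ?thesis ..
  }
qed

text \<open>Translate so that \<open>x\<close> lies on an axis \<open>A\<close> in \<B>; the axis
  containing \<open>y\<close> then becomes a cell or a ping-pong image \<open>Q\<close>. If the
  outermost rotation of \<open>Q\<close> is about \<open>A\<close> itself, undo it: this preserves
  \<open>A\<close>, and \<open>overlap_base\<close> applies.\<close>

lemma overlap_W1:
  assumes C: "C \<in> \<A>" "\<not> Z C \<subseteq> \<Gamma>'" and x: "x \<in> C \<inter> W1" and y: "y \<in> C \<inter> W1"
  shows "d x y \<le> 2 * \<Delta>"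
proof -
  have out: "act g ` C \<notin> \<B>" "act g ` C \<inter> W = {}" if "g \<in> \<Gamma>'" for g
    using axis_in_orbit[OF C(1) that] C(2) by auto
  have inv: "inv g \<in> \<Gamma>'" if "g \<in> \<Gamma>'" for g by (rule subgroup.m_inv_closed[OF \<Gamma>'_subgroup that])
  have CV: "C \<subseteq> V" using axis_sub C by simp
  have pos: "\<exists>A\<in>\<B>. act (inv g) z \<in> A" if g: "g \<in> \<Gamma>'" and z: "z \<in> C" "z \<in> act g ` W0" for g z
  proof -
    have gc: "g \<in> carrier G" using g \<Gamma>'_carrier by simp
    have "act (inv g) z \<in> W0" using act_image_iff[OF gc W0_sub] z CV by auto
    moreover have "act (inv g) z \<notin> W" using out(2)[OF inv[OF g]] z by blast
    ultimately show ?thesis by (auto simp: W0_def)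
  qed
  obtain g where g: "g \<in> \<Gamma>'" "x \<in> act g ` W0" using x by (auto simp: W1_def)
  obtain h where h: "h \<in> \<Gamma>'" "y \<in> act h ` W0" using y by (auto simp: W1_def)
  obtain A where A: "A \<in> \<B>" "act (inv g) x \<in> A" using pos g x by blast
  obtain B where B: "B \<in> \<B>" "act (inv h) y \<in> B" using pos h y by blast
  have c: "g \<in> carrier G" "h \<in> carrier G" using g h \<Gamma>'_carrier by auto
  have V: "x \<in> V" "y \<in> V" using x y W1_V by auto
  have A': "A \<in> \<A>" "A \<subseteq> V" and B': "B \<in> \<A>" "B \<subseteq> V" using A B \<B>_\<A> axis_sub by auto
  define Q where "Q = move (inv g \<otimes> h) (B, {})"
  have ih: "inv g \<otimes> h \<in> \<Gamma>'" by (intro subgroup.m_closed[OF \<Gamma>'_subgroup] inv g h)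
  have Q: "Q \<in> cells \<union> fst ` beyond" unfolding Q_def
    by (rule cells_or_beyond[OF ih]) (use B in \<open>simp add: cells_def\<close>)
  have Q1: "fst Q = act (inv g \<otimes> h) ` B" "snd Q = {}" by (simp_all add: Q_def move_def)
  have QA: "fst Q \<in> \<A>" using Q1 axis_image B' c by simp
  have QV: "fst Q \<subseteq> V" using axis_sub QA by simp
  define x' y' where "x' = act (inv g) x" and "y' = act (inv g) y"
  have x': "x' \<in> act (inv g) ` C \<inter> A" using A x by (auto simp: x'_def)
  have "y' = act (inv g \<otimes> h) (act (inv h) y)" using c V by (simp add: y'_def act_mult)
  then have y': "y' \<in> act (inv g) ` C \<inter> fst Q" using B y Q1(1) by (metis Int_iff imageI y'_def)
  have dxy: "d x y = d x' y'" using c V by (simp add: x'_def y'_def)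
  have nW: "P \<noteq> (W, \<Gamma>)" if "snd P = {}" for P using that \<Gamma>_closed(1) by auto
  have neC: "act k ` C \<noteq> act m ` B" if "k \<in> \<Gamma>'" "m \<in> \<Gamma>'" for k m
  proof
    assume eq: "act k ` C = act m ` B"
    have km: "k \<in> carrier G" "m \<in> carrier G" using that \<Gamma>'_carrier by auto
    have "act (inv m \<otimes> k) ` C = act (inv m) ` act m ` B"
      using eq km CV by (simp add: act_image_mult)
    also have "\<dots> = B" by (rule act_image_inv(1)[OF km(2) B'(2)])
    finally show False using out(1)[of "inv m \<otimes> k"] B(1) subgroup.m_closed[OF \<Gamma>'_subgroup inv[OF that(2)] that(1)] by simp
  qed
  have main: "d x' y' \<le> 2 * \<Delta>" if "s \<in> Z A" and P: "P \<in> cells \<or> (\<exists>B. B \<noteq> A \<and> (P, B) \<in> beyond)"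
    "Q = move s P" for s P
  proof -
    have s: "s \<in> carrier G" "s \<in> \<Gamma>'" using that Z_carrier Z_\<Gamma>' A by auto
    have P1: "fst P \<subseteq> V" "snd P \<subseteq> carrier G" using P(1) cells_sub beyond_sub by blast+
    have PQ: "P = move (inv s) Q" using P(2) s P1 by (simp flip: move_mult add: move_one)
    have P2: "fst P = act (inv s \<otimes> (inv g \<otimes> h)) ` B" "snd P = {}"
      using PQ s c B'(2) by (simp_all add: move_def Q1 act_image_mult)
    have V': "x' \<in> V" "y' \<in> V" using V c by (auto simp: x'_def y'_def)
    have xy: "act (inv s) x' \<in> act (inv s) ` act (inv g) ` C \<inter> A"
      "act (inv s) y' \<in> act (inv s) ` act (inv g) ` C \<inter> fst P"
      using x' y' Z_image[OF Z_inv[OF A'(1) that(1)]] PQ by (auto simp: move_def)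
    have C': "act (inv s) ` act (inv g) ` C = act (inv s \<otimes> inv g) ` C"
      using s c CV by (simp add: act_image_mult)
    have sg: "inv s \<otimes> inv g \<in> \<Gamma>'" by (intro subgroup.m_closed[OF \<Gamma>'_subgroup] inv s g)
    have sgh: "inv s \<otimes> (inv g \<otimes> h) \<in> \<Gamma>'" by (intro subgroup.m_closed[OF \<Gamma>'_subgroup] inv s ih)
    have "d (act (inv s) x') (act (inv s) y') \<le> 2 * \<Delta>"
    proof (rule overlap_base[OF _ _ _ A(1) P(1) nW[OF P2(2)]])
      show "act (inv s \<otimes> inv g) ` C \<in> \<A>" using axis_image C s c by simp
      show "act (inv s \<otimes> inv g) ` C \<notin> \<B>" "act (inv s \<otimes> inv g) ` C \<inter> W = {}"
        using out[OF sg] by auto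
      show "fst P \<in> \<A>" unfolding P2 by (rule axis_image) (use s c B' in auto)
      show "fst P \<noteq> act (inv s \<otimes> inv g) ` C" unfolding P2 using neC[OF sg sgh] by metis
      show "act (inv s) x' \<in> act (inv s \<otimes> inv g) ` C \<inter> A" using xy(1) C' by simp
      show "act (inv s) y' \<in> act (inv s \<otimes> inv g) ` C \<inter> fst P" using xy(2) C' by simp
    qed
    then show ?thesis using s V' by simp
  qed
  have "Q \<in> cells \<or> (\<exists>B. (Q, B) \<in> beyond)" using Q in_beyondD[of Q] by auto
  then have "(Q \<in> cells \<or> (\<exists>B. B \<noteq> A \<and> (Q, B) \<in> beyond)) \<or> (Q, A) \<in> beyond" by metis
  then consider "Q \<in> cells \<or> (\<exists>B. B \<noteq> A \<and> (Q, B) \<in> beyond)" | "(Q, A) \<in> beyond"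
    by metis
  then have "d x' y' \<le> 2 * \<Delta>"
  proof cases
    case 1
    have "move \<one> Q = Q" using QV Q1 by (intro move_one) auto
    then show ?thesis using main[OF Z_one[OF A'(1)] 1] by simp
  next
    case 2
    then show ?thesis
    proof (cases rule: beyond.cases)
      case (base P s)
      then show ?thesis using main[of s P] by simp
    next
      case (step P B s)
      have "\<exists>B. B \<noteq> A \<and> (P, B) \<in> beyond" using step(2,4) by (intro exI[of _ B]) auto
      then show ?thesis using main[of s P] step by simp
    qed
  qed
  then show ?thesis using dxy by simp
qed

text \<open>\<open>W1\<close> grows only along axes that already meet \<open>W\<close>; the
  thickening makes the windmills exhaust the tree, so that every axis is met eventually.\<close>

definition W2 :: "'v set" where
  "W2 = {x \<in> V. d x (gate W1 x) \<le> 1}"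

lemma W1_nonempty: "W1 \<noteq> {}" and v_W1: "v \<in> W1"
  using W0_W1 v_in by (auto simp: W0_def)

lemma W1_W2: "W1 \<subseteq> W2"
  using gate_id[OF W1_convex] W1_V by (auto simp: W2_def)

lemma overlap_W2:
  assumes C: "C \<in> \<A>" "\<not> Z C \<subseteq> \<Gamma>'" and x: "x \<in> C \<inter> W2" and y: "y \<in> C \<inter> W2"
  shows "d x y \<le> 2 * \<Delta> + 2"
proof -
  have V: "x \<in> V" "y \<in> V" using x y by (auto simp: W2_def)
  let ?p = "gate W1 x" and ?q = "gate W1 y"
  have pq: "?p \<in> V" "?q \<in> V" "?p \<in> W1" "?q \<in> W1"
    using gate(1)[OF W1_convex W1_nonempty] V W1_V by auto
  have "d x y \<le> d x ?p + d ?p y" by (rule d_tri) (use V pq in auto)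
  moreover have "d ?p y \<le> d ?p ?q + d ?q y" by (rule d_tri) (use V pq in auto)
  moreover have "d x ?p \<le> 1" "d ?q y \<le> 1" using x y d_sym[OF V(2) pq(2)] by (auto simp: W2_def)
  moreover have "d ?p ?q \<le> 2 * \<Delta>"
  proof (cases "?p = ?q")
    case True
    then show ?thesis using pq by simp
  next
    case False
    then have "?p \<in> seg x y" "?q \<in> seg x y" using gates_on_seg[OF W1_convex V W1_nonempty] by auto
    then have "?p \<in> C" "?q \<in> C" using convexD(1)[OF axis_convex[OF C(1)]] x y by blast+
    then show ?thesis using overlap_W1[OF C] pq by blast
  qed
  ultimately show ?thesis by linarith
qed

lemma W2_act:
  assumes g: "g \<in> \<Gamma>'" shows "act g ` W2 = W2"
proof -
  have sub: "act g ` W2 \<subseteq> W2" if g: "g \<in> \<Gamma>'" for g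
  proof
    fix y assume "y \<in> act g ` W2"
    then obtain x where x: "x \<in> V" "d x (gate W1 x) \<le> 1" "y = act g x" by (auto simp: W2_def)
    have gc: "g \<in> carrier G" using g \<Gamma>'_carrier by simp
    have "gate W1 (act g x) = act g (gate W1 x)"
      using act_gate[OF gc W1_convex W1_nonempty x(1)] W1_act[OF g] by simp
    then show "y \<in> W2"
      using x gc gate(1)[OF W1_convex W1_nonempty x(1)] W1_V by (auto simp: W2_def)
  qed
  have W2V: "W2 \<subseteq> V" by (auto simp: W2_def)
  have "W2 = act g ` act (inv g) ` W2" using act_image_inv(2)[OF _ W2V, of g] g \<Gamma>'_carrier by auto
  also have "\<dots> \<subseteq> act g ` W2" 
    using sub[of "inv g"] subgroup.m_inv_closed[OF \<Gamma>'_subgroup g] by (intro image_mono) auto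
  finally show ?thesis using sub[OF g] by auto
qed

lemma windmill_next: "windmill v W2 \<Gamma>'"
  unfolding windmill_def
proof (intro conjI ballI impI)
  show "convex W2" unfolding W2_def by (rule gate_neighbourhood_convex[OF W1_convex W1_nonempty])
  show "v \<in> W2" using v_W1 W1_W2 by blast
  show "Z C \<subseteq> \<Gamma>' \<or> (\<forall>x\<in>C \<inter> W2. \<forall>y\<in>C \<inter> W2. d x y \<le> 2 * \<Delta> + 2)" if "C \<in> \<A>" for C
    using overlap_W2[OF that] by blast
  show "subgroup \<Gamma>' G" by (rule \<Gamma>'_subgroup)
  show "act g ` W2 = W2" if "g \<in> \<Gamma>'" for g by (rule W2_act[OF that])
  show "big v (act g v)" if "g \<in> \<Gamma>'" "g \<noteq> \<one>" for g by (rule \<Gamma>'_big[OF that])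
qed

lemma windmill_grows: "\<lbrakk>y \<in> W; x \<in> V; d x y \<le> 1\<rbrakk> \<Longrightarrow> x \<in> W2"
proof -
  assume a: "y \<in> W" "x \<in> V" "d x y \<le> 1"
  then have "y \<in> W1" using W0_W1 by (auto simp: W0_def)
  then have "gate W1 x \<in> seg x y" using gate(2)[OF W1_convex W1_nonempty a(2)] by blast
  then show "x \<in> W2" using segD(1) a by (fastforce simp: W2_def)
qed

lemma windmill_absorbs: "C \<in> \<A> \<Longrightarrow> C \<inter> W \<noteq> {} \<Longrightarrow> Z C \<subseteq> \<Gamma>'"
  using \<Gamma>_\<Gamma>' Z_\<Gamma>' by (auto simp: \<B>_def)

end

section \<open>Greendlinger's lemma and its first consequences\<close>

context small_cancellation begin

lemma windmill_step_ex:
  assumes "windmill v W \<Gamma>"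
  shows "\<exists>W' \<Gamma>'. windmill v W' \<Gamma>' \<and> (\<forall>y\<in>W. \<forall>x\<in>V. d x y \<le> 1 \<longrightarrow> x \<in> W') \<and> \<Gamma> \<subseteq> \<Gamma>' \<and>
    (\<forall>C\<in>\<A>. C \<inter> W \<noteq> {} \<longrightarrow> Z C \<subseteq> \<Gamma>')"
proof -
  interpret windmill_step V d G act \<A> \<tau> \<Delta> v W \<Gamma> by unfold_locales (rule assms)
  show ?thesis
    using windmill_next windmill_grows windmill_absorbs \<Gamma>_\<Gamma>' by blast
qed

text \<open>The \<open>k\<close>-th subtree of an iterated sequence contains the ball of radius
  \<open>k\<close> about \<open>v\<close>, so every axis meets one of them and is absorbed in the
  next step. Hence every product of rotations lies in one of the groups.\<close>

theorem greendlinger: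
  assumes n: "n \<in> relator_group" "n \<noteq> \<one>" and v: "v \<in> V"
  shows "big v (act n v)"
proof -
  have "\<exists>f. \<forall>k. windmill v (fst (f k)) (snd (f k)) \<and> 
      ((\<forall>y\<in>fst (f k). \<forall>x\<in>V. d x y \<le> 1 \<longrightarrow> x \<in> fst (f (Suc k))) \<and> snd (f k) \<subseteq> snd (f (Suc k)) \<and>
        (\<forall>C\<in>\<A>. C \<inter> fst (f k) \<noteq> {} \<longrightarrow> Z C \<subseteq> snd (f (Suc k))))"
  proof (rule dependent_nat_choice)
    show "\<exists>x. windmill v (fst x) (snd x)" using windmill_start[OF v] by auto
    show "\<exists>y. windmill v (fst y) (snd y) \<and> (\<forall>y'\<in>fst x. \<forall>x\<in>V. d x y' \<le> 1 \<longrightarrow> x \<in> fst y) \<and> snd x \<subseteq> snd y \<and>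
        (\<forall>C\<in>\<A>. C \<inter> fst x \<noteq> {} \<longrightarrow> Z C \<subseteq> snd y)" if "windmill v (fst x) (snd x)" for x :: "'v set \<times> 'g set" and k :: nat
      using windmill_step_ex[OF that] by auto
  qed
  then obtain f where f0: "\<forall>k. windmill v (fst (f k)) (snd (f k)) \<and> 
      ((\<forall>y\<in>fst (f k). \<forall>x\<in>V. d x y \<le> 1 \<longrightarrow> x \<in> fst (f (Suc k))) \<and> snd (f k) \<subseteq> snd (f (Suc k)) \<and>
        (\<forall>C\<in>\<A>. C \<inter> fst (f k) \<noteq> {} \<longrightarrow> Z C \<subseteq> snd (f (Suc k))))" by (rule exE)
  have f: "windmill v (fst (f k)) (snd (f k))"
    "\<lbrakk>y \<in> fst (f k); x \<in> V; d x y \<le> 1\<rbrakk> \<Longrightarrow> x \<in> fst (f (Suc k))"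
    "snd (f k) \<subseteq> snd (f (Suc k))"
    "\<lbrakk>C \<in> \<A>; C \<inter> fst (f k) \<noteq> {}\<rbrakk> \<Longrightarrow> Z C \<subseteq> snd (f (Suc k))" for k y x C
    using f0[rule_format, of k] by simp_all
  have ball: "x \<in> fst (f k)" if "x \<in> V" "d v x \<le> k" for x k
    using that
  proof (induction k arbitrary: x)
    case 0
    then have "x = v" using d_zero v by auto
    then show ?case using f(1)[of 0] by (simp add: windmill_def)
  next
    case (Suc k)
    show ?case
    proof (cases "d v x = 0")
      case True
      then have "x = v" using d_zero v Suc by auto
      then show ?thesis using f(1)[of "Suc k"] by (simp add: windmill_def)
    next
      case False
      then obtain z where z: "z \<in> V" "d v z + d z x = d v x" "d v z = d v x - 1"
        using seg_point[of v x "d v x - 1"] v Suc by auto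
      then have "z \<in> fst (f k)" using Suc by auto
      moreover have "d x z \<le> 1" using z False Suc d_sym by simp
      ultimately show ?thesis using f(2) Suc by blast
    qed
  qed
  have mono: "snd (f k) \<subseteq> snd (f l)" if "k \<le> l" for k l
    using lift_Suc_mono_le[of "\<lambda>k. snd (f k)", OF f(3) that] .
  have sub: "subgroup (snd (f k)) G" for k using f(1)[of k] by (simp add: windmill_def)
  have ax: "\<exists>k. Z C \<subseteq> snd (f k)" if C: "C \<in> \<A>" for C
  proof -
    obtain x where "x \<in> C" using axis_nonempty C by blast
    then have "C \<inter> fst (f (d v x)) \<noteq> {}" using ball axis_V C by blast
    then show ?thesis using f(4)[OF C] by blast
  qed
  have "\<exists>k. n \<in> snd (f k)"
    using n(1) unfolding relator_group_def
  proof (induction rule: generate.induct)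
    case one
    then show ?case using subgroup.one_closed[OF sub] by blast
  next
    case (incl h)
    then show ?case using ax by blast
  next
    case (inv h)
    then show ?case using ax subgroup.m_inv_closed[OF sub] by blast
  next
    case (eng h1 h2)
    then obtain k l where "h1 \<in> snd (f k)" "h2 \<in> snd (f l)" by blast
    then have "h1 \<in> snd (f (max k l))" "h2 \<in> snd (f (max k l))" using mono[of k "max k l"] mono[of l "max k l"] by auto
    then show ?case using subgroup.m_closed[OF sub] by blast
  qed
  then show ?thesis using f(1) n(2) by (auto simp: windmill_def)
qed

lemma relator_group_carrier: "n \<in> relator_group \<Longrightarrow> n \<in> carrier G"
  unfolding relator_group_def using Z_carrier by (auto intro: generate_in_carrier[of "\<Union>A\<in>\<A>. Z A"])

lemma relator_subgroup: "subgroup relator_group G"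
  unfolding relator_group_def using Z_carrier by (intro generate_is_subgroup) auto

lemma Z_relator_group: "A \<in> \<A> \<Longrightarrow> Z A \<subseteq> relator_group"
  unfolding relator_group_def by (auto intro: generate.incl)

lemma relator_conj:
  assumes "n \<in> relator_group" and g: "g \<in> carrier G"
  shows "g \<otimes> n \<otimes> inv g \<in> relator_group"
  using assms(1) unfolding relator_group_def
proof (induction rule: generate.induct)
  case one
  then show ?case using g by (simp add: generate.one)
next
  case (incl h)
  then show ?case using Z_conj g axis_image by (blast intro: generate.incl)
next
  case (inv h)
  then obtain A where "A \<in> \<A>" "inv h \<in> Z A" using Z_inv by blast
  then show ?case using Z_conj g axis_image by (blast intro: generate.incl)
next
  case (eng h1 h2)
  have "h1 \<in> carrier G" "h2 \<in> carrier G"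
    using eng relator_group_carrier by (simp_all add: relator_group_def)
  then have "g \<otimes> (h1 \<otimes> h2) \<otimes> inv g = (g \<otimes> h1 \<otimes> inv g) \<otimes> (g \<otimes> h2 \<otimes> inv g)"
    using g by (simp add: m_assoc)
  then show ?case using eng by (auto intro: generate.eng)
qed

lemma relator_normal: "relator_group \<lhd> G"
  using relator_subgroup relator_conj by (simp add: normal_inv_iff)

text \<open>For a nontrivial \<open>n\<close>, the geodesic to \<open>act n v\<close> contains a
  stretch of length at least \<open>c\<close>.\<close>

lemma short_trivial:
  assumes "n \<in> relator_group" "v \<in> V" "d v (act n v) < c"
  shows "n = \<one>"
proof (rule ccontr)
  assume "n \<noteq> \<one>"
  then have "big v (act n v)" using greendlinger assms by blast
  then obtain A p q where A: "A \<in> \<A>" "p \<in> seg v (act n v)" "q \<in> seg v (act n v)" "c \<le> d p q"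
    unfolding big_def by blast
  have V: "act n v \<in> V" "p \<in> V" "q \<in> V" using A relator_group_carrier assms segD by auto
  have "d p q \<le> d v (act n v)"
  proof (cases "p \<in> seg v q")
    case True
    then show ?thesis using segD(1)[OF True] segD(1)[OF A(3)] by simp
  next
    case False
    then have "p \<in> seg q (act n v)" using seg_split[OF assms(2) V(1) A(3,2)] by simp
    then show ?thesis using segD(1)[of p q "act n v"] segD(1)[OF A(3)] d_sym V by fastforce
  qed
  then show False using A assms by simp
qed

lemma big_ordered:
  assumes "big x y" "x \<in> V" "y \<in> V"
  obtains A p q where "A \<in> \<A>" "p \<in> A" "q \<in> A" "c \<le> d p q" "d x y = d x p + d p q + d q y"
    "p \<in> seg x y" "q \<in> seg x y"
proof -
  obtain A p q where A: "A \<in> \<A>" "p \<in> A" "q \<in> A" "p \<in> seg x y" "q \<in> seg x y" "c \<le> d p q"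
    using assms unfolding big_def by blast
  have V: "p \<in> V" "q \<in> V" using A segD by auto
  show ?thesis
  proof (cases "p \<in> seg x q")
    case True
    then show ?thesis using that[OF A(1-3,6) _ A(4,5)] segD(1)[OF A(5)] segD(1)[OF True] by simp
  next
    case False
    then have "p \<in> seg q y" using seg_split[OF assms(2,3) A(5,4)] by simp
    then show ?thesis
      using that[OF A(1,3,2) _ _ A(5,4)] A(6) segD(1)[OF A(5)] segD(1)[of p q y] d_sym V by simp
  qed
qed

text \<open>Rotating about \<open>A\<close> replaces more than half a period of the geodesic by the
  shorter complement.\<close>

lemma shortcut:
  assumes A: "A \<in> \<A>" "p \<in> A" "q \<in> A" and half: "\<tau> < 2 * d p q" and V: "x \<in> V" "y \<in> V"
    and xy: "d x y = d x p + d p q + d q y"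
  shows "\<exists>s\<in>Z A. d x (act s y) < d x y"
proof -
  have pq: "p \<in> V" "q \<in> V" using A axis_V by auto
  \<comment> \<open>\<open>axis_shortcut\<close> handles at most one period, so a longer stretch is
    cut off at \<open>r\<close>.\<close>
  define k where "k = min (d p q) \<tau>"
  obtain r where r: "r \<in> V" "d p r + d r q = d p q" "d p r = k"
    using seg_point[OF pq, of k] by (auto simp: k_def)
  have rA: "r \<in> A" using convexD(1)[OF axis_convex[OF A(1)] A(2,3)] r by (auto simp: seg_def)
  have k: "\<tau> < 2 * k" "k \<le> \<tau>" using half large by (auto simp: k_def)
  obtain s where s: "s \<in> carrier G" "act s ` A = A" "d p (act s r) = \<tau> - k"
    using axis_shortcut[OF A(1) rA A(2)] r k d_sym[OF pq(1) r(1)] by auto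
  have "d x (act s y) \<le> d x p + d p (act s y)" by (rule d_tri) (use V pq s in auto)
  also have "d p (act s y) \<le> d p (act s r) + d (act s r) (act s y)" by (rule d_tri) (use V pq s r in auto)
  also have "d (act s r) (act s y) = d r y" using s r V by simp
  also have "d r y \<le> d r q + d q y" by (rule d_tri) (use V pq r in auto)
  finally have "d x (act s y) \<le> d x p + (\<tau> - k + (d r q + d q y))" using s(3) by simp
  then have "d x (act s y) < d x y" using xy r k by linarith
  then show ?thesis using s by (auto simp: Z_def)
qed

section \<open>Malnormality and torsion modulo the relators\<close>

lemma Z_fixed_point: "\<lbrakk>A \<in> \<A>; f \<in> Z A; x \<in> A; act f x = x\<rbrakk> \<Longrightarrow> f = \<one>"
  using axis_displacement[of A f x] axis_V[of A x] large by (auto simp: Z_def)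

text \<open>
  Replace \<open>g\<close> by \<open>h \<in> g N\<close> with \<open>inv h v\<close> closest to \<open>v\<close>. The conjugate \<open>f\<close> of \<open>k\<close> fixes the midpoint of the path
  from \<open>v\<close> to \<open>f v\<close>, so an axis followed by that path is, by minimality, centred at the midpoint and
  mapped to itself by \<open>f\<close>.
\<close>

theorem vertex_stabilizer_malnormal_mod:
  assumes v: "v \<in> V" and g: "g \<in> carrier G" and k: "k \<in> carrier G" "act k v = v" "k \<noteq> \<one>"
    and k': "k' \<in> carrier G" "act k' v = v"
    and rel: "(inv g \<otimes> k \<otimes> g) \<otimes> inv k' \<in> relator_group"
    and mal: "\<And>g k. \<lbrakk>g \<in> carrier G; k \<in> carrier G; act k v = v; k \<noteq> \<one>; act (inv g \<otimes> k \<otimes> g) v = v\<rbrakk> \<Longrightarrow> act g v = v"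
  shows "\<exists>n\<in>relator_group. act (g \<otimes> n) v = v"
proof -
  define m where "m n = d v (act (inv (g \<otimes> n)) v)" for n
  have "\<exists>n. n \<in> relator_group \<and> (\<forall>n'. n' \<in> relator_group \<longrightarrow> m n \<le> m n')"
    using ex_has_least_nat[of "\<lambda>n. n \<in> relator_group" \<one> m] subgroup.one_closed[OF relator_subgroup] by blast
  then obtain n where n: "n \<in> relator_group" "\<And>n'. n' \<in> relator_group \<Longrightarrow> m n \<le> m n'" by blast
  have nc: "n \<in> carrier G" using n relator_group_carrier by simp
  define h where "h = g \<otimes> n"
  have h: "h \<in> carrier G" using g nc by (simp add: h_def)
  define f where "f = inv h \<otimes> k \<otimes> h"
  have f: "f \<in> carrier G" using h k by (simp add: f_def)
  define y where "y = act (inv h) v"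
  have y: "y \<in> V" using h v by (simp add: y_def)
  have fy: "act f y = y" using h k v by (simp add: f_def y_def act_mult)
  \<comment> \<open>Passing from \<open>g\<close> to \<open>g \<otimes> n\<close> alters the
    relation by \<open>inv n\<close> and a conjugate of \<open>n\<close>, both in
    \<open>relator_group\<close>.\<close>
  have fk: "f \<otimes> inv k' \<in> relator_group"
  proof -
    have "inv n \<otimes> ((inv g \<otimes> k \<otimes> g) \<otimes> inv k') \<otimes> (k' \<otimes> n \<otimes> inv k') \<in> relator_group"
      by (intro subgroup.m_closed[OF relator_subgroup] subgroup.m_inv_closed[OF relator_subgroup] n rel relator_conj k')
    moreover have "inv n \<otimes> ((inv g \<otimes> k \<otimes> g) \<otimes> inv k') \<otimes> (k' \<otimes> n \<otimes> inv k') = f \<otimes> inv k'"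
      using g nc k k' by (simp add: f_def h_def inv_mult_group m_assoc)
    ultimately show ?thesis by simp
  qed
  have fv: "act (f \<otimes> inv k') v = act f v"
  proof -
    have "act (inv k') v = v" using act_inv(1)[OF k'(1) v] k'(2) by simp
    then show ?thesis using f k' v by (simp add: act_mult)
  qed
  have min: "d v y \<le> d v (act s y)" if A: "A \<in> \<A>" "s \<in> Z A" for A s
  proof -
    have s: "s \<in> relator_group" "s \<in> carrier G" using that Z_relator_group Z_carrier by auto
    have "n \<otimes> inv s \<in> relator_group"
      by (intro subgroup.m_closed[OF relator_subgroup] subgroup.m_inv_closed[OF relator_subgroup] n s)
    then have "m n \<le> m (n \<otimes> inv s)" using n(2) by blast
    moreover have "inv (g \<otimes> (n \<otimes> inv s)) = s \<otimes> inv h"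
      using g nc s by (simp add: h_def inv_mult_group m_assoc)
    ultimately show ?thesis using s h v by (simp add: m_def y_def h_def act_mult)
  qed
  show ?thesis
  proof (cases "f \<otimes> inv k' = \<one>")
    \<comment> \<open>Here \<open>f\<close> equals \<open>k'\<close>, so the malnormality hypothesis
      applies to \<open>h\<close> without any quotient.\<close>
    case True
    then have "act f v = v" using fv v by simp
    then have "act h v = v" using mal[OF h k] by (simp add: f_def)
    then show ?thesis using n h_def by blast
  next
    case False
    have fvV: "act f v \<in> V" using f v by simp
    have "big v (act f v)" using greendlinger[OF fk False v] fv by simp
    then obtain A p q where A: "A \<in> \<A>" "p \<in> A" "q \<in> A" "c \<le> d p q" "d v (act f v) = d v p + d p q + d q (act f v)"
      "p \<in> seg v (act f v)" "q \<in> seg v (act f v)"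
      using big_ordered v fvV by blast
    have pqV: "p \<in> V" "q \<in> V" using A segD by auto
    \<comment> \<open>As \<open>f\<close> fixes \<open>y\<close>, it carries the path from
      \<open>v\<close> to \<open>y\<close> to the path from \<open>act f v\<close> to
      \<open>y\<close>. The branch point \<open>b\<close> of this tripod is equidistant from
      \<open>v\<close> and \<open>act f v\<close>, so it is fixed too.\<close>
    obtain b where b: "b \<in> V" "b \<in> seg v (act f v)" "b \<in> seg (act f v) y" "b \<in> seg v y"
      using median_ex[OF v fvV y] by blast
    have dy: "d (act f v) y = d v y" using act_dist[OF f v y] fy by simp
    have bsym: "d (act f v) b = d v b" using segD(1)[OF b(3)] segD(1)[OF b(4)] dy by simp
    have "act f b \<in> seg (act f v) y" using act_seg_iff[OF f v y b(1)] b(4) fy by simp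
    then have fb: "act f b = b"
      using seg_unique[of "act f v" y "act f b" b] b(1,3) f v y bsym fvV by (auto simp: seg_def)
    \<comment> \<open>More than half a period on the way from \<open>v\<close> to \<open>y\<close>
      would give a rotation that shortens this way, against the choice of \<open>n\<close>.\<close>
    have half: "2 * d r t \<le> \<tau>" if "B \<in> \<A>" "r \<in> B" "t \<in> B" "r \<in> seg v b" "t \<in> seg v b" for B r t
    proof (rule ccontr)
      assume n: "\<not> 2 * d r t \<le> \<tau>"
      have V': "r \<in> V" "t \<in> V" using that segD by auto
      have vy: "r \<in> seg v y" "t \<in> seg v y" using seg_trans(1)[OF v y b(4)] that by auto
      have False if w: "B \<in> \<A>" "r \<in> B" "t \<in> B" "r \<in> seg v t" "t \<in> seg v y" "\<tau> < 2 * d r t" for r t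
      proof -
        have "d v y = d v r + d r t + d t y" using segD(1)[OF w(4)] segD(1)[OF w(5)] by simp
        then obtain s where "s \<in> Z B" "d v (act s y) < d v y" using shortcut[OF w(1-3,6) v y] by blast
        then show False using min[OF w(1)] by fastforce
      qed
      moreover have "r \<in> seg v t \<or> t \<in> seg v r"
      proof (rule ccontr)
        assume neg: "\<not> ?thesis"
        then have "r \<in> seg t y" "t \<in> seg r y" using seg_split[OF v y] vy by blast+
        then have "r = t" using seg_antisym[OF y] seg_commute y V' by blast
        then show False using neg v V' by simp
      qed
      ultimately show False using that(1-3) n vy d_sym[OF V'] by (metis not_le)
    qed
    \<comment> \<open>\<open>inv f\<close> carries the second half of the path onto the first, so
      the bound \<open>half\<close> also holds beyond \<open>b\<close>.\<close>
    have fseg: "act (inv f) r \<in> seg v b" if "r \<in> seg b (act f v)" for r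
    proof -
      have rV: "r \<in> V" using that segD by auto
      have "act f (act (inv f) r) \<in> seg (act f b) (act f v)" using that fb f rV by simp
      then have "act (inv f) r \<in> seg b v"
        using act_seg_iff[OF f b(1) v, of "act (inv f) r"] f rV by simp
      then show ?thesis using seg_commute b v by blast
    qed
    have half': "2 * d r t \<le> \<tau>" if "B \<in> \<A>" "r \<in> B" "t \<in> B" "r \<in> seg b (act f v)" "t \<in> seg b (act f v)" for B r t
    proof -
      have V': "r \<in> V" "t \<in> V" using that segD by auto
      have "2 * d (act (inv f) r) (act (inv f) t) \<le> \<tau>"
        using half[of "act (inv f) ` B"] axis_image f that fseg by auto
      then show ?thesis using f V' by simp
    qed
    have ccc: "\<tau> < 2 * c" "\<tau> + 2 * \<Delta> < 2 * c" using large by (auto simp: c_def)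
    have dpq: "d v q = d v p + d p q" using segD(1)[OF A(7)] A(5) by simp
    \<comment> \<open>A stretch of length \<open>c\<close> is too long for either half, so
      \<open>p\<close> and \<open>q\<close> lie on different sides of \<open>b\<close>.\<close>
    have pvb: "p \<in> seg v b"
    proof (rule ccontr)
      assume n: "p \<notin> seg v b"
      then have p: "p \<in> seg b (act f v)" using seg_split[OF v fvV b(2) A(6)] by blast
      have "q \<in> seg b (act f v)"
      proof (rule ccontr)
        assume "q \<notin> seg b (act f v)"
        then have "q \<in> seg v b" using seg_split[OF v fvV b(2) A(7)] by blast
        then have "d v q \<le> d v b" using segD(1) by fastforce
        moreover have "d v b \<le> d v p" using segD(1)[OF p] segD(1)[OF A(6)] segD(1)[OF b(2)] by linarith
        ultimately have "d p q = 0" using dpq by linarith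
        then show False using A(4) ccc by simp
      qed
      then have "2 * d p q \<le> \<tau>" using half'[OF A(1-3) p] by blast
      then show False using A ccc by simp
    qed
    have qbf: "q \<in> seg b (act f v)"
    proof (rule ccontr)
      assume "q \<notin> seg b (act f v)"
      then have "q \<in> seg v b" using seg_split[OF v fvV b(2) A(7)] by blast
      then have "2 * d p q \<le> \<tau>" using half[OF A(1-3) pvb] by blast
      then show False using A ccc by simp
    qed
    have vp: "d v p + d p b = d v b" using segD(1)[OF pvb] .
    have vq: "d v b + d b q = d v q"
      using segD(1)[OF qbf] segD(1)[OF b(2)] segD(1)[OF A(7)] by linarith
    then have pbq: "d p b + d b q = d p q" using vp dpq by linarith
    have bA: "b \<in> A" using convexD(1)[OF axis_convex[OF A(1)] A(2,3)] pbq b by (auto simp: seg_def)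
    have bv: "b \<in> seg v b" "b \<in> seg b (act f v)" using b v fvV by auto
    have hp: "2 * d p b \<le> \<tau>" using half[OF A(1,2) bA pvb bv(1)] .
    have hq: "2 * d b q \<le> \<tau>" using half'[OF A(1) bA A(3) bv(2) qbf] .
    define z where "z = act f p"
    have zV: "z \<in> V" using f pqV by (simp add: z_def)
    have zA: "z \<in> act f ` A" using A by (simp add: z_def)
    have bfA: "b \<in> act f ` A" using bA fb by (metis imageI)
    have dz: "d b z = d p b" using act_dist[OF f b(1) pqV(1)] fb d_sym b pqV by (simp add: z_def)
    have zseg: "z \<in> seg b (act f v)"
    proof -
      have "p \<in> seg b v" using pvb seg_commute b v by blast
      then show ?thesis using act_seg_iff[OF f b(1) v pqV(1)] fb by (simp add: z_def)
    qed
    \<comment> \<open>\<open>z\<close> mirrors \<open>p\<close> beyond \<open>b\<close>, so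
      \<open>A\<close> and its image both run from \<open>b\<close> towards \<open>act f v\<close>.
      Each of \<open>d p b\<close> and \<open>d b q\<close> is at most half of \<tau> while their
      sum is at least \<open>c\<close>; so both exceed \<Delta>, and the shorter one is a common
      stretch.\<close>
    have "act f ` A = A"
    proof (rule ccontr)
      assume ne: "act f ` A \<noteq> A"
      have fA: "act f ` A \<in> \<A>" using axis_image f A by simp
      from seg_split[OF b(1) fvV qbf zseg] show False
      proof
        assume "z \<in> seg b q"
        then have "z \<in> A" using convexD(1)[OF axis_convex[OF A(1)] bA A(3)] by blast
        then have "d b z \<le> \<Delta>" using axis_overlap[OF fA A(1) ne] zA bfA bA by blast
        then show False using dz hq pbq A(4) ccc by linarith
      next
        assume "z \<in> seg q (act f v)"
        then have "q \<in> seg b z"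
          using segD(1)[OF qbf] segD(1)[OF zseg] segD(1)[of z q "act f v"] pqV
            d_tri[OF b(1) pqV(2) zV] by (auto simp: seg_def)
        then have "q \<in> act f ` A" using convexD(1)[OF axis_convex[OF fA] bfA zA] by blast
        then have "d b q \<le> \<Delta>" using axis_overlap[OF fA A(1) ne] A(3) bfA bA by blast
        then show False using hp pbq A(4) ccc by linarith
      qed
    qed
    then have "f = \<one>" using Z_fixed_point[OF A(1) _ bA fb] f by (simp add: Z_def)
    then have "k = \<one>" using conj_eq_one[of "inv h" k] h k by (simp add: f_def)
    then show ?thesis using k by simp
  qed
qed

text \<open>Minimal positive displacement puts \<open>v\<close> on the axis of a hyperbolic element:
  the path from \<open>v\<close> to \<open>act g v\<close> does not backtrack against its translate,
  so the translates concatenate to a geodesic.\<close>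

lemma power_act_geodesic:
  assumes g: "g \<in> carrier G" and v: "v \<in> V"
    and even: "\<And>x. x \<in> V \<Longrightarrow> even (d x (act g x))"
    and min: "\<And>x. x \<in> V \<Longrightarrow> d v (act g v) \<le> d x (act g x)" and pos: "0 < d v (act g v)"
  shows "d v (act (g [^] k) v) = k * d v (act g v)"
proof -
  let ?t = "d v (act g v)"
  have gv: "act g v \<in> V" "act g (act g v) \<in> V" using g v by auto
  \<comment> \<open>If there were backtracking at \<open>act g v\<close>, the neighbour
    \<open>u\<close> of \<open>v\<close> on the path would be mapped to a vertex \<open>w\<close> of
    the same path, and moving from \<open>v\<close> to \<open>u\<close> would lower the displacement
    by 2.\<close>
  have turn: "seg v (act g v) \<inter> seg (act g v) (act g (act g v)) \<subseteq> {act g v}"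
  proof (rule ccontr)
    assume "\<not> ?thesis"
    then obtain z where z: "z \<in> seg v (act g v)" "z \<in> seg (act g v) (act g (act g v))" "z \<noteq> act g v" by blast
    have zV: "z \<in> V" using z segD by blast
    have z1: "1 \<le> d z (act g v)" using z zV d_zero gv by (metis less_one not_le)
    obtain u where u: "u \<in> V" "d v u + d u (act g v) = ?t" "d v u = 1"
      using seg_point[OF v gv(1), of 1] pos by auto
    obtain w where w: "w \<in> V" "d (act g v) w + d w z = d (act g v) z" "d (act g v) w = 1"
      using seg_point[OF gv(1) zV, of 1] z1 d_sym[OF zV gv(1)] by auto
    have ws: "w \<in> seg (act g v) z" using w by (simp add: segI)
    have "w \<in> seg (act g v) (act g (act g v))" using seg_trans(1)[OF gv(1,2) z(2) ws] .
    moreover have "act g u \<in> seg (act g v) (act g (act g v))"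
      using act_seg_iff[OF g v gv(1) u(1)] u by (auto simp: seg_def)
    moreover have "d (act g v) (act g u) = 1" using u g v by simp
    ultimately have gu: "act g u = w"
      using seg_unique[OF gv, of "act g u" w] g u(1) w by (auto simp: seg_def)
    have "z \<in> seg (act g v) v" using z(1) seg_commute gv v by blast
    then have wv: "w \<in> seg (act g v) v" using seg_trans(1)[OF gv(1) v _ ws] by blast
    then have "d v w = ?t - 1" using segD(1)[OF wv] w(3) d_sym[OF w(1) v] d_sym[OF gv(1) v] by simp
    \<comment> \<open>Parity rules out displacement 1, which is what an inversion of an edge would
      have.\<close>
    have t2: "2 \<le> ?t" using even[OF v] pos by (metis One_nat_def Suc_leI le_neq_implies_less odd_one one_add_one plus_1_eq_Suc)
    have "w \<in> seg v (act g v)" using wv seg_commute gv v by blast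
    have uw: "u \<in> seg v w"
    proof (rule ccontr)
      assume "u \<notin> seg v w"
      then have "u \<in> seg w (act g v)"
        using seg_split[OF v gv(1) \<open>w \<in> seg v (act g v)\<close>, of u] u by (auto simp: seg_def)
      then have "d u (act g v) \<le> 1" using segD(1)[of u w "act g v"] w(3) d_sym[OF gv(1) w(1)] by simp
      then have "d u (act g v) = 1" "?t = 2" using u t2 by auto
      then have "u = w" using seg_unique[OF v gv(1), of u w] u w(1) \<open>d v w = ?t - 1\<close> \<open>w \<in> seg v (act g v)\<close>
        by (auto simp: seg_def)
      then show False using \<open>u \<notin> seg v w\<close> v u by simp
    qed
    then have "d u w = ?t - 2" using segD(1)[OF uw] u(3) \<open>d v w = ?t - 1\<close> by simp
    then show False using min[OF u(1)] gu t2 by simp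
  qed
  have "d v (act (g [^] k) v) = k * ?t \<and> (0 < k \<longrightarrow> act g v \<in> seg v (act (g [^] k) v))"
  proof (induction k)
    case 0
    then show ?case using v by simp
  next
    case (Suc k)
    let ?x = "act (g [^] k) v"
    have x: "?x \<in> V" using g v by simp
    have gx: "act (g [^] Suc k) v = act g ?x"
      using g v by (simp add: act_mult[symmetric] nat_pow_mult[of g 1 k, simplified, symmetric] nat_pow_Suc2)
    have "d (act g v) (act g ?x) = k * ?t" using Suc g v x by simp
    moreover have "act g v \<in> seg v (act g ?x)"
    proof (cases k)
      case 0
      then show ?thesis using v g by simp
    next
      case (Suc k')
      then have "act g v \<in> seg v ?x" using Suc.IH by simp
      then have ggv: "act g (act g v) \<in> seg (act g v) (act g ?x)"
        using act_seg_iff[OF g v x gv(1)] by simp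
      have gxV: "act g ?x \<in> V" using g x by simp
      obtain m where m: "m \<in> V" "m \<in> seg v (act g v)" "m \<in> seg (act g v) (act g ?x)" "m \<in> seg v (act g ?x)"
        using median_ex[OF v gv(1) gxV] by blast
      \<comment> \<open>Otherwise the way back towards \<open>v\<close> would pass through
        \<open>act g (act g v)\<close>, and \<open>turn\<close> would identify that vertex with
        \<open>act g v\<close>.\<close>
      have "m = act g v"
      proof (rule ccontr)
        assume ne: "m \<noteq> act g v"
        then have "m \<notin> seg (act g v) (act g (act g v))" using turn m by blast
        then have "m \<in> seg (act g (act g v)) (act g ?x)" using seg_split[OF gv(1) gxV ggv m(3)] by blast
        then have "act g (act g v) \<in> seg (act g v) m"
          using seg_trans(2)[OF gxV gv(1), of "act g (act g v)" m] ggv seg_commute gv gxV m(1) by metis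
        then have "act g (act g v) \<in> seg v (act g v)"
          using seg_trans(1)[OF gv(1) v, of m "act g (act g v)"] m(2) seg_commute gv v by metis
        then have "act g (act g v) = act g v" using turn gv by auto
        then have "d v (act g v) = 0" using act_dist[OF g v gv(1)] gv by simp
        then show False using pos by simp
      qed
      then show ?thesis using m by simp
    qed
    ultimately show ?case using gx segD(1)[of "act g v" v "act g ?x"] by simp
  qed
  then show ?thesis by simp
qed

text \<open>
  Replace \<open>g\<close> by \<open>h \<in> N g\<close> of minimal displacement. If \<open>h\<close> is hyperbolic, then \<open>h\<^sup>k \<in> N\<close> moves a vertex along
  a path that follows a relator axis: either \<open>h\<close> preserves that axis, or a rotation about it shortens the
  displacement of \<open>h\<close>.
\<close>

theorem torsion_mod:
  assumes g: "g \<in> carrier G" and k: "g [^] (k::nat) \<in> relator_group" "0 < k"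
    and even: "\<And>g x. g \<in> carrier G \<Longrightarrow> x \<in> V \<Longrightarrow> even (d x (act g x))"
    and V0: "V \<noteq> {}"
    and stab: "\<And>g x k. \<lbrakk>g \<in> carrier G; x \<in> V; act g x = x; 0 < (k::nat); g [^] k = \<one>\<rbrakk> \<Longrightarrow> g = \<one>"
  shows "g \<in> relator_group"
proof -
  let ?N = relator_group
  define D where "D p = d (snd p) (act (fst p \<otimes> g) (snd p))" for p
  obtain v0 where "v0 \<in> V" using V0 by blast
  then have "(\<one>, v0) \<in> ?N \<times> V" using subgroup.one_closed[OF relator_subgroup] by simp
  then obtain p where p: "p \<in> ?N \<times> V" "\<And>p'. p' \<in> ?N \<times> V \<Longrightarrow> D p \<le> D p'"
    using ex_has_least_nat[of "\<lambda>p. p \<in> ?N \<times> V" _ D] by blast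
  obtain n v where nv: "p = (n, v)" by force
  have n: "n \<in> ?N" "n \<in> carrier G" and v: "v \<in> V" using p nv relator_group_carrier by auto
  define h where "h = n \<otimes> g"
  have h: "h \<in> carrier G" using n g by (simp add: h_def)
  let ?t = "d v (act h v)"
  have min: "?t \<le> d x (act (m \<otimes> h) x)" if "m \<in> ?N" "x \<in> V" for m x
  proof -
    have "m \<otimes> n \<in> ?N" by (rule subgroup.m_closed[OF relator_subgroup that(1) n(1)])
    then have "D p \<le> D (m \<otimes> n, x)" using p that by auto
    then show ?thesis using nv h_def relator_group_carrier[OF that(1)] n g by (simp add: D_def m_assoc)
  qed
  have hN: "h [^] j \<otimes> inv (g [^] j) \<in> ?N" for j :: nat
  proof (induction j)
    case 0
    then show ?case using subgroup.one_closed[OF relator_subgroup] by simp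
  next
    case (Suc j)
    have "h [^] Suc j \<otimes> inv (g [^] Suc j) =
        h [^] j \<otimes> inv (g [^] j) \<otimes> (g [^] j \<otimes> n \<otimes> inv (g [^] j))"
      using g n h by (simp add: h_def m_assoc inv_mult_group)
    then show ?case using subgroup.m_closed[OF relator_subgroup Suc relator_conj[OF n(1)]] g by simp
  qed
  have hk: "h [^] k \<in> ?N"
  proof -
    have "h [^] k \<otimes> inv (g [^] k) \<otimes> g [^] k \<in> ?N"
      by (rule subgroup.m_closed[OF relator_subgroup hN k(1)])
    then show ?thesis using g h by (simp add: m_assoc)
  qed
  have back_N: "g \<in> ?N" if "h \<in> ?N"
  proof -
    have "inv n \<otimes> h \<in> ?N"
      by (intro subgroup.m_closed[OF relator_subgroup] subgroup.m_inv_closed[OF relator_subgroup] that n)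
    then show ?thesis using n g by (simp add: h_def)
  qed
  show ?thesis
  proof (cases "?t = 0")
    \<comment> \<open>\<open>h\<close> is elliptic: its power \<open>h [^] k\<close> fixes
      \<open>v\<close>, hence is trivial, and \<open>stab\<close> applies.\<close>
    case True
    then have hv: "act h v = v" using d_zero v h by auto
    have "act (h [^] j) v = v" for j :: nat
      by (induction j) (use hv v h in \<open>auto simp: act_mult\<close>)
    then have "d v (act (h [^] k) v) < c" using v large by (simp add: c_def)
    then have "h [^] k = \<one>" using short_trivial[OF hk v] by blast
    then have "h = \<one>" using stab[OF h v hv k(2)] by blast
    then show ?thesis using back_N subgroup.one_closed[OF relator_subgroup] by simp
  next
    case False
    have geo: "d v (act (h [^] j) v) = j * ?t" for j :: nat
      using power_act_geodesic[OF h v even[OF h]] min[OF subgroup.one_closed[OF relator_subgroup]] h False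
      by simp
    have hk1: "h [^] k \<noteq> \<one>" using geo[of k] False k v by auto
    have hjV: "act (h [^] j) v \<in> V" for j :: nat using h v by simp
    obtain A p q where A: "A \<in> \<A>" "p \<in> A" "q \<in> A" "c \<le> d p q"
      "d v (act (h [^] k) v) = d v p + d p q + d q (act (h [^] k) v)"
      "p \<in> seg v (act (h [^] k) v)" "q \<in> seg v (act (h [^] k) v)"
      using big_ordered[OF greendlinger[OF hk hk1 v] v hjV] by blast
    have pqV: "p \<in> V" "q \<in> V" using A segD by auto
    \<comment> \<open>One more period is appended so that the images under \<open>h\<close> of
      points of the path stay on the same geodesic.\<close>
    have sub: "act (h [^] k) v \<in> seg v (act (h [^] Suc k) v)"
    proof -
      have "act (h [^] Suc k) v = act (h [^] k) (act h v)" using h v by (simp add: act_mult)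
      then show ?thesis using geo[of k] geo[of "Suc k"] h v by (intro segI) auto
    qed
    let ?e = "act (h [^] Suc k) v"
    have eV: "?e \<in> V" using hjV .
    have pe: "p \<in> seg v ?e" "q \<in> seg v ?e" using seg_trans(1)[OF v eV sub] A by auto
    have shift: "act h r \<in> seg v ?e \<and> d v (act h r) = ?t + d v r" if r: "r \<in> seg v (act (h [^] k) v)" for r
    proof -
      have rV: "r \<in> V" using r segD by blast
      have e: "?e = act h (act (h [^] k) v)"
        using h v nat_pow_Suc2[OF h, of k] act_mult[of h "h [^] k" v] by (simp del: nat_pow_Suc)
      have "act h r \<in> seg (act h v) ?e" using act_seg_iff[OF h v hjV rV] r e by simp
      then have 1: "?t * k = d v r + d (act h r) ?e"
        using segD(1)[OF r] geo[of k] h v rV segD(1)[of "act h r" "act h v" ?e] act_dist[OF h v hjV] e by (simp add: mult.commute)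
      have hrV: "act h r \<in> V" using h rV by simp
      have hvV: "act h v \<in> V" using h v by simp
      have 2: "d v (act h r) \<le> ?t + d v r" using d_tri[OF v hvV hrV] h v rV by simp
      have 3: "d v ?e \<le> d v (act h r) + d (act h r) ?e" using d_tri[OF v hrV eV] .
      have 4: "d v ?e = ?t + ?t * k" using geo[of "Suc k"] by simp
      have "d v (act h r) + d (act h r) ?e = d v ?e" using 1 2 3 4 by linarith
      moreover have "d v (act h r) = ?t + d v r" using 1 2 3 4 by linarith
      ultimately show ?thesis using hrV by (simp add: segI)
    qed
    have order: "d r s = d v s - d v r \<and> r \<in> seg v s" 
      if rs: "r \<in> seg v ?e" "s \<in> seg v ?e" "d v r \<le> d v s" for r s
    proof -
      have rsV: "r \<in> V" "s \<in> V" using rs segD by auto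
      have "r \<in> seg v s"
      proof (rule ccontr)
        assume n: "r \<notin> seg v s"
        then have "r \<in> seg s ?e" using seg_split[OF v eV rs(2,1)] by blast
        then have "d v r = d v s" using segD(1)[of r s ?e] segD(1)[OF rs(1)] segD(1)[OF rs(2)] rs(3) by linarith
        then have "r = s" using seg_unique[OF v eV rsV] rs segD(1) by blast
        then show False using n v rsV by simp
      qed
      then show ?thesis using segD(1)[of r v s] by simp
    qed
    have dpq: "d v q = d v p + d p q" using segD(1)[OF A(7)] A(5) by simp
    have hp: "act h p \<in> seg v ?e" "d v (act h p) = ?t + d v p" using shift[OF A(6)] by auto
    have hpV: "act h p \<in> V" using h pqV by simp
    have ccc: "\<tau> + 2 * \<Delta> + 2 < 2 * c" using large by (auto simp: c_def)
    show ?thesis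
    \<comment> \<open>If the stretch on \<open>A\<close> exceeds \<open>?t\<close> by more than
      \<Delta>, then \<open>A\<close> and its image under \<open>h\<close> share the segment from
      \<open>act h p\<close> to \<open>q\<close>. Otherwise \<open>?t\<close> is at least
      \<open>c - \<Delta>\<close>, more than half a period.\<close>
    proof (cases "?t + \<Delta> < d p q")
      case True
      have hpq: "act h p \<in> seg p q"
      proof -
        have "d p (act h p) = ?t" using order[OF pe(1) hp(1)] hp(2) by simp
        moreover have "d (act h p) q = d v q - d v (act h p)" using order[OF hp(1) pe(2)] hp(2) dpq True by simp
        ultimately show ?thesis using hp(2) dpq True hpV by (intro segI) auto
      qed
      then have hpA: "act h p \<in> A" using convexD(1)[OF axis_convex[OF A(1)] A(2,3)] by blast
      \<comment> \<open>\<open>q'\<close> is the point that \<open>h\<close> moves to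
        \<open>q\<close>; it puts \<open>q\<close> on the image of \<open>A\<close>.\<close>
      obtain q' where q': "q' \<in> V" "d p q' + d q' q = d p q" "d p q' = d p q - ?t"
        using seg_point[OF pqV, of "d p q - ?t"] by auto
      have q's: "q' \<in> seg p q" using q' by (simp add: segI)
      then have q'A: "q' \<in> A" using convexD(1)[OF axis_convex[OF A(1)] A(2,3)] by blast
      have q'k: "q' \<in> seg v (act (h [^] k) v)" 
        using convexD(1)[OF convex_seg[OF v hjV] A(6,7)] q's by blast
      have vq': "d v q' = d v p + d p q'"
      proof -
        have "q' \<in> seg v ?e" using seg_trans(1)[OF v eV sub q'k] .
        moreover have "p \<in> seg v q" using order[OF pe] dpq by simp
        ultimately have "p \<in> seg v q'" 
          using seg_trans(2)[of q v p q'] q's seg_commute v pqV q'(1) by metis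
        then show ?thesis using segD(1) by fastforce
      qed
      have "act h q' \<in> seg v ?e" "d v (act h q') = d v q" using shift[OF q'k] vq' q'(3) dpq True by auto
      then have hq': "act h q' = q" using seg_unique[OF v eV _ pqV(2) segD(1) segD(1)[OF pe(2)]] h q'(1) by simp
      have "d (act h p) q = d v q - d v (act h p)" using order[OF hp(1) pe(2)] hp(2) dpq True by simp
      then have big: "\<Delta> < d (act h p) q" using hp(2) dpq True by simp
      have "act h ` A = A"
      proof (rule ccontr)
        assume ne: "act h ` A \<noteq> A"
        have "q \<in> act h ` A" using q'A hq' by blast
        then have "d (act h p) q \<le> \<Delta>"
          using axis_overlap[OF axis_image[OF h A(1)] A(1) ne] hpA A by blast
        then show False using big by simp
      qed
      then have "h \<in> ?N" using Z_relator_group[OF A(1)] h by (auto simp: Z_def)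
      then show ?thesis by (rule back_N)
    next
      case False
      \<comment> \<open>Only the part of \<open>A\<close> between \<open>p\<close> and
        \<open>act h p\<close> may be used: shortening that segment contradicts the minimality of
        \<open>?t\<close>.\<close>
      define l where "l = min (d p q) ?t"
      obtain r where r: "r \<in> V" "d p r + d r q = d p q" "d p r = l"
        using seg_point[OF pqV, of l] by (auto simp: l_def)
      have rs: "r \<in> seg p q" using r by (simp add: segI)
      have rA: "r \<in> A" using convexD(1)[OF axis_convex[OF A(1)] A(2,3)] rs by blast
      have re: "r \<in> seg v ?e" using convexD(1)[OF convex_seg[OF v eV] pe] rs by blast
      have "p \<in> seg v q" using order[OF pe] dpq by simp
      then have "p \<in> seg v r" using seg_trans(2)[of q v p r] rs seg_commute v pqV r(1) by metis
      then have vr: "d v r = d v p + l" using segD(1) r by fastforce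
      have rhp: "d r (act h p) = ?t - l" using order[OF re hp(1)] hp(2) vr by (simp add: l_def)
      have php: "d p (act h p) = ?t" using order[OF pe(1) hp(1)] hp(2) by simp
      have "\<tau> < 2 * d p r" using r(3) False A(4) ccc by (auto simp: l_def)
      then obtain s where s: "s \<in> Z A" "d p (act s (act h p)) < d p (act h p)"
        using shortcut[OF A(1,2) rA _ pqV(1) hpV] pqV php rhp r(3) by (auto simp: l_def)
      have sN: "s \<in> ?N" "s \<in> carrier G" using s Z_relator_group[OF A(1)] Z_carrier by auto
      have "?t \<le> d p (act (s \<otimes> h) p)" using min[OF sN(1) pqV(1)] .
      then show ?thesis using s php sN h pqV by (simp add: act_mult)
    qed
  qed
qed

end

section \<open>Trees from acyclic graphs\<close>

text \<open>\<open>m\<close> is the branch vertex of two walks with a common start, the last entry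
  of their longest common prefix.\<close>

lemma diverge:
  assumes "p \<noteq> []" "q \<noteq> []" "hd p = hd q"
  obtains xs m p' q' where "p = xs @ m # p'" "q = xs @ m # q'" "p' = [] \<or> q' = [] \<or> hd p' \<noteq> hd q'"
  using assms
proof (induction p arbitrary: q thesis)
  case Nil
  then show ?case by simp
next
  case (Cons x p)
  have "q \<noteq> []" "hd q = x" using Cons.prems by simp_all
  then obtain q' where q: "q = x # q'" by (cases q) auto
  show ?case
  proof (cases "p = [] \<or> q' = [] \<or> hd p \<noteq> hd q'")
    case True
    then show ?thesis using Cons.prems(1)[of "[]" x p q'] q by simp
  next
    case False
    then obtain xs m a b where "p = xs @ m # a" "q' = xs @ m # b" "a = [] \<or> b = [] \<or> hd a \<noteq> hd b"
      using Cons.IH[of q'] by blast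
    then show ?thesis using Cons.prems(1)[of "x # xs" m a b] q by simp
  qed
qed

locale graph_tree =
  fixes V :: "'v set" and E :: "'v \<Rightarrow> 'v \<Rightarrow> bool"
  assumes E_sym: "E x y \<Longrightarrow> E y x" and E_V: "E x y \<Longrightarrow> x \<in> V"

text \<open>Walks without backtracking. The empty list is excluded so that \<open>hd\<close> and
  \<open>last\<close> are the end vertices.\<close>

fun (in graph_tree) rwalk :: "'v list \<Rightarrow> bool" where
  "rwalk [] = False"
| "rwalk [x] = (x \<in> V)"
| "rwalk [x, y] = E x y"
| "rwalk (x # y # z # xs) = (E x y \<and> x \<noteq> z \<and> rwalk (y # z # xs))"

context graph_tree begin

lemma rwalk_nonempty: "rwalk p \<Longrightarrow> p \<noteq> []"
  by auto

lemma rwalk_V: "rwalk p \<Longrightarrow> set p \<subseteq> V"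
  by (induction p rule: rwalk.induct) (use E_V E_sym in auto)

lemma rwalk_Cons:
  "p \<noteq> [] \<Longrightarrow> rwalk (x # p) \<longleftrightarrow> E x (hd p) \<and> (tl p = [] \<or> x \<noteq> hd (tl p)) \<and> rwalk p"
  using E_V E_sym by (cases p; cases "tl p"; auto)

lemma rwalk_append:
  "rwalk (p @ m # q) \<longleftrightarrow> rwalk (p @ [m]) \<and> rwalk (m # q) \<and> (p = [] \<or> q = [] \<or> last p \<noteq> hd q)"
proof (induction p)
  case Nil
  then show ?case using rwalk_V[of "m # q"] by auto
next
  case (Cons x p)
  show ?case
  proof (cases p)
    case Nil
    then show ?thesis by (cases q) (auto simp: rwalk_Cons dest: E_sym E_V)
  next
    case (Cons y p')
    then have "hd (tl (p @ m # q)) = hd (tl (p @ [m]))" "tl (p @ m # q) \<noteq> []" "tl (p @ [m]) \<noteq> []"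
      by (cases p'; simp)+
    then show ?thesis using Cons.IH Cons by (simp add: rwalk_Cons del: rwalk.simps)
  qed
qed

lemma rwalk_rev: "rwalk (rev p) = rwalk p"
proof (induction p)
  case (Cons x p)
  show ?case
  proof (cases p)
    case Nil then show ?thesis by simp
  next
    case (Cons y q)
    have "rwalk (rev (x # p)) = rwalk (rev q @ y # [x])" using Cons by simp
    also have "\<dots> = (rwalk (rev p) \<and> rwalk [y, x] \<and> (q = [] \<or> hd q \<noteq> x))"
      by (subst rwalk_append) (simp add: Cons last_rev)
    also have "\<dots> = rwalk (x # p)"
      using Cons.IH Cons E_sym E_V by (cases q) auto
    finally show ?thesis .
  qed
qed simp

end

locale acyclic_connected = graph_tree +
  assumes acyclic: "rwalk p \<Longrightarrow> hd p = last p \<Longrightarrow> length p = 1"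
    and connected: "x \<in> V \<Longrightarrow> y \<in> V \<Longrightarrow> E\<^sup>*\<^sup>* x y"
begin

lemma rwalk_join:
  assumes "rwalk (xs @ m # p)" "rwalk (ys @ m # q)" "p = [] \<or> q = [] \<or> hd p \<noteq> hd q"
  shows "rwalk (rev p @ m # q)"
proof -
  have "rwalk (m # p)" "rwalk (m # q)" using assms rwalk_append by blast+
  moreover from this have "rwalk (rev p @ [m])" using rwalk_rev[of "m # p"] by simp
  ultimately show ?thesis using assms(3) by (subst rwalk_append) (auto simp: last_rev)
qed

text \<open>Removing the common prefix and reversing one remainder gives a closed reduced walk, so
  nothing remains.\<close>

lemma rwalk_unique:
  assumes "rwalk p" "rwalk q" "hd p = hd q" "last p = last q"
  shows "p = q"
proof -
  obtain xs m a b where ab: "p = xs @ m # a" "q = xs @ m # b" "a = [] \<or> b = [] \<or> hd a \<noteq> hd b"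
    using diverge assms rwalk_nonempty by metis
  have "rwalk (rev a @ m # b)" using rwalk_join assms ab by blast
  moreover have "hd (rev a @ m # b) = last p" "last (rev a @ m # b) = last q"
    using ab by (auto simp: hd_append hd_rev)
  ultimately have "length (rev a @ m # b) = 1" using acyclic assms by metis
  then show ?thesis using ab by simp
qed

text \<open>Adding an edge either keeps the walk reduced or cancels its last step.\<close>

lemma rwalk_ex:
  assumes "x \<in> V" "y \<in> V" shows "\<exists>p. rwalk p \<and> hd p = x \<and> last p = y"
  using connected[OF assms]
proof (induction rule: rtranclp_induct)
  case base
  then show ?case using assms by (intro exI[of _ "[x]"]) simp
next
  case (step y z)
  then obtain p where p: "rwalk p" "hd p = x" "last p = y" by blast
  then obtain a where a: "p = a @ [y]" using rwalk_nonempty by (metis append_butlast_last_id)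
  show ?case
  proof (cases "a = [] \<or> last a \<noteq> z")
    case True
    then have "rwalk (a @ y # [z])" using p a step by (subst rwalk_append) auto
    then show ?thesis using p a by (intro exI[of _ "a @ [y, z]"]) (auto simp: hd_append)
  next
    case False
    then obtain b where b: "a = b @ [z]" by (metis append_butlast_last_id)
    then have "rwalk (b @ [z])" using p a rwalk_append[of b z "[y]"] by simp
    then show ?thesis using p a b by (intro exI[of _ "b @ [z]"]) (auto simp: hd_append)
  qed
qed

definition d :: "'a \<Rightarrow> 'a \<Rightarrow> nat" where
  "d x y = length (SOME p. rwalk p \<and> hd p = x \<and> last p = y) - 1"

lemma d_rwalk: "rwalk p \<Longrightarrow> d (hd p) (last p) = length p - 1"
proof -
  assume p: "rwalk p"
  then have "\<exists>q. rwalk q \<and> hd q = hd p \<and> last q = last p" by blast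
  from someI_ex[OF this] have "(SOME q. rwalk q \<and> hd q = hd p \<and> last q = last p) = p"
    using rwalk_unique p by blast
  then show ?thesis by (simp add: d_def)
qed

lemma d_eqI: "rwalk p \<Longrightarrow> hd p = x \<Longrightarrow> last p = y \<Longrightarrow> length p = Suc n \<Longrightarrow> d x y = n"
  using d_rwalk by fastforce

lemma d_adjacent: "E x y \<Longrightarrow> d x y = 1"
  using d_eqI[of "[x, y]"] by simp

lemma d_split:
  assumes "rwalk (xs @ m # ys)"
  shows "d (hd (xs @ [m])) m = length xs" "d m (last (m # ys)) = length ys"
    "d (hd (xs @ [m])) (last (m # ys)) = length xs + length ys"
proof -
  have r: "rwalk (xs @ [m])" "rwalk (m # ys)" using assms rwalk_append by blast+
  show "d (hd (xs @ [m])) m = length xs" using d_rwalk[OF r(1)] by simp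
  show "d m (last (m # ys)) = length ys" using d_rwalk[OF r(2)] by simp
  have "hd (xs @ m # ys) = hd (xs @ [m])" by (cases xs) auto
  then show "d (hd (xs @ [m])) (last (m # ys)) = length xs + length ys"
    using d_rwalk[OF assms] by simp
qed

text \<open>The median is the vertex where the walks from \<open>x\<close> to \<open>y\<close> and
  to \<open>z\<close> part; the two remainders join to the walk from \<open>y\<close> to
  \<open>z\<close>.\<close>

lemma walk_median:
  assumes "x \<in> V" "y \<in> V" "z \<in> V"
  obtains xs m a b where "rwalk (xs @ m # a)" "rwalk (xs @ m # b)" "rwalk (rev a @ m # b)"
    "hd (xs @ [m]) = x" "last (m # a) = y" "last (m # b) = z" "hd (rev a @ [m]) = y"
proof -
  obtain p q where p: "rwalk p" "hd p = x" "last p = y" and q: "rwalk q" "hd q = x" "last q = z"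
    using rwalk_ex assms by metis
  then obtain xs m a b where ab: "p = xs @ m # a" "q = xs @ m # b" "a = [] \<or> b = [] \<or> hd a \<noteq> hd b"
    using diverge[of p q] rwalk_nonempty by metis
  have "rwalk (rev a @ m # b)" using rwalk_join p q ab by blast
  moreover have "hd (xs @ [m]) = x" using p ab by (cases xs) auto
  moreover have "hd (rev a @ [m]) = last (m # a)" by (cases a rule: rev_cases) auto
  ultimately show ?thesis using that p q ab by simp
qed

text \<open>Equality in the triangle inequality makes the leg from \<open>z\<close> to the median
  trivial.\<close>

lemma on_segment:
  assumes "x \<in> V" "y \<in> V" "z \<in> V" "d x z + d z y = d x y"
  obtains xs ys where "rwalk (xs @ z # ys)" "hd (xs @ [z]) = x" "last (z # ys) = y" "d x z = length xs"
proof -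
  obtain xs m a b where w: "rwalk (xs @ m # a)" "rwalk (xs @ m # b)" "rwalk (rev a @ m # b)"
    "hd (xs @ [m]) = z" "last (m # a) = x" "last (m # b) = y" "hd (rev a @ [m]) = x"
    using walk_median assms by metis
  have "d z x = length xs + length a" "d z y = length xs + length b" "d x y = length a + length b"
    using d_split(3)[OF w(1)] d_split(3)[OF w(2)] d_split(3)[OF w(3)] w by auto
  moreover have "d x z = length a + length xs"
  proof (rule d_eqI)
    show "rwalk (rev (xs @ m # a))" by (subst rwalk_rev) (rule w(1))
    show "hd (rev (xs @ m # a)) = x" using w(5) hd_rev[of "xs @ m # a"] by simp
    have "hd (xs @ m # a) = hd (xs @ [m])" by (cases xs) auto
    then show "last (rev (xs @ m # a)) = z" using w(4) last_rev[of "xs @ m # a"] by simp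
    show "length (rev (xs @ m # a)) = Suc (length a + length xs)" by simp
  qed
  ultimately have "xs = []" using assms by simp
  then show ?thesis using that[of "rev a" b] w \<open>d x z = length a + length xs\<close> by simp
qed

sublocale tree_metric V d
proof
  fix x y z z' :: 'a and n
  assume x: "x \<in> V" and y: "y \<in> V"
  obtain p where p: "rwalk p" "hd p = x" "last p = y" using rwalk_ex x y by blast
  have dp: "d x y = length p - 1" using d_rwalk p by metis
  have p1: "p \<noteq> []" using p rwalk_nonempty by blast
  show "d x y = 0 \<longleftrightarrow> x = y"
  proof
    assume "d x y = 0"
    then have "length p = 1" using dp p1 by (cases p) auto
    then show "x = y" using p by (cases p) auto
  next
    assume "x = y"
    then show "d x y = 0" using d_eqI[of "[x]" x y 0] x by simp
  qed
  show "d x y = d y x"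
  proof -
    have "d (hd (rev p)) (last (rev p)) = length (rev p) - 1" 
      by (rule d_rwalk) (simp only: rwalk_rev p)
    then show ?thesis using dp p p1 by (simp add: hd_rev last_rev)
  qed
  {
    assume n: "n \<le> d x y"
    then have nl: "n < length p" using dp p1 by (cases p) auto
    have e: "p = take n p @ p ! n # drop (Suc n) p" using id_take_nth_drop[OF nl] .
    then have r: "rwalk (take n p @ p ! n # drop (Suc n) p)" using p by simp
    have h: "hd (take n p @ [p ! n]) = x" using p(2) nl e 
      by (cases n; cases p) auto
    have l: "last (p ! n # drop (Suc n) p) = y" using p(3) e by (metis last_append list.discI)
    show "\<exists>z\<in>V. d x z + d z y = d x y \<and> d x z = n"
      using d_split[OF r] h l nl rwalk_V[OF p(1)] nth_mem[OF nl] by (intro bexI[of _ "p ! n"]) auto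
  }
  assume z: "z \<in> V"
  obtain xs m a b where w: "rwalk (xs @ m # a)" "rwalk (xs @ m # b)" "rwalk (rev a @ m # b)"
    "hd (xs @ [m]) = y" "last (m # a) = x" "last (m # b) = z" "hd (rev a @ [m]) = x"
    using walk_median[OF y x z] by metis
  have mV: "m \<in> V" using w(1) rwalk_V by fastforce
  note s1 = d_split[OF w(1), unfolded w] and s2 = d_split[OF w(2), unfolded w] and s3 = d_split[OF w(3), unfolded w]
  have sym: "d u v = d v u" if "u \<in> V" "v \<in> V" for u v
  proof -
    from rwalk_ex[OF that] obtain p where p: "rwalk p" "hd p = u" "last p = v" by blast
    have "p \<noteq> []" using p rwalk_nonempty by blast
    moreover have "d (hd (rev p)) (last (rev p)) = length (rev p) - 1" 
      by (rule d_rwalk) (simp only: rwalk_rev p)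
    ultimately show ?thesis using d_rwalk[OF p(1)] p by (simp add: hd_rev last_rev)
  qed
  show "d x z \<le> d x y + d y z"
    using s1 s2 s3 sym[OF x y] by simp
  show "\<exists>m\<in>V. d x m + d m y = d x y \<and> d y m + d m z = d y z \<and> d x m + d m z = d x z"
    using s1 s2 s3 sym[OF x y] sym[OF mV y] sym[OF mV x] mV by (intro bexI[of _ m]) simp_all
  assume z': "z' \<in> V" and dz: "d x z + d z y = d x y" "d x z' + d z' y = d x y" "d x z = d x z'"
  obtain as bs where 1: "rwalk (as @ z # bs)" "hd (as @ [z]) = x" "last (z # bs) = y" "d x z = length as"
    using on_segment[OF x y z dz(1)] by blast
  obtain cs ds where 2: "rwalk (cs @ z' # ds)" "hd (cs @ [z']) = x" "last (z' # ds) = y" "d x z' = length cs"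
    using on_segment[OF x y z' dz(2)] by blast
  have "hd (as @ z # bs) = x" using 1(2) by (cases as) auto
  moreover have "hd (cs @ z' # ds) = x" using 2(2) by (cases cs) auto
  ultimately have "as @ z # bs = cs @ z' # ds" using rwalk_unique[OF 1(1) 2(1)] 1 2 by simp
  then show "z = z'" using 1 2 dz by simp
qed

lemma rwalk_seg:
  assumes "rwalk (xs @ m # ys)" shows "m \<in> seg (hd (xs @ [m])) (last (m # ys))"
  using d_split[OF assms] rwalk_V[OF assms] by (auto intro: segI)

end

section \<open>Normal forms in an amalgamated product\<close>

locale group_pair = K: group K + L: group L for K L :: "'a monoid" +
  fixes H :: "'a set"
  assumes HK: "subgroup H K" and HL: "subgroup H L"
    and H_eq: "carrier K \<inter> carrier L = H"
    and agree: "x \<in> H \<Longrightarrow> y \<in> H \<Longrightarrow> x \<otimes>\<^bsub>K\<^esub> y = x \<otimes>\<^bsub>L\<^esub> y"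
begin

lemma swap: "group_pair L K H"
proof (intro group_pair.intro group_pair_axioms.intro)
  show "subgroup H L" "subgroup H K" by (rule HL HK)+
  show "carrier L \<inter> carrier K = H" using H_eq by auto
qed (use agree K.is_group L.is_group in auto)

lemma one_eq: "\<one>\<^bsub>K\<^esub> = \<one>\<^bsub>L\<^esub>"
proof -
  have "\<one>\<^bsub>K\<^esub> \<in> H" using HK subgroup.one_closed by blast
  moreover from this have "\<one>\<^bsub>K\<^esub> \<otimes>\<^bsub>L\<^esub> \<one>\<^bsub>K\<^esub> = \<one>\<^bsub>K\<^esub>" using agree by (metis K.l_one K.one_closed)
  ultimately show ?thesis using H_eq by (auto dest: L.l_cancel_one')
qed

end

text \<open>
  For a subgroup \<open>H\<close> of \<open>X\<close>, every \<open>x\<close> is \<open>hpart X H x \<otimes> rep X H x\<close>, where \<open>rep X H x\<close> depends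
  only on the right coset of \<open>x\<close>.
\<close>

definition rep :: "'a monoid \<Rightarrow> 'a set \<Rightarrow> 'a \<Rightarrow> 'a" where
  "rep X H x = (if x \<in> H then \<one>\<^bsub>X\<^esub> else SOME y. y \<in> H #>\<^bsub>X\<^esub> x)"

definition hpart :: "'a monoid \<Rightarrow> 'a set \<Rightarrow> 'a \<Rightarrow> 'a" where
  "hpart X H x = x \<otimes>\<^bsub>X\<^esub> inv\<^bsub>X\<^esub> (rep X H x)"

context
  fixes X :: "'a monoid" (structure) and H :: "'a set"
  assumes X: "group X" and H: "subgroup H X"
begin

interpretation group X by (rule X)
interpretation H: subgroup H X by (rule H)

lemma rep_coset: "x \<in> carrier X \<Longrightarrow> rep X H x \<in> H #> x"
proof (cases "x \<in> H")
  case True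
  then show ?thesis by (simp add: rep_def coset_join2[OF _ H])
next
  case False
  assume "x \<in> carrier X"
  then have "\<exists>y. y \<in> H #> x" using rcos_self[OF _ H] by blast
  then show ?thesis using False someI_ex[of "\<lambda>y. y \<in> H #> x"] by (simp add: rep_def)
qed

lemma rep_closed [simp]: "x \<in> carrier X \<Longrightarrow> rep X H x \<in> carrier X"
  using rep_coset r_coset_subset_G[OF H.subset] by blast

lemma hpart_in: assumes "x \<in> carrier X" shows "hpart X H x \<in> H"
proof -
  obtain h where h: "h \<in> H" "rep X H x = h \<otimes> x" using rep_coset assms unfolding r_coset_def by blast
  then have "hpart X H x = inv h" using assms by (simp add: hpart_def inv_mult_group m_assoc[symmetric])
  then show ?thesis using h by simp
qed

lemma hpart_rep: "x \<in> carrier X \<Longrightarrow> hpart X H x \<otimes> rep X H x = x"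
  by (simp add: hpart_def m_assoc)

lemma rep_mult: assumes "h \<in> H" "x \<in> carrier X" shows "rep X H (h \<otimes> x) = rep X H x"
proof -
  have "H #> (h \<otimes> x) = H #> x" using assms coset_join2[OF _ H] coset_mult_assoc[OF H.subset] by (metis H.mem_carrier)
  moreover have "h \<otimes> x \<in> H \<longleftrightarrow> x \<in> H"
  proof
    assume "h \<otimes> x \<in> H"
    then have "inv h \<otimes> (h \<otimes> x) \<in> H" using assms by blast
    then show "x \<in> H" using assms by simp
  qed (use assms in blast)
  ultimately show ?thesis by (simp add: rep_def)
qed

lemma hpart_mult: "h \<in> H \<Longrightarrow> x \<in> carrier X \<Longrightarrow> hpart X H (h \<otimes> x) = h \<otimes> hpart X H x"
  using rep_mult by (simp add: hpart_def m_assoc)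

lemma rep_notin: assumes "x \<in> carrier X" "x \<notin> H" shows "rep X H x \<notin> H"
  using hpart_rep[OF assms(1)] hpart_in[OF assms(1)] assms(2) H.m_closed by metis

lemma rep_rep: assumes "x \<in> carrier X" shows "rep X H (rep X H x) = rep X H x"
  using rep_mult[OF hpart_in[OF assms], of "rep X H x"] assms by (simp add: hpart_rep)

lemma hpart_rep_fixed: "t \<in> carrier X \<Longrightarrow> rep X H t = t \<Longrightarrow> h \<in> H \<Longrightarrow> hpart X H (h \<otimes> t) = h"
  using hpart_mult[of h t] by (simp add: hpart_def)

end

section \<open>The action of both factors on normal forms\<close>

fun unpack :: "'a monoid \<Rightarrow> 'a \<times> 'a list \<Rightarrow> 'a \<times> 'a list" where
  "unpack X (h, []) = (h, [])"
| "unpack X (h, t # ts) = (if t \<in> carrier X then (h \<otimes>\<^bsub>X\<^esub> t, ts) else (h, t # ts))"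

definition pack :: "'a monoid \<Rightarrow> 'a set \<Rightarrow> 'a \<times> 'a list \<Rightarrow> 'a \<times> 'a list" where
  "pack X H p = (if fst p \<in> H then p else (hpart X H (fst p), rep X H (fst p) # snd p))"

definition shift :: "'a monoid \<Rightarrow> 'a set \<Rightarrow> 'a \<Rightarrow> 'a \<times> 'a list \<Rightarrow> 'a \<times> 'a list" where
  "shift X H x p = pack X H (x \<otimes>\<^bsub>X\<^esub> fst (unpack X p), snd (unpack X p))"

context group_pair begin

text \<open>
  Van der Waerden's method: \<open>\<Omega>\<close> consists of the prospective normal forms \<open>h t\<^sub>1 \<dots> t\<^sub>n\<close>. Absorbing a leading
  letter from \<open>K\<close> into \<open>h\<close> (\<open>unpack\<close>) identifies \<open>\<Omega>\<close> with \<open>\<Omega>K\<close>, on which \<open>K\<close> acts by left translation of the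
  first component.
\<close>

definition nlists :: "'a list set" where
  "nlists = {ts. successively (\<lambda>s t. \<not> (s \<in> carrier K \<and> t \<in> carrier K) \<and> \<not> (s \<in> carrier L \<and> t \<in> carrier L)) ts \<and>
     (\<forall>t\<in>set ts. t \<notin> H \<and> (t \<in> carrier K \<and> rep K H t = t \<or> t \<in> carrier L \<and> rep L H t = t))}"

definition \<Omega> :: "('a \<times> 'a list) set" where
  "\<Omega> = H \<times> nlists"

definition \<Omega>K :: "('a \<times> 'a list) set" where
  "\<Omega>K = carrier K \<times> {ts \<in> nlists. ts = [] \<or> hd ts \<notin> carrier K}"

lemma nlists_Cons:
  "t # ts \<in> nlists \<longleftrightarrow> t \<notin> H \<and> (t \<in> carrier K \<and> rep K H t = t \<or> t \<in> carrier L \<and> rep L H t = t) \<and>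
    ts \<in> nlists \<and> (ts = [] \<or> \<not> (t \<in> carrier K \<and> hd ts \<in> carrier K) \<and> \<not> (t \<in> carrier L \<and> hd ts \<in> carrier L))"
  by (cases ts) (auto simp: nlists_def)

lemma nlists_hd: "t # ts \<in> nlists \<Longrightarrow> t \<in> carrier K \<longleftrightarrow> t \<notin> carrier L"
  using H_eq by (auto simp: nlists_Cons)

lemma H_carrier: "h \<in> H \<Longrightarrow> h \<in> carrier K"
  using H_eq by auto

lemma unpack_in: "p \<in> \<Omega> \<Longrightarrow> unpack K p \<in> \<Omega>K"
proof -
  assume p: "p \<in> \<Omega>"
  obtain h ts where [simp]: "p = (h, ts)" by force
  show ?thesis
  proof (cases ts)
    case Nil
    then show ?thesis using p H_carrier by (simp add: \<Omega>_def \<Omega>K_def)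
  next
    case (Cons t us)
    then have "h \<in> H" "t # us \<in> nlists" using p by (auto simp: \<Omega>_def)
    moreover from this have "us \<in> nlists" "t \<in> carrier K \<Longrightarrow> us = [] \<or> hd us \<notin> carrier K"
      using nlists_Cons by blast+
    ultimately show ?thesis using Cons H_carrier by (auto simp: \<Omega>K_def)
  qed
qed

lemma pack_in: "p \<in> \<Omega>K \<Longrightarrow> pack K H p \<in> \<Omega>"
proof -
  assume p: "p \<in> \<Omega>K"
  obtain k ts where kt: "p = (k, ts)" by force
  have k: "k \<in> carrier K" "ts \<in> nlists" "ts = [] \<or> hd ts \<notin> carrier K" using p by (auto simp: kt \<Omega>K_def)
  show ?thesis
  proof (cases "k \<in> H")
    case True
    then show ?thesis using k by (simp add: kt pack_def \<Omega>_def)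
  next
    case False
    have "rep K H k \<in> carrier K" "rep K H k \<notin> H" "rep K H (rep K H k) = rep K H k" "hpart K H k \<in> H"
      using rep_closed[OF K.is_group HK k(1)] rep_notin[OF K.is_group HK k(1) False]
        rep_rep[OF K.is_group HK k(1)] hpart_in[OF K.is_group HK k(1)] by auto
    moreover from this have "rep K H k \<notin> carrier L" using H_eq by auto
    ultimately show ?thesis using k False by (simp add: kt pack_def \<Omega>_def nlists_Cons)
  qed
qed

lemma pack_unpack: assumes "p \<in> \<Omega>" shows "pack K H (unpack K p) = p"
proof (cases "snd p")
  case Nil
  then show ?thesis using assms by (cases p) (auto simp: \<Omega>_def pack_def)
next
  case (Cons t ts)
  then obtain h where 2: "p = (h, t # ts)" by (cases p) auto
  then have h: "h \<in> H" "t # ts \<in> nlists" using assms by (auto simp: \<Omega>_def)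
  show ?thesis
  proof (cases "t \<in> carrier K")
    case True
    then have t: "t \<notin> H" "rep K H t = t" using h(2) H_eq unfolding nlists_Cons by blast+
    have "h \<otimes>\<^bsub>K\<^esub> t \<notin> H"
      using t h True H_carrier by (metis K.cancel_inv(1) HK subgroup.m_closed subgroup.m_inv_closed)
    then show ?thesis using 2 True t h hpart_rep_fixed[OF K.is_group HK True t(2) h(1)]
        rep_mult[OF K.is_group HK h(1) True] by (simp add: pack_def)
  next
    case False
    then show ?thesis using 2 h by (simp add: pack_def)
  qed
qed

lemma unpack_pack: assumes "p \<in> \<Omega>K" shows "unpack K (pack K H p) = p"
proof -
  obtain k ts where p: "p = (k, ts)" "k \<in> carrier K" "ts = [] \<or> hd ts \<notin> carrier K"
    using assms by (auto simp: \<Omega>K_def)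
  then show ?thesis
    using hpart_rep[OF K.is_group HK] rep_closed[OF K.is_group HK]
    by (cases ts) (auto simp: pack_def)
qed

lemma shift_in: "x \<in> carrier K \<Longrightarrow> p \<in> \<Omega> \<Longrightarrow> shift K H x p \<in> \<Omega>"
  using unpack_in[of p] by (auto simp: shift_def \<Omega>K_def intro!: pack_in)

lemma shift_mult:
  assumes "x \<in> carrier K" "y \<in> carrier K" "p \<in> \<Omega>"
  shows "shift K H (x \<otimes>\<^bsub>K\<^esub> y) p = shift K H x (shift K H y p)"
proof -
  have u: "unpack K p \<in> \<Omega>K" using unpack_in assms by simp
  then have "(y \<otimes>\<^bsub>K\<^esub> fst (unpack K p), snd (unpack K p)) \<in> \<Omega>K" using assms by (auto simp: \<Omega>K_def)
  then show ?thesis using unpack_pack u assms by (simp add: shift_def K.m_assoc \<Omega>K_def mem_Times_iff)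
qed

lemma shift_one: "p \<in> \<Omega> \<Longrightarrow> shift K H \<one>\<^bsub>K\<^esub> p = p"
  using unpack_in[of p] pack_unpack[of p] by (auto simp: shift_def \<Omega>K_def)

text \<open>Elements of \<open>H\<close> only multiply the first component. As the two products
  agree on \<open>H\<close>, so do the actions of \<open>K\<close> and \<open>L\<close>.\<close>

lemma shift_H: 
  assumes "x \<in> H" "p \<in> \<Omega>" shows "shift K H x p = (x \<otimes>\<^bsub>K\<^esub> fst p, snd p)"
proof -
  have "(x \<otimes>\<^bsub>K\<^esub> fst p, snd p) \<in> \<Omega>" using assms HK by (auto simp: \<Omega>_def subgroup.m_closed)
  moreover have "unpack K (x \<otimes>\<^bsub>K\<^esub> fst p, snd p) = (x \<otimes>\<^bsub>K\<^esub> fst (unpack K p), snd (unpack K p))"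
    using assms H_carrier by (cases p; cases "snd p") (auto simp: \<Omega>_def K.m_assoc)
  ultimately show ?thesis using pack_unpack by (metis shift_def)
qed

text \<open>When the normal form does not start in \<open>K\<close>, there is no letter to merge
  with, so exactly one is prepended.\<close>

lemma shift_cons:
  assumes "x \<in> carrier K" "x \<notin> H" "(h, ts) \<in> \<Omega>" "ts = [] \<or> hd ts \<notin> carrier K"
  shows "\<exists>h' t. shift K H x (h, ts) = (h', t # ts) \<and> t \<in> carrier K \<and> t \<notin> H \<and> h' \<in> H \<and> h' \<otimes>\<^bsub>K\<^esub> t = x \<otimes>\<^bsub>K\<^esub> h"
proof -
  have h: "h \<in> H" "h \<in> carrier K" using assms H_carrier by (auto simp: \<Omega>_def)
  have "unpack K (h, ts) = (h, ts)" using assms(4) by (cases ts) auto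
  moreover have n: "x \<otimes>\<^bsub>K\<^esub> h \<notin> H"
  proof
    assume "x \<otimes>\<^bsub>K\<^esub> h \<in> H"
    then have "x \<otimes>\<^bsub>K\<^esub> h \<otimes>\<^bsub>K\<^esub> inv\<^bsub>K\<^esub> h \<in> H" using HK h by (simp add: subgroup.m_closed subgroup.m_inv_closed)
    then show False using assms h by (simp add: K.m_assoc)
  qed
  ultimately have "shift K H x (h, ts) = (hpart K H (x \<otimes>\<^bsub>K\<^esub> h), rep K H (x \<otimes>\<^bsub>K\<^esub> h) # ts)"
    by (simp add: shift_def pack_def)
  then show ?thesis
    using assms(1) h n rep_closed[OF K.is_group HK] rep_notin[OF K.is_group HK] hpart_in[OF K.is_group HK]
      hpart_rep[OF K.is_group HK] by auto
qed

lemma shift_hom: "(\<lambda>x. \<lambda>p\<in>\<Omega>. shift K H x p) \<in> hom K (BijGroup \<Omega>)"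
proof (rule homI)
  fix x y assume x: "x \<in> carrier K"
  have bij: "(\<lambda>p\<in>\<Omega>. shift K H x p) \<in> Bij \<Omega>" if x: "x \<in> carrier K" for x
  proof -
    have "bij_betw (shift K H x) \<Omega> \<Omega>"
    proof (rule bij_betw_byWitness[where f' = "shift K H (inv\<^bsub>K\<^esub> x)"])
      show "\<forall>p\<in>\<Omega>. shift K H (inv\<^bsub>K\<^esub> x) (shift K H x p) = p" "\<forall>p\<in>\<Omega>. shift K H x (shift K H (inv\<^bsub>K\<^esub> x) p) = p"
        using x shift_one by (simp_all flip: shift_mult)
    qed (use x shift_in in auto)
    then show ?thesis by (simp add: Bij_def cong: bij_betw_cong)
  qed
  show "(\<lambda>p\<in>\<Omega>. shift K H x p) \<in> carrier (BijGroup \<Omega>)" using bij[OF x] by (simp add: BijGroup_def)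
  assume y: "y \<in> carrier K"
  show "(\<lambda>p\<in>\<Omega>. shift K H (x \<otimes>\<^bsub>K\<^esub> y) p) = (\<lambda>p\<in>\<Omega>. shift K H x p) \<otimes>\<^bsub>BijGroup \<Omega>\<^esub> (\<lambda>p\<in>\<Omega>. shift K H y p)"
    using bij[OF x] bij[OF y] x y shift_in[OF y] by (auto simp: BijGroup_def compose_def shift_mult fun_eq_iff)
qed

interpretation S: group_pair L K H by (rule swap)

text \<open>The conditions on normal forms treat the two factors alike, so both act on the same
  set.\<close>

lemma \<Omega>_swap: "S.\<Omega> = \<Omega>"
  unfolding S.\<Omega>_def \<Omega>_def S.nlists_def nlists_def 
  by (rule arg_cong[where f="\<lambda>A. H \<times> A"], rule Collect_cong, rule conj_cong[OF arg_cong2[where f=successively, OF _ refl]]) auto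

text \<open>On \<open>H\<close> both branches agree by \<open>shift_H_eq\<close>, so this is a
  homomorphism on either factor.\<close>

definition \<Phi> :: "'a \<Rightarrow> 'a \<times> 'a list \<Rightarrow> 'a \<times> 'a list" where
  "\<Phi> x = (\<lambda>p\<in>\<Omega>. if x \<in> carrier K then shift K H x p else shift L H x p)"

lemma shift_H_eq: "x \<in> H \<Longrightarrow> p \<in> \<Omega> \<Longrightarrow> shift K H x p = shift L H x p"
  using shift_H[of x p] S.shift_H[of x p] agree[of x "fst p"] by (auto simp: \<Omega>_swap \<Omega>_def)

lemma \<Phi>_K: "x \<in> carrier K \<Longrightarrow> \<Phi> x = (\<lambda>p\<in>\<Omega>. shift K H x p)"
  and \<Phi>_L: "x \<in> carrier L \<Longrightarrow> \<Phi> x = (\<lambda>p\<in>\<Omega>. shift L H x p)"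
  using shift_H_eq H_eq by (auto simp: \<Phi>_def fun_eq_iff)

lemma \<Phi>_hom: "\<Phi> \<in> hom K (BijGroup \<Omega>)" "\<Phi> \<in> hom L (BijGroup \<Omega>)"
proof -
  show "\<Phi> \<in> hom K (BijGroup \<Omega>)"
    using shift_hom \<Phi>_K by (auto simp: hom_def Pi_def)
  show "\<Phi> \<in> hom L (BijGroup \<Omega>)"
    using S.shift_hom \<Phi>_L by (auto simp: hom_def Pi_def \<Omega>_swap)
qed

definition act_hom where
  "act_hom = (SOME h. h \<in> hom (amalgam K L) (BijGroup \<Omega>) \<and> (\<forall>x \<in> carrier K \<union> carrier L. h (amalg_emb K L x) = \<Phi> x))"

lemma act_hom: "act_hom \<in> hom (amalgam K L) (BijGroup \<Omega>)"
  "x \<in> carrier K \<union> carrier L \<Longrightarrow> act_hom (amalg_emb K L x) = \<Phi> x"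
proof -
  have "\<exists>h. h \<in> hom (amalgam K L) (BijGroup \<Omega>) \<and> (\<forall>x \<in> carrier K \<union> carrier L. h (amalg_emb K L x) = \<Phi> x)"
    using amalgam_universal(1)[OF K.is_group L.is_group group_BijGroup \<Phi>_hom] by blast
  from someI_ex[OF this, folded act_hom_def] show "act_hom \<in> hom (amalgam K L) (BijGroup \<Omega>)"
    "x \<in> carrier K \<union> carrier L \<Longrightarrow> act_hom (amalg_emb K L x) = \<Phi> x"
    by simp_all
qed

definition base :: "'a \<times> 'a list" where
  "base = (\<one>\<^bsub>K\<^esub>, [])"

lemma base_in: "base \<in> \<Omega>"
  using HK by (simp add: base_def \<Omega>_def nlists_def subgroup.one_closed)

lemma \<Phi>_cons:
  assumes "x \<in> carrier K \<union> carrier L" "x \<notin> H" "(h, ts) \<in> \<Omega>" "ts = [] \<or> (x \<in> carrier K \<longleftrightarrow> hd ts \<notin> carrier K)"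
  shows "\<exists>h' t. \<Phi> x (h, ts) = (h', t # ts) \<and> (t \<in> carrier K \<longleftrightarrow> x \<in> carrier K) \<and> (h', t # ts) \<in> \<Omega> \<and>
    (if x \<in> carrier K then h' \<otimes>\<^bsub>K\<^esub> t = x \<otimes>\<^bsub>K\<^esub> h else h' \<otimes>\<^bsub>L\<^esub> t = x \<otimes>\<^bsub>L\<^esub> h)"
proof (cases "x \<in> carrier K")
  case True
  then have "\<Phi> x (h, ts) = shift K H x (h, ts)" using assms by (simp add: \<Phi>_K)
  then show ?thesis using shift_cons[OF True assms(2,3)] shift_in[OF True assms(3)] assms True by auto
next
  case False
  then have L: "x \<in> carrier L" using assms by simp
  have hd: "ts = [] \<or> hd ts \<notin> carrier L"
    using assms(3,4) False nlists_hd[of "hd ts" "tl ts"] by (cases ts) (simp_all add: \<Omega>_def)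
  have in': "(h, ts) \<in> S.\<Omega>" using assms(3) by (simp add: \<Omega>_swap)
  have e: "\<Phi> x (h, ts) = shift L H x (h, ts)" using assms(3) by (simp add: \<Phi>_L[OF L])
  obtain h' t where t: "shift L H x (h, ts) = (h', t # ts)" "t \<in> carrier L" "t \<notin> H" "h' \<otimes>\<^bsub>L\<^esub> t = x \<otimes>\<^bsub>L\<^esub> h"
    using S.shift_cons[OF L assms(2) in' hd] by blast
  moreover have "(h', t # ts) \<in> \<Omega>" using S.shift_in[OF L in'] t(1) by (simp add: \<Omega>_swap)
  moreover have "t \<notin> carrier K" using t H_eq by auto
  ultimately show ?thesis using e False by simp
qed

lemma emb_closed: "x \<in> carrier K \<union> carrier L \<Longrightarrow> amalg_emb K L x \<in> carrier (amalgam K L)"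
  by (auto simp: amalg_emb_def intro: amalgam_class_closed)

lemma group_M: "group (amalgam K L)"
  by (rule group_amalgam[OF K.is_group L.is_group])

lemma emb_hom: "amalg_emb K L \<in> hom K (amalgam K L)" "amalg_emb K L \<in> hom L (amalgam K L)"
  using amalg_emb_hom_left amalg_emb_hom_right K.is_group L.is_group by auto

lemma act_hom_mult:
  assumes "A \<in> carrier (amalgam K L)" "B \<in> carrier (amalgam K L)" "p \<in> \<Omega>"
  shows "act_hom (A \<otimes>\<^bsub>amalgam K L\<^esub> B) p = act_hom A (act_hom B p)"
proof -
  have "act_hom A \<in> Bij \<Omega>" "act_hom B \<in> Bij \<Omega>"
    using assms act_hom(1) by (auto simp: BijGroup_def hom_def)
  then show ?thesis using hom_mult[OF act_hom(1) assms(1,2)] assms(3)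
    by (simp add: BijGroup_def compose_def)
qed

lemma act_hom_one: "p \<in> \<Omega> \<Longrightarrow> act_hom \<one>\<^bsub>amalgam K L\<^esub> p = p"
  using hom_one[OF act_hom(1) group_M group_BijGroup] by (simp add: BijGroup_def)

text \<open>The image of \<open>base\<close> determines the acting element, as the product of the
  parts of the resulting normal form.\<close>

lemma emb_inj: "inj_on (amalg_emb K L) (carrier K \<union> carrier L)"
proof (rule inj_onI)
  fix x y assume xy: "x \<in> carrier K \<union> carrier L" "y \<in> carrier K \<union> carrier L"
    and "amalg_emb K L x = amalg_emb K L y"
  then have eq: "\<Phi> x base = \<Phi> y base" using act_hom(2) by metis
  have val: "(\<exists>h'. z \<in> H \<and> \<Phi> z base = (z, [])) \<or>
      (\<exists>h' t. z \<notin> H \<and> \<Phi> z base = (h', [t]) \<and> (t \<in> carrier K \<longleftrightarrow> z \<in> carrier K) \<and> 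
        z = (if z \<in> carrier K then h' \<otimes>\<^bsub>K\<^esub> t else h' \<otimes>\<^bsub>L\<^esub> t))" if z: "z \<in> carrier K \<union> carrier L" for z
  proof (cases "z \<in> H")
    case True
    then show ?thesis using \<Phi>_K[of z] shift_H[OF True base_in] H_carrier base_in by (simp add: base_def)
  next
    case False
    obtain h' t where "\<Phi> z base = (h', [t])" "(t \<in> carrier K \<longleftrightarrow> z \<in> carrier K)"
      "if z \<in> carrier K then h' \<otimes>\<^bsub>K\<^esub> t = z \<otimes>\<^bsub>K\<^esub> \<one>\<^bsub>K\<^esub> else h' \<otimes>\<^bsub>L\<^esub> t = z \<otimes>\<^bsub>L\<^esub> \<one>\<^bsub>K\<^esub>"
      using \<Phi>_cons[OF z False, of "\<one>\<^bsub>K\<^esub>" "[]"] base_in unfolding base_def by metis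
    moreover have "z \<in> carrier L \<Longrightarrow> z \<otimes>\<^bsub>L\<^esub> \<one>\<^bsub>K\<^esub> = z" by (simp add: one_eq)
    ultimately show ?thesis using False z by (auto split: if_splits)
  qed
  show "x = y" using val[OF xy(1)] val[OF xy(2)] eq by (auto split: if_splits)
qed

text \<open>Read from the right, every letter prepends one letter to the normal form, so
  \<open>base\<close> is not returned to. The type of the leading letter is carried along because
  \<open>\<Phi>_cons\<close> needs it for the next one.\<close>

lemma alternating_nontrivial:
  assumes "ws \<noteq> []" "set ws \<subseteq> carrier K \<union> carrier L - H" 
    "successively (\<lambda>x y. x \<in> carrier K \<longleftrightarrow> y \<in> carrier L) ws"
  shows "word_prod (amalgam K L) (map (amalg_emb K L) ws) \<noteq> \<one>\<^bsub>amalgam K L\<^esub>"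
proof -
  have M: "word_prod (amalgam K L) (map (amalg_emb K L) us) \<in> carrier (amalgam K L)" if "set us \<subseteq> carrier K \<union> carrier L - H" for us
    using word_prod_append[OF group_M, of "map (amalg_emb K L) us" "[]"] emb_closed that by auto
  have "\<exists>h t ts. act_hom (word_prod (amalgam K L) (map (amalg_emb K L) ws)) base = (h, t # ts) \<and>
      (t \<in> carrier K \<longleftrightarrow> hd ws \<in> carrier K) \<and> (h, t # ts) \<in> \<Omega>"
    using assms
  proof (induction ws)
    case (Cons x ws)
    have x: "x \<in> carrier K \<union> carrier L" "x \<notin> H" using Cons by auto
    have m: "word_prod (amalgam K L) (map (amalg_emb K L) ws) \<in> carrier (amalgam K L)" using M Cons by simp
    have "word_prod (amalgam K L) (map (amalg_emb K L) (x # ws)) =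
        amalg_emb K L x \<otimes>\<^bsub>amalgam K L\<^esub> word_prod (amalgam K L) (map (amalg_emb K L) ws)"
      by (simp add: word_prod_def)
    then have e: "act_hom (word_prod (amalgam K L) (map (amalg_emb K L) (x # ws))) base =
        \<Phi> x (act_hom (word_prod (amalgam K L) (map (amalg_emb K L) ws)) base)"
      using act_hom_mult[OF emb_closed[OF x(1)] m base_in] act_hom(2)[OF x(1)] by simp
    show ?case
    proof (cases "ws = []")
      case True
      then have "act_hom (word_prod (amalgam K L) (map (amalg_emb K L) ws)) base = base"
        using act_hom_one[OF base_in] by (simp add: word_prod_def)
      then show ?thesis using e \<Phi>_cons[OF x, of "\<one>\<^bsub>K\<^esub>" "[]"] base_in by (fastforce simp: base_def)
    next
      case False
      then obtain y ws' where y: "ws = y # ws'" by (cases ws) auto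
      obtain h t ts where IH: "act_hom (word_prod (amalgam K L) (map (amalg_emb K L) ws)) base = (h, t # ts)"
        "t \<in> carrier K \<longleftrightarrow> hd ws \<in> carrier K" "(h, t # ts) \<in> \<Omega>"
        using Cons False y by auto
      have "x \<in> carrier K \<longleftrightarrow> t \<notin> carrier K" 
        using IH(2) y Cons.prems H_eq by (auto simp: successively_Cons)
      then show ?thesis using e IH \<Phi>_cons[OF x IH(3)] by fastforce
    qed
  qed simp
  then show ?thesis using act_hom_one[OF base_in] by (auto simp: base_def)
qed

lemma emb_generate: "generate (amalgam K L) (amalg_emb K L ` carrier K \<union> amalg_emb K L ` carrier L) = carrier (amalgam K L)"
  (is "generate ?M ?S = _")
proof
  interpret M: group ?M by (rule group_M)
  have S: "?S \<subseteq> carrier ?M" using emb_closed by auto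
  then show "generate ?M ?S \<subseteq> carrier ?M" using M.generate_in_carrier by blast
  show "carrier ?M \<subseteq> generate ?M ?S"
  proof
    fix A assume "A \<in> carrier ?M"
    then obtain us where us: "us \<in> amalg_words K L" "A = amalg_rel K L `` {us}" by (rule amalgam_cases)
    have "amalg_rel K L `` {us} \<in> generate ?M ?S"
      using us(1)
    proof (induction us)
      case Nil
      then show ?case using generate.one[of ?M ?S] by (simp add: amalgam_one)
    next
      case (Cons x us)
      then have x: "x \<in> carrier K \<union> carrier L" "us \<in> amalg_words K L" by auto
      have "amalg_rel K L `` {x # us} = amalg_emb K L x \<otimes>\<^bsub>?M\<^esub> amalg_rel K L `` {us}"
        using x by (simp add: amalg_emb_def amalgam_mult_class)
      moreover have "amalg_emb K L x \<in> generate ?M ?S" using x by (intro generate.incl) auto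
      ultimately show ?case using generate.eng Cons.IH[OF x(2)] by metis
    qed
    then show "A \<in> generate ?M ?S" using us by simp
  qed
qed

end

text \<open>Alternating words with a prescribed starting factor; fixing the start makes
  concatenation a matter of parity.\<close>

fun typed :: "'a set \<Rightarrow> 'a set \<Rightarrow> 'a list \<Rightarrow> bool" where
  "typed A B [] = True"
| "typed A B (c # cs) = (c \<in> A \<and> typed B A cs)"

lemma typed_append: "typed A B (us @ vs) \<longleftrightarrow> typed A B us \<and> (if even (length us) then typed A B vs else typed B A vs)"
  by (induction us arbitrary: A B) auto

lemma typed_set: "typed A B cs \<Longrightarrow> set cs \<subseteq> A \<union> B"
  by (induction cs arbitrary: A B) auto

context group begin

lemma word_prod_Nil [simp]: "word_prod G [] = \<one>"
  and word_prod_Cons [simp]: "word_prod G (x # xs) = x \<otimes> word_prod G xs"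
  by (simp_all add: word_prod_def)

lemma word_prod_closed [simp]: "set xs \<subseteq> carrier G \<Longrightarrow> word_prod G xs \<in> carrier G"
  by (induction xs) auto

lemma word_prod_app: "\<lbrakk>set us \<subseteq> carrier G; set vs \<subseteq> carrier G\<rbrakk> \<Longrightarrow>
    word_prod G (us @ vs) = word_prod G us \<otimes> word_prod G vs"
  by (induction us) (auto simp: m_assoc)

lemma inv_word_prod: "set us \<subseteq> carrier G \<Longrightarrow> inv (word_prod G us) = word_prod G (rev (map (m_inv G) us))"
proof (induction us)
  case (Cons u us)
  then have "set (rev (map (m_inv G) us)) \<subseteq> carrier G" "u \<in> carrier G" by auto
  then show ?case using Cons by (simp add: word_prod_app inv_mult_group)
qed simp

lemma mem_l_coset: "\<lbrakk>g \<in> carrier G; F \<subseteq> carrier G\<rbrakk> \<Longrightarrow> x \<in> g <# F \<longleftrightarrow> x \<in> carrier G \<and> inv g \<otimes> x \<in> F"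
  by (force simp: l_coset_def subset_iff)

lemma l_coset_eq_iff:
  assumes F: "subgroup F G" and g: "g \<in> carrier G" "h \<in> carrier G"
  shows "g <# F = h <# F \<longleftrightarrow> inv g \<otimes> h \<in> F"
proof
  have FG: "F \<subseteq> carrier G" using F subgroup.subset by blast
  assume "g <# F = h <# F"
  moreover have "h \<in> h <# F" using mem_l_coset[OF g(2) FG] g subgroup.one_closed[OF F] by simp
  ultimately show "inv g \<otimes> h \<in> F" using mem_l_coset[OF g(1) FG] by simp
next
  have FG: "F \<subseteq> carrier G" using F subgroup.subset by blast
  assume gh: "inv g \<otimes> h \<in> F"
  have "inv g \<otimes> x \<in> F \<longleftrightarrow> inv h \<otimes> x \<in> F" if x: "x \<in> carrier G" for x
  proof
    assume "inv g \<otimes> x \<in> F"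
    then have "inv (inv g \<otimes> h) \<otimes> (inv g \<otimes> x) \<in> F"
      using subgroup.m_closed[OF F subgroup.m_inv_closed[OF F gh]] by blast
    then show "inv h \<otimes> x \<in> F" using g x by (simp add: inv_mult_group m_assoc)
  next
    assume "inv h \<otimes> x \<in> F"
    from subgroup.m_closed[OF F gh this] show "inv g \<otimes> x \<in> F" using g x by (simp add: m_assoc)
  qed
  then show "g <# F = h <# F" using mem_l_coset[OF g(1) FG] mem_l_coset[OF g(2) FG] by blast
qed

end

section \<open>The Bass--Serre tree of an amalgamated product\<close>

text \<open>The internal description of an amalgamated product: two generating subgroups with the
  normal form property. The tree is built from this alone, without the construction of
  \<open>amalgam\<close> by words.\<close>

locale amalgam_decomposition = group M for M (structure) +
  fixes K L :: "'a set"
  assumes K_sub: "subgroup K M" and L_sub: "subgroup L M"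
    and gen: "generate M (K \<union> L) = carrier M"
    and reduced: "\<lbrakk>cs \<noteq> []; typed K L cs \<or> typed L K cs; set cs \<inter> (K \<inter> L) = {}\<rbrakk> \<Longrightarrow> word_prod M cs \<noteq> \<one>"
begin

abbreviation H :: "'a set" where "H \<equiv> K \<inter> L"

definition fac :: "bool \<Rightarrow> 'a set" where
  "fac t = (if t then K else L)"

lemma fac_sub: "subgroup (fac t) M"
  using K_sub L_sub by (simp add: fac_def)

lemma fac_carrier: "x \<in> fac t \<Longrightarrow> x \<in> carrier M"
  by (rule subgroup.mem_carrier[OF fac_sub])

lemma fac_subset: "fac t \<subseteq> carrier M"
  using fac_carrier by blast

lemma fac_closed: "\<one> \<in> fac t" "x \<in> fac t \<Longrightarrow> inv x \<in> fac t" "x \<in> fac t \<Longrightarrow> y \<in> fac t \<Longrightarrow> x \<otimes> y \<in> fac t"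
  by (auto intro: subgroup.one_closed[OF fac_sub] subgroup.m_inv_closed[OF fac_sub] subgroup.m_closed[OF fac_sub])

lemma H_sub: "subgroup H M"
  by (rule subgroups_Inter_pair[OF K_sub L_sub])

lemma H_closed: "\<one> \<in> H" "x \<in> H \<Longrightarrow> inv x \<in> H" "x \<in> H \<Longrightarrow> y \<in> H \<Longrightarrow> x \<otimes> y \<in> H"
  by (rule subgroup.one_closed[OF H_sub] subgroup.m_inv_closed[OF H_sub] subgroup.m_closed[OF H_sub]; assumption)+

lemma H_fac: "x \<in> H \<longleftrightarrow> x \<in> fac t \<and> x \<in> fac (\<not> t)"
  by (auto simp: fac_def)

lemma H_carrier: "x \<in> H \<Longrightarrow> x \<in> carrier M"
  by (rule subgroup.mem_carrier[OF H_sub])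

lemma K_carrier: "x \<in> K \<Longrightarrow> x \<in> carrier M" and L_carrier: "x \<in> L \<Longrightarrow> x \<in> carrier M"
  using fac_carrier[of x True] fac_carrier[of x False] by (auto simp: fac_def)

lemma typed_carrier: "typed (fac t) (fac (\<not> t)) cs \<Longrightarrow> set cs \<subseteq> carrier M"
  using typed_set[of "fac t" "fac (\<not> t)" cs] fac_carrier by blast

text \<open>Otherwise prepend the inverse of the product, or merge it with the first letter if it
  lies in \<open>H\<close>: this gives a nonempty reduced word with product one.\<close>

lemma reduced_fac:
  assumes "typed (fac (\<not> t)) (fac t) us" "us \<noteq> []" "set us \<inter> H = {}"
  shows "word_prod M us \<notin> fac t"
proof
  assume x: "word_prod M us \<in> fac t"
  let ?x = "word_prod M us"
  have ty: "typed (fac (\<not> t)) (fac t) ws \<Longrightarrow> typed K L ws \<or> typed L K ws" for ws t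
    by (cases t) (auto simp: fac_def)
  obtain u vs where us: "us = u # vs" using assms by (cases us) auto
  have c: "u \<in> carrier M" "set vs \<subseteq> carrier M" "u \<in> fac (\<not> t)" "?x \<in> carrier M"
    using assms us typed_carrier[of "\<not> t" us] fac_carrier x by auto
  show False
  proof (cases "?x \<in> H")
    case False
    then have "inv ?x \<notin> H" using H_closed(2)[of "inv ?x"] c(4) by auto
    moreover have "typed (fac t) (fac (\<not> t)) (inv ?x # us)" using assms x fac_closed by simp
    moreover have "word_prod M (inv ?x # us) = \<one>" using c by simp
    ultimately show False using reduced[of "inv ?x # us"] ty[of "\<not> t" "inv ?x # us"] assms(3) by simp
  next
    case True
    have ix: "inv ?x \<in> H" "inv ?x \<in> fac (\<not> t)" using H_closed(2)[OF True] H_fac[of _ t] by auto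
    have "inv ?x \<otimes> u \<notin> H"
    proof
      assume "inv ?x \<otimes> u \<in> H"
      from H_closed(3)[OF True this] show False using c assms us by simp
    qed
    moreover have "typed (fac (\<not> t)) (fac t) ((inv ?x \<otimes> u) # vs)"
      using assms(1) us fac_closed(3)[OF ix(2) c(3)] by simp
    moreover have "word_prod M ((inv ?x \<otimes> u) # vs) = \<one>" using c us by (simp add: m_assoc)
    ultimately show False
      using reduced[of "(inv ?x \<otimes> u) # vs"] ty[of t "(inv ?x \<otimes> u) # vs"] assms(3) us by simp
  qed
qed

text \<open>Vertices are left cosets of the two factors. The tag keeps the types apart even if two
  cosets coincide as sets, and it makes the parity of distances visible. Edges correspond to cosets
  of \<open>H\<close>.\<close>

definition pt :: "bool \<Rightarrow> 'a \<Rightarrow> bool \<times> 'a set" where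
  "pt t g = (t, g <# fac t)"

definition V :: "(bool \<times> 'a set) set" where
  "V = {pt t g | t g. g \<in> carrier M}"

definition E :: "bool \<times> 'a set \<Rightarrow> bool \<times> 'a set \<Rightarrow> bool" where
  "E x y \<longleftrightarrow> (\<exists>g\<in>carrier M. \<exists>t. x = pt t g \<and> y = pt (\<not> t) g)"

definition act :: "'a \<Rightarrow> bool \<times> 'a set \<Rightarrow> bool \<times> 'a set" where
  "act g x = (fst x, g <# snd x)"

lemma pt_V [simp]: "g \<in> carrier M \<Longrightarrow> pt t g \<in> V"
  by (auto simp: V_def)

lemma fst_pt [simp]: "fst (pt t g) = t"
  by (simp add: pt_def)

lemma V_cases: assumes "x \<in> V" obtains g where "g \<in> carrier M" "x = pt (fst x) g"
  using assms by (auto simp: V_def)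

lemma pt_eq_iff: "\<lbrakk>g \<in> carrier M; h \<in> carrier M\<rbrakk> \<Longrightarrow> pt t g = pt u h \<longleftrightarrow> t = u \<and> inv g \<otimes> h \<in> fac t"
  using l_coset_eq_iff[OF fac_sub] by (auto simp: pt_def)

lemma pt_mult: "\<lbrakk>g \<in> carrier M; c \<in> fac t\<rbrakk> \<Longrightarrow> pt t (g \<otimes> c) = pt t g"
  using pt_eq_iff[of g "g \<otimes> c" t t] fac_carrier[of c t] by auto

lemma act_pt [simp]: "\<lbrakk>g \<in> carrier M; h \<in> carrier M\<rbrakk> \<Longrightarrow> act g (pt t h) = pt t (g \<otimes> h)"
  using lcos_m_assoc[OF fac_subset] by (simp add: act_def pt_def)

lemma act_V: "g \<in> carrier M \<Longrightarrow> x \<in> V \<Longrightarrow> act g x \<in> V"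
  using pt_V by (auto simp: V_def simp del: pt_V)

lemma fst_act [simp]: "fst (act g x) = fst x"
  by (simp add: act_def)

lemma act_mult': "\<lbrakk>g \<in> carrier M; h \<in> carrier M; x \<in> V\<rbrakk> \<Longrightarrow> act (g \<otimes> h) x = act g (act h x)"
  by (auto simp: V_def m_assoc)

lemma act_one': "x \<in> V \<Longrightarrow> act \<one> x = x"
  by (auto simp: V_def)

lemma act_inv': "\<lbrakk>g \<in> carrier M; x \<in> V\<rbrakk> \<Longrightarrow> act (inv g) (act g x) = x"
  by (auto simp: V_def)

lemma E_act: "g \<in> carrier M \<Longrightarrow> E x y \<Longrightarrow> E (act g x) (act g y)"
  unfolding E_def by (metis act_pt m_closed)

sublocale graph_tree V E
proof
  show "E y x" if "E x y" for x y
  proof -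
    from that obtain g t where "g \<in> carrier M" "x = pt t g" "y = pt (\<not> t) g" by (auto simp: E_def)
    then show ?thesis unfolding E_def by (intro bexI[of _ g] exI[of _ "\<not> t"]) simp_all
  qed
  show "x \<in> V" if "E x y" for x y using that by (auto simp: E_def)
qed

text \<open>The walk spelled by an alternating word: a letter of \<open>fac t\<close> does not move
  the coset of type \<open>t\<close>, so it selects the next edge at that vertex.\<close>

fun trace :: "bool \<Rightarrow> 'a \<Rightarrow> 'a list \<Rightarrow> (bool \<times> 'a set) list" where
  "trace t g [] = [pt t g]"
| "trace t g (c # cs) = pt t g # trace (\<not> t) (g \<otimes> c) cs"

lemma trace_simps [simp]: "trace t g cs \<noteq> []" "hd (trace t g cs) = pt t g" "length (trace t g cs) = Suc (length cs)"
proof -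
  show "trace t g cs \<noteq> []" "hd (trace t g cs) = pt t g" by (cases cs; simp)+
  show "length (trace t g cs) = Suc (length cs)" by (induction cs arbitrary: t g) auto
qed

lemma last_trace:
  "\<lbrakk>g \<in> carrier M; set cs \<subseteq> carrier M\<rbrakk> \<Longrightarrow> last (trace t g cs) = pt (t = even (length cs)) (g \<otimes> word_prod M cs)"
proof (induction cs arbitrary: t g)
  case (Cons c cs)
  have "((\<not> t) = even (length cs)) = (t = odd (length cs))" by blast
  then show ?case using Cons by (simp add: m_assoc)
qed simp

text \<open>The first letter may lie in \<open>H\<close>, since it only chooses the initial edge; a
  later letter in \<open>H\<close> would make the walk turn back.\<close>

lemma rwalk_trace:
  assumes "g \<in> carrier M" "typed (fac t) (fac (\<not> t)) cs" "set (tl cs) \<inter> H = {}"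
  shows "rwalk (trace t g cs)"
  using assms
proof (induction cs arbitrary: t g)
  case Nil
  then show ?case by simp
next
  case (Cons c cs)
  have c: "c \<in> fac t" "g \<otimes> c \<in> carrier M" using Cons fac_carrier by auto
  have r: "rwalk (trace (\<not> t) (g \<otimes> c) cs)"
  proof (rule Cons.IH)
    show "set (tl cs) \<inter> H = {}" using Cons.prems(3) by (cases cs) auto
  qed (use Cons c in auto)
  have e: "E (pt t g) (pt (\<not> t) (g \<otimes> c))" unfolding E_def using pt_mult[OF Cons.prems(1) c(1)] c(2) by metis
  show ?case
  proof (cases cs)
    case Nil
    then show ?thesis using e by simp
  next
    case (Cons c' ds)
    have c': "c' \<in> fac (\<not> t)" "c' \<notin> H" using Cons.prems Cons by auto
    then have "c' \<in> carrier M" "c' \<notin> fac t" using fac_carrier H_fac[of c' t] by auto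
    then have "pt t (g \<otimes> c) \<noteq> pt t (g \<otimes> c \<otimes> c')" using pt_eq_iff c(2) by simp
    then have "pt t g \<noteq> hd (trace t (g \<otimes> c \<otimes> c') ds)" using pt_mult[OF Cons.prems(1) c(1)] by simp
    then show ?thesis using r e Cons by (simp add: rwalk_Cons del: rwalk.simps)
  qed
qed

lemma rwalk_is_trace:
  assumes "rwalk p" "hd p = pt t g" "g \<in> carrier M"
  shows "\<exists>cs. p = trace t g cs \<and> typed (fac t) (fac (\<not> t)) cs \<and> set (tl cs) \<inter> H = {}"
  using assms
proof (induction p arbitrary: t g)
  case Nil
  then show ?case by simp
next
  case (Cons x p)
  show ?case
  proof (cases "p = []")
    case True
    then show ?thesis using Cons by (intro exI[of _ "[]"]) simp
  next
    case False
    then have r: "E x (hd p)" "rwalk p" "tl p = [] \<or> x \<noteq> hd (tl p)" using Cons.prems by (auto simp: rwalk_Cons)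
    then obtain h u where h: "h \<in> carrier M" "x = pt u h" "hd p = pt (\<not> u) h" by (auto simp: E_def)
    have x: "x = pt t g" "u = t" using Cons.prems h by (auto dest: arg_cong[where f=fst])
    obtain cs where cs: "p = trace (\<not> t) h cs" "typed (fac (\<not> t)) (fac t) cs" "set (tl cs) \<inter> H = {}"
      using Cons.IH[OF r(2), of "\<not> t" h] h x by auto
    define c where "c = inv g \<otimes> h"
    have gc: "g \<otimes> c = h" using Cons.prems h by (simp add: c_def)
    have cf: "c \<in> fac t" using h x pt_eq_iff Cons.prems by (simp add: c_def)
    have "set cs \<inter> H = {}"
    proof (cases cs)
      case (Cons c' ds)
      have c': "c' \<in> fac (\<not> t)" using cs Cons by simp
      have "c' \<notin> H"
      proof
        assume "c' \<in> H"
        then have "pt t (h \<otimes> c') = pt t h" using pt_mult h H_fac[of c' t] by simp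
        moreover have "tl p = trace t (h \<otimes> c') ds" using cs Cons by simp
        ultimately show False using r(3) h x by simp
      qed
      then show ?thesis using cs Cons by auto
    qed simp
    then show ?thesis using cs cf gc x by (intro exI[of _ "c # cs"]) simp
  qed
qed

text \<open>A closed reduced walk spells an element of \<open>fac t\<close>; stripping the first
  letter leaves a reduced word, and \<open>reduced_fac\<close> excludes it unless it is
  empty.\<close>

lemma closed_walk: assumes "rwalk p" "hd p = last p" shows "length p = 1"
proof -
  have "hd p \<in> V" using assms rwalk_V by (metis hd_in_set rwalk_nonempty subsetD)
  then obtain g t where g: "g \<in> carrier M" "hd p = pt t g" by (auto simp: V_def)
  then obtain cs where cs: "p = trace t g cs" "typed (fac t) (fac (\<not> t)) cs" "set (tl cs) \<inter> H = {}"
    using rwalk_is_trace assms by blast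
  have csC: "set cs \<subseteq> carrier M" using typed_carrier cs by blast
  have "pt t g = pt (t = even (length cs)) (g \<otimes> word_prod M cs)"
    using last_trace[OF g(1) csC, of t] cs assms g by simp
  then have e: "even (length cs)" "word_prod M cs \<in> fac t" using pt_eq_iff g csC by auto
  show ?thesis
  proof (cases cs)
    case Nil
    then show ?thesis using cs by simp
  next
    case (Cons c ds)
    then have c: "c \<in> fac t" "c \<in> carrier M" "set ds \<subseteq> carrier M" using cs csC by auto
    have "inv c \<otimes> word_prod M cs \<in> fac t" using fac_closed e c by simp
    then have "word_prod M ds \<in> fac t" using Cons c by simp
    moreover have "ds \<noteq> []" using e Cons by auto
    moreover have "typed (fac (\<not> t)) (fac t) ds" "set ds \<inter> H = {}" using cs Cons by auto
    ultimately show ?thesis using reduced_fac by blast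
  qed
qed

text \<open>Each generator moves the base vertex along a path of length at most 2, and translates of
  such paths reach every \<open>g\<close>.\<close>

lemma connected_pt: assumes "g \<in> carrier M" shows "E\<^sup>*\<^sup>* (pt True \<one>) (pt True g)"
proof -
  have E1: "E (pt t g) (pt (\<not> t) g)" if "g \<in> carrier M" for t g using that by (auto simp: E_def)
  have act: "E\<^sup>*\<^sup>* (act g x) (act g y)" if "E\<^sup>*\<^sup>* x y" "g \<in> carrier M" for x y g
    using that(1) by (induction rule: rtranclp_induct) (use E_act[OF that(2)] in \<open>auto intro: rtranclp.rtrancl_into_rtrancl\<close>)
  have gens: "E\<^sup>*\<^sup>* (pt True \<one>) (pt True x)" if x: "x \<in> K \<union> L" for x
  proof (cases "x \<in> K")
    case True
    then show ?thesis using pt_mult[of \<one> x True] fac_carrier[of x True] by (simp add: fac_def)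
  next
    case False
    then have "x \<in> L" "x \<in> carrier M" using x fac_carrier[of x False] by (auto simp: fac_def)
    then have "pt False x = pt False \<one>" using pt_mult[of \<one> x False] by (simp add: fac_def)
    then have "E (pt True \<one>) (pt False x)" "E (pt False x) (pt True x)"
      using E1[of \<one> True] E1[of x False] \<open>x \<in> carrier M\<close> by auto
    then show ?thesis by (rule converse_rtranclp_into_rtranclp[OF _ r_into_rtranclp])
  qed
  have "g \<in> generate M (K \<union> L)" using gen assms by simp
  then have "g \<in> carrier M \<and> E\<^sup>*\<^sup>* (pt True \<one>) (pt True g)"
  proof (induction rule: generate.induct)
    case one
    then show ?case by simp
  next
    case (incl h)
    then show ?case using gens fac_carrier[of h True] fac_carrier[of h False] by (auto simp: fac_def)
  next
    case (inv h)
    then have "inv h \<in> K \<union> L" using fac_closed(2)[of h True] fac_closed(2)[of h False] by (auto simp: fac_def)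
    then show ?case using gens fac_carrier[of _ True] fac_carrier[of _ False] by (auto simp: fac_def)
  next
    case (eng a b)
    then have "E\<^sup>*\<^sup>* (pt True a) (pt True (a \<otimes> b))" using act[of "pt True \<one>" "pt True b" a] by simp
    then show ?case using eng by auto
  qed
  then show ?thesis by simp
qed

sublocale acyclic_connected V E
proof
  show "length p = 1" if "rwalk p" "hd p = last p" for p using closed_walk that .
  have 1: "E\<^sup>*\<^sup>* (pt True \<one>) x" if "x \<in> V" for x
  proof -
    from that obtain t g where x: "g \<in> carrier M" "x = pt t g" by (auto simp: V_def)
    have "E (pt True g) (pt (\<not> True) g)" using x unfolding E_def by blast
    then have "E (pt True g) (pt False g)" by simp
    then show ?thesis using connected_pt[OF x(1)] x(2) by (cases t) (auto intro: rtranclp.rtrancl_into_rtrancl)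
  qed
  have sym: "E\<^sup>*\<^sup>* y x" if "E\<^sup>*\<^sup>* x y" for x y
    using that by (induction rule: rtranclp_induct) (auto intro: converse_rtranclp_into_rtranclp E_sym)
  show "E\<^sup>*\<^sup>* x y" if "x \<in> V" "y \<in> V" for x y
    using rtranclp_trans[OF sym[OF 1[OF that(1)]] 1[OF that(2)]] .
qed

lemma rwalk_act: assumes "g \<in> carrier M" "rwalk p" shows "rwalk (map (act g) p)"
  using assms(2)
proof (induction p rule: rwalk.induct)
  case (4 x y z xs)
  have "x \<in> V" "z \<in> V" using rwalk_V[OF 4(2)] by auto
  then have "act g x \<noteq> act g z" using 4 act_inv'[OF assms(1)] by (metis rwalk.simps(4))
  then show ?case using 4 E_act[OF assms(1)] by simp
qed (use assms act_V E_act in auto)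

sublocale tree_action V d M act
proof
  show "d (act g x) (act g y) = d x y" if "g \<in> carrier M" "x \<in> V" "y \<in> V" for g x y
  proof -
    from rwalk_ex[OF that(2,3)] obtain p where p: "rwalk p" "hd p = x" "last p = y" by blast
    have "p \<noteq> []" using rwalk_nonempty[OF p(1)] .
    then show ?thesis using d_rwalk[OF p(1)] d_rwalk[OF rwalk_act[OF that(1) p(1)]] p by (simp add: hd_map last_map)
  qed
qed (use act_V act_one' act_mult' in auto)

lemma rwalk_parity: "rwalk p \<Longrightarrow> fst (hd p) = fst (last p) \<longleftrightarrow> odd (length p)"
  by (induction p rule: rwalk.induct) (auto simp: E_def)

text \<open>Every edge changes the type. As the action preserves types, all displacements are
  even.\<close>

lemma d_parity: "x \<in> V \<Longrightarrow> y \<in> V \<Longrightarrow> even (d x y) \<longleftrightarrow> fst x = fst y"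
proof -
  assume "x \<in> V" "y \<in> V"
  then obtain p where p: "rwalk p" "hd p = x" "last p = y" using rwalk_ex by blast
  have "p \<noteq> []" using rwalk_nonempty[OF p(1)] .
  then show ?thesis using d_rwalk[OF p(1)] rwalk_parity[OF p(1)] p by (cases p) auto
qed

lemma stab_pt: "\<lbrakk>g \<in> carrier M; h \<in> carrier M\<rbrakk> \<Longrightarrow> act g (pt t h) = pt t h \<longleftrightarrow> inv h \<otimes> g \<otimes> h \<in> fac t"
  using pt_eq_iff[of h "g \<otimes> h" t t] pt_eq_iff[of "g \<otimes> h" h t t] by (auto simp: m_assoc)

end

section \<open>The pattern of the word \<open>rho\<close>\<close>

text \<open>
  \<open>ypos j\<close> enumerates, increasingly in \<open>j\<close>, the positions of \<open>y\<close> in the bi-infinite periodic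
  word with period \<open>rho\<close>; the gaps determine \<open>j\<close> modulo 80.
\<close>

definition ypos0 :: "int \<Rightarrow> int" where
  "ypos0 m = (m + 1) * (m + 4) div 2 - 1"

definition ypos :: "int \<Rightarrow> int" where
  "ypos j = 3320 * (j div 80) + ypos0 (j mod 80)"

definition isY :: "int \<Rightarrow> bool" where
  "isY t \<longleftrightarrow> (\<exists>j. t = ypos j)"

lemma ypos0_step: "ypos0 (m + 1) = ypos0 m + m + 3"
proof -
  have "even ((m + 1) * (m + 4))" by simp
  then obtain q where "(m + 1) * (m + 4) = 2 * q" by (elim evenE)
  moreover from this have "(m + 1 + 1) * (m + 1 + 4) = 2 * (q + m + 3)" by (simp add: algebra_simps)
  ultimately show ?thesis by (simp add: ypos0_def)
qed

lemma ypos0_vals: "ypos0 0 = 1" "ypos0 79 = 3319"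
  by (simp_all add: ypos0_def)

lemma ypos_period: "ypos (j + 80 * k) = ypos j + 3320 * k"
  by (simp add: ypos_def algebra_simps)

text \<open>Within a period the gaps take each value from 2 to 81 once, so a single gap identifies
  its position modulo the period. The case \<open>r = 79\<close> is the wrap-around from the longest
  block to the shortest.\<close>

lemma ypos_step: "ypos (j + 1) = ypos j + (j + 1) mod 80 + 2"
proof -
  define q r where "q = j div 80" and "r = j mod 80"
  have j: "j = 80 * q + r" "0 \<le> r" "r < 80" by (simp_all add: q_def r_def)
  show ?thesis
  proof (cases "r = 79")
    case True
    have "(j + 1) mod 80 = 0" "(j + 1) div 80 = q + 1"
      using j True int_mod_pos_eq[of "j + 1" 80 "q + 1" 0] int_div_pos_eq[of "j + 1" 80 "q + 1" 0] by simp_all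
    then show ?thesis using True by (simp add: ypos_def ypos0_vals q_def[symmetric] r_def[symmetric])
  next
    case False
    then have "(j + 1) mod 80 = r + 1" "(j + 1) div 80 = q"
      using j int_mod_pos_eq[of "j + 1" 80 q "r + 1"] int_div_pos_eq[of "j + 1" 80 q "r + 1"] by simp_all
    then show ?thesis by (simp add: ypos_def ypos0_step q_def[symmetric] r_def[symmetric])
  qed
qed

lemma ypos_gap: "ypos j + 2 \<le> ypos (j + 1)" "ypos (j + 1) \<le> ypos j + 81"
  using ypos_step[of j] pos_mod_bound[of 80 "j + 1"] pos_mod_sign[of 80 "j + 1"] by linarith+

lemma ypos_mono: "i < j \<Longrightarrow> ypos i < ypos j"
proof (induction j rule: int_gr_induct)
  case base
  then show ?case using ypos_gap(1)[of i] by simp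
next
  case (step j)
  then show ?case using ypos_gap(1)[of j] by simp
qed

lemma ypos_less_iff: "ypos i < ypos j \<longleftrightarrow> i < j"
  using ypos_mono[of i j] ypos_mono[of j i] by (cases i j rule: linorder_cases) auto

lemma ypos_bracket: "\<exists>j. ypos j < t \<and> t \<le> ypos (j + 1)"
proof (induction t rule: int_induct[where k = 2])
  case base
  have "ypos 0 = 1" "ypos 1 = 4" by (simp_all add: ypos_def ypos0_def)
  then show ?case by (intro exI[of _ 0]) simp
next
  case (step1 t)
  then obtain j where j: "ypos j < t" "t \<le> ypos (j + 1)" by blast
  show ?case
  proof (cases "t = ypos (j + 1)")
    case True
    then show ?thesis using ypos_gap(1)[of "j + 1"] by (intro exI[of _ "j + 1"]) simp
  next
    case False
    then show ?thesis using j by (intro exI[of _ j]) simp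
  qed
next
  case (step2 t)
  then obtain j where j: "ypos j < t" "t \<le> ypos (j + 1)" by blast
  show ?case
  proof (cases "t - 1 = ypos j")
    case True
    then show ?thesis using ypos_gap(1)[of "j - 1"] by (intro exI[of _ "j - 1"]) simp
  next
    case False
    then show ?thesis using j by (intro exI[of _ j]) simp
  qed
qed

lemma ypos_near: obtains j where "t \<le> ypos j" "ypos j \<le> t + 80"
proof -
  obtain j where "ypos j < t" "t \<le> ypos (j + 1)" using ypos_bracket by blast
  then show ?thesis using that[of "j + 1"] ypos_gap(2)[of j] by simp
qed

lemma isY_ypos [simp]: "isY (ypos j)"
  by (auto simp: isY_def)

lemma consecutive_Y:
  assumes "isY p" "isY q" "p < q" "\<And>t. p < t \<Longrightarrow> t < q \<Longrightarrow> \<not> isY t"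
  shows "\<exists>j. p = ypos j \<and> q = ypos (j + 1)"
proof -
  obtain i j where ij: "p = ypos i" "q = ypos j" using assms by (auto simp: isY_def)
  then have "i < j" using assms ypos_less_iff by simp
  have "\<not> i + 1 < j" using assms(4)[of "ypos (i + 1)"] ij ypos_less_iff by auto
  then have "j = i + 1" using \<open>i < j\<close> by simp
  then show ?thesis using ij by blast
qed

lemma no_Y_between: "ypos j < t \<Longrightarrow> t < ypos (j + 1) \<Longrightarrow> \<not> isY t"
  using ypos_less_iff by (auto simp: isY_def)

lemma no_YY: "isY t \<Longrightarrow> \<not> isY (t + 1)"
proof
  assume "isY t" "isY (t + 1)"
  then obtain j where "t = ypos j" "t + 1 = ypos (j + 1)" using consecutive_Y[of t "t + 1"] by fastforce
  then show False using ypos_gap(1)[of j] by simp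
qed

text \<open>Only a gap of length 2 holds a single \<open>x\<close>, and the gap after it has length
  3. At most 80 steps lead to some \<open>y\<close>, one more to the next \<open>x\<close>, and the
  exceptional gap costs 2.\<close>

lemma XX_near: obtains t where "s \<le> t" "t \<le> s + 83" "\<not> isY t" "\<not> isY (t + 1)"
proof -
  obtain j where j: "s \<le> ypos j" "ypos j \<le> s + 80" by (rule ypos_near)
  show ?thesis
  proof (cases "ypos (j + 1) \<ge> ypos j + 3")
    case True
    then show ?thesis using that[of "ypos j + 1"] j no_Y_between[of j] by simp
  next
    case False
    then have "(j + 1) mod 80 = 0" using ypos_step[of j] pos_mod_sign[of 80 "j + 1"] by linarith
    then have "(j + 1 + 1) mod 80 = (0 + 1) mod 80" using mod_add_left_eq[of "j + 1" 80 1] by (simp only:)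
    also have "(0 + 1) mod 80 = (1 :: int)" by simp
    finally have "(j + 1 + 1) mod 80 = 1" .
    then have "ypos (j + 1 + 1) = ypos (j + 1) + 3" using ypos_step[of "j + 1"] by linarith
    then show ?thesis
      using that[of "ypos (j + 1) + 1"] j no_Y_between[of "j + 1" "ypos (j + 1) + 1"]
        no_Y_between[of "j + 1" "ypos (j + 1) + 1 + 1"] False ypos_gap(1)[of j] by linarith
  qed
qed

text \<open>One complete gap inside the window fixes the position modulo 80. At most 80 letters
  precede the first \<open>y\<close> and a gap is at most 81 long; 250 leaves room for the two gaps
  needed in \<open>pattern_reverse\<close>.\<close>

lemma pattern_translate:
  assumes "\<And>u. 0 \<le> u \<Longrightarrow> u \<le> 250 \<Longrightarrow> isY (s + u) \<longleftrightarrow> isY (s' + u)"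
  shows "\<exists>k. s' = s + 3320 * k"
proof -
  obtain j where j: "s \<le> ypos j" "ypos j \<le> s + 80" by (rule ypos_near)
  define p q where "p = ypos j - s" and "q = ypos (j + 1) - s"
  have pq: "0 \<le> p" "p < q" "q \<le> 250" using j ypos_gap[of j] by (auto simp: p_def q_def)
  have "\<exists>i. s' + p = ypos i \<and> s' + q = ypos (i + 1)"
  proof (rule consecutive_Y)
    show "isY (s' + p)" "isY (s' + q)" using assms[of p] assms[of q] pq by (auto simp: p_def q_def)
    show "\<not> isY t" if t: "s' + p < t" "t < s' + q" for t
      using assms[of "t - s'"] no_Y_between[of j "s + (t - s')"] t pq by (simp add: p_def q_def)
  qed (use pq in simp)
  then obtain i where i: "s' + p = ypos i" "s' + q = ypos (i + 1)" by blast
  then have "(i + 1) mod 80 = (j + 1) mod 80"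
    using ypos_step[of i] ypos_step[of j] by (simp add: p_def q_def)
  then have "80 dvd i - j" by (simp add: mod_eq_dvd_iff)
  then obtain k where "i - j = 80 * k" by (elim dvdE)
  then have "i = j + 80 * k" by simp
  then show ?thesis using i ypos_period[of j k] by (intro exI[of _ k]) (simp add: p_def)
qed

text \<open>Reading backwards, the gaps would decrease instead of increasing.\<close>

lemma pattern_reverse:
  assumes "\<And>u. 0 \<le> u \<Longrightarrow> u \<le> 250 \<Longrightarrow> isY (s + u) \<longleftrightarrow> isY (s' - u)"
  shows False
proof -
  obtain j where j: "s \<le> ypos j" "ypos j \<le> s + 80" by (rule ypos_near)
  define p q r where "p = ypos j - s" and "q = ypos (j + 1) - s" and "r = ypos (j + 1 + 1) - s"
  have pq: "0 \<le> p" "p < q" "q < r" "r \<le> 250" using j ypos_gap[of j] ypos_gap[of "j + 1"] 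
    by (auto simp: p_def q_def r_def)
  have "\<exists>i. s' - q = ypos i \<and> s' - p = ypos (i + 1)"
  proof (rule consecutive_Y)
    show "isY (s' - p)" "isY (s' - q)" using assms[of p] assms[of q] pq by (auto simp: p_def q_def)
    show "\<not> isY t" if t: "s' - q < t" "t < s' - p" for t
      using assms[of "s' - t"] no_Y_between[of j "s + (s' - t)"] t pq by (simp add: p_def q_def)
  qed (use pq in simp)
  then obtain i where i: "s' - q = ypos i" "s' - p = ypos (i + 1)" by blast
  have "\<exists>i. s' - r = ypos i \<and> s' - q = ypos (i + 1)"
  proof (rule consecutive_Y)
    show "isY (s' - q)" "isY (s' - r)" using assms[of q] assms[of r] pq by (auto simp: q_def r_def)
    show "\<not> isY t" if t: "s' - r < t" "t < s' - q" for t
      using assms[of "s' - t"] no_Y_between[of "j + 1" "s + (s' - t)"] t pq by (simp add: r_def q_def)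
  qed (use pq in simp)
  then obtain k where k: "s' - r = ypos k" "s' - q = ypos (k + 1)" by blast
  have "i = k + 1" using i k ypos_less_iff[of i "k + 1"] ypos_less_iff[of "k + 1" i] by simp
  then have "(k + 1 + 1) mod 80 = (j + 1) mod 80" "(k + 1) mod 80 = (j + 1 + 1) mod 80"
    using i k ypos_step[of "k + 1"] ypos_step[of k] ypos_step[of j] ypos_step[of "j + 1"]
    unfolding p_def q_def r_def \<open>i = k + 1\<close> by linarith+
  then have "80 dvd (k + 1 + 1) - (j + 1)" "80 dvd (k + 1) - (j + 1 + 1)" by (simp_all only: mod_eq_dvd_iff)
  from dvd_diff[OF this] show False by simp
qed

text \<open>The blocks have lengths 2 to \<open>n + 1\<close>, which add up to
  \<open>n * (n + 3) div 2\<close>; the last letter is the \<open>y\<close> with index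
  \<open>n - 1\<close>.\<close>

lemma rho_word_upto:
  "concat (map (\<lambda>k. replicate k x @ [y]) [1..<Suc n]) =
    map (\<lambda>t. if \<exists>m<n. int t = ypos0 (int m) then y else x) [0..<n * (n + 3) div 2]"
proof (induction n)
  case (Suc n)
  define l where "l = n * (n + 3) div 2"
  have "even (n * (n + 3))" by simp
  then obtain q where q: "n * (n + 3) = 2 * q" by (elim evenE)
  moreover from this have "Suc n * (Suc n + 3) = 2 * (q + n + 2)" by (simp add: algebra_simps)
  ultimately have l': "Suc n * (Suc n + 3) div 2 = l + Suc n + 1" by (simp add: l_def)
  have "(int n + 1) * (int n + 4) = 2 * (int q + int n + 2)"
    using arg_cong[OF q, of int] by (simp add: algebra_simps)
  then have yn: "ypos0 (int n) = int (l + Suc n)" using q by (simp add: ypos0_def l_def)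
  have small: "ypos0 (int m) < int l" if "m < n" for m
  proof -
    have "(m + 1) * (m + 4) \<le> n * (n + 3)" using that by (intro mult_mono) auto
    then have "(m + 1) * (m + 4) div 2 \<le> l" unfolding l_def by (rule div_le_mono)
    then have "int ((m + 1) * (m + 4) div 2) \<le> int l" by (simp only: of_nat_le_iff)
    then show ?thesis by (simp add: ypos0_def zdiv_int algebra_simps)
  qed
  have split: "[0..<l + Suc n + 1] = [0..<l] @ [l..<l + Suc n] @ [l + Suc n]"
    using upt_add_eq_append[of 0 l "Suc n"] by simp
  have "map (\<lambda>t. if \<exists>m<Suc n. int t = ypos0 (int m) then y else x) [0..<l] =
      map (\<lambda>t. if \<exists>m<n. int t = ypos0 (int m) then y else x) [0..<l]"
    using yn by (auto simp: less_Suc_eq)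
  moreover have "map (\<lambda>t. if \<exists>m<Suc n. int t = ypos0 (int m) then y else x) [l..<l + Suc n] = replicate (Suc n) x"
  proof -
    have "map (\<lambda>t. if \<exists>m<Suc n. int t = ypos0 (int m) then y else x) [l..<l + Suc n] = map (\<lambda>_. x) [l..<l + Suc n]"
      by (rule map_cong) (use yn small in \<open>force simp: less_Suc_eq\<close>)+
    then show ?thesis by (simp only: map_replicate_const length_upt add_diff_cancel_left')
  qed
  moreover have "\<exists>m<Suc n. int (l + Suc n) = ypos0 (int m)" using yn by (intro exI[of _ n]) simp
  ultimately show ?case
    unfolding l' split map_append Suc.IH[folded l_def, symmetric] by (simp add: Suc.IH[folded l_def])
qed simp

lemma isY_upto: assumes "t < 3320" shows "isY (int t) \<longleftrightarrow> (\<exists>m<80. int t = ypos0 (int m))"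
proof
  assume "isY (int t)"
  then obtain j where j: "int t = ypos j" by (auto simp: isY_def)
  have "ypos (-1) < 0" "ypos 80 = 3321" by (simp_all add: ypos_def ypos0_def)
  then have "-1 < j" "j < 80" using j assms ypos_less_iff[of "-1" j] ypos_less_iff[of j 80] by simp_all
  then have "ypos j = ypos0 (int (nat j))" "nat j < 80" by (simp_all add: ypos_def)
  then show "\<exists>m<80. int t = ypos0 (int m)" using j by metis
next
  assume "\<exists>m<80. int t = ypos0 (int m)"
  then obtain m where "m < 80" "int t = ypos0 (int m)" by blast
  then have "int t = ypos (int m)" by (simp add: ypos_def)
  then show "isY (int t)" by simp
qed

lemma rho_word_map: "rho_word x y = map (\<lambda>t. if isY (int t) then y else x) [0..<3320]"
proof -
  have "rho_word x y = map (\<lambda>t. if \<exists>m<80. int t = ypos0 (int m) then y else x) [0..<3320]"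
    using rho_word_upto[of x y 80] by (simp add: rho_word_def del: upt_rec_numeral)
  then show ?thesis using isY_upto by (simp del: upt_rec_numeral)
qed

text \<open>The negation of \<open>good_fellows\<close>, by \<open>good_fellows_iff\<close>; the
  existential form is the one that homomorphisms and the tree produce.\<close>

definition (in group) fellow :: "'a set \<Rightarrow> 'a \<Rightarrow> 'a \<Rightarrow> bool" where
  "fellow F x y \<longleftrightarrow> (\<exists>f\<in>F. \<exists>f'\<in>F. x = f \<otimes> y \<otimes> f' \<or> x = f \<otimes> inv y \<otimes> f')"

lemma dvd_unique:
  fixes x y n :: int
  assumes "n dvd x" "n dvd y" "\<bar>x - y\<bar> < n" shows "x = y"
  using assms zdvd_not_zless[of "\<bar>x - y\<bar>" n] dvd_diff[of n x y] by (cases "x = y") auto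

section \<open>Axes of the relators\<close>

locale relator_family = amalgam_decomposition M K L
  for M (structure) and K L :: "'a set" +
  fixes I :: "'i set" and h a b b' :: "'i \<Rightarrow> 'a"
  assumes mal: "\<lbrakk>x \<in> H; x \<noteq> \<one>; g \<in> L; g \<notin> K\<rbrakk> \<Longrightarrow> inv g \<otimes> x \<otimes> g \<notin> H"
    and data: "i \<in> I \<Longrightarrow> h i \<in> H" "i \<in> I \<Longrightarrow> a i \<in> K" "i \<in> I \<Longrightarrow> a i \<notin> L"
      "i \<in> I \<Longrightarrow> b i \<in> L" "i \<in> I \<Longrightarrow> b i \<notin> K" "i \<in> I \<Longrightarrow> b' i \<in> L" "i \<in> I \<Longrightarrow> b' i \<notin> K"
    and cond1: "i \<in> I \<Longrightarrow> \<not> fellow H (b i) (b' i)"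
    and cond2: "\<lbrakk>i \<in> I; k \<in> I; i \<noteq> k\<rbrakk> \<Longrightarrow>
        \<not> fellow H (a i) (a k) \<or> (b i = b k \<and> b' i = b' k \<and> a i \<noteq> a k) \<or> \<not> fellow H (b i) (b k) \<or>
        (\<exists>H' K'. subgroup K' M \<and> K' \<subseteq> K \<and> H' = K' \<inter> H \<and> a i \<in> K' - H \<and> a k \<in> K' - H \<and>
          \<not> fellow H' (b i) (b k) \<and> \<not> fellow H (b i) (b' k) \<and>
          (\<forall>x\<in>K' - H. \<forall>y\<in>H - K'. \<forall>z\<in>K' - H. x \<otimes> y \<otimes> z \<notin> H))"
begin

lemma fellow_sym:
  assumes "fellow H x y" "x \<in> carrier M" "y \<in> carrier M" shows "fellow H y x"
proof -
  obtain f f' where f: "f \<in> H" "f' \<in> H" "x = f \<otimes> y \<otimes> f' \<or> x = f \<otimes> inv y \<otimes> f'"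
    using assms unfolding fellow_def by blast
  have c: "f \<in> carrier M" "f' \<in> carrier M" using f H_carrier by auto
  from f(3) show ?thesis
  proof
    assume "x = f \<otimes> y \<otimes> f'"
    then have "y = inv f \<otimes> x \<otimes> inv f'" using c assms by (simp add: m_assoc)
    then show ?thesis unfolding fellow_def using H_closed(2) f by blast
  next
    assume "x = f \<otimes> inv y \<otimes> f'"
    then have "y = f' \<otimes> inv x \<otimes> f" using c assms by (simp add: m_assoc inv_mult_group)
    then show ?thesis unfolding fellow_def using f by blast
  qed
qed

definition \<beta> :: "'i \<Rightarrow> int \<Rightarrow> 'a" where
  "\<beta> i t = (if isY t then b' i else b i)"

text \<open>The letters of the bi-infinite periodic word of the relator; even positions carry letters in \<open>L\<close>.\<close>

definition letter :: "'i \<Rightarrow> int \<Rightarrow> 'a" where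
  "letter i n = (if odd n then a i else
    if 3320 dvd n div 2 then inv (h i) \<otimes> \<beta> i (n div 2) else \<beta> i (n div 2))"

lemma \<beta>_L: "i \<in> I \<Longrightarrow> \<beta> i t \<in> L" and \<beta>_K: "i \<in> I \<Longrightarrow> \<beta> i t \<notin> K"
  using data by (auto simp: \<beta>_def)

lemma letter_even: "letter i (2 * t) = (if 3320 dvd t then inv (h i) \<otimes> \<beta> i t else \<beta> i t)"
  by (simp add: letter_def)

lemma letter_odd: "odd n \<Longrightarrow> letter i n = a i"
  by (simp add: letter_def)

lemma letter_L: assumes "i \<in> I" shows "letter i (2 * t) \<in> L" "letter i (2 * t) \<notin> K"
proof -
  have h: "inv (h i) \<in> K" "inv (h i) \<in> L" using H_closed(2) data(1)[OF assms] by auto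
  have c: "h i \<in> carrier M" "\<beta> i t \<in> carrier M" using data(1)[OF assms] H_carrier \<beta>_L[OF assms] L_carrier by auto
  show "letter i (2 * t) \<in> L"
    using \<beta>_L[OF assms] h subgroup.m_closed[OF L_sub] by (simp add: letter_even)
  have "inv (h i) \<otimes> \<beta> i t \<notin> K"
  proof
    assume "inv (h i) \<otimes> \<beta> i t \<in> K"
    moreover have "h i \<in> K" using data(1)[OF assms] by simp
    ultimately have "h i \<otimes> (inv (h i) \<otimes> \<beta> i t) \<in> K" using subgroup.m_closed[OF K_sub] by blast
    then show False using \<beta>_K[OF assms] c by simp
  qed
  then show "letter i (2 * t) \<notin> K" using \<beta>_K[OF assms] by (simp add: letter_even)
qed

lemma letter_fac: assumes "i \<in> I" shows "letter i n \<in> fac (odd n)" "letter i n \<notin> fac (even n)"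
proof -
  consider "odd n" | t where "n = 2 * t" using evenE by blast
  then have "letter i n \<in> fac (odd n) \<and> letter i n \<notin> fac (even n)"
    by cases (use letter_L[OF assms] data[OF assms] in \<open>auto simp: fac_def letter_odd\<close>)
  then show "letter i n \<in> fac (odd n)" "letter i n \<notin> fac (even n)" by auto
qed

lemma letter_carrier: "i \<in> I \<Longrightarrow> letter i n \<in> carrier M"
  using letter_fac fac_carrier by blast

lemma isY_period: "isY (t + 3320 * k) = isY t"
proof -
  have "isY (t + 3320 * k)" if "isY t" for t k
    using that ypos_period by (auto simp: isY_def) (metis add.commute)
  from this[of t k] this[of "t + 3320 * k" "-k"] show ?thesis by auto
qed

lemma letter_period: "letter i (n + 6640 * k) = letter i n"
proof -
  have "(n + 6640 * k) div 2 = n div 2 + 3320 * k" by simp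
  moreover have "3320 dvd n div 2 + 3320 * k \<longleftrightarrow> 3320 dvd n div 2" by (simp add: dvd_add_left_iff)
  ultimately show ?thesis by (simp add: letter_def \<beta>_def isY_period)
qed

text \<open>The factors \<open>h\<close> that perturb the letters at multiples of 3320 lie in
  \<open>H\<close> and disappear in the double coset.\<close>

lemma fellow_letter:
  assumes i: "i \<in> I" and j: "j \<in> I" and \<eta>: "\<eta> \<in> H" "\<eta>' \<in> H"
    and eq: "letter i (2 * s) = inv \<eta> \<otimes> (if pos then letter j (2 * t) else inv (letter j (2 * t))) \<otimes> \<eta>'"
  shows "fellow H (\<beta> i s) (\<beta> j t)"
proof -
  define u where "u = (if 3320 dvd s then h i else \<one>)"
  define v where "v = (if 3320 dvd t then inv (h j) else \<one>)"
  have uv: "u \<in> H" "v \<in> H" using data(1) i j H_closed by (auto simp: u_def v_def simp del: Int_iff)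
  have c: "u \<in> carrier M" "v \<in> carrier M" "\<eta> \<in> carrier M" "\<eta>' \<in> carrier M" "\<beta> i s \<in> carrier M" "\<beta> j t \<in> carrier M"
    using uv \<eta> H_carrier \<beta>_L[OF i] \<beta>_L[OF j] L_carrier by (auto simp del: Int_iff)
  have s: "\<beta> i s = u \<otimes> letter i (2 * s)"
    using data(1)[OF i] H_carrier c by (auto simp: letter_even u_def simp del: Int_iff)
  have t: "letter j (2 * t) = v \<otimes> \<beta> j t" using c by (auto simp: letter_even v_def)
  show ?thesis
  proof (cases pos)
    case True
    then have "\<beta> i s = (u \<otimes> inv \<eta> \<otimes> v) \<otimes> \<beta> j t \<otimes> \<eta>'" using s t eq c by (simp add: m_assoc)
    moreover have "u \<otimes> inv \<eta> \<otimes> v \<in> H" by (intro H_closed uv \<eta>)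
    ultimately show ?thesis unfolding fellow_def using \<eta> by blast
  next
    case False
    then have "\<beta> i s = (u \<otimes> inv \<eta>) \<otimes> inv (\<beta> j t) \<otimes> (inv v \<otimes> \<eta>')" using s t eq c by (simp add: m_assoc inv_mult_group)
    moreover have "u \<otimes> inv \<eta> \<in> H" "inv v \<otimes> \<eta>' \<in> H" by (intro H_closed uv \<eta>)+
    ultimately show ?thesis unfolding fellow_def by blast
  qed
qed

text \<open>Otherwise \<open>b i\<close> would be matched with \<open>b' i\<close>, against
  \<open>cond1\<close>.\<close>

lemma same_pattern:
  assumes "i \<in> I" "fellow H (\<beta> i s) (\<beta> j t)" "b i = b j" "b' i = b' j"
  shows "isY s = isY t"
proof (rule ccontr)
  assume "isY s \<noteq> isY t"
  then have "fellow H (b i) (b' i) \<or> fellow H (b' i) (b i)"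
    using assms by (auto simp: \<beta>_def split: if_splits)
  then show False using fellow_sym cond1[OF assms(1)] data[OF assms(1)] L_carrier by blast
qed

text \<open>
  A long match of the bi-infinite words of \<open>i\<close> and \<open>j\<close>, read in the same (\<open>pos\<close>) or in opposite
  directions; \<open>\<eta>\<close> is the discrepancy in \<open>H\<close> between the two paths.
\<close>

lemma long_match:
  fixes m n :: int and \<eta> :: "int \<Rightarrow> 'a" and pos :: bool
  defines "\<epsilon> \<equiv> (if pos then 1 else -1 :: int)"
  assumes i: "i \<in> I" and j: "j \<in> I" and par: "even (m - n)"
    and \<eta>: "\<And>t. 1 \<le> t \<Longrightarrow> t \<le> 600 \<Longrightarrow> \<eta> t \<in> H"
    and eq: "\<And>t. 1 \<le> t \<Longrightarrow> t < 600 \<Longrightarrow>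
       letter i (m + t) = inv (\<eta> t) \<otimes> (if pos then letter j (n + t) else inv (letter j (n - t))) \<otimes> \<eta> (t + 1)"
  shows "i = j \<and> pos \<and> (\<exists>k. n = m + 6640 * k) \<and> (\<exists>t. 1 \<le> t \<and> t \<le> 600 \<and> \<eta> t = \<one>)"
proof -
  \<comment> \<open>Moves the start to an even position, so that from here on letters of
    \<open>L\<close> come first and alternate with the letters \<open>a\<close>.\<close>
  define t0 :: int where "t0 = (if even m then 2 else 1)"
  have "even (m + t0)" "even (n + \<epsilon> * t0)" using par by (auto simp: t0_def \<epsilon>_def)
  then obtain s s' where s: "m + t0 = 2 * s" "n + \<epsilon> * t0 = 2 * s'" by (elim evenE)
  define \<theta> where "\<theta> u = \<eta> (t0 + 2 * u)" for u
  define \<theta>' where "\<theta>' u = \<eta> (t0 + 2 * u + 1)" for u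
  have t0: "1 \<le> t0" "t0 \<le> 2" by (auto simp: t0_def)
  have \<theta>H: "\<theta> u \<in> H" "\<theta>' u \<in> H" if "0 \<le> u" "u \<le> 290" for u
    unfolding \<theta>_def \<theta>'_def by (rule \<eta>; use that t0 in linarith)+
  have \<theta>c: "\<theta> u \<in> carrier M" "\<theta>' u \<in> carrier M" if "0 \<le> u" "u \<le> 290" for u
    using \<theta>H[OF that] H_carrier by auto
  have L: "letter i (2 * (s + u)) = inv (\<theta> u) \<otimes> (if pos then letter j (2 * (s' + \<epsilon> * u)) else inv (letter j (2 * (s' + \<epsilon> * u)))) \<otimes> \<theta>' u"
    if "0 \<le> u" "u \<le> 290" for u
  proof -
    have e: "m + (t0 + 2 * u) = 2 * (s + u)" "pos \<Longrightarrow> n + (t0 + 2 * u) = 2 * (s' + \<epsilon> * u)"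
      "\<not> pos \<Longrightarrow> n - (t0 + 2 * u) = 2 * (s' + \<epsilon> * u)"
      using s by (auto simp: \<epsilon>_def algebra_simps)
    have "letter i (m + (t0 + 2 * u)) = inv (\<eta> (t0 + 2 * u)) \<otimes> 
        (if pos then letter j (n + (t0 + 2 * u)) else inv (letter j (n - (t0 + 2 * u)))) \<otimes> \<eta> (t0 + 2 * u + 1)"
      by (rule eq; use that t0 in linarith)
    then show ?thesis unfolding e(1) \<theta>_def \<theta>'_def by (cases pos) (simp_all only: e if_True if_False not_False_eq_True)
  qed
  have A: "a i = inv (\<theta>' u) \<otimes> (if pos then a j else inv (a j)) \<otimes> \<theta> (u + 1)" if "0 \<le> u" "u \<le> 290" for u
  proof -
    have o: "odd (m + (t0 + 2 * u + 1))" "odd (n + (t0 + 2 * u + 1))" "odd (n - (t0 + 2 * u + 1))"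
      using par by (auto simp: t0_def)
    have "letter i (m + (t0 + 2 * u + 1)) = inv (\<theta>' u) \<otimes> (if pos then letter j (n + (t0 + 2 * u + 1))
        else inv (letter j (n - (t0 + 2 * u + 1)))) \<otimes> \<eta> (t0 + 2 * u + 1 + 1)"
      unfolding \<theta>'_def by (rule eq; use that t0 in linarith)
    moreover have "t0 + 2 * u + 1 + 1 = t0 + 2 * (u + 1)" by simp
    ultimately show ?thesis unfolding \<theta>_def by (simp only: letter_odd[OF o(1)] letter_odd[OF o(2)] letter_odd[OF o(3)])
  qed
  have F: "fellow H (\<beta> i (s + u)) (\<beta> j (s' + \<epsilon> * u))" if "0 \<le> u" "u \<le> 290" for u
    using fellow_letter[OF i j \<theta>H[OF that] L[OF that]] .
  have ac: "a i \<in> carrier M" "a j \<in> carrier M" "b i \<in> carrier M" "b j \<in> carrier M"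
    using data i j K_carrier L_carrier by auto
  \<comment> \<open>The case of one index or of alternative (b): the letters \<open>b\<close> and
    \<open>b'\<close> are common to both words, so the pattern is visible in the match.\<close>
  have same: ?thesis if bb: "b i = b j" "b' i = b' j" and ne: "i = j \<or> a i \<noteq> a j"
  proof -
    have pat: "isY (s + u) = isY (s' + \<epsilon> * u)" if "0 \<le> u" "u \<le> 250" for u
      using same_pattern[OF i F bb] that by simp
    have pos: pos
    proof (rule ccontr)
      assume "\<not> pos"
      then show False using pattern_reverse[of s s'] pat by (simp add: \<epsilon>_def)
    qed
    then have e1: "\<epsilon> = 1" by (simp add: \<epsilon>_def)
    obtain k where k: "s' = s + 3320 * k" using pattern_translate[of s s'] pat e1 by auto
    have nm: "n = m + 6640 * k" using s k e1 by simp
    \<comment> \<open>Away from the positions perturbed by \<open>h\<close>, both words carry the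
      same letter \<open>?b\<close>, which conjugates \<open>\<theta> u\<close> in \<open>H\<close>
      to \<open>\<theta>' u\<close> in \<open>H\<close>; malnormality makes both trivial.\<close>
    have one: "\<theta> u = \<one> \<and> \<theta>' u = \<one>" if u: "0 \<le> u" "u \<le> 290" "\<not> 3320 dvd s + u" for u
    proof -
      have su: "s' + u = (s + u) + 3320 * k" using k by simp
      have "isY (s' + u) = isY (s + u)" "\<not> 3320 dvd s' + u"
        unfolding su using u(3) isY_period dvd_add_left_iff[OF dvd_triv_left[of 3320 k], of "s + u"] by blast+
      then have eq': "letter j (2 * (s' + u)) = \<beta> i (s + u)" "letter i (2 * (s + u)) = \<beta> i (s + u)"
        unfolding letter_even using bb u(3) by (auto simp: \<beta>_def)
      let ?b = "\<beta> i (s + u)"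
      have bc: "?b \<in> carrier M" using \<beta>_L[OF i] L_carrier by blast
      have "?b = inv (\<theta> u) \<otimes> ?b \<otimes> \<theta>' u" using L[OF u(1,2)] eq' pos e1 by simp
      then have "\<theta> u \<otimes> ?b = ?b \<otimes> \<theta>' u" using bc \<theta>c[OF u(1,2)]
        by (metis cancel_inv(2) inv_closed m_assoc m_closed)
      then have t: "\<theta>' u = inv ?b \<otimes> \<theta> u \<otimes> ?b" using bc \<theta>c[OF u(1,2)] by (simp add: m_assoc)
      then have "\<theta> u = \<one>" using mal[OF \<theta>H(1)[OF u(1,2)] _ \<beta>_L[OF i] \<beta>_K[OF i]] \<theta>H(2)[OF u(1,2)] by metis
      then show ?thesis using t bc by simp
    qed
    \<comment> \<open>At two consecutive unperturbed positions the discrepancies vanish, so the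
      letters \<open>a\<close> between them are equal; this excludes alternative (b).\<close>
    obtain u where u: "0 \<le> u" "u \<le> 2" "\<not> 3320 dvd s + u" "\<not> 3320 dvd s + (u + 1)"
    proof (cases "3320 dvd s \<or> 3320 dvd s + 1")
      case True
      then have "\<not> 3320 dvd s + 2" "\<not> 3320 dvd s + 3"
        using dvd_unique[of 3320 s "s + 2"] dvd_unique[of 3320 s "s + 3"] 
          dvd_unique[of 3320 "s + 1" "s + 2"] dvd_unique[of 3320 "s + 1" "s + 3"] by auto
      then show ?thesis using that[of 2] by simp
    next
      case False
      then show ?thesis using that[of 0] by simp
    qed
    have "\<theta>' u = \<one>" "\<theta> (u + 1) = \<one>" "\<theta> u = \<one>" using one[of u] one[of "u + 1"] u by auto
    moreover from this have "a i = a j" using A[of u] u pos ac by simp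
    moreover have "1 \<le> t0 + 2 * u" "t0 + 2 * u \<le> 600" using t0 u by auto
    ultimately show ?thesis using ne pos nm unfolding \<theta>_def by blast
  qed
  show ?thesis
  proof (cases "i = j \<or> (b i = b j \<and> b' i = b' j \<and> a i \<noteq> a j)")
    case True
    then show ?thesis using same by blast
  next
    case False
    then have "i \<noteq> j" by simp
    note cond2[OF i j this]
    moreover have "fellow H (a i) (a j)"
      using A[of 0] \<theta>H[of 0] \<theta>H[of 1] H_closed(2)[OF \<theta>H(2)[of 0]] unfolding fellow_def by (cases pos) (auto simp del: Int_iff)
    \<comment> \<open>Take two adjacent letters \<open>b i\<close>. As \<open>b' j\<close> never
      occurs at two adjacent positions, one of them faces \<open>b j\<close>.\<close>
    moreover have "fellow H (b i) (b j)"
    proof -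
      obtain t where t: "s \<le> t" "t \<le> s + 83" "\<not> isY t" "\<not> isY (t + 1)" by (rule XX_near)
      define u where "u = t - s"
      have u: "0 \<le> u" "u + 1 \<le> 290" "\<not> isY (s + u)" "\<not> isY (s + (u + 1))"
        using t by (auto simp: u_def algebra_simps)
      have "\<not> isY (s' + \<epsilon> * u) \<or> \<not> isY (s' + \<epsilon> * (u + 1))"
        using no_YY[of "s' + u"] no_YY[of "s' - u - 1"] by (auto simp: \<epsilon>_def algebra_simps)
      then show ?thesis using F[of u] F[of "u + 1"] u by (auto simp: \<beta>_def)
    qed
    ultimately obtain H' K' where HK: "subgroup K' M" "K' \<subseteq> K" "H' = K' \<inter> H" "a i \<in> K' - H" "a j \<in> K' - H"
      "\<not> fellow H' (b i) (b j)" "\<not> fellow H (b i) (b' j)"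
      "\<And>x y z. \<lbrakk>x \<in> K' - H; y \<in> H - K'; z \<in> K' - H\<rbrakk> \<Longrightarrow> x \<otimes> y \<otimes> z \<notin> H"
      using False by metis
    have ex: "\<exists>u\<in>{v, v + 1}. \<not> isY (s + u)" for v using no_YY[of "s + v"] by (auto simp: algebra_simps)
    \<comment> \<open>Each of the pairs {1, 2}, {3, 4}, {5, 6} contains a position with
      \<open>b i\<close>, and each word has at most one perturbed position in this range, so one of
      the three survives. The range starts at 1 because the letter \<open>a\<close> before position
      \<open>u\<close> is needed.\<close>
    have "\<exists>u. 1 \<le> u \<and> u \<le> 6 \<and> \<not> isY (s + u) \<and> \<not> 3320 dvd s + u \<and> \<not> 3320 dvd s' + \<epsilon> * u"
    proof (rule ccontr)
      assume n: "\<not> ?thesis"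
      obtain u1 u2 u3 where us: "u1 \<in> {1, 2}" "u2 \<in> {3, 4}" "u3 \<in> {5, 6}" "\<not> isY (s + u1)" "\<not> isY (s + u2)" "\<not> isY (s + u3)"
        using ex[of 1] ex[of 3] ex[of 5] by auto
      have r: "1 \<le> u" "u \<le> 6" "\<not> isY (s + u)" if "u \<in> {u1, u2, u3}" for u
        using us that by auto
      have k: "3320 dvd s + u \<or> 3320 dvd s' + \<epsilon> * u" if "u \<in> {u1, u2, u3}" for u
        using n r[OF that] by blast
      have "u = v" if "u \<in> {u1, u2, u3}" "v \<in> {u1, u2, u3}"
        "(3320 dvd s + u \<and> 3320 dvd s + v) \<or> (3320 dvd s' + \<epsilon> * u \<and> 3320 dvd s' + \<epsilon> * v)" for u v
      proof -
        have uv: "\<bar>u - v\<bar> < 3320" using r[OF that(1)] r[OF that(2)] by linarith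
        then have "\<bar>(s + u) - (s + v)\<bar> < 3320" "\<bar>(s' + \<epsilon> * u) - (s' + \<epsilon> * v)\<bar> < 3320"
          by (auto simp: \<epsilon>_def)
        then have "s + u = s + v \<or> s' + \<epsilon> * u = s' + \<epsilon> * v"
          using that(3) dvd_unique[of 3320 "s + u" "s + v"] dvd_unique[of 3320 "s' + \<epsilon> * u" "s' + \<epsilon> * v"] by blast
        then show ?thesis by (auto simp: \<epsilon>_def split: if_splits)
      qed
      moreover have "u1 \<noteq> u2" "u1 \<noteq> u3" "u2 \<noteq> u3" using us by auto
      ultimately show False using k[of u1] k[of u2] k[of u3] by blast
    qed
    then obtain u where u: "1 \<le> u" "u \<le> 6" "\<not> isY (s + u)" "\<not> 3320 dvd s + u" "\<not> 3320 dvd s' + \<epsilon> * u" by blast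
    \<comment> \<open>By (iv), the letter opposite \<open>b i\<close> is not
      \<open>b' j\<close>.\<close>
    have nY: "\<not> isY (s' + \<epsilon> * u)" using F[of u] u HK(7) by (auto simp: \<beta>_def)
    have "letter i (2 * (s + u)) = b i" "letter j (2 * (s' + \<epsilon> * u)) = b j"
      unfolding letter_even using u nY by (auto simp: \<beta>_def)
    then have Lu: "b i = inv (\<theta> u) \<otimes> (if pos then b j else inv (b j)) \<otimes> \<theta>' u" using L[of u] u by simp
    define x where "x = (if pos then a j else inv (a j))"
    have xK: "x \<in> K'" "inv x \<in> K'" "a i \<in> K'" "inv (a i) \<in> K'" 
      using HK subgroup.m_inv_closed[OF HK(1)] ac by (auto simp: x_def)
    have nH: "y \<notin> H \<Longrightarrow> inv y \<notin> H" if "y \<in> carrier M" for y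
      using H_closed(2)[of "inv y"] that by auto
    have aH: "a i \<notin> H" "a j \<notin> H" using HK(4,5) by blast+
    have xH: "x \<notin> H" "inv x \<notin> H" "a i \<notin> H" "inv (a i) \<notin> H"
      using aH nH[OF ac(1)] nH[OF ac(2)] ac unfolding x_def by (cases pos; simp only: if_True if_False inv_inv; blast)+
    have xc: "x \<in> carrier M" using ac by (simp add: x_def)
    have A1: "a i = inv (\<theta>' (u - 1)) \<otimes> x \<otimes> \<theta> u" using A[of "u - 1"] u by (simp add: x_def)
    have A2: "a i = inv (\<theta>' u) \<otimes> x \<otimes> \<theta> (u + 1)" using A[of u] u by (simp add: x_def)
    have c: "\<theta> u \<in> carrier M" "\<theta>' u \<in> carrier M" "\<theta> (u + 1) \<in> carrier M" "\<theta>' (u - 1) \<in> carrier M"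
      using \<theta>c u by auto
    \<comment> \<open>The neighbouring letters \<open>a\<close> lie in \<open>K'\<close>, so (v)
      forces the discrepancies on both sides of \<open>b i\<close> into \<open>K'\<close>. The match
      is then one over \<open>H'\<close>, against (iii).\<close>
    have "\<theta> u \<in> K'"
    proof (rule ccontr)
      assume n: "\<theta> u \<notin> K'"
      have "x \<otimes> \<theta> u \<otimes> inv (a i) = \<theta>' (u - 1)"
        unfolding A1 using c xc by (simp add: inv_mult_group m_assoc)
      then show False using HK(8)[of x "\<theta> u" "inv (a i)"] xK xH n \<theta>H(1)[of u] \<theta>H(2)[of "u - 1"] u by simp
    qed
    moreover have "\<theta>' u \<in> K'"
    proof (rule ccontr)
      assume n: "\<theta>' u \<notin> K'"
      have "inv x \<otimes> \<theta>' u \<otimes> a i = \<theta> (u + 1)"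
        unfolding A2 using c xc by (simp add: m_assoc)
      then show False using HK(8)[of "inv x" "\<theta>' u" "a i"] xK xH n \<theta>H(2)[of u] \<theta>H(1)[of "u + 1"] u by simp
    qed
    ultimately have "\<theta> u \<in> H'" "\<theta>' u \<in> H'" "inv (\<theta> u) \<in> H'"
      using HK(3) \<theta>H[of u] u subgroup.m_inv_closed[OF HK(1)] H_closed(2) by auto
    then have "fellow H' (b i) (b j)" unfolding fellow_def using Lu by (cases pos) auto
    then show ?thesis using HK(6) by simp
  qed
qed

section \<open>Parametrization of the axes\<close>

definition pw :: "'i \<Rightarrow> nat \<Rightarrow> 'a" where
  "pw i N = word_prod M (map (\<lambda>k. letter i (int k)) [0..<N])"

definition r :: "'i \<Rightarrow> 'a" where
  "r i = pw i 6640"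

text \<open>Extends the prefix products to all integers; \<open>w i (n + 1)\<close> represents the
  edge of the axis between \<open>p i n\<close> and \<open>p i (n + 1)\<close>.\<close>

definition w :: "'i \<Rightarrow> int \<Rightarrow> 'a" where
  "w i n = r i [^] (n div 6640) \<otimes> pw i (nat (n mod 6640))"

definition p :: "'i \<Rightarrow> int \<Rightarrow> bool \<times> 'a set" where
  "p i n = pt (odd n) (w i n)"

definition axis :: "'i \<Rightarrow> (bool \<times> 'a set) set" where
  "axis i = range (p i)"

context
  fixes i assumes i: "i \<in> I"
begin

lemma pw_closed [simp]: "pw i N \<in> carrier M"
  unfolding pw_def by (rule word_prod_closed) (use letter_carrier[OF i] in auto)

lemma pw_Suc: "pw i (Suc N) = pw i N \<otimes> letter i (int N)"
proof -
  have "set (map (\<lambda>k. letter i (int k)) [0..<N]) \<subseteq> carrier M" using letter_carrier[OF i] by auto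
  then show ?thesis using letter_carrier[OF i] by (simp add: pw_def word_prod_app)
qed

lemma r_closed [simp]: "r i \<in> carrier M"
  by (simp add: r_def)

lemma w_closed [simp]: "w i n \<in> carrier M"
  by (simp add: w_def)

lemma w_0: "w i 0 = \<one>"
  by (simp add: w_def pw_def)

lemma w_period: "w i (n + 6640 * k) = r i [^] k \<otimes> w i n"
proof -
  have "(n + 6640 * k) div 6640 = k + n div 6640" "(n + 6640 * k) mod 6640 = n mod 6640" by simp_all
  then show ?thesis by (simp add: w_def int_pow_mult m_assoc)
qed

lemma w_step: "w i (n + 1) = w i n \<otimes> letter i n"
proof -
  define q s where "q = n div 6640" and "s = nat (n mod 6640)"
  have n: "n = int s + 6640 * q" "s < 6640" by (auto simp: q_def s_def nat_less_iff)
  have l: "letter i n = letter i (int s)" using letter_period[of i "int s" q] n by simp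
  have wn: "w i n = r i [^] q \<otimes> pw i s" by (simp add: w_def q_def s_def)
  show ?thesis
  proof (cases "s = 6639")
    case True
    then have "n + 1 = 0 + 6640 * (q + 1)" using n by simp
    then have "w i (n + 1) = w i (0 + 6640 * (q + 1))" by (simp only:)
    then have "w i (n + 1) = r i [^] (q + 1)" unfolding w_period w_0 by simp
    also have "\<dots> = r i [^] q \<otimes> r i" by (simp add: int_pow_mult)
    also have "\<dots> = r i [^] q \<otimes> pw i (Suc s)" using True by (simp add: r_def)
    finally show ?thesis using wn l by (simp add: pw_Suc m_assoc letter_carrier[OF i])
  next
    case False
    then have "s + 1 < 6640" using n by simp
    moreover have n1: "n + 1 = int (Suc s) + 6640 * q" using n by simp
    ultimately have "(n + 1) div 6640 = q" "(n + 1) mod 6640 = int (Suc s)"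
      using int_div_pos_eq[of "n + 1" 6640 q "int (Suc s)"] int_mod_pos_eq[of "n + 1" 6640 q "int (Suc s)"] by simp_all
    then have "w i (n + 1) = r i [^] q \<otimes> pw i (Suc s)" unfolding w_def by (simp only: nat_int)
    then show ?thesis using wn l by (simp add: pw_Suc m_assoc letter_carrier[OF i])
  qed
qed

lemma p_V [simp]: "p i n \<in> V"
  by (simp add: p_def)

lemma p_shift: "p i n = pt (odd n) (w i (n + 1))"
  using w_step pt_mult[of "w i n" "letter i n" "odd n"] letter_fac(1)[OF i] by (simp add: p_def)

lemma p_period: "p i (n + 6640 * k) = act (r i [^] k) (p i n)"
  by (simp add: p_def w_period)

lemma trace_axis:
  "trace (odd m) (w i m) (map (\<lambda>k. letter i (m + int k)) [0..<N]) = map (\<lambda>k. p i (m + int k)) [0..<Suc N]"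
proof (induction N arbitrary: m)
  case 0
  then show ?case by (simp add: p_def)
next
  case (Suc N)
  have u: "[0..<Suc n] = 0 # map Suc [0..<n]" for n by (simp only: upt_conv_Cons map_Suc_upt zero_less_Suc)
  have "trace (odd m) (w i m) (map (\<lambda>k. letter i (m + int k)) [0..<Suc N]) =
    p i m # trace (odd (m + 1)) (w i (m + 1)) (map (\<lambda>k. letter i (m + 1 + int k)) [0..<N])"
    unfolding u[of N] by (simp add: p_def w_step comp_def add.assoc del: upt_Suc)
  also have "\<dots> = map (\<lambda>k. p i (m + int k)) [0..<Suc (Suc N)]"
    unfolding Suc.IH u[of "Suc N"] by (simp add: comp_def add.assoc del: upt_Suc)
  finally show ?case .
qed

lemma rwalk_axis: "rwalk (map (\<lambda>k. p i (m + int k)) [0..<Suc N])"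
  unfolding trace_axis[symmetric]
proof (rule rwalk_trace)
  show "w i m \<in> carrier M" by simp
  have "typed (fac (odd m)) (fac (\<not> odd m)) (map (\<lambda>k. letter i (m + int k)) [0..<N])" for m
  proof (induction N arbitrary: m)
    case (Suc N)
    have u: "[0..<Suc N] = 0 # map Suc [0..<N]" by (simp only: upt_conv_Cons map_Suc_upt zero_less_Suc)
    show ?case unfolding u using Suc[of "m + 1"] letter_fac(1)[OF i, of m]
      by (simp add: comp_def add.assoc del: upt_Suc)
  qed simp
  then show "typed (fac (odd m)) (fac (\<not> odd m)) (map (\<lambda>k. letter i (m + int k)) [0..<N])" .
  have "letter i n \<notin> H" for n using letter_fac(2)[OF i, of n] by (auto simp: fac_def split: if_splits)
  then show "set (tl (map (\<lambda>k. letter i (m + int k)) [0..<N])) \<inter> H = {}"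
    using list.set_sel(2) by (cases N) (auto simp del: upt_Suc simp: map_tl[symmetric] dest!: list.set_sel(2)[rotated])
qed

lemma p_dist: assumes "m \<le> n" shows "d (p i m) (p i n) = nat (n - m)"
proof -
  define N where "N = nat (n - m)"
  have "hd (map (\<lambda>k. p i (m + int k)) [0..<Suc N]) = p i m"
    by (simp only: upt_conv_Cons zero_less_Suc list.map list.sel) simp
  moreover have "last (map (\<lambda>k. p i (m + int k)) [0..<Suc N]) = p i n"
    using assms by (simp add: N_def)
  ultimately show ?thesis using d_rwalk[OF rwalk_axis[of m N]] by (simp add: N_def del: upt_Suc)
qed

lemma p_dist_abs: "int (d (p i m) (p i n)) = \<bar>m - n\<bar>"
  using p_dist[of m n] p_dist[of n m] d_sym[of "p i m" "p i n"] by (cases "m \<le> n") auto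

lemma p_seg:
  assumes "z \<in> seg (p i m) (p i n)"
  obtains k where "z = p i k" "\<bar>m - k\<bar> = int (d (p i m) z)" "\<bar>m - k\<bar> + \<bar>k - n\<bar> = \<bar>m - n\<bar>"
proof -
  have z: "z \<in> V" "d (p i m) z + d z (p i n) = d (p i m) (p i n)" using assms segD by auto
  define k where "k = (if m \<le> n then m + int (d (p i m) z) else m - int (d (p i m) z))"
  have le: "int (d (p i m) z) \<le> \<bar>m - n\<bar>" using z(2) p_dist_abs[of m n] by linarith
  then have k: "\<bar>m - k\<bar> = int (d (p i m) z)" "\<bar>m - k\<bar> + \<bar>k - n\<bar> = \<bar>m - n\<bar>"
    by (auto simp: k_def)
  have "d (p i m) (p i k) = d (p i m) z" using p_dist_abs[of m k] k by simp
  moreover have "d (p i m) (p i k) + d (p i k) (p i n) = d (p i m) (p i n)"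
    using p_dist_abs[of m k] p_dist_abs[of k n] p_dist_abs[of m n] k by linarith
  ultimately have "z = p i k"
    by (intro seg_unique[OF p_V p_V z(1) p_V z(2)]) simp_all
  then show ?thesis using that k by blast
qed

lemma axis_convex': "convex (axis i)"
  unfolding convex_def
proof (intro conjI ballI subsetI)
  show "x \<in> V" if "x \<in> axis i" for x using that by (auto simp: axis_def)
  fix x y z assume xy: "x \<in> axis i" "y \<in> axis i" and z: "z \<in> seg x y"
  obtain m where m: "x = p i m" using xy(1) unfolding axis_def by (rule rangeE)
  obtain n where n: "y = p i n" using xy(2) unfolding axis_def by (rule rangeE)
  obtain k where "z = p i k" by (rule p_seg[OF z[unfolded m n]])
  then show "z \<in> axis i" by (simp add: axis_def)
qed

lemma r_pow_axis: "act (r i [^] (k :: int)) ` axis i = axis i"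
proof -
  have e: "act (r i [^] k) (p i n) = p i (n + 6640 * k)" for n using p_period by simp
  have "p i n \<in> act (r i [^] k) ` axis i" for n
    using e[of "n - 6640 * k"] by (intro image_eqI[of _ _ "p i (n - 6640 * k)"]) (auto simp: axis_def)
  then show ?thesis using e by (auto simp: axis_def)
qed

end

text \<open>The two paths use the same edges, so the representatives of these edges differ by
  discrepancies \<eta> in \<open>H\<close>, to which \<open>long_match\<close> applies. Where a
  discrepancy is trivial, comparing the representatives determines \<open>g\<close>.\<close>

lemma axis_match:
  assumes i: "i \<in> I" and j: "j \<in> I" and g: "g \<in> carrier M"
    and 1: "act g (p i m) = p j n" and 2: "act g (p i m') = p j n'" and len: "m + 600 \<le> m'"
  shows "i = j \<and> (\<exists>k::int. g = r i [^] k \<and> n = m + 6640 * k)"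
proof -
  define pos where "pos = (n \<le> n')"
  define \<epsilon> :: int where "\<epsilon> = (if pos then 1 else -1)"
  have dd: "\<bar>n - n'\<bar> = m' - m"
  proof -
    have "d (p j n) (p j n') = d (p i m) (p i m')" using 1[symmetric] 2[symmetric] act_dist[OF g] p_V[OF i] by simp
    then show ?thesis using p_dist_abs[OF j, of n n'] p_dist_abs[OF i, of m m'] len by linarith
  qed
  have match: "act g (p i (m + t)) = p j (n + \<epsilon> * t)" if t: "0 \<le> t" "t \<le> 600" for t
  proof (rule seg_unique[of "p j n" "p j n'"])
    show V: "p j n \<in> V" "p j n' \<in> V" "act g (p i (m + t)) \<in> V" "p j (n + \<epsilon> * t) \<in> V"
      using g p_V[OF i] p_V[OF j] by auto
    have dl: "d (p j n) (act g (p i (m + t))) = d (p i m) (p i (m + t))"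
      "d (act g (p i (m + t))) (p j n') = d (p i (m + t)) (p i m')"
      using 1[symmetric] 2[symmetric] act_dist[OF g] p_V[OF i] by simp_all
    have e: "int (d (p i m) (p i (m + t))) = t" "int (d (p i (m + t)) (p i m')) = m' - m - t"
      "int (d (p j n) (p j (n + \<epsilon> * t))) = t" "int (d (p j (n + \<epsilon> * t)) (p j n')) = m' - m - t"
      "int (d (p j n) (p j n')) = m' - m"
      using p_dist_abs[OF i] p_dist_abs[OF j] t len dd by (auto simp: \<epsilon>_def pos_def)
    show "d (p j n) (act g (p i (m + t))) + d (act g (p i (m + t))) (p j n') = d (p j n) (p j n')"
      "d (p j n) (p j (n + \<epsilon> * t)) + d (p j (n + \<epsilon> * t)) (p j n') = d (p j n) (p j n')"
      "d (p j n) (act g (p i (m + t))) = d (p j n) (p j (n + \<epsilon> * t))"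
      using dl e by linarith+
  qed
  \<comment> \<open>With reversed direction, the \<open>t\<close>-th edge lies between positions
    \<open>n - t\<close> and \<open>n - t + 1\<close>, and \<open>w\<close> indexes it by the larger
    one.\<close>
  define N where "N t = (if pos then n + t else n - t + 1)" for t
  define \<eta> where "\<eta> t = inv (w j (N t)) \<otimes> g \<otimes> w i (m + t)" for t
  have wc: "w i k \<in> carrier M" "w j k \<in> carrier M" for k using w_closed[OF i] w_closed[OF j] by auto
  have par: "even (m - n)"
  proof -
    have "pt (odd m) (g \<otimes> w i m) = pt (odd n) (w j n)" using 1 wc g by (simp add: p_def)
    then have "odd m = odd n" by (auto dest: arg_cong[where f=fst])
    then show ?thesis by auto
  qed
  have \<eta>F: "\<eta> t \<in> fac u" if "pt u (g \<otimes> w i (m + t)) = pt u (w j (N t))" for t u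
    using pt_eq_iff[of "w j (N t)" "g \<otimes> w i (m + t)" u u] that wc g by (simp add: \<eta>_def m_assoc)
  have \<eta>H: "\<eta> t \<in> H" if t: "1 \<le> t" "t \<le> 600" for t
  proof -
    have "pt (odd (m + t)) (g \<otimes> w i (m + t)) = act g (p i (m + t))" using wc g by (simp add: p_def)
    also have "\<dots> = p j (n + \<epsilon> * t)" using match t by simp
    also have "\<dots> = pt (odd (m + t)) (w j (N t))"
      using p_shift[OF j, of "n - t"] par by (auto simp: \<epsilon>_def N_def p_def)
    finally have a: "\<eta> t \<in> fac (odd (m + t))" by (rule \<eta>F)
    have "pt (odd (m + (t - 1))) (g \<otimes> w i (m + t)) = act g (p i (m + (t - 1)))"
      using wc g p_shift[OF i, of "m + (t - 1)"] by (simp add: algebra_simps)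
    also have "\<dots> = p j (n + \<epsilon> * (t - 1))" using match[of "t - 1"] t by simp
    also have "\<dots> = pt (odd (m + (t - 1))) (w j (N t))"
      using p_shift[OF j, of "n + (t - 1)"] par by (auto simp: \<epsilon>_def N_def p_def algebra_simps)
    finally have "\<eta> t \<in> fac (odd (m + (t - 1)))" by (rule \<eta>F)
    then have "\<eta> t \<in> fac (\<not> odd (m + t))" by simp
    then show ?thesis using a H_fac by blast
  qed
  have lc: "letter i k \<in> carrier M" "letter j k \<in> carrier M" for k using letter_carrier i j by auto
  have eq: "letter i (m + t) = inv (\<eta> t) \<otimes> (if pos then letter j (n + t) else inv (letter j (n - t))) \<otimes> \<eta> (t + 1)" for t
  proof -
    have wi: "w i (m + (t + 1)) = w i (m + t) \<otimes> letter i (m + t)" using w_step[OF i, of "m + t"] by (simp add: add.assoc)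
    show ?thesis
    proof (cases pos)
      case True
      then have "w j (N (t + 1)) = w j (N t) \<otimes> letter j (n + t)" using w_step[OF j, of "n + t"] by (simp add: N_def add.assoc)
      then show ?thesis using True wi wc lc g by (simp add: \<eta>_def inv_mult_group m_assoc)
    next
      case False
      then have "w j (N t) = w j (N (t + 1)) \<otimes> letter j (n - t)" using w_step[OF j, of "n - t"] by (simp add: N_def)
      then show ?thesis using False wi wc lc g by (simp add: \<eta>_def inv_mult_group m_assoc)
    qed
  qed
  obtain k t where ij: "i = j" "pos" and k: "n = m + 6640 * k" and t: "\<eta> t = \<one>"
    using long_match[of i j m n \<eta> pos, OF i j par \<eta>H] eq by blast
  have "w j (N t) = g \<otimes> w i (m + t)"
  proof -
    have "w j (N t) \<otimes> \<eta> t = g \<otimes> w i (m + t)" using wc g by (simp add: \<eta>_def m_assoc)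
    then show ?thesis using t wc by simp
  qed
  moreover have "w j (N t) = r i [^] k \<otimes> w i (m + t)"
    using w_period[OF i, of "m + t" k] ij k by (simp add: N_def algebra_simps)
  ultimately have "g = r i [^] k" using wc g i by (metis int_pow_closed r_closed right_cancel)
  then show ?thesis using ij k by blast
qed

definition axes :: "(bool \<times> 'a set) set set" where
  "axes = {act g ` axis i | g i. g \<in> carrier M \<and> i \<in> I}"

lemma axis_V': "i \<in> I \<Longrightarrow> axis i \<subseteq> V"
  by (auto simp: axis_def)

lemma axes_cases:
  assumes "A \<in> axes" obtains g i where "g \<in> carrier M" "i \<in> I" "A = act g ` axis i"
  using assms by (auto simp: axes_def)

text \<open>After a translation, \<open>axis_match\<close> shows that the axes differ by a power of
  \<open>r i\<close>, which preserves the axis.\<close>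

lemma axes_overlap:
  assumes A: "A \<in> axes" "B \<in> axes" and x: "x \<in> A \<inter> B" and y: "y \<in> A \<inter> B" and far: "600 < d x y"
  shows "A = B"
proof -
  obtain g i where g: "g \<in> carrier M" "i \<in> I" "A = act g ` axis i" using A axes_cases by blast
  obtain f j where f: "f \<in> carrier M" "j \<in> I" "B = act f ` axis j" using A axes_cases by blast
  have pts: "\<exists>m. z = act g (p i m)" "\<exists>n. z = act f (p j n)" if "z \<in> A \<inter> B" for z
    using that g f unfolding axis_def by blast+
  obtain m n where x': "x = act g (p i m)" "x = act f (p j n)" using pts[OF x] by metis
  obtain m' n' where y': "y = act g (p i m')" "y = act f (p j n')" using pts[OF y] by metis
  note pV = p_V[OF g(2)] p_V[OF f(2)]
  define e where "e = inv f \<otimes> g"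
  have e: "e \<in> carrier M" using f g by (simp add: e_def)
  have ex: "act e (p i m) = p j n" "act e (p i m') = p j n'"
    using f g pV unfolding e_def by (simp_all add: act_mult flip: x'(1) y'(1)) (simp_all add: x'(2) y'(2))
  have "d (p i m) (p i m') = d x y" using x' y' g pV by simp
  then have "\<bar>m - m'\<bar> > 600" using far p_dist_abs[OF g(2), of m m'] by linarith
  then have "i = j \<and> (\<exists>k::int. e = r i [^] k)"
    using axis_match[OF g(2) f(2) e ex(1,2)] axis_match[OF g(2) f(2) e ex(2,1)] by (cases "m \<le> m'") auto
  then obtain k :: int where k: "i = j" "e = r i [^] k" by blast
  have "g = f \<otimes> e" using f g by (simp add: e_def)
  then have "A = act f ` act e ` axis i" using g(3) act_image_mult[OF f(1) e axis_V'[OF g(2)]] by simp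
  then show ?thesis using k r_pow_axis[OF g(2)] f by simp
qed

text \<open>Two points of the axis at distance 600 and their images on the axis are exactly the data
  that \<open>axis_match\<close> needs.\<close>

lemma axis_stabilizer:
  assumes i: "i \<in> I" and s: "s \<in> carrier M" "act s ` axis i = axis i"
  shows "\<exists>k::int. s = r i [^] k"
proof -
  have "act s (p i 0) \<in> axis i" "act s (p i 600) \<in> axis i" using s(2) by (auto simp: axis_def)
  then obtain n n' where "act s (p i 0) = p i n" "act s (p i 600) = p i n'" by (auto simp: axis_def)
  then show ?thesis using axis_match[OF i i s(1), of 0 n 600 n'] by auto
qed

sublocale small_cancellation V d M act axes 6640 600
proof
  fix A B x y g s
  show "convex A" if "A \<in> axes"
    using that by (elim axes_cases) (simp add: act_convex axis_convex')
  show "A \<noteq> {}" if "A \<in> axes" using that by (elim axes_cases) (simp add: axis_def)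
  show "act g ` A \<in> axes" if g: "g \<in> carrier M" and A: "A \<in> axes"
  proof -
    obtain f i where f: "f \<in> carrier M" "i \<in> I" "A = act f ` axis i" using A by (rule axes_cases)
    then have "act g ` A = act (g \<otimes> f) ` axis i" using g axis_V' by (simp add: act_image_mult)
    then show ?thesis using f g unfolding axes_def by blast
  qed
  show "6640 \<le> d x (act s x)" if A: "A \<in> axes" "s \<in> carrier M" "act s ` A = A" "s \<noteq> \<one>" "x \<in> A"
  proof -
    obtain f i where f: "f \<in> carrier M" "i \<in> I" "A = act f ` axis i" using A(1) by (rule axes_cases)
    define s' where "s' = inv f \<otimes> s \<otimes> f"
    have s': "s' \<in> carrier M" using f A by (simp add: s'_def)
    note iV = axis_V'[OF f(2)]
    have "act s' ` axis i = act (inv f) ` act s ` act f ` axis i"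
      using f A iV by (simp add: s'_def act_image_mult act_image_sub)
    also have "\<dots> = axis i" using A f act_image_inv(1)[OF f(1) iV] by simp
    finally obtain k :: int where k: "s' = r i [^] k" using axis_stabilizer[OF f(2) s'] by blast
    have "k \<noteq> 0"
    proof
      assume "k = 0"
      then have "inv f \<otimes> s \<otimes> inv (inv f) = \<one>" using k f by (simp add: s'_def)
      then show False using conj_eq_one[of "inv f" s] A f by simp
    qed
    obtain n where n: "x = act f (p i n)" using A f by (auto simp: axis_def)
    have sf: "s \<otimes> f = f \<otimes> s'" using f A by (simp add: s'_def m_assoc)
    have pV: "p i n \<in> V" using p_V[OF f(2)] .
    have "act s x = act f (act s' (p i n))" using n sf f A s' pV by (simp flip: act_mult)
    also have "act s' (p i n) = p i (n + 6640 * k)" using k p_period[OF f(2)] by simp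
    finally have "d x (act s x) = d (p i n) (p i (n + 6640 * k))" using n f pV p_V[OF f(2)] by simp
    then have "int (d x (act s x)) = \<bar>6640 * k\<bar>" using p_dist_abs[OF f(2), of n "n + 6640 * k"] by simp
    then show ?thesis using \<open>k \<noteq> 0\<close> by linarith
  qed
  show "d x y \<le> 600" if "A \<in> axes" "B \<in> axes" "A \<noteq> B" "x \<in> A \<inter> B" "y \<in> A \<inter> B"
    using axes_overlap[OF that(1,2,4,5)] that(3) by force
  show "\<exists>s\<in>carrier M. act s ` A = A \<and> d y (act s x) = 6640 - d x y"
    if A: "A \<in> axes" "x \<in> A" "y \<in> A" "d x y \<le> 6640"
  proof -
    obtain f i where f: "f \<in> carrier M" "i \<in> I" "A = act f ` axis i" using A(1) by (rule axes_cases)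
    obtain m n where mn: "x = act f (p i m)" "y = act f (p i n)" using A f by (auto simp: axis_def)
    note pV = p_V[OF f(2)] and iV = axis_V'[OF f(2)]
    have dxy: "int (d x y) = \<bar>m - n\<bar>" using mn f pV p_dist_abs[OF f(2), of m n] by simp
    \<comment> \<open>Translate towards \<open>y\<close>, so that the image of \<open>x\<close>
      comes to lie at or beyond \<open>y\<close>.\<close>
    define k :: int where "k = (if m \<le> n then 1 else -1)"
    define s where "s = f \<otimes> r i [^] k \<otimes> inv f"
    have c: "r i [^] k \<in> carrier M" "s \<in> carrier M" using f by (auto simp: s_def)
    have "act s ` A = act f ` act (r i [^] k) ` act (inv f) ` act f ` axis i"
      using f c iV by (simp add: s_def act_image_mult act_image_sub)
    also have "\<dots> = A" using f act_image_inv(1)[OF f(1) iV] r_pow_axis[OF f(2)] by simp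
    finally have sA: "act s ` A = A" .
    have "act s x = act f (act (r i [^] k) (p i m))" using mn f c pV by (simp add: s_def act_mult)
    also have "act (r i [^] k) (p i m) = p i (m + 6640 * k)" using p_period[OF f(2)] by simp
    finally have "d y (act s x) = d (p i n) (p i (m + 6640 * k))" using mn f pV by simp
    then have "int (d y (act s x)) = \<bar>n - (m + 6640 * k)\<bar>" using p_dist_abs[OF f(2), of n] by simp
    also have "\<dots> = 6640 - int (d x y)" using A(4) dxy by (auto simp: k_def)
    finally show ?thesis using sA c A(4) by (intro bexI[of _ s]) auto
  qed
qed simp

end

section \<open>Stabilizers and displacements\<close>

context amalgam_decomposition begin

text \<open>\<open>k\<close> fixes the base vertex and its translate by \<open>g\<close>, hence the
  path between them. If they differ, conjugation along the first edge takes \<open>k\<close> into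
  \<open>H\<close>, and the letter \<open>l\<close> at the next vertex contradicts
  \<open>mal\<close>.\<close>

lemma fac_malnormal:
  assumes mal: "\<And>x g. \<lbrakk>x \<in> H; x \<noteq> \<one>; g \<in> fac (\<not> t); g \<notin> H\<rbrakk> \<Longrightarrow> inv g \<otimes> x \<otimes> g \<notin> H"
    and g: "g \<in> carrier M" and k: "k \<in> fac t" "k \<noteq> \<one>" "inv g \<otimes> k \<otimes> g \<in> fac t"
  shows "g \<in> fac t"
proof (rule ccontr)
  assume ng: "g \<notin> fac t"
  let ?v = "pt t \<one>" and ?w = "pt t g"
  have kc: "k \<in> carrier M" using k fac_carrier by blast
  have V: "?v \<in> V" "?w \<in> V" using g by auto
  have fixv: "act k ?v = ?v" "act k ?w = ?w" using k kc g by (auto simp: stab_pt simp del: act_pt)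
  obtain q where q: "rwalk q" "hd q = ?v" "last q = ?w" using rwalk_ex[OF V] by blast
  then obtain cs where cs: "q = trace t \<one> cs" "typed (fac t) (fac (\<not> t)) cs" "set (tl cs) \<inter> H = {}"
    using rwalk_is_trace[of q t \<one>] by auto
  have csC: "set cs \<subseteq> carrier M" using typed_carrier cs(2) .
  have eq: "pt t g = pt (t = even (length cs)) (word_prod M cs)"
    using last_trace[of \<one> cs t] csC cs q by simp
  have e: "even (length cs)" using arg_cong[OF eq, of fst] by auto
  have "g \<in> fac t" if w: "word_prod M cs \<in> fac t"
  proof -
    have "inv g \<otimes> word_prod M cs \<in> fac t" using eq g csC by (simp add: pt_eq_iff)
    then have "word_prod M cs \<otimes> inv (inv g \<otimes> word_prod M cs) \<in> fac t"
      using fac_closed(3)[OF w fac_closed(2)] by blast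
    then show "g \<in> fac t" using g csC by (simp add: inv_mult_group)
  qed
  then have "cs \<noteq> []" using ng fac_closed(1) by auto
  then obtain c l ds where c: "cs = c # l # ds" using e by (cases cs; cases "tl cs") auto
  have cl: "c \<in> fac t" "l \<in> fac (\<not> t)" "l \<notin> H" "c \<in> carrier M" "l \<in> carrier M" using cs csC c by auto
  have fixq: "act k x = x" if x: "x \<in> set q" for x
  proof -
    obtain xs ys where xy: "q = xs @ x # ys" using x by (meson split_list)
    have "x \<in> seg (hd (xs @ [x])) (last (x # ys))" using rwalk_seg q(1) xy by blast
    moreover have "hd (xs @ [x]) = ?v" using q(2) xy by (cases xs) auto
    moreover have "last (x # ys) = ?w" using q(3) xy by simp
    ultimately have s: "x \<in> seg ?v ?w" by simp
    then have xV: "x \<in> V" using segD by blast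
    have s': "act k x \<in> seg ?v ?w" using act_seg_iff[OF kc V xV] fixv s by simp
    have "d ?v (act k x) = d ?v x" using act_dist[OF kc V(1) xV] fixv by simp
    then show ?thesis using seg_unique[OF V _ xV segD(1)[OF s'] segD(1)[OF s]] act_closed[OF kc xV] by simp
  qed
  have "pt (\<not> t) c \<in> set q" "pt t (c \<otimes> l) \<in> set q"
  proof -
    have "q = pt t \<one> # pt (\<not> t) c # trace t (c \<otimes> l) ds" using cs c cl by simp
    then show "pt (\<not> t) c \<in> set q" "pt t (c \<otimes> l) \<in> set q"
      using trace_simps(1,2)[of t "c \<otimes> l" ds] list.set_sel(1)[of "trace t (c \<otimes> l) ds"] by auto
  qed
  then have f: "inv c \<otimes> k \<otimes> c \<in> fac (\<not> t)" "inv (c \<otimes> l) \<otimes> k \<otimes> (c \<otimes> l) \<in> fac t"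
    using fixq[of "pt (\<not> t) c"] fixq[of "pt t (c \<otimes> l)"] stab_pt[OF kc, of c] stab_pt[OF kc, of "c \<otimes> l"] cl
    by (simp_all only: m_closed)
  let ?x = "inv c \<otimes> k \<otimes> c"
  have "?x \<in> fac t" using cl k by (intro fac_closed)
  then have xH: "?x \<in> H" using f H_fac by blast
  have "?x \<noteq> \<one>" using conj_eq_one[of "inv c" k] cl kc k by auto
  then have "inv l \<otimes> ?x \<otimes> l \<notin> H" using mal xH cl by blast
  moreover have "inv l \<otimes> ?x \<otimes> l \<in> fac t" using f(2) cl kc by (simp add: inv_mult_group m_assoc)
  moreover have "inv l \<otimes> ?x \<otimes> l \<in> fac (\<not> t)" by (intro fac_closed(3) fac_closed(2)[OF cl(2)] f(1) cl(2))
  ultimately show False using H_fac by blast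
qed

lemma displacement_mult:
  assumes "g \<in> carrier M" "f \<in> carrier M" "v \<in> V"
  shows "d v (act (g \<otimes> f) v) \<le> d v (act g v) + d v (act f v)"
proof -
  have "d v (act (g \<otimes> f) v) \<le> d v (act g v) + d (act g v) (act (g \<otimes> f) v)"
    by (rule d_tri) (use assms in auto)
  then show ?thesis using assms by (simp add: act_mult)
qed

text \<open>An element of a factor fixes one of the two ends of the base edge.\<close>

lemma displacement_factor: assumes "x \<in> K \<union> L" shows "d (pt t \<one>) (act x (pt t \<one>)) \<le> 2"
proof -
  obtain u where u: "x \<in> fac u" using assms fac_def by (metis UnE)
  have x: "x \<in> carrier M" using fac_carrier u .
  have e: "pt u x = pt u \<one>" using pt_mult[of \<one> x u] u x by simp
  have E: "E (pt t g) (pt (\<not> t) g)" if "g \<in> carrier M" for g t using that unfolding E_def by blast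
  show ?thesis
  proof (cases "u = t")
    case True
    then show ?thesis using e x by simp
  next
    case False
    then have t: "u = (\<not> t)" by simp
    have "d (pt t \<one>) (pt t x) \<le> d (pt t \<one>) (pt u \<one>) + d (pt u \<one>) (pt t x)"
      by (rule d_tri) (use x in auto)
    moreover have "d (pt t \<one>) (pt u \<one>) = 1" using d_adjacent E[of \<one> t] t by simp
    moreover have "d (pt u \<one>) (pt t x) = 1" using d_adjacent E_sym[OF E[of x t]] t x e by simp
    ultimately show ?thesis using x by simp
  qed
qed

lemma displacement_word:
  "set ws \<subseteq> K \<union> L \<Longrightarrow> d (pt t \<one>) (act (word_prod M ws) (pt t \<one>)) \<le> 2 * length ws"
proof (induction ws)
  case (Cons x ws)
  have c: "x \<in> carrier M" "set ws \<subseteq> carrier M" using Cons.prems K_carrier L_carrier by auto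
  then have "d (pt t \<one>) (act (word_prod M (x # ws)) (pt t \<one>)) \<le> 
      d (pt t \<one>) (act x (pt t \<one>)) + d (pt t \<one>) (act (word_prod M ws) (pt t \<one>))"
    using displacement_mult[of x "word_prod M ws" "pt t \<one>"] by (simp del: act_pt)
  then show ?case using Cons displacement_factor[of x t] by simp
qed simp

end

context relator_family begin

text \<open>A word of 100 letters moves the base vertex by at most 200, far below \<open>c\<close>,
  which is 4838 here.\<close>

lemma short_word:
  assumes "set ws \<subseteq> K \<union> L" "length ws \<le> 100" "word_prod M ws \<in> relator_group"
  shows "word_prod M ws = \<one>"
proof (rule short_trivial[OF assms(3), of "pt True \<one>"])
  show "d (pt True \<one>) (act (word_prod M ws) (pt True \<one>)) < c"
    using displacement_word[OF assms(1), of True] assms(2) by (simp add: c_def)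
qed simp

lemma relator_malnormal:
  assumes mal: "\<And>x g. \<lbrakk>x \<in> H; x \<noteq> \<one>; g \<in> fac (\<not> t); g \<notin> H\<rbrakk> \<Longrightarrow> inv g \<otimes> x \<otimes> g \<notin> H"
    and g: "g \<in> carrier M" and k: "k \<in> fac t" "k \<noteq> \<one>" "k' \<in> fac t"
    and rel: "(inv g \<otimes> k \<otimes> g) \<otimes> inv k' \<in> relator_group"
  shows "\<exists>n\<in>relator_group. g \<otimes> n \<in> fac t"
proof -
  have stab: "act x (pt t \<one>) = pt t \<one> \<longleftrightarrow> x \<in> fac t" if "x \<in> carrier M" for x
    using stab_pt[OF that, of \<one> t] that by simp
  have c: "k \<in> carrier M" "k' \<in> carrier M" using k fac_carrier by auto
  have "\<exists>n\<in>relator_group. act (g \<otimes> n) (pt t \<one>) = pt t \<one>"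
  proof (rule vertex_stabilizer_malnormal_mod[OF _ g c(1) _ k(2) c(2) _ rel])
    show "act f (pt t \<one>) = pt t \<one>" if f: "f \<in> carrier M" "l \<in> carrier M" "act l (pt t \<one>) = pt t \<one>" "l \<noteq> \<one>"
      "act (inv f \<otimes> l \<otimes> f) (pt t \<one>) = pt t \<one>" for f l
    proof -
      have "l \<in> fac t" "inv f \<otimes> l \<otimes> f \<in> fac t" using f stab by (simp_all del: act_pt)
      then have "f \<in> fac t" using fac_malnormal[OF mal f(1)] f(4) by blast
      then show ?thesis using stab f(1) by blast
    qed
  qed (use stab c k in \<open>simp_all del: act_pt\<close>)
  then show ?thesis using stab g relator_group_carrier by (metis m_closed)
qed

text \<open>An element with a fixed vertex is conjugate into a factor, where \<open>tf\<close>
  applies.\<close>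

lemma relator_torsion:
  assumes tf: "\<And>x (n::nat) t. x \<in> fac t \<Longrightarrow> 0 < n \<Longrightarrow> x [^] n = \<one> \<Longrightarrow> x = \<one>"
    and g: "g \<in> carrier M" and k: "g [^] (k::nat) \<in> relator_group" "0 < k"
  shows "g \<in> relator_group"
proof (rule torsion_mod[OF g k])
  show "even (d x (act f x))" if "f \<in> carrier M" "x \<in> V" for f x
    using that d_parity by simp
  show "V \<noteq> {}" using pt_V by blast
  show "f = \<one>" if f: "f \<in> carrier M" "x \<in> V" "act f x = x" "0 < n" "f [^] n = \<one>" for f x and n :: nat
  proof -
    obtain u where u: "u \<in> carrier M" "x = pt (fst x) u" using f(2) by (rule V_cases)
    then have fac: "inv u \<otimes> f \<otimes> u \<in> fac (fst x)" using stab_pt f by metis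
    have "(inv u \<otimes> f \<otimes> u) [^] m = inv u \<otimes> f [^] m \<otimes> u" for m :: nat
      by (induction m) (use u f in \<open>simp_all add: m_assoc\<close>)
    then have "(inv u \<otimes> f \<otimes> u) [^] n = \<one>" using f u by simp
    then have "inv u \<otimes> f \<otimes> u = \<one>" using tf fac f(4) by blast
    then show "f = \<one>" using conj_eq_one[of "inv u" f] u f by simp
  qed
qed

end

section \<open>Canonical forms as geodesics\<close>

context amalgam_decomposition begin

lemma canonical_typed:
  assumes "canonical H K L ws" "1 < length ws"
  obtains t where "typed (fac t) (fac (\<not> t)) ws" "set ws \<inter> H = {}"
proof -
  have c: "set ws \<subseteq> K \<union> L" "\<And>i. i < length ws \<Longrightarrow> ws ! i \<notin> H"
    "\<And>i. i + 1 < length ws \<Longrightarrow> ws ! i \<in> K \<longleftrightarrow> ws ! (i + 1) \<in> L"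
    using assms by (auto simp: canonical_def simp del: Int_iff)
  have "typed (fac t) (fac (\<not> t)) ws" if "hd ws \<in> fac t" "ws \<noteq> []" for t
    using c that
  proof (induction ws arbitrary: t)
    case (Cons x ws)
    show ?case
    proof (cases ws)
      case Nil
      then show ?thesis using Cons by simp
    next
      case (Cons y us)
      have x: "x \<in> fac t" "x \<notin> H" using Cons.prems(2)[of 0] Cons.prems(4) by (simp_all del: Int_iff)
      have xy: "x \<in> K \<longleftrightarrow> y \<in> L" "y \<in> K \<union> L" using Cons.prems(3)[of 0] Cons.prems(1) Cons by auto
      have yH: "y \<notin> H" using Cons.prems(2)[of 1] Cons by (simp del: Int_iff)
      have "y \<in> fac (\<not> t)" using x xy yH by (auto simp: fac_def split: if_splits)
      then have "typed (fac (\<not> t)) (fac (\<not> \<not> t)) ws"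
      proof (intro Cons.IH)
        show "set ws \<subseteq> K \<union> L" using Cons.prems(1) by auto
        show "ws ! i \<notin> H" if "i < length ws" for i using Cons.prems(2)[of "Suc i"] that by (simp del: Int_iff)
        show "ws ! i \<in> K \<longleftrightarrow> ws ! (i + 1) \<in> L" if "i + 1 < length ws" for i
          using Cons.prems(3)[of "Suc i"] that by simp
      qed (use Cons in auto)
      then show ?thesis using x by simp
    qed
  qed simp
  moreover have ne: "ws \<noteq> []" "hd ws \<in> K \<union> L" using assms(2) c(1) by (cases ws; auto)+
  moreover have "set ws \<inter> H = {}" using c(2) by (metis disjoint_iff in_set_conv_nth)
  moreover from ne have "hd ws \<in> fac True \<or> hd ws \<in> fac False" by (auto simp: fac_def)
  ultimately show ?thesis using that by metis
qed

lemma typed_fac_append: "typed (fac t) (fac (\<not> t)) (us @ vs) \<longleftrightarrow> typed (fac t) (fac (\<not> t)) us \<and>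
    typed (fac (t = even (length us))) (fac (\<not> (t = even (length us)))) vs"
  by (cases t; cases "even (length us)") (simp_all add: typed_append)

lemma typed_canonical:
  assumes "typed (fac t) (fac (\<not> t)) ws" "set ws \<inter> H = {}" "1 < length ws"
  shows "canonical H K L ws"
proof -
  have nth: "ws ! i \<in> fac (t = even i)" if "i < length ws" for i
    using assms(1) that
  proof (induction ws arbitrary: t i)
    case (Cons x ws)
    have "((\<not> t) = even j) = (t = odd j)" for j :: nat by blast
    then show ?case using Cons.prems Cons.IH[of "\<not> t" "i - 1"] by (cases i) auto
  qed simp
  have "set ws \<subseteq> K \<union> L" using typed_set[OF assms(1)] by (auto simp: fac_def split: if_splits)
  moreover have nH: "ws ! i \<notin> H" if "i < length ws" for i using assms(2) nth_mem[OF that] by blast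
  moreover have "ws ! i \<in> K \<longleftrightarrow> ws ! (i + 1) \<in> L" if "i + 1 < length ws" for i
    using nth[of i] nth[of "i + 1"] nH[of i] nH[of "i + 1"] that by (auto simp: fac_def split: if_splits)
  ultimately show ?thesis using assms(3) by (auto simp: canonical_def simp del: Int_iff)
qed

lemma typed_rev_inv:
  assumes "typed (fac t) (fac (\<not> t)) ws"
  shows "typed (fac (t = odd (length ws))) (fac (t = even (length ws))) (rev (map (m_inv M) ws))"
  using assms
proof (induction ws arbitrary: t)
  case (Cons x ws)
  have e: "((\<not> t) = odd n) = (t = even n)" "((\<not> t) = even n) = (t = odd n)" for n :: nat by blast+
  have "typed (fac (t = even (length ws))) (fac (t = odd (length ws))) (rev (map (m_inv M) ws))"
    using Cons.IH[of "\<not> t"] Cons.prems by (simp add: e)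
  then show ?case using Cons.prems fac_closed(2)[of x t] by (auto simp: typed_append)
qed simp

lemma inv_notin_H: "x \<in> carrier M \<Longrightarrow> x \<notin> H \<Longrightarrow> inv x \<notin> H"
  using H_closed(2)[of "inv x"] by auto

lemma map_inv_H: "set ws \<subseteq> carrier M \<Longrightarrow> set ws \<inter> H = {} \<Longrightarrow> set (map (m_inv M) ws) \<inter> H = {}"
proof -
  assume a: "set ws \<subseteq> carrier M" "set ws \<inter> H = {}"
  have "inv x \<notin> H" if "x \<in> set ws" for x using inv_notin_H[of x] a that by blast
  then show ?thesis unfolding set_map by blast
qed

text \<open>If the first letters came from different factors, the inverse of \<open>us\<close>
  followed by \<open>vs\<close> would be a reduced word, whose product is not in
  \<open>H\<close>.\<close>

lemma same_start:
  assumes us: "typed (fac t) (fac (\<not> t)) us" "set us \<inter> H = {}" "us \<noteq> []"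
    and vs: "typed (fac u) (fac (\<not> u)) vs" "set vs \<inter> H = {}" "vs \<noteq> []"
    and eq: "inv (word_prod M us) \<otimes> word_prod M vs \<in> H"
  shows "t = u"
proof (rule ccontr)
  assume "t \<noteq> u"
  then have u: "u = (\<not> t)" by blast
  have C: "set us \<subseteq> carrier M" "set vs \<subseteq> carrier M" using typed_carrier us vs by blast+
  let ?ws = "rev (map (m_inv M) us) @ vs"
  let ?s = "t = odd (length us)"
  have e: "(t = even (length us)) = (\<not> ?s)" "(?s = even (length us)) = u" using u by blast+
  have "length (rev (map (m_inv M) us)) = length us" by simp
  then have "typed (fac ?s) (fac (\<not> ?s)) ?ws"
    unfolding typed_fac_append using typed_rev_inv[OF us(1)] vs(1) by (simp only: e)
  moreover have "set ?ws \<inter> H = {}" using map_inv_H[OF C(1) us(2)] vs(2) by auto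
  ultimately have "word_prod M ?ws \<notin> fac (\<not> ?s)"
    using reduced_fac[of "\<not> ?s" ?ws] us(3) by simp
  moreover have "word_prod M ?ws = inv (word_prod M us) \<otimes> word_prod M vs"
  proof -
    have "set (rev (map (m_inv M) us)) \<subseteq> carrier M" using C(1) by auto
    then show ?thesis using C inv_word_prod[OF C(1)] by (simp add: word_prod_app)
  qed
  ultimately show False using eq H_fac[of "word_prod M ?ws" "\<not> ?s"] by simp
qed

lemma wcr_inv:
  assumes "weakly_cyclically_reduced M H K L x" "x \<in> carrier M"
  shows "weakly_cyclically_reduced M H K L (inv x)"
proof -
  obtain gs where gs: "x \<noteq> \<one>" "canonical H K L gs" "word_prod M gs = x"
    "length gs = 1 \<or> even (length gs) \<or> last gs \<otimes> hd gs \<notin> H"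
    using assms by (auto simp: weakly_cyclically_reduced_def simp del: Int_iff)
  let ?hs = "rev (map (m_inv M) gs)"
  have C: "set gs \<subseteq> carrier M" using gs(2) K_carrier L_carrier by (auto simp: canonical_def)
  have "canonical H K L ?hs"
  proof (cases "length gs = 1")
    case True
    then obtain g where "gs = [g]" by (cases gs) auto
    then show ?thesis using gs(2) fac_closed(2)[of g True] fac_closed(2)[of g False]
      by (auto simp: canonical_def fac_def)
  next
    case False
    then have l: "1 < length gs" using gs(2) by (auto simp: canonical_def)
    then obtain t where t: "typed (fac t) (fac (\<not> t)) gs" "set gs \<inter> H = {}" using canonical_typed gs(2) by blast
    let ?s = "t = odd (length gs)"
    have e: "(t = even (length gs)) = (\<not> ?s)" by blast
    show ?thesis
      by (rule typed_canonical[OF typed_rev_inv[OF t(1), unfolded e]]) (use map_inv_H[OF C t(2)] l in simp_all)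
  qed
  moreover have "word_prod M ?hs = inv x" using inv_word_prod[OF C] gs(3) by simp
  moreover have "length ?hs = 1 \<or> even (length ?hs) \<or> last ?hs \<otimes> hd ?hs \<notin> H"
  proof -
    have "gs \<noteq> []" using gs(2) by (auto simp: canonical_def)
    then have "last ?hs = inv (hd gs)" "hd ?hs = inv (last gs)" "hd gs \<in> carrier M" "last gs \<in> carrier M"
      using C by (auto simp: last_rev hd_rev hd_map last_map)
    then show ?thesis using gs(4) inv_notin_H[of "last gs \<otimes> hd gs"] by (auto simp: inv_mult_group simp del: Int_iff)
  qed
  moreover have "inv x \<noteq> \<one>" using gs(1) assms(2) by (metis inv_inv inv_one)
  ultimately show ?thesis unfolding weakly_cyclically_reduced_def by blast
qed

text \<open>The statement about \<open>x \<otimes> x\<close> forces the base vertex onto the axis of \<open>x\<close>.\<close>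

lemma wcr_straight:
  assumes "weakly_cyclically_reduced M H K L x" and x: "x \<in> carrier M" and no_fix: "\<And>t. x \<notin> fac t"
  obtains t gs where "typed (fac t) (fac (\<not> t)) gs" "set gs \<inter> H = {}" "gs \<noteq> []" "word_prod M gs = x"
    "d (pt t \<one>) (act (x \<otimes> x) (pt t \<one>)) = 2 * d (pt t \<one>) (act x (pt t \<one>))"
proof -
  obtain gs where gs: "canonical H K L gs" "word_prod M gs = x"
    "length gs = 1 \<or> even (length gs) \<or> last gs \<otimes> hd gs \<notin> H"
    using assms(1) by (auto simp: weakly_cyclically_reduced_def simp del: Int_iff)
  have C: "set gs \<subseteq> carrier M" using gs(1) K_carrier L_carrier by (auto simp: canonical_def)
  have "length gs \<noteq> 1"
  proof
    assume "length gs = 1"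
    then obtain g where "gs = [g]" by (cases gs) auto
    then have "x \<in> K \<union> L" using gs(1,2) C by (auto simp: canonical_def)
    then show False using no_fix[of True] no_fix[of False] by (auto simp: fac_def)
  qed
  then have l: "1 < length gs" using gs(1) by (auto simp: canonical_def)
  obtain t where t: "typed (fac t) (fac (\<not> t)) gs" "set gs \<inter> H = {}" using canonical_typed[OF gs(1) l] .
  have dist: "d (pt t \<one>) (pt t (word_prod M us)) = length us"
    if us: "typed (fac t) (fac (\<not> t)) us" "set us \<inter> H = {}" "even (length us)" for us
  proof -
    have U: "set us \<subseteq> carrier M" using typed_carrier us(1) .
    have tl: "set (tl us) \<inter> H = {}" using us(2) by (cases us) auto
    show ?thesis
      by (rule d_eqI[OF rwalk_trace[OF one_closed us(1) tl]]) (use last_trace[OF one_closed U, of t] us(3) U in simp_all)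
  qed
  show ?thesis
  proof (cases "even (length gs)")
    case True
    have "typed (fac t) (fac (\<not> t)) (gs @ gs)" using t True by (simp add: typed_append)
    then have "d (pt t \<one>) (pt t (x \<otimes> x)) = 2 * length gs"
      using dist[of "gs @ gs"] t gs(2) C by (simp add: word_prod_app)
    moreover have "d (pt t \<one>) (pt t x) = length gs" using dist[OF t True] gs by simp
    ultimately show ?thesis using that[OF t _ gs(2)] l x by fastforce
  next
    case False
    obtain c ks z where k: "gs = c # ks @ [z]" using l by (cases gs; cases "tl gs" rule: rev_cases) auto
    have odd: "odd (length ks)" using False k by simp
    have zc: "z \<otimes> c \<notin> H" using gs(3) False l k by (simp del: Int_iff)
    have ty: "c \<in> fac t" "typed (fac (\<not> t)) (fac t) ks" "z \<in> fac t"
      using t(1) odd k by (auto simp: typed_append)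
    have cC: "c \<in> carrier M" "z \<in> carrier M" "set ks \<subseteq> carrier M" using C k by auto
    let ?P = "word_prod M (c # ks)"
    have P: "?P \<in> carrier M" "?P \<otimes> z = x" using cC gs(2) k by (auto simp: word_prod_app m_assoc)
    have e1: "pt t x = pt t ?P" using pt_mult[OF P(1) ty(3)] P(2) by simp
    have "d (pt t \<one>) (pt t ?P) = length (c # ks)"
      by (rule dist) (use ty t(2) k odd in auto)
    then have 1: "d (pt t \<one>) (pt t x) = length (c # ks)" using e1 by simp
    \<comment> \<open>For odd length, \<open>z\<close> and \<open>c\<close> meet in the square and
      merge to one letter outside \<open>H\<close>; the final \<open>z\<close> lies in
      \<open>fac t\<close> and does not move the end vertex.\<close>
    have "d (pt t \<one>) (pt t (word_prod M (c # ks @ (z \<otimes> c) # ks))) = length (c # ks @ (z \<otimes> c) # ks)"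
    proof (rule dist)
      show "typed (fac t) (fac (\<not> t)) (c # ks @ (z \<otimes> c) # ks)"
        using ty odd fac_closed(3)[OF ty(3,1)] by (simp add: typed_append)
    qed (use t(2) k zc odd in auto)
    moreover have "word_prod M (c # ks @ (z \<otimes> c) # ks) = x \<otimes> ?P"
      using cC P(2)[symmetric] by (simp add: word_prod_app m_assoc)
    moreover have "pt t (x \<otimes> ?P) = pt t (x \<otimes> x)"
      using pt_mult[of "x \<otimes> ?P" z t] P x ty(3) cC(2) by (simp add: m_assoc)
    ultimately have "d (pt t \<one>) (pt t (x \<otimes> x)) = 2 * d (pt t \<one>) (pt t x)" using 1 by simp
    then show ?thesis using that[OF t _ gs(2)] l x by fastforce
  qed
qed

text \<open>Prefixes of a reduced word mark the successive vertices of a geodesic; parity determines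
  their types.\<close>

lemma trace_geodesic:
  assumes ty: "typed (fac t) (fac (\<not> t)) vs" "set vs \<inter> H = {}" and k: "k \<le> length vs"
    and m: "m \<le> length vs" "k \<le> m" 
  shows "d (pt t \<one>) (pt (t = even k) (word_prod M (take k vs))) = k"
    "pt (t = even k) (word_prod M (take k vs)) \<in> seg (pt t \<one>) (pt (t = even m) (word_prod M (take m vs)))"
proof -
  have sub: "typed (fac t) (fac (\<not> t)) (take n vs)" "set (take n vs) \<subseteq> carrier M" "set (tl (take n vs)) \<inter> H = {}" for n
  proof -
    show 1: "typed (fac t) (fac (\<not> t)) (take n vs)"
      using ty(1) typed_append[of _ _ "take n vs" "drop n vs"] by simp
    show "set (take n vs) \<subseteq> carrier M" by (rule typed_carrier[OF 1])
    have "set (tl (take n vs)) \<subseteq> set vs" by (cases n; cases vs) (auto dest: in_set_takeD)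
    then show "set (tl (take n vs)) \<inter> H = {}" using ty(2) by auto
  qed
  have r: "rwalk (trace t \<one> (take n vs))" for n by (rule rwalk_trace[OF one_closed sub(1,3)])
  have dist: "d (pt t \<one>) (pt (t = even n) (word_prod M (take n vs))) = n" if "n \<le> length vs" for n
    by (rule d_eqI[OF r[of n]]) (use last_trace[OF one_closed sub(2), of t n] sub(2)[of n] that in simp_all)
  show "d (pt t \<one>) (pt (t = even k) (word_prod M (take k vs))) = k" using dist k by blast
  let ?x = "pt (t = even k) (word_prod M (take k vs))" and ?y = "pt (t = even m) (word_prod M (take m vs))"
  let ?u = "t = even k" and ?ws = "take (m - k) (drop k vs)"
  have split: "take m vs = take k vs @ ?ws" using m(2) by (metis le_add_diff_inverse take_add)
  have tyw: "typed (fac ?u) (fac (\<not> ?u)) ?ws"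
    using sub(1)[of m] k unfolding split typed_append by (cases t; cases "even k") simp_all
  have W: "set ?ws \<subseteq> carrier M" using typed_carrier[OF tyw] .
  have "set (tl ?ws) \<subseteq> set ?ws" by (cases ?ws) auto
  also have "set ?ws \<subseteq> set vs" by (meson in_set_takeD in_set_dropD subsetI)
  finally have "set (tl ?ws) \<subseteq> set vs" .
  then have tl: "set (tl ?ws) \<inter> H = {}" using ty(2) by auto
  have "d ?x (pt (?u = even (m - k)) (word_prod M (take k vs) \<otimes> word_prod M ?ws)) = m - k"
    by (rule d_eqI[OF rwalk_trace[OF _ tyw tl, of "word_prod M (take k vs)"]])
      (use last_trace[OF _ W, of "word_prod M (take k vs)" ?u] sub(2)[of k] m k in simp_all)
  moreover have "(?u = even (m - k)) = (t = even m)" using m(2) by auto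
  moreover have "word_prod M (take k vs) \<otimes> word_prod M ?ws = word_prod M (take m vs)"
    unfolding split using sub(2)[of k] W by (simp add: word_prod_app)
  ultimately have "d ?x ?y = m - k" by simp
  then show "?x \<in> seg (pt t \<one>) ?y" using dist[OF k] dist[OF m(1)] m(2) sub(2)[of k] by (intro segI) simp_all
qed

end

context relator_family begin

section \<open>The condition \<open>C'\<close>\<close>

lemma pw_pairs: assumes i: "i \<in> I"
  shows "pw i (2 * m) = word_prod M (map (\<lambda>t. letter i (2 * int t) \<otimes> a i) [0..<m])"
proof (induction m)
  case 0
  then show ?case by (simp add: pw_def)
next
  case (Suc m)
  have c: "letter i n \<in> carrier M" "a i \<in> carrier M" for n using letter_carrier[OF i] data(2)[OF i] K_carrier by auto
  have "pw i (2 * Suc m) = pw i (2 * m) \<otimes> letter i (2 * int m) \<otimes> a i"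
    using pw_Suc[OF i, of "2 * m"] pw_Suc[OF i, of "Suc (2 * m)"] by (simp add: letter_odd)
  also have "\<dots> = word_prod M (map (\<lambda>t. letter i (2 * int t) \<otimes> a i) [0..<m]) \<otimes> (letter i (2 * int m) \<otimes> a i)"
    using Suc pw_closed[OF i, of "2 * m"] c by (simp add: m_assoc)
  also have "\<dots> = word_prod M (map (\<lambda>t. letter i (2 * int t) \<otimes> a i) [0..<Suc m])"
    by (subst upt_Suc_append, simp, subst map_append, subst word_prod_app) (use c in auto)
  finally show ?case .
qed

text \<open>Of the positions below 3320 only 0 is a multiple of 3320, so the perturbation
  contributes the single factor \<open>inv (h i)\<close> in front.\<close>

lemma r_eq: assumes i: "i \<in> I"
  shows "r i = inv (h i) \<otimes> rho M (b i \<otimes> a i) (b' i \<otimes> a i)"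
proof -
  have u: "[0..<3320] = 0 # [1..<3320::nat]" using upt_conv_Cons[of 0 3320] by (simp del: upt_rec_numeral)
  have c: "h i \<in> carrier M" "a i \<in> carrier M" "\<beta> i t \<in> carrier M" for t
    using data(1,2)[OF i] H_carrier K_carrier \<beta>_L[OF i] L_carrier by blast+
  have dv: "\<not> 3320 dvd int t" if "t \<in> set [1..<3320]" for t
    using that zdvd_not_zless[of "int t" 3320] by auto
  have m: "map (\<lambda>t. letter i (2 * int t) \<otimes> a i) [1..<3320] = map (\<lambda>t. \<beta> i (int t) \<otimes> a i) [1..<3320]"
    by (rule map_cong) (use dv in \<open>auto simp: letter_even\<close>)
  have "r i = word_prod M (map (\<lambda>t. letter i (2 * int t) \<otimes> a i) [0..<3320])"
    using pw_pairs[OF i, of 3320] by (simp add: r_def del: upt_rec_numeral)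
  also have "\<dots> = inv (h i) \<otimes> (\<beta> i 0 \<otimes> a i) \<otimes> word_prod M (map (\<lambda>t. \<beta> i (int t) \<otimes> a i) [1..<3320])"
    unfolding u list.map word_prod_Cons m using letter_even[of i 0] c by (simp add: m_assoc del: upt_rec_numeral)
  also have "\<dots> = inv (h i) \<otimes> word_prod M (map (\<lambda>t. \<beta> i (int t) \<otimes> a i) [0..<3320])"
  proof -
    have "word_prod M (map (\<lambda>t. \<beta> i (int t) \<otimes> a i) [1..<3320]) \<in> carrier M"
      by (rule word_prod_closed) (use c in auto)
    then show ?thesis unfolding u list.map word_prod_Cons using c by (simp add: m_assoc del: upt_rec_numeral)
  qed
  also have "map (\<lambda>t. \<beta> i (int t) \<otimes> a i) [0..<3320] = rho_word (b i \<otimes> a i) (b' i \<otimes> a i)"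
    unfolding rho_word_map by (rule map_cong) (auto simp: \<beta>_def)
  finally show ?thesis by (simp add: rho_def)
qed

text \<open>An explicit symmetrized set containing the relators, hence an upper bound for the
  symmetric closure, which inherits \<open>C_prime\<close> from it.\<close>

definition conjugates :: "'a set" where
  "conjugates = {x \<in> carrier M. weakly_cyclically_reduced M H K L x \<and>
     (\<exists>g\<in>carrier M. \<exists>i\<in>I. \<exists>e\<in>{1, -1::int}. x = g \<otimes> r i [^] e \<otimes> inv g)}"

lemma r_wcr: assumes i: "i \<in> I" shows "weakly_cyclically_reduced M H K L (r i)"
proof -
  let ?gs = "map (\<lambda>k. letter i (int k)) [0..<6640]"
  have nH: "letter i n \<notin> H" for n using letter_fac(2)[OF i, of n] by (auto simp: fac_def split: if_splits)
  have ty: "typed (fac (odd m)) (fac (\<not> odd m)) (map (\<lambda>k. letter i (int k)) [m..<m + n])" for m n :: nat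
  proof (induction n arbitrary: m)
    case (Suc n)
    have "[m..<m + Suc n] = m # [Suc m..<Suc m + n]" by (simp add: upt_conv_Cons del: upt_Suc)
    then show ?case using Suc[of "Suc m"] letter_fac(1)[OF i, of "int m"] by (simp del: upt_Suc)
  qed simp
  have t0: "typed (fac False) (fac (\<not> False)) ?gs" using ty[of 0 6640] by (simp del: upt_rec_numeral)
  have H: "set ?gs \<inter> H = {}" using nH by auto
  have can: "canonical H K L ?gs" by (rule typed_canonical[OF t0 H]) (simp del: upt_rec_numeral)
  moreover have "word_prod M ?gs = r i" by (simp add: r_def pw_def del: upt_rec_numeral)
  moreover have "word_prod M ?gs \<noteq> \<one>"
    by (rule reduced[OF _ _ H]) (use t0 in \<open>simp_all add: fac_def del: upt_rec_numeral\<close>)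
  ultimately show ?thesis unfolding weakly_cyclically_reduced_def by (intro conjI exI[of _ ?gs]) (simp_all del: upt_rec_numeral)
qed

lemma r_conjugates: "i \<in> I \<Longrightarrow> r i \<in> conjugates"
  using r_wcr r_closed[of i] by (auto simp: conjugates_def intro!: bexI[of _ \<one>] bexI[of _ i])

lemma conjugates_inv: assumes "x \<in> conjugates" shows "inv x \<in> conjugates"
proof -
  obtain g i and e :: int where x: "x \<in> carrier M" "weakly_cyclically_reduced M H K L x" "g \<in> carrier M" "i \<in> I" "e \<in> {1, -1}"
    "x = g \<otimes> r i [^] e \<otimes> inv g" using assms unfolding conjugates_def by blast
  have ri: "r i \<in> carrier M" using r_closed x by blast
  have "inv x = g \<otimes> r i [^] (- e) \<otimes> inv g" using x ri by (simp add: inv_mult_group m_assoc int_pow_neg)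
  moreover have "- e \<in> {1, -1}" using x by auto
  moreover have "weakly_cyclically_reduced M H K L (inv x)" using wcr_inv x by blast
  moreover have "inv x \<in> carrier M" using x by simp
  ultimately show ?thesis unfolding conjugates_def using x(3,4) by blast
qed

lemma symmetrized_conjugates: "symmetrized M H K L conjugates"
  unfolding symmetrized_def
proof (intro conjI ballI impI)
  show "conjugates \<subseteq> carrier M" by (auto simp: conjugates_def)
  show "inv x \<in> conjugates" if "x \<in> conjugates" for x using conjugates_inv that .
  fix x y assume x: "x \<in> conjugates" and y: "y \<in> carrier M" "weakly_cyclically_reduced M H K L (inv y \<otimes> x \<otimes> y)"
  obtain g i and e :: int where g: "x \<in> carrier M" "g \<in> carrier M" "i \<in> I" "e \<in> {1, -1}"
    "x = g \<otimes> r i [^] e \<otimes> inv g" using x unfolding conjugates_def by blast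
  have ri: "r i \<in> carrier M" using r_closed g by blast
  have "inv y \<otimes> x \<otimes> y = (inv y \<otimes> g) \<otimes> r i [^] e \<otimes> inv (inv y \<otimes> g)"
    using g y ri by (simp add: inv_mult_group m_assoc)
  moreover have "inv y \<otimes> g \<in> carrier M" "inv y \<otimes> x \<otimes> y \<in> carrier M" using g y by auto
  ultimately show "inv y \<otimes> x \<otimes> y \<in> conjugates" unfolding conjugates_def using g(3,4) y(2) by blast
qed

lemma conjugate_axis:
  assumes x: "x = g \<otimes> r i [^] (e::int) \<otimes> inv g" "g \<in> carrier M" "i \<in> I"
    and v: "v \<in> act g ` axis i"
  obtains n where "v = act g (p i n)" "act x v = act g (p i (n + 6640 * e))"
proof -
  obtain n where n: "v = act g (p i n)" using v by (auto simp: axis_def)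
  have "act x v = act g (act (r i [^] e) (p i n))"
    using x n p_V[OF x(3)] r_closed[OF x(3)] by (simp add: act_mult)
  then show ?thesis using that n p_period[OF x(3)] by simp
qed

text \<open>Weak cyclic reducedness puts the base vertex on the axis of \<open>x\<close>; whichever
  canonical form was chosen, it then traces that axis.\<close>

lemma conjugate_canonical:
  assumes x: "x \<in> conjugates" and xg: "x = g \<otimes> r i [^] (e::int) \<otimes> inv g" "g \<in> carrier M" "i \<in> I" "e \<in> {1, -1}"
    and vs: "canonical H K L vs" "word_prod M vs = x"
  obtains t where "typed (fac t) (fac (\<not> t)) vs" "set vs \<inter> H = {}" "6640 \<le> length vs"
    "\<And>k. k < length vs \<Longrightarrow> pt (t = even k) (word_prod M (take k vs)) \<in> act g ` axis i \<inter> seg (pt t \<one>) (act x (pt t \<one>))"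
proof -
  let ?A = "act g ` axis i"
  have xc: "x \<in> carrier M" "weakly_cyclically_reduced M H K L x" using x by (auto simp: conjugates_def)
  have A: "?A \<in> axes" using xg unfolding axes_def by blast
  have ri: "r i [^] e \<in> carrier M" using r_closed[OF xg(3)] by simp
  have xA: "act x ` ?A = ?A"
  proof -
    have "act x ` ?A = act g ` act (r i [^] e) ` act (inv g) ` act g ` axis i"
      using xg ri axis_V'[OF xg(3)] by (simp add: act_image_mult act_image_sub)
    then show ?thesis using act_image_inv(1)[OF xg(2) axis_V'[OF xg(3)]] r_pow_axis[OF xg(3)] by simp
  qed
  have d1: "d v (act x v) = 6640" if vA: "v \<in> ?A" for v
  proof -
    obtain n where n: "v = act g (p i n)" "act x v = act g (p i (n + 6640 * e))"
      using conjugate_axis[OF xg(1-3) vA] .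
    then have "d v (act x v) = d (p i n) (p i (n + 6640 * e))" using xg(2) p_V[OF xg(3)] by simp
    then show ?thesis using p_dist_abs[OF xg(3), of n "n + 6640 * e"] xg(4) by auto
  qed
  \<comment> \<open>The displacement formula for a translation: twice the distance to the axis plus
    the translation length.\<close>
  have dA: "d v (act x v) = 2 * d v (gate ?A v) + 6640" "act (x) (gate ?A v) = gate ?A (act x v)" if v: "v \<in> V" for v
  proof -
    let ?q = "gate ?A v"
    have q: "?q \<in> ?A" using gate(1)[OF axis_convex[OF A] axis_nonempty[OF A] v] .
    have qV: "?q \<in> V" using axis_V[OF A q] .
    show e: "act x ?q = gate ?A (act x v)"
      using act_gate[OF xc(1) axis_convex[OF A] axis_nonempty[OF A] v] xA by simp
    have ne: "?q \<noteq> gate ?A (act x v)" using d1[OF q] e qV by auto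
    have "d v (act x v) = d v ?q + d ?q (act x ?q) + d (act x ?q) (act x v)"
      using gates_on_seg(1)[OF axis_convex[OF A] v act_closed[OF xc(1) v] axis_nonempty[OF A] ne] e by simp
    then show "d v (act x v) = 2 * d v ?q + 6640" using d1[OF q] xc v qV d_sym[OF v qV] by simp
  qed
  have nofix: "x \<notin> fac t" for t
  proof
    assume "x \<in> fac t"
    then have "act x (pt t \<one>) = pt t \<one>" using stab_pt[OF xc(1) one_closed] xc(1) by simp
    then show False using dA(1)[of "pt t \<one>"] by simp
  qed
  obtain t gs where gs: "typed (fac t) (fac (\<not> t)) gs" "set gs \<inter> H = {}" "gs \<noteq> []" "word_prod M gs = x"
    "d (pt t \<one>) (act (x \<otimes> x) (pt t \<one>)) = 2 * d (pt t \<one>) (act x (pt t \<one>))"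
    using wcr_straight[OF xc(2,1) nofix] by metis
  let ?v = "pt t \<one>"
  have v: "?v \<in> V" by simp
  \<comment> \<open>Let \<open>D\<close> be the distance of the base vertex to the axis. The square
    of \<open>x\<close> moves that vertex by at most \<open>2 * D + 2 * 6640\<close>, while
    straightness demands \<open>4 * D + 2 * 6640\<close>.\<close>
  have vA: "?v \<in> ?A"
  proof -
    let ?q = "gate ?A ?v"
    have q: "?q \<in> ?A" using gate(1)[OF axis_convex[OF A] axis_nonempty[OF A] v] .
    have qV: "?q \<in> V" using axis_V[OF A q] .
    have xq: "act x ?q \<in> V" "act x (act x ?q) \<in> V" "act x (act x ?v) \<in> V" "act x ?v \<in> V"
      using act_closed xc(1) qV v by blast+
    have "d ?v (act x (act x ?v)) \<le> d ?v ?q + d ?q (act x (act x ?v))" using d_tri[OF v qV xq(3)] .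
    also have "d ?q (act x (act x ?v)) \<le> d ?q (act x (act x ?q)) + d (act x (act x ?q)) (act x (act x ?v))"
      using d_tri[OF qV xq(2,3)] .
    also have "d (act x (act x ?q)) (act x (act x ?v)) = d ?q ?v" using xc(1) xq qV v by (simp del: act_pt)
    also have "d ?q (act x (act x ?q)) \<le> d ?q (act x ?q) + d (act x ?q) (act x (act x ?q))" using d_tri[OF qV xq(1,2)] .
    also have "d (act x ?q) (act x (act x ?q)) = d ?q (act x ?q)" using xc(1) xq qV by (simp del: act_pt)
    finally have "d ?v (act x (act x ?v)) \<le> 2 * d ?v ?q + 2 * 6640" using d1[OF q] d_sym[OF qV v] by simp
    moreover have "d ?v (act x (act x ?v)) = 2 * (2 * d ?v ?q + 6640)"
      using gs(5) dA(1)[OF v] act_mult[OF xc(1) xc(1) v] by simp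
    ultimately have "d ?v ?q = 0" by simp
    then show ?thesis using d_zero[OF v qV] q by simp
  qed
  have "length vs \<noteq> 1"
  proof
    assume "length vs = 1"
    then obtain y where "vs = [y]" by (cases vs) auto
    moreover from this have "y \<in> carrier M" "y \<in> K \<union> L" using vs(1) K_carrier L_carrier by (auto simp: canonical_def)
    ultimately have "x \<in> K \<union> L" using vs(2) by auto
    then show False using nofix[of True] nofix[of False] by (auto simp: fac_def)
  qed
  then have "1 < length vs" using vs(1) by (auto simp: canonical_def)
  then obtain u where u: "typed (fac u) (fac (\<not> u)) vs" "set vs \<inter> H = {}" "vs \<noteq> []"
    using canonical_typed[OF vs(1)] by (metis list.size(3) not_one_less_zero)
  have "inv (word_prod M vs) \<otimes> word_prod M gs \<in> H" using vs(2) gs(4) xc(1) H_closed(1) by simp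
  from same_start[OF u gs(1-3) this] have ut: "u = t" .
  have vsC: "set vs \<subseteq> carrier M" using typed_carrier[OF u(1)] .
  \<comment> \<open>For odd length the last letter fixes the base vertex, so the geodesic is one
    edge shorter than the form.\<close>
  define m where "m = (if even (length vs) then length vs else length vs - 1)"
  have m: "m \<le> length vs" "even m" "length vs - 1 \<le> m" by (auto simp: m_def)
  have end': "pt (t = even m) (word_prod M (take m vs)) = act x ?v"
  proof (cases "even (length vs)")
    case True
    then show ?thesis using vs(2) xc(1) by (simp add: m_def)
  next
    case False
    then obtain ys z where yz: "vs = ys @ [z]" using u(3) by (cases vs rule: rev_cases) auto
    have ev: "even (length ys)" using False yz by simp
    have z: "z \<in> fac t" using u(1) ut yz ev by (simp add: typed_append)
    have c: "set ys \<subseteq> carrier M" "z \<in> carrier M" using vsC yz by auto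
    have "x = word_prod M ys \<otimes> z" using vs(2) yz c by (simp add: word_prod_app)
    then have "pt t x = pt t (word_prod M ys)" using pt_mult[OF word_prod_closed[OF c(1)] z] by simp
    then show ?thesis using yz ev xc(1) by (simp add: m_def)
  qed
  have "d ?v (act x ?v) = m"
    using trace_geodesic(1)[OF u(1,2) m(1) m(1)] end' ut by simp
  then have "6640 \<le> length vs" using d1[OF vA] m(1) by simp
  moreover have "pt (t = even k) (word_prod M (take k vs)) \<in> ?A \<inter> seg ?v (act x ?v)" if k: "k < length vs" for k
  proof -
    have "k \<le> m" using k m(3) by simp
    then have s: "pt (t = even k) (word_prod M (take k vs)) \<in> seg ?v (act x ?v)"
      using trace_geodesic(2)[OF u(1,2) less_imp_le[OF k] m(1)] end' ut by simp
    moreover have "act x ?v \<in> ?A" using xA vA by blast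
    ultimately show ?thesis using convexD(1)[OF axis_convex[OF A] vA] by blast
  qed
  ultimately show ?thesis using that[of t] u ut by simp
qed

text \<open>Inverting the first relator turns the cancellation into a common initial stretch of two
  geodesics from one base vertex. For \<open>l\<close> at least 664 it exceeds 600 edges, so both
  run along the same axis: in the same direction, and then the relators cancel, or in opposite
  directions.\<close>

theorem C_prime_conjugates: "C_prime M H K L (1/10) conjugates"
  unfolding C_prime_def
proof (intro allI impI, elim conjE)
  fix us vs l
  assume us: "canonical H K L (rev us)" "word_prod M (rev us) \<in> conjugates"
    and vs: "canonical H K L vs" "word_prod M vs \<in> conjugates"
    and ne: "word_prod M (rev us @ vs) \<noteq> \<one>" and l: "l < length us" "l < length vs"
    and piece: "word_prod M (rev (take l us) @ take l vs) \<in> H"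
  define ws where "ws = map (m_inv M) us"
  have usC: "set us \<subseteq> carrier M" "set vs \<subseteq> carrier M"
    using us(1) vs(1) K_carrier L_carrier by (auto simp: canonical_def)
  define x y where "x = inv (word_prod M (rev us))" and "y = word_prod M vs"
  have ws_x: "word_prod M ws = x" using inv_word_prod[of "rev us"] usC by (simp add: x_def ws_def rev_map)
  have wsC: "set ws \<subseteq> carrier M" using usC by (auto simp: ws_def)
  have xc: "x \<in> conjugates" unfolding x_def by (rule conjugates_inv[OF us(2)])
  have yc: "y \<in> conjugates" unfolding y_def by (rule vs(2))
  have xy: "x \<noteq> y" "x \<in> carrier M" "y \<in> carrier M"
  proof -
    show "x \<in> carrier M" "y \<in> carrier M" using xc yc by (auto simp: conjugates_def)
    show "x \<noteq> y"
    proof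
      assume "x = y"
      have "word_prod M (rev us @ vs) = word_prod M (rev us) \<otimes> y"
        using usC by (simp add: word_prod_app y_def)
      also have "\<dots> = word_prod M (rev us) \<otimes> x" using \<open>x = y\<close> by simp
      also have "\<dots> = \<one>" unfolding x_def by (rule r_inv) (use usC in simp)
      finally have "word_prod M (rev us @ vs) = \<one>" .
      then show False using ne by simp
    qed
  qed
  have ws: "canonical H K L ws"
  proof -
    have i: "inv u \<in> K \<longleftrightarrow> u \<in> K" "inv u \<in> L \<longleftrightarrow> u \<in> L" if "u \<in> carrier M" for u
      using fac_closed(2)[of u True] fac_closed(2)[of "inv u" True] fac_closed(2)[of u False] fac_closed(2)[of "inv u" False] that
      by (auto simp: fac_def)
    have nth: "rev us ! (length us - 1 - k) = us ! k" if "k < length us" for k using that by (simp add: rev_nth)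
    have C: "us ! k \<in> carrier M" if "k < length us" for k using usC that nth_mem by blast
    show ?thesis
    proof (cases "length us = 1")
      case True
      then show ?thesis using us(1) i usC by (auto simp: canonical_def ws_def)
    next
      case False
      then have c: "set us \<subseteq> K \<union> L" "1 < length us" "\<And>k. k < length us \<Longrightarrow> rev us ! k \<notin> H"
        "\<And>k. k + 1 < length us \<Longrightarrow> rev us ! k \<in> K \<longleftrightarrow> rev us ! (k + 1) \<in> L"
        using us(1) by (auto simp: canonical_def simp del: Int_iff)
      have nH: "us ! k \<notin> H" if "k < length us" for k using c(3)[of "length us - 1 - k"] nth[OF that] that by simp
      have al: "us ! k \<in> K \<longleftrightarrow> us ! (k + 1) \<in> L" if k: "k + 1 < length us" for k
      proof -
        have s: "length us - 1 - k = length us - 1 - (k + 1) + 1" using k by simp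
        have "us ! (k + 1) \<in> K \<longleftrightarrow> us ! k \<in> L"
          using c(4)[of "length us - 1 - (k + 1)"] nth[of "k + 1"] nth[of k] k unfolding s by simp
        moreover have "us ! k \<in> K \<union> L" "us ! (k + 1) \<in> K \<union> L" using c(1) k by (meson nth_mem subsetD add_lessD1)+
        ultimately show ?thesis using nH[of k] nH[of "k + 1"] k by auto
      qed
      have sub: "set ws \<subseteq> K \<union> L"
      proof
        fix z assume "z \<in> set ws"
        then obtain u where u: "u \<in> set us" "z = inv u" by (auto simp: ws_def)
        moreover from this have "u \<in> carrier M" "u \<in> K \<union> L" using usC(1) c(1) by blast+
        ultimately show "z \<in> K \<union> L" using i by simp
      qed
      have "ws ! k \<notin> H" if "k < length ws" for k using nH[of k] i[OF C[of k]] that by (simp add: ws_def)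
      moreover have "ws ! k \<in> K \<longleftrightarrow> ws ! (k + 1) \<in> L" if "k + 1 < length ws" for k
        using al[of k] i[OF C[of k]] i[OF C[of "k + 1"]] that by (simp add: ws_def)
      ultimately show ?thesis using sub c(2) by (auto simp: canonical_def ws_def simp del: Int_iff)
    qed
  qed
  obtain g i and e :: int where g: "g \<in> carrier M" "i \<in> I" "e \<in> {1, -1}" "x = g \<otimes> r i [^] e \<otimes> inv g"
    using xc unfolding conjugates_def by blast
  obtain f j and e' :: int where f: "f \<in> carrier M" "j \<in> I" "e' \<in> {1, -1}" "y = f \<otimes> r j [^] e' \<otimes> inv f"
    using yc unfolding conjugates_def by blast
  obtain t where t: "typed (fac t) (fac (\<not> t)) ws" "set ws \<inter> H = {}" "6640 \<le> length ws"
    "\<And>k. k < length ws \<Longrightarrow> pt (t = even k) (word_prod M (take k ws)) \<in> act g ` axis i \<inter> seg (pt t \<one>) (act x (pt t \<one>))"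
    by (rule conjugate_canonical[OF xc g(4,1,2,3) ws ws_x]) simp
  obtain u where u: "typed (fac u) (fac (\<not> u)) vs" "set vs \<inter> H = {}" "6640 \<le> length vs"
    "\<And>k. k < length vs \<Longrightarrow> pt (u = even k) (word_prod M (take k vs)) \<in> act f ` axis j \<inter> seg (pt u \<one>) (act y (pt u \<one>))"
    by (rule conjugate_canonical[OF yc f(4,1,2,3) vs(1) y_def[symmetric]]) simp
  have lws: "l < length ws" using l by (simp add: ws_def)
  show "real l < real (min (length us) (length vs)) * (1 / 10)"
  proof (rule ccontr)
    assume "\<not> ?thesis"
    moreover have "6640 \<le> min (length us) (length vs)" using t(3) u(3) by (simp add: ws_def)
    ultimately have l664: "664 \<le> l" by linarith
    define P Q where "P = word_prod M (take l vs)" and "Q = word_prod M (take l ws)"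
    have tk: "set (take n vs) \<subseteq> carrier M" "set (take n ws) \<subseteq> carrier M" for n
      using usC(2) wsC set_take_subset by fast+
    have PQc: "P \<in> carrier M" "Q \<in> carrier M" using tk by (auto simp: P_def Q_def)
    have QP: "inv Q \<otimes> P \<in> H"
    proof -
      have "inv Q = word_prod M (rev (map (m_inv M) (take l ws)))" unfolding Q_def by (rule inv_word_prod[OF tk(2)])
      also have "map (m_inv M) (take l ws) = take l us"
      proof -
        have "map (m_inv M) ws = us" using usC(1) unfolding ws_def map_map by (intro map_idI) auto
        then show ?thesis by (metis take_map)
      qed
      finally have "inv Q = word_prod M (rev (take l us))" .
      moreover have "set (rev (take l us)) \<subseteq> carrier M" using usC(1) set_take_subset by fastforce
      ultimately show ?thesis using piece tk(1) by (simp add: P_def word_prod_app)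
    qed
    have "typed (fac t) (fac (\<not> t)) (take l ws)" "typed (fac u) (fac (\<not> u)) (take l vs)"
      using typed_append[of "fac t" "fac (\<not> t)" "take l ws" "drop l ws"] t(1)
        typed_append[of "fac u" "fac (\<not> u)" "take l vs" "drop l vs"] u(1) by simp_all
    moreover have "set (take l ws) \<inter> H = {}" "set (take l vs) \<inter> H = {}"
      using t(2) u(2) set_take_subset by fast+
    moreover have "take l ws \<noteq> []" "take l vs \<noteq> []" using l664 l lws by auto
    ultimately have tu: "t = u" using same_start QP unfolding P_def Q_def by blast
    define k where "k = l - 1"
    have k: "l = Suc k" "k < length vs" "k < length ws" using l664 l lws by (auto simp: k_def)
    let ?w = "pt t \<one>"
    \<comment> \<open>\<open>P\<close> and \<open>Q\<close> agree up to \<open>H\<close>, and letter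
      number \<open>k\<close> does not change the coset of this type; so \<open>?z\<close> is the
      \<open>k\<close>-th vertex of both geodesics.\<close>
    let ?z = "pt (t = even k) P"
    have shorten: "pt (t = even k) (word_prod M (take k zs)) = pt (t = even k) (word_prod M (take l zs))"
      if zs: "typed (fac t) (fac (\<not> t)) zs" "k < length zs" for zs
    proof -
      have zC: "set zs \<subseteq> carrier M" using typed_carrier zs by blast
      have e: "take l zs = take k zs @ [zs ! k]" using zs(2) k(1) by (simp add: take_Suc_conv_app_nth)
      have "typed (fac t) (fac (\<not> t)) (take k zs @ zs ! k # drop (Suc k) zs)"
        using zs by (simp add: id_take_nth_drop[symmetric])
      then have z: "zs ! k \<in> fac (t = even k)" using zs(2) unfolding typed_fac_append by simp
      have s: "set (take k zs) \<subseteq> carrier M" using zC set_take_subset by fast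
      have "word_prod M (take l zs) = word_prod M (take k zs) \<otimes> zs ! k"
        using s fac_carrier[OF z] by (simp add: e word_prod_app)
      then show ?thesis using pt_mult[OF word_prod_closed[OF s] z] by simp
    qed
    have zQ: "pt (t = even k) Q = ?z"
      using pt_eq_iff[OF PQc(2,1), of "t = even k" "t = even k"] QP H_fac by blast
    have z1: "?z \<in> act g ` axis i \<inter> seg ?w (act x ?w)"
      using t(4)[OF k(3)] shorten[OF t(1) k(3)] zQ by (simp add: Q_def)
    have z2: "?z \<in> act f ` axis j \<inter> seg ?w (act y ?w)"
      using u(4)[OF k(2)] shorten[OF u(1)[folded tu] k(2)] tu by (simp add: P_def)
    have w1: "?w \<in> act g ` axis i" "?w \<in> act f ` axis j"
      using t(4)[of 0] u(4)[of 0] k tu by (cases "0 < length ws"; cases "0 < length vs"; simp)+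
    have "d ?w (pt (t = even k) (word_prod M (take k vs))) = k"
      using trace_geodesic(1)[of t vs k "length vs"] u(1,2) tu k by simp
    then have dz: "d ?w ?z = k" using shorten[OF u(1)[folded tu] k(2)] by (simp add: P_def)
    have far: "600 < d ?w ?z" using dz k(1) l664 by simp
    have AB: "act g ` axis i = act f ` axis j"
      using axes_overlap[of "act g ` axis i" "act f ` axis j" ?w ?z] g f w1 z1 z2 far unfolding axes_def by blast
    have "i = j \<and> (\<exists>n::int. inv f \<otimes> g = r i [^] n)"
    proof -
      have c: "inv f \<otimes> g \<in> carrier M" using f g by simp
      have "act (inv f \<otimes> g) ` axis i = act (inv f) ` act f ` axis j"
        using AB f g axis_V'[OF g(2)] by (simp add: act_image_mult)
      then have fg: "act (inv f \<otimes> g) ` axis i = axis j" using act_image_inv(1)[OF f(1) axis_V'[OF f(2)]] by simp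
      have "act (inv f \<otimes> g) (p i 0) \<in> axis j" "act (inv f \<otimes> g) (p i 600) \<in> axis j"
        unfolding fg[symmetric] by (auto simp: axis_def)
      then obtain n n' where "act (inv f \<otimes> g) (p i 0) = p j n" "act (inv f \<otimes> g) (p i 600) = p j n'"
        unfolding axis_def by blast
      then show ?thesis using axis_match[OF g(2) f(2) c, of 0 n 600 n'] by auto
    qed
    then obtain n :: int where ij: "i = j" and n: "inv f \<otimes> g = r i [^] n" by blast
    have ri: "r i \<in> carrier M" using r_closed[OF g(2)] .
    have gf: "g = f \<otimes> r i [^] n" using n f g ri by (metis cancel_inv(2))
    have x': "x = f \<otimes> r j [^] e \<otimes> inv f"
    proof -
      have "r i [^] n \<otimes> r i [^] e \<otimes> inv (r i [^] n) = r i [^] (n + e + (- n))"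
        using ri by (simp only: int_pow_mult int_pow_neg)
      moreover have "n + e + (- n) = e" by simp
      moreover have "x = f \<otimes> (r i [^] n \<otimes> r i [^] e \<otimes> inv (r i [^] n)) \<otimes> inv f"
        using g(4) gf f(1) ri by (simp add: inv_mult_group m_assoc)
      ultimately show ?thesis using ij by simp
    qed
    \<comment> \<open>Equal exponents would give \<open>x = y\<close>, the excluded case of a
      trivial product.\<close>
    have "e \<noteq> e'" using x' f(4) xy(1) by blast
    then have ee: "e' = - e" using g(3) f(3) by auto
    obtain m where m: "?w = act f (p j m)" "act x ?w = act f (p j (m + 6640 * e))"
      using conjugate_axis[OF x' f(1,2) w1(2)] .
    obtain m' where m': "?w = act f (p j m')" "act y ?w = act f (p j (m' + 6640 * e'))"
      using conjugate_axis[OF f(4,1,2) w1(2)] .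
    have pV: "p j s \<in> V" for s using p_V[OF f(2)] .
    have "p j m = p j m'" using m(1) m'(1) act_inv(1)[OF f(1) pV] by metis
    then have mm: "m = m'" using p_dist_abs[OF f(2), of m m'] pV by simp
    \<comment> \<open>With opposite exponents the geodesics leave the base vertex in opposite
      directions, so they cannot both pass through \<open>?z\<close>.\<close>
    have dd: "d (act x ?w) (act y ?w) = 13280" "d ?w (act x ?w) = 6640" "d ?w (act y ?w) = 6640"
    proof -
      have "d (act x ?w) (act y ?w) = d (p j (m + 6640 * e)) (p j (m' + 6640 * e'))"
        "d ?w (act x ?w) = d (p j m) (p j (m + 6640 * e))" "d ?w (act y ?w) = d (p j m') (p j (m' + 6640 * e'))"
        using m m' f(1) pV act_dist by metis+
      then show "d (act x ?w) (act y ?w) = 13280" "d ?w (act x ?w) = 6640" "d ?w (act y ?w) = 6640"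
        using p_dist_abs[OF f(2), of "m + 6640 * e" "m' + 6640 * e'"] p_dist_abs[OF f(2), of m "m + 6640 * e"]
          p_dist_abs[OF f(2), of m' "m' + 6640 * e'"] mm ee g(3) by auto
    qed
    have V': "?w \<in> V" "?z \<in> V" "act x ?w \<in> V" "act y ?w \<in> V" using PQc xy by auto
    have "d (act x ?w) (act y ?w) \<le> d (act x ?w) ?z + d ?z (act y ?w)" by (rule d_tri[OF V'(3,2,4)])
    moreover have "k + d ?z (act x ?w) = 6640" "k + d ?z (act y ?w) = 6640"
      using segD(1)[of ?z ?w "act x ?w"] segD(1)[of ?z ?w "act y ?w"] z1 z2 dd dz by auto
    ultimately have "k = 0" using dd(1) d_sym[OF V'(3,2)] by simp
    then show False using k(1) l664 by simp
  qed
qed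

end

lemma (in group) good_fellows_iff:
  "good_fellows G F x y \<longleftrightarrow> \<not> fellow F x y"
  by (auto simp: good_fellows_def fellow_def set_mult_def)

lemma C_prime_mono: "C_prime G F A B \<chi> S \<Longrightarrow> T \<subseteq> S \<Longrightarrow> C_prime G F A B \<chi> T"
  unfolding C_prime_def by blast

context amalgam_decomposition begin

text \<open>If \<open>e\<close> were in \<open>H\<close>, so would be \<open>x\<close>. Otherwise
  \<open>l \<otimes> e \<otimes> l'\<close> can return to \<open>fac t\<close> only if
  \<open>l\<close> and \<open>l'\<close> are absorbed into \<open>e\<close>.\<close>

lemma factor_fellow:
  assumes x: "x \<in> fac t" "e \<in> fac t" and l: "l \<in> fac (\<not> t)" "l' \<in> fac (\<not> t)"
    and eq: "x = l \<otimes> e \<otimes> l'" and nH: "\<not> (x \<in> H \<and> e \<in> H)"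
  shows "l \<in> H \<and> l' \<in> H"
proof -
  have c: "x \<in> carrier M" "e \<in> carrier M" "l \<in> carrier M" "l' \<in> carrier M" using x l fac_carrier by blast+
  have eH: "e \<notin> H"
  proof
    assume e: "e \<in> H"
    then have "e \<in> fac (\<not> t)" using H_fac by blast
    then have "x \<in> fac (\<not> t)" unfolding eq using l by (intro fac_closed(3))
    then show False using nH e x(1) H_fac by blast
  qed
  have lt: "l \<in> fac t"
  proof (rule ccontr)
    assume n: "l \<notin> fac t"
    then have lH: "l \<notin> H" using H_fac by blast
    show False
    proof (cases "l' \<in> H")
      case True
      then have "e \<otimes> l' \<in> fac t" using x(2) H_fac by (intro fac_closed(3)) blast+
      then have "x \<otimes> inv (e \<otimes> l') \<in> fac t" using fac_closed(3)[OF x(1) fac_closed(2)] by blast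
      moreover have "x \<otimes> inv (e \<otimes> l') = l" using c by (simp add: eq m_assoc inv_mult_group)
      ultimately show False using n by simp
    next
      case False
      have "word_prod M [l, e, l'] \<notin> fac t"
        by (rule reduced_fac) (use x l lH eH False in auto)
      then show False using x(1) eq c by (simp add: m_assoc)
    qed
  qed
  have "inv e \<otimes> inv l \<otimes> x \<in> fac t" using fac_closed(3)[OF fac_closed(3)[OF fac_closed(2)[OF x(2)] fac_closed(2)[OF lt]] x(1)] .
  moreover have "inv e \<otimes> inv l \<otimes> x = l'" using c by (simp add: eq m_assoc)
  ultimately show ?thesis using lt l H_fac by metis
qed

end

context relator_family begin

section \<open>The quotient by the relators\<close>

lemma conjugates_relator_group: "conjugates \<subseteq> relator_group"
proof
  fix x assume "x \<in> conjugates"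
  then obtain g i and e :: int where x: "g \<in> carrier M" "i \<in> I" "x = g \<otimes> r i [^] e \<otimes> inv g"
    unfolding conjugates_def by blast
  have "act \<one> ` axis i = axis i" using act_image_one[OF axis_V'[OF x(2)]] .
  then have A: "axis i \<in> axes" using x(2) one_closed unfolding axes_def by (metis (mono_tags, lifting) mem_Collect_eq)
  have "r i [^] e \<in> Z (axis i)" using r_pow_axis[OF x(2)] r_closed[OF x(2)] by (simp add: Z_def)
  then have "r i [^] e \<in> relator_group" using Z_relator_group[OF A] by blast
  then show "x \<in> relator_group" using relator_conj x by blast
qed

context
  fixes R
  assumes R: "R = symmetric_closure M H K L {r i | i. i \<in> I}"
begin

lemma closure_conjugates: "R \<subseteq> conjugates"
  unfolding R symmetric_closure_def using symmetrized_conjugates r_conjugates by blast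

lemma closure_C_prime: "C_prime M H K L (1/10) R"
  using C_prime_mono[OF C_prime_conjugates closure_conjugates] .

text \<open>The stabilizer of an axis consists of conjugates of powers of one relator, so every
  normal subgroup containing the relators contains it.\<close>

lemma normal_closure_relators: "normal_closure M R = relator_group"
proof
  show "normal_closure M R \<subseteq> relator_group"
    unfolding normal_closure_def
    using relator_normal closure_conjugates conjugates_relator_group by blast
  show "relator_group \<subseteq> normal_closure M R"
    unfolding normal_closure_def
  proof (intro Inter_greatest, elim CollectE conjE)
    fix N assume N: "N \<lhd> M" "R \<subseteq> N"
    interpret N: normal N M by (rule N(1))
    have rR: "r i \<in> N" if "i \<in> I" for i using that N(2) unfolding R symmetric_closure_def by blast
    have "Z A \<subseteq> N" if A: "A \<in> axes" for A
    proof
      fix s assume s: "s \<in> Z A"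
      obtain g i where g: "g \<in> carrier M" "i \<in> I" "A = act g ` axis i" using A by (rule axes_cases)
      have sc: "s \<in> carrier M" using s Z_carrier by blast
      note iV = axis_V'[OF g(2)]
      have "act (inv g \<otimes> s \<otimes> g) ` axis i = act (inv g) ` act s ` act g ` axis i"
        using g sc iV by (simp add: act_image_mult act_image_sub)
      also have "\<dots> = axis i" using Z_image[OF s] g act_image_inv(1)[OF g(1) iV] by simp
      finally obtain k :: int where k: "inv g \<otimes> s \<otimes> g = r i [^] k"
        using axis_stabilizer[OF g(2), of "inv g \<otimes> s \<otimes> g"] g sc by auto
      have "r i [^] k \<in> N" using subgroup_int_pow_closed[OF N.is_subgroup rR[OF g(2)]] .
      then have "g \<otimes> (inv g \<otimes> s \<otimes> g) \<otimes> inv g \<in> N" unfolding k using N.inv_op_closed2[OF g(1)] by blast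
      then show "s \<in> N" using g sc by (simp add: m_assoc)
    qed
    then show "relator_group \<subseteq> N"
      unfolding relator_group_def by (intro generate_subgroup_incl N.is_subgroup) blast
  qed
qed

end

definition \<pi> :: "'a \<Rightarrow> 'a set" where
  "\<pi> x = relator_group #> x"

abbreviation Q :: "'a set monoid" where
  "Q \<equiv> M Mod relator_group"

lemma Q_group: "group Q"
  by (rule normal.factorgroup_is_group[OF relator_normal])

lemma \<pi>_hom: "\<pi> \<in> hom M Q"
  unfolding \<pi>_def by (rule normal.r_coset_hom_Mod[OF relator_normal])

lemma \<pi>_mult: "x \<in> carrier M \<Longrightarrow> y \<in> carrier M \<Longrightarrow> \<pi> x \<otimes>\<^bsub>Q\<^esub> \<pi> y = \<pi> (x \<otimes> y)"
  using hom_mult[OF \<pi>_hom] by simp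

text \<open>The simplifier rewrites products in the factor group to \<open><#>\<close>; this form of
  \<open>\<pi>_mult\<close> still matches then.\<close>

lemma \<pi>_set_mult: "x \<in> carrier M \<Longrightarrow> y \<in> carrier M \<Longrightarrow> \<pi> x <#> \<pi> y = \<pi> (x \<otimes> y)"
  using \<pi>_mult by simp

lemma \<pi>_one: "\<one>\<^bsub>Q\<^esub> = \<pi> \<one>"
  using hom_one[OF \<pi>_hom is_group Q_group] by simp

lemma \<pi>_group_hom: "group_hom M Q \<pi>"
  using is_group Q_group \<pi>_hom by (simp add: group_hom_def group_hom_axioms_def)

lemma \<pi>_inv: "x \<in> carrier M \<Longrightarrow> inv\<^bsub>Q\<^esub> (\<pi> x) = \<pi> (inv x)"
  using group_hom.hom_inv[OF \<pi>_group_hom] by simp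

lemma \<pi>_pow: "x \<in> carrier M \<Longrightarrow> \<pi> x [^]\<^bsub>Q\<^esub> (n::nat) = \<pi> (x [^] n)"
  using group_hom.hom_nat_pow[OF \<pi>_group_hom] by simp

lemma Q_carrier: "carrier Q = \<pi> ` carrier M"
  by (auto simp: FactGroup_def RCOSETS_def \<pi>_def)

lemma \<pi>_eq: 
  assumes "x \<in> carrier M" "y \<in> carrier M" shows "\<pi> x = \<pi> y \<longleftrightarrow> x \<otimes> inv y \<in> relator_group"
proof -
  have "x \<in> relator_group #> y \<longleftrightarrow> x \<otimes> inv y \<in> relator_group"
    using subgroup.rcos_module[OF relator_subgroup is_group assms(2,1)] by simp
  moreover have "x \<in> relator_group #> x" using rcos_self[OF assms(1) relator_subgroup] .
  moreover have "x \<in> relator_group #> y \<Longrightarrow> relator_group #> y = relator_group #> x"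
    using repr_independence[OF _ assms(2) relator_subgroup] .
  ultimately show ?thesis unfolding \<pi>_def by auto
qed

lemma \<pi>_eq_one: "x \<in> carrier M \<Longrightarrow> \<pi> x = \<one>\<^bsub>Q\<^esub> \<longleftrightarrow> x \<in> relator_group"
  using \<pi>_eq[of x \<one>] \<pi>_one by simp

lemma KL_carrier: "x \<in> K \<union> L \<Longrightarrow> x \<in> carrier M"
  using K_carrier L_carrier by blast

text \<open>The bound 50 keeps one word times the inverse of the other within the 100 letters of
  \<open>short_word\<close>.\<close>

lemma word_eq:
  assumes us: "set us \<subseteq> K \<union> L" "length us \<le> 50" and vs: "set vs \<subseteq> K \<union> L" "length vs \<le> 50"
    and eq: "\<pi> (word_prod M us) = \<pi> (word_prod M vs)"
  shows "word_prod M us = word_prod M vs"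
proof -
  have C: "set us \<subseteq> carrier M" "set vs \<subseteq> carrier M" using us vs KL_carrier by blast+
  let ?ws = "us @ rev (map (m_inv M) vs)"
  have iC: "set (rev (map (m_inv M) vs)) \<subseteq> carrier M" using C by auto
  have w: "word_prod M ?ws = word_prod M us \<otimes> inv (word_prod M vs)"
    using C iC inv_word_prod[OF C(2)] by (simp add: word_prod_app)
  have "inv x \<in> K \<union> L" if "x \<in> K \<union> L" for x
    using that fac_closed(2)[of x True] fac_closed(2)[of x False] by (auto simp: fac_def)
  then have "set ?ws \<subseteq> K \<union> L" using us vs by auto
  moreover have "word_prod M ?ws \<in> relator_group" using eq C \<pi>_eq w by simp
  ultimately have "word_prod M ?ws = \<one>" using us vs by (intro short_word) auto
  then have "word_prod M us \<otimes> inv (word_prod M vs) \<otimes> word_prod M vs = word_prod M vs" using w C by simp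
  then show ?thesis using C by (simp add: m_assoc)
qed

lemma \<pi>_inj: "inj_on \<pi> (K \<union> L)"
proof (rule inj_onI)
  fix x y assume xy: "x \<in> K \<union> L" "y \<in> K \<union> L" "\<pi> x = \<pi> y"
  have c: "x \<in> carrier M" "y \<in> carrier M" using xy KL_carrier by auto
  then have "word_prod M [x] = word_prod M [y]" using xy by (intro word_eq) auto
  then show "x = y" using c by simp
qed

lemma fac_KL: "x \<in> fac t \<Longrightarrow> x \<in> K \<union> L"
  by (auto simp: fac_def split: if_splits)

lemma quotient_malnormal:
  assumes mal': "\<And>x g. \<lbrakk>x \<in> H; x \<noteq> \<one>; g \<in> fac (\<not> t); g \<notin> H\<rbrakk> \<Longrightarrow> inv g \<otimes> x \<otimes> g \<notin> H"
  shows "malnormal (\<pi> ` fac t) Q"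
  unfolding malnormal_def
proof (intro conjI ballI notI)
  show "subgroup (\<pi> ` fac t) Q"
    using group_hom.subgroup_img_is_subgroup[OF \<pi>_group_hom fac_sub] .
  fix x y
  assume x: "x \<in> \<pi> ` fac t - {\<one>\<^bsub>Q\<^esub>}" and y: "y \<in> carrier Q - \<pi> ` fac t"
    and xy: "inv\<^bsub>Q\<^esub> y \<otimes>\<^bsub>Q\<^esub> x \<otimes>\<^bsub>Q\<^esub> y \<in> \<pi> ` fac t"
  obtain k where k: "k \<in> fac t" "x = \<pi> k" using x by blast
  obtain g where g: "g \<in> carrier M" "y = \<pi> g" using y Q_carrier by auto
  obtain k' where k': "k' \<in> fac t" "inv\<^bsub>Q\<^esub> y \<otimes>\<^bsub>Q\<^esub> x \<otimes>\<^bsub>Q\<^esub> y = \<pi> k'" using xy by blast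
  have kc: "k \<in> carrier M" "k' \<in> carrier M" using k k' fac_carrier by auto
  have "\<pi> (inv g \<otimes> k \<otimes> g) = \<pi> k'" using k' k g kc by (simp add: \<pi>_inv \<pi>_set_mult)
  then have rel: "(inv g \<otimes> k \<otimes> g) \<otimes> inv k' \<in> relator_group" using \<pi>_eq g kc by simp
  have "k \<noteq> \<one>" using x k \<pi>_one by auto
  then obtain n where n: "n \<in> relator_group" "g \<otimes> n \<in> fac t"
    using relator_malnormal[OF mal' g(1) k(1) _ k'(1) rel] by blast
  have nc: "n \<in> carrier M" using relator_group_carrier n by blast
  have "\<pi> g = \<pi> (g \<otimes> n)" 
    using \<pi>_mult[OF g(1) nc] \<pi>_eq_one[OF nc] n(1) g(1) nc monoid.r_one[OF group.is_monoid[OF Q_group], of "\<pi> g"] Q_carrier by auto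
  then show False using y g(2) n(2) by blast
qed

text \<open>A violation would be an equation between short words, hence hold in \<open>M\<close>,
  where the left-hand word is reduced.\<close>

lemma quotient_not_fac:
  assumes l: "l \<in> fac (\<not> t)" "l \<notin> H" "l' \<in> fac (\<not> t)" "l' \<notin> H" and k: "k \<in> fac t" "k \<notin> H"
  shows "\<pi> l \<otimes>\<^bsub>Q\<^esub> \<pi> k \<otimes>\<^bsub>Q\<^esub> \<pi> l' \<notin> \<pi> ` fac t" "\<pi> l \<otimes>\<^bsub>Q\<^esub> \<pi> k \<notin> \<pi> ` fac t"
proof -
  have c: "l \<in> carrier M" "l' \<in> carrier M" "k \<in> carrier M" using l k fac_carrier by auto
  have KL: "l \<in> K \<union> L" "l' \<in> K \<union> L" "k \<in> K \<union> L" using l k fac_KL by blast+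
  show "\<pi> l \<otimes>\<^bsub>Q\<^esub> \<pi> k \<otimes>\<^bsub>Q\<^esub> \<pi> l' \<notin> \<pi> ` fac t"
  proof
    assume "\<pi> l \<otimes>\<^bsub>Q\<^esub> \<pi> k \<otimes>\<^bsub>Q\<^esub> \<pi> l' \<in> \<pi> ` fac t"
    then obtain x where x: "x \<in> fac t" "\<pi> (word_prod M [l, k, l']) = \<pi> (word_prod M [x])"
      using c fac_carrier by (auto simp: \<pi>_set_mult m_assoc)
    have "word_prod M [l, k, l'] = word_prod M [x]"
      by (rule word_eq) (use x KL fac_KL[OF x(1)] in auto)
    moreover have "word_prod M [l, k, l'] \<notin> fac t" by (rule reduced_fac) (use l k in auto)
    ultimately show False using x(1) fac_carrier[OF x(1)] by simp
  qed
  show "\<pi> l \<otimes>\<^bsub>Q\<^esub> \<pi> k \<notin> \<pi> ` fac t"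
  proof
    assume "\<pi> l \<otimes>\<^bsub>Q\<^esub> \<pi> k \<in> \<pi> ` fac t"
    then obtain x where x: "x \<in> fac t" "\<pi> (word_prod M [l, k]) = \<pi> (word_prod M [x])"
      using c fac_carrier by (auto simp: \<pi>_set_mult)
    have "word_prod M [l, k] = word_prod M [x]"
      by (rule word_eq) (use x KL fac_KL[OF x(1)] in auto)
    then have "l \<otimes> k = x" using c fac_carrier[OF x(1)] by simp
    then have "l = x \<otimes> inv k" using c by (auto simp: m_assoc)
    then have "l \<in> fac t" using fac_closed(3)[OF x(1) fac_closed(2)[OF k(1)]] by simp
    then show False using l H_fac by blast
  qed
qed

lemma quotient_fellow_cases:
  assumes "group.fellow Q (\<pi> ` F) (\<pi> x) (\<pi> y)" and F: "F \<subseteq> carrier M" and c: "x \<in> carrier M" "y \<in> carrier M"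
  obtains f f' where "f \<in> F" "f' \<in> F" "\<pi> x = \<pi> (f \<otimes> y \<otimes> f')"
  | f f' where "f \<in> F" "f' \<in> F" "\<pi> x = \<pi> (f \<otimes> inv y \<otimes> f')"
proof -
  obtain f f' where f: "f \<in> F" "f' \<in> F"
    "\<pi> x = \<pi> f \<otimes>\<^bsub>Q\<^esub> \<pi> y \<otimes>\<^bsub>Q\<^esub> \<pi> f' \<or> \<pi> x = \<pi> f \<otimes>\<^bsub>Q\<^esub> inv\<^bsub>Q\<^esub> (\<pi> y) \<otimes>\<^bsub>Q\<^esub> \<pi> f'"
    using assms(1) unfolding group.fellow_def[OF Q_group] by blast
  have "f \<in> carrier M" "f' \<in> carrier M" using f F by auto
  then have "\<pi> x = \<pi> (f \<otimes> y \<otimes> f') \<or> \<pi> x = \<pi> (f \<otimes> inv y \<otimes> f')"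
    using f(3) c by (simp add: \<pi>_set_mult \<pi>_inv)
  then show ?thesis using that f by blast
qed

text \<open>Lifted to \<open>M\<close>, the double coset relation becomes an equation of short
  words, and \<open>factor_fellow\<close> forces the outer factors into \<open>H\<close>. Both (E)
  and (F) are instances.\<close>

lemma quotient_fellow_fac:
  assumes F: "F \<subseteq> fac (\<not> t)" and x: "x \<in> fac t" "y \<in> fac t" and nH: "\<not> (x \<in> H \<and> y \<in> H)"
    and fel: "group.fellow Q (\<pi> ` F) (\<pi> x) (\<pi> y)"
  shows "fellow (F \<inter> H) x y"
proof -
  have c: "x \<in> carrier M" "y \<in> carrier M" "F \<subseteq> carrier M" using x F fac_carrier by blast+
  have main: "f \<in> F \<inter> H \<and> f' \<in> F \<inter> H \<and> x = f \<otimes> e \<otimes> f'" 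
    if f: "f \<in> F" "f' \<in> F" "\<pi> x = \<pi> (f \<otimes> e \<otimes> f')" and e: "e \<in> fac t" "\<not> (x \<in> H \<and> e \<in> H)" for f f' e
  proof -
    have fc: "f \<in> fac (\<not> t)" "f' \<in> fac (\<not> t)" using f F by auto
    then have C: "f \<in> carrier M" "f' \<in> carrier M" "e \<in> carrier M" using fac_carrier e by blast+
    have "word_prod M [x] = word_prod M [f, e, f']"
      by (rule word_eq) (use f(3) C c fc e x fac_KL in \<open>auto simp: m_assoc\<close>)
    then have eq: "x = f \<otimes> e \<otimes> f'" using c C by (simp add: m_assoc)
    from factor_fellow[OF x(1) e(1) fc eq e(2)] show ?thesis using eq f by simp
  qed
  have iy: "inv y \<in> fac t" "\<not> (x \<in> H \<and> inv y \<in> H)"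
    using fac_closed(2)[OF x(2)] nH inv_notin_H[OF c(2)] by blast+
  show ?thesis
    using fel c(3,1,2)
  proof (cases rule: quotient_fellow_cases)
    case (1 f f')
    then show ?thesis using main[OF 1 x(2) nH] unfolding fellow_def by blast
  next
    case (2 f f')
    then show ?thesis using main[OF 2 iy] unfolding fellow_def by blast
  qed
qed

text \<open>Multiplying by \<open>K\<close> on either side does not change how far the base vertex
  of type \<open>K\<close> is moved. That distance is 2 for \<open>x \<otimes> y'\<close> but 4 for
  the longer element and for its inverse.\<close>

lemma quotient_long_short:
  assumes d: "x \<in> K" "x \<notin> L" and c: "y \<in> L" "y \<notin> K" "y' \<in> L" "y' \<notin> K"
  shows "\<not> group.fellow Q (\<pi> ` K) (\<pi> (x \<otimes> y')) (\<pi> (x \<otimes> y \<otimes> x \<otimes> y))"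
proof
  let ?v = "pt True \<one>"
  let ?w = "x \<otimes> y \<otimes> x \<otimes> y"
  have C: "x \<in> carrier M" "y \<in> carrier M" "y' \<in> carrier M" using d c K_carrier L_carrier by auto
  have Kfix: "act k ?v = ?v" if "k \<in> K" for k
    using that stab_pt[of k \<one> True] K_carrier[OF that] by (simp add: fac_def del: act_pt)
  have dist: "d ?v (act (word_prod M ws) ?v) = length ws"
    if ws: "typed K L ws" "set ws \<inter> H = {}" "even (length ws)" for ws
  proof -
    have "typed (fac True) (fac (\<not> True)) ws" using ws by (simp add: fac_def)
    from trace_geodesic(1)[OF this ws(2), of "length ws" "length ws"] typed_carrier[OF this] ws(3)
    show ?thesis by simp
  qed
  have d2: "d ?v (act (x \<otimes> y') ?v) = 2" using dist[of "[x, y']"] d c C by simp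
  have d4: "d ?v (act ?w ?v) = 4" using dist[of "[x, y, x, y]"] d c C by (simp add: m_assoc)
  have w: "?w \<in> carrier M" using C by simp
  have d4i: "d ?v (act (inv ?w) ?v) = 4"
  proof -
    have V: "?v \<in> V" by simp
    have "d ?v (act (inv ?w) ?v) = d (act ?w ?v) (act ?w (act (inv ?w) ?v))"
      using act_dist[OF w V act_closed[OF inv_closed[OF w] V]] by simp
    then show ?thesis using d4 act_inv(2)[OF w V] d_sym[OF V act_closed[OF w V]] by simp
  qed
  have dK: "d ?v (act (k \<otimes> e \<otimes> k') ?v) = d ?v (act e ?v)" if k: "k \<in> K" "k' \<in> K" and e: "e \<in> carrier M" for k k' e
  proof -
    have kc: "k \<in> carrier M" "k' \<in> carrier M" using k K_carrier by auto
    have V: "?v \<in> V" "act e ?v \<in> V" using act_closed[OF e] by simp_all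
    have "act (k \<otimes> e \<otimes> k') ?v = act k (act e ?v)"
      using kc e V Kfix[OF k(2)] by (simp add: act_mult del: act_pt)
    moreover have "d (act k ?v) (act k (act e ?v)) = d ?v (act e ?v)" using act_dist[OF kc(1) V] .
    ultimately show ?thesis using Kfix[OF k(1)] by simp
  qed
  assume "group.fellow Q (\<pi> ` K) (\<pi> (x \<otimes> y')) (\<pi> ?w)"
  moreover have "K \<subseteq> carrier M" using K_carrier by blast
  moreover have "x \<otimes> y' \<in> carrier M" using C by simp
  moreover note w
  ultimately show False
  proof (cases rule: quotient_fellow_cases)
    case (1 k k')
    have kc: "k \<in> carrier M" "k' \<in> carrier M" using 1 K_carrier by auto
    have "word_prod M [x, y'] = word_prod M [k, x, y, x, y, k']"
      by (rule word_eq) (use 1 d c C kc in \<open>auto simp: m_assoc\<close>)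
    then have "x \<otimes> y' = k \<otimes> ?w \<otimes> k'" using C kc by (simp add: m_assoc)
    then show False using dK[OF 1(1,2) w] d2 d4 by simp
  next
    case (2 k k')
    have kc: "k \<in> carrier M" "k' \<in> carrier M" using 2 K_carrier by auto
    have i: "inv x \<in> K" "inv y \<in> L" using fac_closed(2)[of x True] fac_closed(2)[of y False] d c by (auto simp: fac_def)
    have "word_prod M [x, y'] = word_prod M [k, inv y, inv x, inv y, inv x, k']"
      by (rule word_eq) (use 2 d c C kc i in \<open>auto simp: m_assoc inv_mult_group\<close>)
    then have "x \<otimes> y' = k \<otimes> inv ?w \<otimes> k'" using C kc by (simp add: m_assoc inv_mult_group)
    then show False using dK[OF 2(1,2), of "inv ?w"] w d2 d4i by simp
  qed
qed

lemma quotient_torsion_free: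
  assumes tf: "\<And>x (n::nat) t. x \<in> fac t \<Longrightarrow> 0 < n \<Longrightarrow> x [^] n = \<one> \<Longrightarrow> x = \<one>"
  shows "torsion_free Q"
  unfolding torsion_free_def
proof (intro ballI allI impI)
  fix x and n :: nat assume x: "x \<in> carrier Q" "0 < n" "x [^]\<^bsub>Q\<^esub> n = \<one>\<^bsub>Q\<^esub>"
  obtain g where g: "g \<in> carrier M" "x = \<pi> g" using x(1) Q_carrier by auto
  then have "g [^] n \<in> relator_group" using x(3) \<pi>_pow \<pi>_eq_one by simp
  then have "g \<in> relator_group" by (intro relator_torsion[OF _ g(1) _ x(2)]) (rule tf)
  then show "x = \<one>\<^bsub>Q\<^esub>" using g \<pi>_eq_one by simp
qed

end

section \<open>Transfer along the embedding of the factors\<close>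

lemma fellow_image:
  assumes G: "group G" and M: "group M" and f: "f \<in> hom G M" "inj_on f (carrier G)"
    and F: "F \<subseteq> carrier G" and x: "x \<in> carrier G" "y \<in> carrier G"
  shows "group.fellow M (f ` F) (f x) (f y) \<longleftrightarrow> group.fellow G F x y"
proof -
  interpret group_hom G M f using G M f(1) by (simp add: group_hom_def group_hom_axioms_def)
  have eq: "f x = f u \<otimes>\<^bsub>M\<^esub> f z \<otimes>\<^bsub>M\<^esub> f v \<longleftrightarrow> x = u \<otimes>\<^bsub>G\<^esub> z \<otimes>\<^bsub>G\<^esub> v"
    if "u \<in> F" "v \<in> F" "z \<in> carrier G" for u v z
  proof -
    have c: "u \<in> carrier G" "v \<in> carrier G" "u \<otimes>\<^bsub>G\<^esub> z \<otimes>\<^bsub>G\<^esub> v \<in> carrier G" using that F by auto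
    then have "f x = f u \<otimes>\<^bsub>M\<^esub> f z \<otimes>\<^bsub>M\<^esub> f v \<longleftrightarrow> f x = f (u \<otimes>\<^bsub>G\<^esub> z \<otimes>\<^bsub>G\<^esub> v)" using that by simp
    then show ?thesis using inj_onD[OF f(2) _ x(1) c(3)] by blast
  qed
  have i: "f (inv\<^bsub>G\<^esub> y) = inv\<^bsub>M\<^esub> (f y)" using x by simp
  show ?thesis
    unfolding group.fellow_def[OF G] group.fellow_def[OF M] bex_simps(7)
    using eq[OF _ _ x(2)] eq[OF _ _ G.inv_closed[OF x(2)]] unfolding i by (metis (no_types, lifting))
qed

context group_pair begin

abbreviation M where "M \<equiv> amalgam K L"
abbreviation \<iota> where "\<iota> \<equiv> amalg_emb K L"

lemma emb_mem_iff: "\<lbrakk>x \<in> carrier K \<union> carrier L; A \<subseteq> carrier K \<union> carrier L\<rbrakk> \<Longrightarrow> \<iota> x \<in> \<iota> ` A \<longleftrightarrow> x \<in> A"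
  by (rule inj_on_image_mem_iff[OF emb_inj])

lemma H_sub_K: "H \<subseteq> carrier K" and H_sub_L: "H \<subseteq> carrier L"
  using H_eq by auto

lemma emb_H_iff: "x \<in> carrier K \<union> carrier L \<Longrightarrow> \<iota> x \<in> \<iota> ` H \<longleftrightarrow> x \<in> H"
  by (rule emb_mem_iff[OF _ le_supI1[OF H_sub_K]])

lemma emb_Int: "\<iota> ` carrier K \<inter> \<iota> ` carrier L = \<iota> ` H"
  using inj_on_image_Int[OF emb_inj, of "carrier K" "carrier L"] H_eq by auto

lemma emb_group_hom: "group_hom K M \<iota>" "group_hom L M \<iota>"
  using group_M K.is_group L.is_group emb_hom by (auto simp: group_hom_def group_hom_axioms_def)

lemma decomposition: "amalgam_decomposition M (\<iota> ` carrier K) (\<iota> ` carrier L)"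
proof (intro amalgam_decomposition.intro amalgam_decomposition_axioms.intro)
  show "group M" by (rule group_M)
  show "subgroup (\<iota> ` carrier K) M" "subgroup (\<iota> ` carrier L) M"
    using group_hom.subgroup_img_is_subgroup[OF emb_group_hom(1) K.subgroup_self]
      group_hom.subgroup_img_is_subgroup[OF emb_group_hom(2) L.subgroup_self] .
  show "generate M (\<iota> ` carrier K \<union> \<iota> ` carrier L) = carrier M" by (rule emb_generate)
  fix cs
  assume cs: "cs \<noteq> []" "typed (\<iota> ` carrier K) (\<iota> ` carrier L) cs \<or> typed (\<iota> ` carrier L) (\<iota> ` carrier K) cs"
    "set cs \<inter> (\<iota> ` carrier K \<inter> \<iota> ` carrier L) = {}"
  have lift: "\<exists>ws. cs = map f ws \<and> typed A B ws" if "typed (f ` A) (f ` B) cs" for cs :: "'c list" and f :: "'b \<Rightarrow> 'c" and A B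
    using that
  proof (induction cs arbitrary: A B)
    case (Cons c cs)
    then obtain x ws where "x \<in> A" "c = f x" "cs = map f ws" "typed B A ws" by fastforce
    then show ?case by (intro exI[of _ "x # ws"]) simp
  qed simp
  obtain ws where ws: "cs = map \<iota> ws" "typed (carrier K) (carrier L) ws \<or> typed (carrier L) (carrier K) ws"
    using cs(2) lift by blast
  have sub: "set ws \<subseteq> carrier K \<union> carrier L" using ws(2) typed_set by blast
  have nH: "set ws \<inter> H = {}" using cs(3) unfolding emb_Int ws(1) by auto
  have succ: "successively (\<lambda>x y. x \<in> carrier K \<longleftrightarrow> y \<in> carrier L) ws"
    if "typed A B ws" "set ws \<inter> H = {}" "A = carrier K \<and> B = carrier L \<or> A = carrier L \<and> B = carrier K" for A B ws
    using that
  proof (induction ws arbitrary: A B)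
    case (Cons x ws)
    have "successively (\<lambda>x y. x \<in> carrier K \<longleftrightarrow> y \<in> carrier L) ws" using Cons.IH[of B A] Cons.prems by auto
    then show ?case using Cons.prems H_eq by (cases ws) auto
  qed simp
  have "successively (\<lambda>x y. x \<in> carrier K \<longleftrightarrow> y \<in> carrier L) ws" using ws(2) succ nH by metis
  then show "word_prod M cs \<noteq> \<one>\<^bsub>M\<^esub>"
    using alternating_nontrivial[of ws] cs(1) ws(1) sub nH by auto
qed

lemma emb_one: "\<iota> \<one>\<^bsub>K\<^esub> = \<one>\<^bsub>M\<^esub>" "\<iota> \<one>\<^bsub>L\<^esub> = \<one>\<^bsub>M\<^esub>"
  using group_hom.hom_one[OF emb_group_hom(1)] group_hom.hom_one[OF emb_group_hom(2)] by auto

lemma emb_malnormal_K: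
  assumes "malnormal H K" and x: "x \<in> \<iota> ` H" "x \<noteq> \<one>\<^bsub>M\<^esub>" and g: "g \<in> \<iota> ` carrier K" "g \<notin> \<iota> ` H"
  shows "inv\<^bsub>M\<^esub> g \<otimes>\<^bsub>M\<^esub> x \<otimes>\<^bsub>M\<^esub> g \<notin> \<iota> ` H"
proof -
  interpret h: group_hom K M \<iota> by (rule emb_group_hom)
  obtain y where y: "y \<in> H" "x = \<iota> y" using x by blast
  obtain k where k: "k \<in> carrier K" "k \<notin> H" "g = \<iota> k" using g by blast
  have yc: "y \<in> carrier K" by (rule subsetD[OF H_sub_K y(1)])
  have "y \<noteq> \<one>\<^bsub>K\<^esub>" using x(2) y(2) emb_one(1) by metis
  then have "inv\<^bsub>K\<^esub> k \<otimes>\<^bsub>K\<^esub> y \<otimes>\<^bsub>K\<^esub> k \<notin> H" using assms(1) y(1) k(1,2) unfolding malnormal_def by simp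
  moreover have "inv\<^bsub>M\<^esub> g \<otimes>\<^bsub>M\<^esub> x \<otimes>\<^bsub>M\<^esub> g = \<iota> (inv\<^bsub>K\<^esub> k \<otimes>\<^bsub>K\<^esub> y \<otimes>\<^bsub>K\<^esub> k)" using y k yc by simp
  moreover have "inv\<^bsub>K\<^esub> k \<otimes>\<^bsub>K\<^esub> y \<otimes>\<^bsub>K\<^esub> k \<in> carrier K \<union> carrier L" using yc k by simp
  ultimately show ?thesis using emb_H_iff by simp
qed

lemma emb_malnormal_L:
  assumes "malnormal H L" and x: "x \<in> \<iota> ` H" "x \<noteq> \<one>\<^bsub>M\<^esub>" and g: "g \<in> \<iota> ` carrier L" "g \<notin> \<iota> ` H"
  shows "inv\<^bsub>M\<^esub> g \<otimes>\<^bsub>M\<^esub> x \<otimes>\<^bsub>M\<^esub> g \<notin> \<iota> ` H"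
proof -
  interpret h: group_hom L M \<iota> by (rule emb_group_hom)
  obtain y where y: "y \<in> H" "x = \<iota> y" using x by blast
  obtain k where k: "k \<in> carrier L" "k \<notin> H" "g = \<iota> k" using g by blast
  have yc: "y \<in> carrier L" by (rule subsetD[OF H_sub_L y(1)])
  have "y \<noteq> \<one>\<^bsub>L\<^esub>" using x(2) y(2) emb_one(2) by metis
  then have "inv\<^bsub>L\<^esub> k \<otimes>\<^bsub>L\<^esub> y \<otimes>\<^bsub>L\<^esub> k \<notin> H" using assms(1) y(1) k(1,2) unfolding malnormal_def by simp
  moreover have "inv\<^bsub>M\<^esub> g \<otimes>\<^bsub>M\<^esub> x \<otimes>\<^bsub>M\<^esub> g = \<iota> (inv\<^bsub>L\<^esub> k \<otimes>\<^bsub>L\<^esub> y \<otimes>\<^bsub>L\<^esub> k)" using y k yc by simp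
  moreover have "inv\<^bsub>L\<^esub> k \<otimes>\<^bsub>L\<^esub> y \<otimes>\<^bsub>L\<^esub> k \<in> carrier K \<union> carrier L" using yc k by simp
  ultimately show ?thesis using emb_H_iff by simp
qed

lemma emb_fellow_K: "\<lbrakk>F \<subseteq> carrier K; x \<in> carrier K; y \<in> carrier K\<rbrakk> \<Longrightarrow>
    group.fellow M (\<iota> ` F) (\<iota> x) (\<iota> y) \<longleftrightarrow> \<not> good_fellows K F x y"
  using fellow_image[OF K.is_group group_M emb_hom(1) inj_on_subset[OF emb_inj]] K.good_fellows_iff by auto

lemma emb_fellow_L: "\<lbrakk>F \<subseteq> carrier L; x \<in> carrier L; y \<in> carrier L\<rbrakk> \<Longrightarrow>
    group.fellow M (\<iota> ` F) (\<iota> x) (\<iota> y) \<longleftrightarrow> \<not> good_fellows L F x y"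
  using fellow_image[OF L.is_group group_M emb_hom(2) inj_on_subset[OF emb_inj]] L.good_fellows_iff by auto

lemma relators:
  fixes h a b b' :: "'i \<Rightarrow> 'a"
  assumes mal: "malnormal H L"
    and data: "\<forall>i \<in> I. h i \<in> H \<and> a i \<in> carrier K - H \<and> b i \<in> carrier L - H \<and> b' i \<in> carrier L - H"
    and c1: "\<forall>i \<in> I. good_fellows L H (b i) (b' i)"
    and c2: "\<forall>i \<in> I. \<forall>k \<in> I. i \<noteq> k \<longrightarrow>
          good_fellows K H (a i) (a k)
        \<or> (b i = b k \<and> b' i = b' k \<and> a i \<noteq> a k)
        \<or> good_fellows L H (b i) (b k)
        \<or> (\<exists>H' K'. subgroup H' K \<and> H' \<subseteq> H \<and> subgroup K' K
            \<and> K' \<inter> H = H'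
            \<and> a i \<in> K' - H \<and> a k \<in> K' - H \<and> K' - H = K' - H'
            \<and> good_fellows L H' (b i) (b k)
            \<and> good_fellows L H (b i) (b' k)
            \<and> (K' - H) <#>\<^bsub>K\<^esub> (H - K') <#>\<^bsub>K\<^esub> (K' - H) \<subseteq> carrier K - H)"
  shows "relator_family M (\<iota> ` carrier K) (\<iota> ` carrier L) I (\<lambda>i. \<iota> (h i)) (\<lambda>i. \<iota> (a i)) (\<lambda>i. \<iota> (b i)) (\<lambda>i. \<iota> (b' i))"
proof (intro relator_family.intro decomposition relator_family_axioms.intro; (unfold emb_Int)?)
  have LnK: "g \<in> \<iota> ` carrier L \<Longrightarrow> g \<notin> \<iota> ` carrier K \<Longrightarrow> g \<notin> \<iota> ` H" for g using image_mono[OF H_sub_K] by (rule contra_subsetD)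
  show "inv\<^bsub>M\<^esub> g \<otimes>\<^bsub>M\<^esub> x \<otimes>\<^bsub>M\<^esub> g \<notin> \<iota> ` H"
    if "x \<in> \<iota> ` H" "x \<noteq> \<one>\<^bsub>M\<^esub>" "g \<in> \<iota> ` carrier L" "g \<notin> \<iota> ` carrier K" for x g
    using emb_malnormal_L[OF mal that(1,2,3) LnK[OF that(3,4)]] .
  fix i assume i: "i \<in> I"
  have di: "h i \<in> H" "a i \<in> carrier K" "a i \<notin> H" "b i \<in> carrier L" "b i \<notin> H" "b' i \<in> carrier L" "b' i \<notin> H"
    "a i \<notin> carrier L" "b i \<notin> carrier K" "b' i \<notin> carrier K"
    using data i H_eq by auto
  show "\<iota> (h i) \<in> \<iota> ` H" "\<iota> (a i) \<in> \<iota> ` carrier K" "\<iota> (b i) \<in> \<iota> ` carrier L" "\<iota> (b' i) \<in> \<iota> ` carrier L"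
    using di by auto
  show "\<iota> (a i) \<notin> \<iota> ` carrier L" "\<iota> (b i) \<notin> \<iota> ` carrier K" "\<iota> (b' i) \<notin> \<iota> ` carrier K"
    using emb_mem_iff di by auto
  show "\<not> group.fellow M (\<iota> ` H) (\<iota> (b i)) (\<iota> (b' i))"
    using emb_fellow_L[OF H_sub_L di(4,6)] c1 i by simp
  fix k assume k: "k \<in> I" "i \<noteq> k"
  have dk: "h k \<in> H" "a k \<in> carrier K" "a k \<notin> H" "b k \<in> carrier L" "b k \<notin> H" "b' k \<in> carrier L" "b' k \<notin> H"
    using data k by auto
  from c2[rule_format, OF i k] show "\<not> group.fellow M (\<iota> ` H) (\<iota> (a i)) (\<iota> (a k)) \<or>
     \<iota> (b i) = \<iota> (b k) \<and> \<iota> (b' i) = \<iota> (b' k) \<and> \<iota> (a i) \<noteq> \<iota> (a k) \<or>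
     \<not> group.fellow M (\<iota> ` H) (\<iota> (b i)) (\<iota> (b k)) \<or>
     (\<exists>H' K'. subgroup K' M \<and> K' \<subseteq> \<iota> ` carrier K \<and> H' = K' \<inter> \<iota> ` H \<and> \<iota> (a i) \<in> K' - \<iota> ` H \<and> \<iota> (a k) \<in> K' - \<iota> ` H \<and>
       \<not> group.fellow M H' (\<iota> (b i)) (\<iota> (b k)) \<and> \<not> group.fellow M (\<iota> ` H) (\<iota> (b i)) (\<iota> (b' k)) \<and>
       (\<forall>x\<in>K' - \<iota> ` H. \<forall>y\<in>\<iota> ` H - K'. \<forall>z\<in>K' - \<iota> ` H. x \<otimes>\<^bsub>M\<^esub> y \<otimes>\<^bsub>M\<^esub> z \<notin> \<iota> ` H))"
  proof (elim disjE)
    assume "good_fellows K H (a i) (a k)"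
    then show ?thesis using emb_fellow_K[OF H_sub_K di(2) dk(2)] by simp
  next
    assume *: "b i = b k \<and> b' i = b' k \<and> a i \<noteq> a k"
    then have "\<iota> (a i) \<noteq> \<iota> (a k)" using inj_onD[OF emb_inj, of "a i" "a k"] di dk by auto
    then show ?thesis using * by simp
  next
    assume "good_fellows L H (b i) (b k)"
    then show ?thesis using emb_fellow_L[OF H_sub_L di(4) dk(4)] by simp
  next
    assume "\<exists>H' K'. subgroup H' K \<and> H' \<subseteq> H \<and> subgroup K' K \<and> K' \<inter> H = H'
            \<and> a i \<in> K' - H \<and> a k \<in> K' - H \<and> K' - H = K' - H'
            \<and> good_fellows L H' (b i) (b k) \<and> good_fellows L H (b i) (b' k)
            \<and> (K' - H) <#>\<^bsub>K\<^esub> (H - K') <#>\<^bsub>K\<^esub> (K' - H) \<subseteq> carrier K - H"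
    then obtain H' K' where HK: "H' \<subseteq> H" "subgroup K' K" "K' \<inter> H = H'" "a i \<in> K' - H" "a k \<in> K' - H"
      "good_fellows L H' (b i) (b k)" "good_fellows L H (b i) (b' k)"
      "(K' - H) <#>\<^bsub>K\<^esub> (H - K') <#>\<^bsub>K\<^esub> (K' - H) \<subseteq> carrier K - H" by blast
    interpret h: group_hom K M \<iota> by (rule emb_group_hom)
    have K'c: "K' \<subseteq> carrier K" using HK(2) subgroup.subset by blast
    have sub: "subgroup (\<iota> ` K') M" using h.subgroup_img_is_subgroup[OF HK(2)] .
    have sub2: "\<iota> ` K' \<subseteq> \<iota> ` carrier K" using K'c by blast
    have sub3: "\<iota> ` H' = \<iota> ` K' \<inter> \<iota> ` H"
      using inj_on_image_Int[OF emb_inj, of K' H] K'c H_sub_K HK(3) by auto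
    have mem: "\<iota> x \<in> \<iota> ` K' \<longleftrightarrow> x \<in> K'" "\<iota> x \<in> \<iota> ` H \<longleftrightarrow> x \<in> H" if "x \<in> carrier K" for x
      using emb_mem_iff that K'c H_sub_K by auto
    have am: "\<iota> (a i) \<in> \<iota> ` K' - \<iota> ` H" "\<iota> (a k) \<in> \<iota> ` K' - \<iota> ` H"
      using HK(4,5) mem[OF di(2)] mem[OF dk(2)] by auto
    have prod: "\<forall>x\<in>\<iota> ` K' - \<iota> ` H. \<forall>y\<in>\<iota> ` H - \<iota> ` K'. \<forall>z\<in>\<iota> ` K' - \<iota> ` H. x \<otimes>\<^bsub>M\<^esub> y \<otimes>\<^bsub>M\<^esub> z \<notin> \<iota> ` H"
    proof (intro ballI)
      fix x y z assume x: "x \<in> \<iota> ` K' - \<iota> ` H" and y: "y \<in> \<iota> ` H - \<iota> ` K'" and z: "z \<in> \<iota> ` K' - \<iota> ` H"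
      obtain x' y' z' where x': "x' \<in> K' - H" "x = \<iota> x'" and y': "y' \<in> H - K'" "y = \<iota> y'" and z': "z' \<in> K' - H" "z = \<iota> z'"
        using x y z by blast
      have c: "x' \<in> carrier K" "y' \<in> carrier K" "z' \<in> carrier K" using x' y' z' K'c H_sub_K by auto
      have "x' \<otimes>\<^bsub>K\<^esub> y' \<otimes>\<^bsub>K\<^esub> z' \<in> (K' - H) <#>\<^bsub>K\<^esub> (H - K') <#>\<^bsub>K\<^esub> (K' - H)"
        using x' y' z' unfolding set_mult_def by blast
      then have "x' \<otimes>\<^bsub>K\<^esub> y' \<otimes>\<^bsub>K\<^esub> z' \<notin> H" using HK(8) by blast
      then show "x \<otimes>\<^bsub>M\<^esub> y \<otimes>\<^bsub>M\<^esub> z \<notin> \<iota> ` H"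
        using mem(2)[of "x' \<otimes>\<^bsub>K\<^esub> y' \<otimes>\<^bsub>K\<^esub> z'"] c x' y' z' by simp
    qed
    have f1: "\<not> group.fellow M (\<iota> ` H') (\<iota> (b i)) (\<iota> (b k))"
      using emb_fellow_L[of H' "b i" "b k"] HK(1,6) H_sub_L di dk by auto
    have f2: "\<not> group.fellow M (\<iota> ` H) (\<iota> (b i)) (\<iota> (b' k))"
      using emb_fellow_L[OF H_sub_L di(4) dk(6)] HK(7) by simp
    have "\<exists>H' K'. subgroup K' M \<and> K' \<subseteq> \<iota> ` carrier K \<and> H' = K' \<inter> \<iota> ` H \<and> \<iota> (a i) \<in> K' - \<iota> ` H \<and> \<iota> (a k) \<in> K' - \<iota> ` H \<and>
       \<not> group.fellow M H' (\<iota> (b i)) (\<iota> (b k)) \<and> \<not> group.fellow M (\<iota> ` H) (\<iota> (b i)) (\<iota> (b' k)) \<and>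
       (\<forall>x\<in>K' - \<iota> ` H. \<forall>y\<in>\<iota> ` H - K'. \<forall>z\<in>K' - \<iota> ` H. x \<otimes>\<^bsub>M\<^esub> y \<otimes>\<^bsub>M\<^esub> z \<notin> \<iota> ` H)"
      by (intro exI[of _ "\<iota> ` H'"] exI[of _ "\<iota> ` K'"] conjI sub sub2 sub3 am f1 f2 prod)
    then show ?thesis by (intro disjI2)
  qed
qed

end

section \<open>The parts (A) to (G)\<close>

theorem lemma3p2:
  fixes K L :: "'a monoid" and H :: "'a set"
    and I :: "'i set" and h a b b' :: "'i \<Rightarrow> 'a"
    and M :: "'a list set monoid" and \<iota> :: "'a \<Rightarrow> 'a list set"
    and R N :: "'a list set set"
    and Ms :: "'a list set set monoid" and j :: "'a \<Rightarrow> 'a list set set"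
  assumes "group K" and "group L"
    and "subgroup H K" and "malnormal H L"
    and "carrier K \<inter> carrier L = H"
    and "\<forall>x \<in> H. \<forall>y \<in> H. x \<otimes>\<^bsub>K\<^esub> y = x \<otimes>\<^bsub>L\<^esub> y"
    and "\<forall>i \<in> I. h i \<in> H \<and> a i \<in> carrier K - H \<and> b i \<in> carrier L - H \<and> b' i \<in> carrier L - H"
    and "\<forall>i \<in> I. good_fellows L H (b i) (b' i)"
    and "\<forall>i \<in> I. \<forall>k \<in> I. i \<noteq> k \<longrightarrow>
          good_fellows K H (a i) (a k)
        \<or> (b i = b k \<and> b' i = b' k \<and> a i \<noteq> a k)
        \<or> good_fellows L H (b i) (b k)
        \<or> (\<exists>H' K'. subgroup H' K \<and> H' \<subseteq> H \<and> subgroup K' K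
            \<and> K' \<inter> H = H'
            \<and> a i \<in> K' - H \<and> a k \<in> K' - H \<and> K' - H = K' - H'
            \<and> good_fellows L H' (b i) (b k)
            \<and> good_fellows L H (b i) (b' k)
            \<and> (K' - H) <#>\<^bsub>K\<^esub> (H - K') <#>\<^bsub>K\<^esub> (K' - H) \<subseteq> carrier K - H)"
    and "M = amalgam K L" and "\<iota> = amalg_emb K L"
    and "R = symmetric_closure M (\<iota> ` H) (\<iota> ` carrier K) (\<iota> ` carrier L)
          {inv\<^bsub>M\<^esub> (\<iota> (h i)) \<otimes>\<^bsub>M\<^esub> rho M (\<iota> (b i) \<otimes>\<^bsub>M\<^esub> \<iota> (a i)) (\<iota> (b' i) \<otimes>\<^bsub>M\<^esub> \<iota> (a i)) | i. i \<in> I}"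
    and "N = normal_closure M R"
    and "Ms = M Mod N"
    and "j = (\<lambda>x. N #>\<^bsub>M\<^esub> \<iota> x)"
  shows "(C_prime M (\<iota> ` H) (\<iota> ` carrier K) (\<iota> ` carrier L) (1/10) R
     \<and> inj_on j (carrier K \<union> carrier L))
     \<and>
    (malnormal (j ` carrier K) Ms
     \<and> (malnormal H K \<longrightarrow> malnormal (j ` carrier L) Ms))
     \<and>
    (\<forall>c \<in> carrier L - H. \<forall>c' \<in> carrier L - H. \<forall>d \<in> carrier K - H.
       \<not> good_fellows L H c c' \<longrightarrow>
       good_fellows Ms (j ` carrier K)
         (j d \<otimes>\<^bsub>Ms\<^esub> j c') (j d \<otimes>\<^bsub>Ms\<^esub> j c \<otimes>\<^bsub>Ms\<^esub> j d \<otimes>\<^bsub>Ms\<^esub> j c))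
     \<and>
    (\<forall>c \<in> carrier L - H. \<forall>c' \<in> carrier L - H. \<forall>d \<in> carrier K - H.
       j c \<otimes>\<^bsub>Ms\<^esub> j d \<otimes>\<^bsub>Ms\<^esub> j c' \<notin> j ` carrier K \<and> j c \<otimes>\<^bsub>Ms\<^esub> j d \<notin> j ` carrier K)
     \<and>
    (\<forall>d \<in> carrier K - H. \<forall>d' \<in> carrier K - H. \<forall>c \<in> carrier L - H.
       j d \<otimes>\<^bsub>Ms\<^esub> j c \<otimes>\<^bsub>Ms\<^esub> j d' \<notin> j ` carrier L \<and> j d \<otimes>\<^bsub>Ms\<^esub> j c \<notin> j ` carrier L)
     \<and>
    (\<forall>d \<in> carrier K. \<forall>d' \<in> carrier K. \<forall>H' L'.
       \<not> (d \<in> H \<and> d' \<in> H) \<and>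
       subgroup H' K \<and> H' \<subseteq> H \<and> good_fellows K H' d d' \<and>
       subgroup L' L \<and> L' \<inter> carrier K = H' \<and> L' \<inter> H = H' \<longrightarrow>
       good_fellows Ms (j ` L') (j d) (j d'))
     \<and>
    (\<forall>c \<in> carrier L. \<forall>c' \<in> carrier L.
       good_fellows L H c c' \<longrightarrow> good_fellows Ms (j ` carrier K) (j c) (j c'))
     \<and>
    (torsion_free K \<and> torsion_free L \<longrightarrow> torsion_free Ms)"
proof -
  note A = assms
  interpret P: group_pair K L H
  proof (intro group_pair.intro group_pair_axioms.intro)
    show "group K" "group L" "subgroup H K" "subgroup H L" "carrier K \<inter> carrier L = H"
      using A(1-5) by (auto simp: malnormal_def)
  qed (use A(6) in auto)
  define h' a' c0 c1 where "h' = (\<lambda>i. \<iota> (h i))" and "a' = (\<lambda>i. \<iota> (a i))" and "c0 = (\<lambda>i. \<iota> (b i))" and "c1 = (\<lambda>i. \<iota> (b' i))"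
  have M: "M = P.M" and \<iota>: "\<iota> = P.\<iota>" using A(10,11) by auto
  interpret F: relator_family M "\<iota> ` carrier K" "\<iota> ` carrier L" I h' a' c0 c1
    unfolding M \<iota> h'_def a'_def c0_def c1_def by (rule P.relators[OF A(4,7,8,9)])
  have Hi: "\<iota> ` carrier K \<inter> \<iota> ` carrier L = \<iota> ` H" using P.emb_Int unfolding \<iota> .
  have "{inv\<^bsub>M\<^esub> (\<iota> (h i)) \<otimes>\<^bsub>M\<^esub> rho M (\<iota> (b i) \<otimes>\<^bsub>M\<^esub> \<iota> (a i)) (\<iota> (b' i) \<otimes>\<^bsub>M\<^esub> \<iota> (a i)) | i. i \<in> I} = {F.r i | i. i \<in> I}"
    using F.r_eq unfolding h'_def a'_def c0_def c1_def by (intro Collect_cong ex_cong1) auto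
  then have R: "R = symmetric_closure M (\<iota> ` carrier K \<inter> \<iota> ` carrier L) (\<iota> ` carrier K) (\<iota> ` carrier L) {F.r i | i. i \<in> I}"
    using A(12) Hi by simp
  have N: "N = F.relator_group" using A(13) F.normal_closure_relators[OF R] by simp
  have Ms: "Ms = M Mod F.relator_group" using A(14) N by simp
  have j: "j = (\<lambda>x. F.\<pi> (\<iota> x))" using A(15) N by (simp add: F.\<pi>_def)
  have jim: "j ` S = F.\<pi> ` \<iota> ` S" for S unfolding j by (simp add: image_image)
  have facs: "F.fac True = \<iota> ` carrier K" "F.fac False = \<iota> ` carrier L" by (simp_all add: F.fac_def)
  have inj: "inj_on \<iota> (carrier K \<union> carrier L)" using P.emb_inj unfolding \<iota> .
  have mem: "\<iota> x \<in> \<iota> ` S \<longleftrightarrow> x \<in> S" if "x \<in> carrier K \<union> carrier L" "S \<subseteq> carrier K \<union> carrier L" for x S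
    using P.emb_mem_iff that unfolding \<iota> .
  have Hsub: "H \<subseteq> carrier K" "H \<subseteq> carrier L" using A(5) by auto
  have MK: "\<iota> x \<in> carrier M" if "x \<in> carrier K \<union> carrier L" for x using P.emb_closed that unfolding M \<iota> by blast
  have mult: "j x \<otimes>\<^bsub>Ms\<^esub> j y = F.\<pi> (\<iota> x \<otimes>\<^bsub>M\<^esub> \<iota> y)" if "x \<in> carrier K \<union> carrier L" "y \<in> carrier K \<union> carrier L" for x y
    unfolding j Ms by (rule F.\<pi>_mult) (use MK that in auto)
  have notH: "\<iota> x \<notin> \<iota> ` carrier K \<inter> \<iota> ` carrier L" if "x \<in> carrier K \<union> carrier L" "x \<notin> H" for x
    unfolding Hi using mem[of x H] that Hsub by auto
  have gf: "good_fellows Ms S x y \<longleftrightarrow> \<not> group.fellow Ms S x y" for S x y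
    unfolding Ms by (rule group.good_fellows_iff[OF F.Q_group])

  have partA: "C_prime M (\<iota> ` H) (\<iota> ` carrier K) (\<iota> ` carrier L) (1/10) R"
    using F.closure_C_prime[OF R] unfolding Hi .
  have partA': "inj_on j (carrier K \<union> carrier L)"
  proof -
    have "inj_on F.\<pi> (\<iota> ` (carrier K \<union> carrier L))" using F.\<pi>_inj by (simp add: image_Un)
    from comp_inj_on[OF inj this] show ?thesis unfolding j comp_def .
  qed
  have nofac: "g \<notin> \<iota> ` carrier K \<inter> \<iota> ` carrier L \<Longrightarrow> g \<notin> \<iota> ` H" for g using Hi by simp
  have partB: "malnormal (j ` carrier K) Ms"
  proof -
    have m: "inv\<^bsub>M\<^esub> g \<otimes>\<^bsub>M\<^esub> x \<otimes>\<^bsub>M\<^esub> g \<notin> \<iota> ` carrier K \<inter> \<iota> ` carrier L"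
      if "x \<in> \<iota> ` carrier K \<inter> \<iota> ` carrier L" "x \<noteq> \<one>\<^bsub>M\<^esub>" "g \<in> F.fac (\<not> True)" "g \<notin> \<iota> ` carrier K \<inter> \<iota> ` carrier L" for x g
      using P.emb_malnormal_L[OF A(4), folded M \<iota>, of x g] that
      unfolding Hi not_True_eq_False facs by (simp only: not_False_eq_True)
    have "malnormal (F.\<pi> ` F.fac True) F.Q" by (rule F.quotient_malnormal) (rule m)
    then show ?thesis unfolding facs jim Ms .
  qed
  have partB': "malnormal (j ` carrier L) Ms" if "malnormal H K"
  proof -
    have m: "inv\<^bsub>M\<^esub> g \<otimes>\<^bsub>M\<^esub> x \<otimes>\<^bsub>M\<^esub> g \<notin> \<iota> ` carrier K \<inter> \<iota> ` carrier L"
      if x: "x \<in> \<iota> ` carrier K \<inter> \<iota> ` carrier L" "x \<noteq> \<one>\<^bsub>M\<^esub>" "g \<in> F.fac (\<not> False)" "g \<notin> \<iota> ` carrier K \<inter> \<iota> ` carrier L" for x g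
      using P.emb_malnormal_K[OF \<open>malnormal H K\<close>, folded M \<iota>, of x g] x
      unfolding Hi not_False_eq_True facs by (simp only: not_False_eq_True)
    have "malnormal (F.\<pi> ` F.fac False) F.Q" by (rule F.quotient_malnormal) (rule m)
    then show ?thesis unfolding facs jim Ms .
  qed
  have partC: "good_fellows Ms (j ` carrier K) (j d \<otimes>\<^bsub>Ms\<^esub> j c') (j d \<otimes>\<^bsub>Ms\<^esub> j c \<otimes>\<^bsub>Ms\<^esub> j d \<otimes>\<^bsub>Ms\<^esub> j c)"
    if c: "c \<in> carrier L - H" "c' \<in> carrier L - H" and d: "d \<in> carrier K - H" for c c' d
  proof -
    have C: "\<iota> c \<in> carrier M" "\<iota> c' \<in> carrier M" "\<iota> d \<in> carrier M" using MK c d by auto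
    have "j d \<otimes>\<^bsub>Ms\<^esub> j c \<otimes>\<^bsub>Ms\<^esub> j d \<otimes>\<^bsub>Ms\<^esub> j c = F.\<pi> (\<iota> d \<otimes>\<^bsub>M\<^esub> \<iota> c \<otimes>\<^bsub>M\<^esub> \<iota> d \<otimes>\<^bsub>M\<^esub> \<iota> c)"
      using C unfolding j Ms by (simp add: F.\<pi>_set_mult)
    moreover have "j d \<otimes>\<^bsub>Ms\<^esub> j c' = F.\<pi> (\<iota> d \<otimes>\<^bsub>M\<^esub> \<iota> c')" using mult c d by blast
    moreover have "\<not> group.fellow (M Mod F.relator_group) (F.\<pi> ` \<iota> ` carrier K) (F.\<pi> (\<iota> d \<otimes>\<^bsub>M\<^esub> \<iota> c'))
        (F.\<pi> (\<iota> d \<otimes>\<^bsub>M\<^esub> \<iota> c \<otimes>\<^bsub>M\<^esub> \<iota> d \<otimes>\<^bsub>M\<^esub> \<iota> c))"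
      by (rule F.quotient_long_short) (use c d notH in blast)+
    ultimately show ?thesis unfolding gf unfolding jim Ms by simp
  qed
  have partD: "j c \<otimes>\<^bsub>Ms\<^esub> j d \<otimes>\<^bsub>Ms\<^esub> j c' \<notin> j ` carrier K \<and> j c \<otimes>\<^bsub>Ms\<^esub> j d \<notin> j ` carrier K"
    if c: "c \<in> carrier L - H" "c' \<in> carrier L - H" and d: "d \<in> carrier K - H" for c c' d
    using F.quotient_not_fac[of "\<iota> c" True "\<iota> c'" "\<iota> d"] c d notH
    unfolding jim Ms j facs by (auto simp: F.fac_def simp del: mult_FactGroup)
  have partD': "j d \<otimes>\<^bsub>Ms\<^esub> j c \<otimes>\<^bsub>Ms\<^esub> j d' \<notin> j ` carrier L \<and> j d \<otimes>\<^bsub>Ms\<^esub> j c \<notin> j ` carrier L"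
    if d: "d \<in> carrier K - H" "d' \<in> carrier K - H" and c: "c \<in> carrier L - H" for d d' c
    using F.quotient_not_fac[of "\<iota> d" False "\<iota> d'" "\<iota> c"] c d notH
    unfolding jim Ms j facs by (auto simp: F.fac_def simp del: mult_FactGroup)
  have partE: "good_fellows Ms (j ` L') (j d) (j d')"
    if d: "d \<in> carrier K" "d' \<in> carrier K" "\<not> (d \<in> H \<and> d' \<in> H)" 
      and H': "H' \<subseteq> H" "good_fellows K H' d d'" and L': "subgroup L' L" "L' \<inter> H = H'" for d d' H' L'
  proof (rule ccontr)
    assume "\<not> good_fellows Ms (j ` L') (j d) (j d')"
    then have f: "group.fellow (M Mod F.relator_group) (F.\<pi> ` \<iota> ` L') (F.\<pi> (\<iota> d)) (F.\<pi> (\<iota> d'))"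
      unfolding gf unfolding jim unfolding Ms j by simp
    have L'c: "L' \<subseteq> carrier L" using L'(1) subgroup.subset by blast
    have "\<iota> ` L' \<subseteq> F.fac (\<not> True)" using L'c by (auto simp: F.fac_def)
    moreover have "\<iota> d \<in> F.fac True" "\<iota> d' \<in> F.fac True" using d by (auto simp: F.fac_def)
    moreover have "\<not> (\<iota> d \<in> \<iota> ` carrier K \<inter> \<iota> ` carrier L \<and> \<iota> d' \<in> \<iota> ` carrier K \<inter> \<iota> ` carrier L)"
      using d(3) notH[of d] notH[of d'] d(1,2) by blast
    ultimately have "F.fellow (\<iota> ` L' \<inter> (\<iota> ` carrier K \<inter> \<iota> ` carrier L)) (\<iota> d) (\<iota> d')"
      using F.quotient_fellow_fac[of "\<iota> ` L'" True "\<iota> d" "\<iota> d'"] f by blast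
    moreover have "\<iota> ` L' \<inter> (\<iota> ` carrier K \<inter> \<iota> ` carrier L) = \<iota> ` H'"
    proof -
      have "\<iota> ` (L' \<inter> H) = \<iota> ` L' \<inter> \<iota> ` H" by (rule inj_on_image_Int[OF inj]) (use L'c Hsub in auto)
      then show ?thesis unfolding Hi L'(2) by simp
    qed
    ultimately show False
      using P.emb_fellow_K[of H' d d'] H' Hsub d unfolding M \<iota> by auto
  qed
  have partF: "good_fellows Ms (j ` carrier K) (j c) (j c')"
    if c: "c \<in> carrier L" "c' \<in> carrier L" and g: "good_fellows L H c c'" for c c'
  proof (rule ccontr)
    assume "\<not> good_fellows Ms (j ` carrier K) (j c) (j c')"
    then have f: "group.fellow (M Mod F.relator_group) (F.\<pi> ` \<iota> ` carrier K) (F.\<pi> (\<iota> c)) (F.\<pi> (\<iota> c'))"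
      unfolding gf unfolding jim unfolding Ms j by simp
    \<comment> \<open>Two elements of \<open>H\<close> are always fellows over \<open>H\<close>, so
      the hypothesis on \<open>c\<close> and \<open>c'\<close> excludes this.\<close>
    have nH: "\<not> (c \<in> H \<and> c' \<in> H)"
    proof
      assume "c \<in> H \<and> c' \<in> H"
      then have "c = (c \<otimes>\<^bsub>L\<^esub> inv\<^bsub>L\<^esub> c') \<otimes>\<^bsub>L\<^esub> c' \<otimes>\<^bsub>L\<^esub> \<one>\<^bsub>L\<^esub>" "c \<otimes>\<^bsub>L\<^esub> inv\<^bsub>L\<^esub> c' \<in> H" "\<one>\<^bsub>L\<^esub> \<in> H"
        using c P.HL by (simp_all add: P.L.m_assoc subgroup.m_closed subgroup.m_inv_closed subgroup.one_closed)
      then have "P.L.fellow H c c'" unfolding P.L.fellow_def by blast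
      then show False using g P.L.good_fellows_iff by blast
    qed
    have "\<iota> ` carrier K \<subseteq> F.fac (\<not> False)" "\<iota> c \<in> F.fac False" "\<iota> c' \<in> F.fac False"
      using c by (auto simp: F.fac_def)
    moreover have "\<not> (\<iota> c \<in> \<iota> ` carrier K \<inter> \<iota> ` carrier L \<and> \<iota> c' \<in> \<iota> ` carrier K \<inter> \<iota> ` carrier L)"
      using nH notH[of c] notH[of c'] c by blast
    ultimately have "F.fellow (\<iota> ` carrier K \<inter> (\<iota> ` carrier K \<inter> \<iota> ` carrier L)) (\<iota> c) (\<iota> c')"
      using F.quotient_fellow_fac[of "\<iota> ` carrier K" False "\<iota> c" "\<iota> c'"] f by blast
    moreover have "\<iota> ` carrier K \<inter> (\<iota> ` carrier K \<inter> \<iota> ` carrier L) = \<iota> ` H" using Hi by blast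
    ultimately show False
      using P.emb_fellow_L[OF Hsub(2) c] g unfolding M \<iota> by simp
  qed
  have partG: "torsion_free Ms" if tf: "torsion_free K" "torsion_free L"
  proof -
    have "x = \<one>\<^bsub>M\<^esub>" if x: "x \<in> F.fac t" "0 < n" "x [^]\<^bsub>M\<^esub> n = \<one>\<^bsub>M\<^esub>" for x t and n :: nat
    proof (cases t)
      case True
      then obtain k where k: "k \<in> carrier K" "x = \<iota> k" using x facs by auto
      interpret hK: group_hom K M \<iota> using P.emb_group_hom(1) unfolding M \<iota> .
      have "\<iota> (k [^]\<^bsub>K\<^esub> n) = \<iota> \<one>\<^bsub>K\<^esub>" using x(3) k by (simp add: hK.hom_nat_pow)
      then have "k [^]\<^bsub>K\<^esub> n = \<one>\<^bsub>K\<^esub>" using inj_onD[OF inj] k by simp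
      then have "k = \<one>\<^bsub>K\<^esub>" using tf(1) k x(2) unfolding torsion_free_def by blast
      then show ?thesis using k by simp
    next
      case False
      then obtain k where k: "k \<in> carrier L" "x = \<iota> k" using x facs by auto
      interpret hL: group_hom L M \<iota> using P.emb_group_hom(2) unfolding M \<iota> .
      have "\<iota> (k [^]\<^bsub>L\<^esub> n) = \<iota> \<one>\<^bsub>L\<^esub>" using x(3) k by (simp add: hL.hom_nat_pow)
      then have "k [^]\<^bsub>L\<^esub> n = \<one>\<^bsub>L\<^esub>" using inj_onD[OF inj] k by simp
      then have "k = \<one>\<^bsub>L\<^esub>" using tf(2) k x(2) unfolding torsion_free_def by blast
      then show ?thesis using k by simp
    qed
    then show ?thesis unfolding Ms by (rule F.quotient_torsion_free)
  qed
  show ?thesis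
    by (intro conjI ballI allI impI; (elim conjE)?;
      (rule partA partA' partB partB' partC partD[THEN conjunct1] partD[THEN conjunct2]
        partD'[THEN conjunct1] partD'[THEN conjunct2] partE partF partG; assumption))
qed

end
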